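(* Let $(E,X,\pi_X)$ and $(F,Y,\pi_Y)$ be smooth vector bundles. (i) Let $u=\mathrm{cl}[(u_\varepsilon)_\varepsilon]\in\Gamma_{\mathcal G}(X,E)$ and $\tilde p=\mathrm{cl}[(p_\varepsilon)_\varepsilon]\in\widetilde X_c$. Then $u(\tilde p):=\mathrm{cl}[(u_\varepsilon(p_\varepsilon))_\varepsilon]$ is a well-defined element of $E_c^{\sim_{vb}}$. (ii) Let $v=\mathrm{cl}[(v_\varepsilon)_\varepsilon]\in\mathrm{Hom}_{\mathcal G}[E,F]$ be such that for every $K\subset\subset X$ there exist $\varepsilon_0>0$ and a vector bundle chart $(W,\Psi)$ of $F$ with $\overline{\bigcup_{\varepsilon<\varepsilon_0}\underline{v_\varepsilon}(K)}\subset\subset W$, and let $\tilde e=\mathrm{cl}[(e_\varepsilon)_\varepsilon]\in E_c^{\sim_{vb}}$. Then $v(\tilde e):=\mathrm{cl}[(v_\varepsilon(e_\varepsilon))_\varepsilon]$ is a well-defined element of $F_c^{\sim_{vb}}$. (Well-defined means: the indicated net is $vb$-moderate and its class does not depend on the representatives chosen.)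
   Context: Manifolds are smooth, paracompact, Hausdorff and finite-dimensional. $I=(0,1]$, $\mathbb N=\{1,2,\dots\}$, $\mathbb N_0=\mathbb N\cup\{0\}$; $O(\cdot)$ refers to $\varepsilon\to0$. $K\subset\subset X$ means that $K$ is a compact subset of $X$. A supremum over the empty set is $0$. $D^{(k)}$ is the total derivative of order $k$; norms on finite-dimensional spaces are arbitrary. $d_h$ is the distance function of a Riemannian metric $h$, with $d_h(p,q)=\infty$ if $p,q$ lie in different components. **Bundles.** Vector bundles have typical fibers $\mathbb K^{n'}$ (for $E$) and $\mathbb K^{m'}$ (for $F$), $\mathbb K=\mathbb R$ or $\mathbb C$. A vector bundle chart $(V,\Phi)$ over a chart $(V,\varphi)$ of the base is written $\Phi(z)=(\varphi(p),\boldsymbol\varphi(z))\in\varphi(V)\times\mathbb K^{n'}$, $p=\pi(z)$ (similarly $\Psi=(\psi,\boldsymbol\psi)$). For a smooth vector bundle homomorphism $f\in\mathrm{Hom}(E,F)$, $\underline f:X\to Y$ is the induced base map ($\pi_Y\circ f=\underline f\circ\pi_X$), and $f_{\Psi\Phi}:=\Psi\circ f\circ\Phi^{-1}$ is written $f_{\Psi\Phi}(x,\xi)=(f^{(1)}_{\Psi\Phi}(x),f^{(2)}_{\Psi\Phi}(x)\cdot\xi)$ on $\varphi(V\cap\underline f^{-1}(W))\times\mathbb K^{n'}$. **Manifold-valued generalized functions.** $\mathcal E_M[X,Y]$ is the set of nets $(u_\varepsilon)_\varepsilon\in C^\infty(X,Y)^I$ such that (i) $\forall K\subset\subset X\ \exists\varepsilon_0>0\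 \exists K'\subset\subset Y\ \forall\varepsilon<\varepsilon_0:u_\varepsilon(K)\subseteq K'$; (ii) for all $k\in\mathbb N$, charts $(V,\varphi)$ in $X$, $(W,\psi)$ in $Y$, $L\subset\subset V$, $L'\subset\subset W$ there is $N\in\mathbb N$ with $\sup_{p\in L\cap u_\varepsilon^{-1}(L')}\|D^{(k)}(\psi\circ u_\varepsilon\circ\varphi^{-1})(\varphi(p))\|=O(\varepsilon^{-N})$. In $\mathcal E_M[X,Y]$, $(u_\varepsilon)_\varepsilon\sim(v_\varepsilon)_\varepsilon$ means: (i) $\sup_{p\in K}d_h(u_\varepsilon(p),v_\varepsilon(p))\to0$ for all $K\subset\subset X$ and some (hence every) Riemannian metric $h$ on $Y$; (ii) for all $k\in\mathbb N_0$, $m\in\mathbb N$, and $(V,\varphi),(W,\psi),L,L'$ as before, $\sup_{p\in L\cap u_\varepsilon^{-1}(L')\cap v_\varepsilon^{-1}(L')}\|D^{(k)}(\psi\circ u_\varepsilon\circ\varphi^{-1}-\psi\circ v_\varepsilon\circ\varphi^{-1})(\varphi(p))\|=O(\varepsilon^m)$. **Generalized homomorphisms.** $\mathcal E_M^{\mathrm{VB}}[E,F]$ is the set of nets $(u_\varepsilon)_\varepsilon\in\mathrm{Hom}(E,F)^I$ with (i) $(\underline{u_\varepsilon})_\varepsilon\in\mathcal E_M[X,Y]$; (ii) for all $k\in\mathbb N_0$, vector bundle charts $(V,\Phi)$ of $E$, $(W,\Psi)$ of $F$, $L\subset\subset V$, $L'\subset\subset W$ there are $N\in\mathbb N$, $\varepsilon_1>0$,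 $C>0$ with $\|D^{(k)}u^{(2)}_{\varepsilon\Psi\Phi}(\varphi(p))\|\le C\varepsilon^{-N}$ for all $\varepsilon<\varepsilon_1$ and $p\in L\cap\underline{u_\varepsilon}^{-1}(L')$. $(u_\varepsilon)_\varepsilon\sim_{vb}(v_\varepsilon)_\varepsilon$ means: (i) $(\underline{u_\varepsilon})_\varepsilon\sim(\underline{v_\varepsilon})_\varepsilon$ in $\mathcal E_M[X,Y]$; (ii) for all $k\in\mathbb N_0$, $m\in\mathbb N$, and $(V,\Phi),(W,\Psi),L,L'$ as before there are $\varepsilon_1>0$, $C>0$ with $\|D^{(k)}(u^{(2)}_{\varepsilon\Psi\Phi}-v^{(2)}_{\varepsilon\Psi\Phi})(\varphi(p))\|\le C\varepsilon^m$ for all $\varepsilon<\varepsilon_1$ and $p\in L\cap\underline{u_\varepsilon}^{-1}(L')\cap\underline{v_\varepsilon}^{-1}(L')$. $\mathrm{Hom}_{\mathcal G}[E,F]:=\mathcal E_M^{\mathrm{VB}}[E,F]/\!\sim_{vb}$. **Generalized sections.** Let $\mathcal P(X,E)$ be the linear differential operators on the space $\Gamma(X,E)$ of smooth sections, and $\|\cdot\|_h$ the norm on fibers of $E$ induced by any Riemannian (fiber) metric $h$ on $E$. $\Gamma_{\mathcal E_M}(X,E)$ is the set of nets $(s_\varepsilon)_\varepsilon\in\Gamma(X,E)^I$ such that $\forall P\in\mathcal P(X,E)\ \forall K\subset\subset X\ \exists N\in\mathbb N:\sup_{p\in K}\|Ps_\varepsilon(p)\|_h=O(\varepsilon^{-N})$;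 $\Gamma_{\mathcal N}(X,E)$ is the set of those $(s_\varepsilon)_\varepsilon\in\Gamma_{\mathcal E_M}(X,E)$ with $\sup_{p\in K}\|s_\varepsilon(p)\|_h=O(\varepsilon^m)$ for all $K\subset\subset X$, $m\in\mathbb N$. $\Gamma_{\mathcal G}(X,E):=\Gamma_{\mathcal E_M}(X,E)/\Gamma_{\mathcal N}(X,E)$. **Generalized points.** $\widetilde X_c$ is the set of nets $(p_\varepsilon)_\varepsilon\in X^I$ that lie in some fixed compact set for all small $\varepsilon$, modulo $(p_\varepsilon)_\varepsilon\sim(q_\varepsilon)_\varepsilon:\Leftrightarrow d_g(p_\varepsilon,q_\varepsilon)=O(\varepsilon^m)$ for all $m>0$ (one, equivalently every, Riemannian metric $g$ on $X$). **Generalized vector bundle points.** A net $(e_\varepsilon)_\varepsilon\in E^I$ is $vb$-moderate if (i) there are $K\subset\subset X$, $\varepsilon_0>0$ with $\pi_X(e_\varepsilon)\in K$ for $\varepsilon<\varepsilon_0$; (ii) for some Riemannian (fiber) metric $h$ on $E$ there are $\varepsilon_1>0$, $N\in\mathbb N$, $C>0$ with $\|e_\varepsilon\|_h\le C\varepsilon^{-N}$ for $\varepsilon<\varepsilon_1$. Two such nets are $\sim_{vb}$-equivalent if (iii) $(\pi_X(e_\varepsilon))_\varepsilon\sim(\pi_X(e'_\varepsilon))_\varepsilon$, i.e. $d_g(\pi_X(e_\varepsilon),\pi_X(e'_\varepsilon))=O(\varepsilon^m)$ for all $m>0$ and one (equivalently every) Riemannian metric $g$ on $X$; (iv) for all $m\in\mathbb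 N$, vector bundle charts $(W,\Psi)$ of $E$ and $L'\subset\subset W$ there are $\varepsilon_1>0$, $C>0$ with $|\boldsymbol\psi(e_\varepsilon)-\boldsymbol\psi(e'_\varepsilon)|\le C\varepsilon^m$ for all $\varepsilon<\varepsilon_1$ for which both $\pi_X(e_\varepsilon)$ and $\pi_X(e'_\varepsilon)$ lie in $L'$. The set of classes is $E_c^{\sim_{vb}}$; $F_c^{\sim_{vb}}$ is defined likewise. In all cases $\mathrm{cl}[\cdot]$ denotes the equivalence class. *)

theory Defs
  imports "HOL-Analysis.Analysis"
begin

section \<open>Model spaces\<close>

text \<open>
  Charts and fibers take values in types of the following class. It is \<^class>\<open>euclidean_space\<close> without
  the requirement that the basis be non-empty, so that zero-dimensional manifolds and bundles of rank
  zero (with model space \<^typ>\<open>unit\<close>) are included.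
\<close>

class finite_dim_inner = real_inner +
  assumes ex_finite_orthonormal_basis:
    "\<exists>B. finite B \<and> (\<forall>u\<in>B. \<forall>v\<in>B. inner u v = (if u = v then 1 else 0)) \<and>
         (\<forall>x. (\<forall>u\<in>B. inner x u = 0) \<longleftrightarrow> x = 0)"

instance euclidean_space \<subseteq> finite_dim_inner
proof
  show "\<exists>B::'a set. finite B \<and> (\<forall>u\<in>B. \<forall>v\<in>B. inner u v = (if u = v then 1 else 0)) \<and>
         (\<forall>x. (\<forall>u\<in>B. inner x u = 0) \<longleftrightarrow> x = 0)"
    by (rule exI[of _ Basis]) (auto simp: inner_Basis euclidean_all_zero_iff)
qed

instantiation unit :: finite_dim_inner
begin

definition "0 = ()"
definition "(x::unit) + y = ()"
definition "(r::real) *\<^sub>R (x::unit) = ()"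
definition "inner (x::unit) (y::unit) = (0::real)"
definition "norm (x::unit) = (0::real)"
definition "dist (x::unit) (y::unit) = (0::real)"
definition "sgn (x::unit) = ()"
definition "(uniformity :: (unit \<times> unit) filter) = (INF e\<in>{0<..}. principal {(x, y). dist x y < e})"
definition "open (U :: unit set) \<longleftrightarrow>
  (\<forall>x\<in>U. eventually (\<lambda>(x', y). x' = x \<longrightarrow> y \<in> U) uniformity)"

instance
  by standard
    (auto simp: inner_unit_def norm_unit_def dist_unit_def uniformity_unit_def open_unit_def
      intro: exI[of _ "{}"])

end


section \<open>Higher derivatives and smoothness\<close>

text \<open>
  \<open>iter_deriv f [v1, \<dots>, vk] x\<close> is \<open>D\<^sup>(\<^sup>k\<^sup>) f(x)(v1, \<dots>, vk)\<close>. A function on an open set is smooth iff all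
  iterated directional derivatives exist and are Frechet differentiable at every point.
\<close>

primrec iter_deriv ::
  "('a::real_normed_vector \<Rightarrow> 'b::real_normed_vector) \<Rightarrow> 'a list \<Rightarrow> 'a \<Rightarrow> 'b" where
  "iter_deriv f [] = f"
| "iter_deriv f (v # vs) = (\<lambda>x. frechet_derivative (iter_deriv f vs) (at x) v)"

definition smooth_on ::
  "'a::real_normed_vector set \<Rightarrow> ('a \<Rightarrow> 'b::real_normed_vector) \<Rightarrow> bool" where
  "smooth_on U f \<longleftrightarrow> (\<forall>vs. \<forall>x\<in>U. iter_deriv f vs differentiable (at x))"

text \<open>Operator norm of the multilinear map \<open>D\<^sup>(\<^sup>k\<^sup>) f(x)\<close>. Values in \<^typ>\<open>ennreal\<close> make suprema total, and
  give the supremum of the empty set the value zero.\<close>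

definition deriv_norm ::
  "nat \<Rightarrow> ('a::real_normed_vector \<Rightarrow> 'b::real_normed_vector) \<Rightarrow> 'a \<Rightarrow> ennreal" where
  "deriv_norm k f x =
     (SUP vs\<in>{vs. length vs = k \<and> (\<forall>v\<in>set vs. norm v \<le> 1)}. ennreal (norm (iter_deriv f vs x)))"

text \<open>The same for a function \<open>A\<close> whose values \<open>A x\<close> are linear maps between fibers, normed by the
  operator norm.\<close>

definition hom_deriv_norm ::
  "nat \<Rightarrow> ('a::real_normed_vector \<Rightarrow> 'v::real_normed_vector \<Rightarrow> 'w::real_normed_vector) \<Rightarrow> 'a \<Rightarrow> ennreal" where
  "hom_deriv_norm k A x = (SUP \<xi>\<in>cball 0 1. deriv_norm k (\<lambda>y. A y \<xi>) x)"


section \<open>Manifolds\<close>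

type_synonym ('x, 'a) chart = "'x set \<times> ('x \<Rightarrow> 'a)"

definition paracompact_space :: "'x topology \<Rightarrow> bool" where
  "paracompact_space T \<longleftrightarrow>
     (\<forall>\<U>. (\<forall>U\<in>\<U>. openin T U) \<and> \<Union>\<U> = topspace T \<longrightarrow>
       (\<exists>\<V>. (\<forall>V\<in>\<V>. openin T V) \<and> \<Union>\<V> = topspace T \<and>
            (\<forall>V\<in>\<V>. \<exists>U\<in>\<U>. V \<subseteq> U) \<and> locally_finite_in T \<V>))"

definition is_chart :: "('x::topological_space, 'a::real_normed_vector) chart \<Rightarrow> bool" where
  "is_chart = (\<lambda>(V, \<phi>). open V \<and> open (\<phi> ` V) \<and> (\<exists>\<phi>'. homeomorphism V (\<phi> ` V) \<phi> \<phi>'))"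

definition compatible ::
  "('x, 'a::real_normed_vector) chart \<Rightarrow> ('x, 'a) chart \<Rightarrow> bool" where
  "compatible = (\<lambda>(V, \<phi>) (W, \<psi>).
     smooth_on (\<phi> ` (V \<inter> W)) (\<psi> \<circ> inv_into V \<phi>) \<and> smooth_on (\<psi> ` (V \<inter> W)) (\<phi> \<circ> inv_into W \<psi>))"

text \<open>A manifold is a type in class \<^class>\<open>t2_space\<close> together with its maximal smooth atlas;
  ``chart'' always means a member of that atlas.\<close>

definition manifold :: "('x::t2_space, 'a::finite_dim_inner) chart set \<Rightarrow> bool" where
  "manifold A \<longleftrightarrow>
     paracompact_space (euclidean :: 'x topology) \<and>
     (\<forall>c\<in>A. is_chart c) \<and>
     (\<Union>c\<in>A. fst c) = UNIV \<and>
     (\<forall>c\<in>A. \<forall>d\<in>A. compatible c d) \<and>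
     (\<forall>c. is_chart c \<and> (\<forall>d\<in>A. compatible c d) \<longrightarrow> c \<in> A)"

definition smooth_maps ::
  "('x::t2_space, 'a::finite_dim_inner) chart set \<Rightarrow> ('y::t2_space, 'b::finite_dim_inner) chart set
     \<Rightarrow> ('x \<Rightarrow> 'y) set" where
  "smooth_maps A B = {f. continuous_on UNIV f \<and>
     (\<forall>(V, \<phi>)\<in>A. \<forall>(W, \<psi>)\<in>B. smooth_on (\<phi> ` (V \<inter> f -` W)) (\<psi> \<circ> f \<circ> inv_into V \<phi>))}"


subsection \<open>Riemannian metrics and distance\<close>

text \<open>A Riemannian metric is given by its local expressions: \<open>h c p v w\<close> is the inner product at \<open>p\<close> of
  the tangent vectors with coordinates \<open>v\<close>, \<open>w\<close> in the chart \<open>c\<close>.\<close>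

definition riemannian_metric ::
  "('x::t2_space, 'a::finite_dim_inner) chart set \<Rightarrow>
     (('x, 'a) chart \<Rightarrow> 'x \<Rightarrow> 'a \<Rightarrow> 'a \<Rightarrow> real) \<Rightarrow> bool" where
  "riemannian_metric A h \<longleftrightarrow>
     (\<forall>(V, \<phi>)\<in>A.
        (\<forall>p\<in>V. bilinear (h (V, \<phi>) p) \<and>
               (\<forall>v w. h (V, \<phi>) p v w = h (V, \<phi>) p w v) \<and>
               (\<forall>v. v \<noteq> 0 \<longrightarrow> h (V, \<phi>) p v v > 0)) \<and>
        (\<forall>v w. smooth_on (\<phi> ` V) (\<lambda>x. h (V, \<phi>) (inv_into V \<phi> x) v w))) \<and>
     (\<forall>(V, \<phi>)\<in>A. \<forall>(W, \<psi>)\<in>A. \<forall>p\<in>V \<inter> W. \<forall>v w.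
        h (V, \<phi>) p v w =
          (let T = frechet_derivative (\<psi> \<circ> inv_into V \<phi>) (at (\<phi> p)) in h (W, \<psi>) p (T v) (T w)))"

text \<open>Piecewise continuously differentiable curves; one-sided derivatives are required at the ends of
  each piece.\<close>

definition C1_curve_on ::
  "('x::t2_space, 'a::finite_dim_inner) chart set \<Rightarrow> real \<Rightarrow> real \<Rightarrow> (real \<Rightarrow> 'x) \<Rightarrow> bool" where
  "C1_curve_on A a b \<gamma> \<longleftrightarrow> continuous_on {a..b} \<gamma> \<and>
     (\<forall>(V, \<phi>)\<in>A. \<exists>D. continuous_on ({a..b} \<inter> \<gamma> -` V) D \<and>
        (\<forall>t\<in>{a..b} \<inter> \<gamma> -` V. ((\<phi> \<circ> \<gamma>) has_vector_derivative D t) (at t within {a..b})))"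

definition piecewise_C1_curve ::
  "('x::t2_space, 'a::finite_dim_inner) chart set \<Rightarrow> (real \<Rightarrow> 'x) \<Rightarrow> bool" where
  "piecewise_C1_curve A \<gamma> \<longleftrightarrow>
     (\<exists>S. finite S \<and> {0, 1} \<subseteq> S \<and> S \<subseteq> {0..1} \<and>
        (\<forall>a\<in>S. \<forall>b\<in>S. a < b \<and> {a<..<b} \<inter> S = {} \<longrightarrow> C1_curve_on A a b \<gamma>))"

text \<open>By the transformation law the speed does not depend on the chart that is chosen.\<close>

definition speed ::
  "('x::t2_space, 'a::finite_dim_inner) chart set \<Rightarrow>
     (('x, 'a) chart \<Rightarrow> 'x \<Rightarrow> 'a \<Rightarrow> 'a \<Rightarrow> real) \<Rightarrow> (real \<Rightarrow> 'x) \<Rightarrow> real \<Rightarrow> real" where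
  "speed A h \<gamma> t =
     (let c = (SOME c. c \<in> A \<and> \<gamma> t \<in> fst c); w = vector_derivative (snd c \<circ> \<gamma>) (at t)
      in sqrt (h c (\<gamma> t) w w))"

text \<open>The infimum of the empty set in \<^typ>\<open>ennreal\<close> is infinite, as required for points in different
  components.\<close>

definition riem_dist ::
  "('x::t2_space, 'a::finite_dim_inner) chart set \<Rightarrow>
     (('x, 'a) chart \<Rightarrow> 'x \<Rightarrow> 'a \<Rightarrow> 'a \<Rightarrow> real) \<Rightarrow> 'x \<Rightarrow> 'x \<Rightarrow> ennreal" where
  "riem_dist A h p q =
     (INF \<gamma>\<in>{\<gamma>. piecewise_C1_curve A \<gamma> \<and> \<gamma> 0 = p \<and> \<gamma> 1 = q}.
        \<integral>\<^sup>+t\<in>{0..1}. ennreal (speed A h \<gamma> t) \<partial>lborel)"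


section \<open>Vector bundles\<close>

text \<open>
  The scalar type \<open>'k\<close> of a vector bundle is a finite-dimensional \<^class>\<open>real_normed_field\<close>, that is
  \<open>\<real>\<close> or \<open>\<complex>\<close>. The typical fiber is the type \<open>'v\<close> with scalar multiplication \<^term>\<open>vb_scale\<close>, a
  finite-dimensional vector space over \<open>'k\<close>. A vector bundle chart \<open>(V, \<Phi>)\<close> over \<open>(V, \<phi>)\<close> is stored as
  the triple of \<open>V\<close>, \<open>\<phi>\<close> and the fiber component of \<open>\<Phi>\<close>.
\<close>

type_synonym ('x, 'a, 'e, 'v) vb_chart = "'x set \<times> ('x \<Rightarrow> 'a) \<times> ('e \<Rightarrow> 'v)"

record ('x, 'a, 'e, 'v, 'k) vbundle =
  vb_base :: "('x, 'a) chart set"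
  vb_proj :: "'e \<Rightarrow> 'x"
  vb_scale :: "'k \<Rightarrow> 'v \<Rightarrow> 'v"
  vb_charts :: "('x, 'a, 'e, 'v) vb_chart set"

definition vb_triv ::
  "('x, 'a, 'e, 'v, 'k) vbundle \<Rightarrow> ('x \<Rightarrow> 'a) \<Rightarrow> ('e \<Rightarrow> 'v) \<Rightarrow> 'e \<Rightarrow> 'a \<times> 'v" where
  "vb_triv E \<phi> \<Phi> z = (\<phi> (vb_proj E z), \<Phi> z)"

definition vb_inv ::
  "('x, 'a, 'e, 'v, 'k) vbundle \<Rightarrow> ('x, 'a, 'e, 'v) vb_chart \<Rightarrow> 'a \<Rightarrow> 'v \<Rightarrow> 'e" where
  "vb_inv E = (\<lambda>(V, \<phi>, \<Phi>) x \<xi>. inv_into (vb_proj E -` V) (vb_triv E \<phi> \<Phi>) (x, \<xi>))"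

definition is_vb_chart ::
  "('x::t2_space, 'a::finite_dim_inner, 'e::t2_space, 'v::finite_dim_inner, 'k) vbundle
     \<Rightarrow> ('x, 'a, 'e, 'v) vb_chart \<Rightarrow> bool" where
  "is_vb_chart E = (\<lambda>(V, \<phi>, \<Phi>). (V, \<phi>) \<in> vb_base E \<and>
     (\<exists>g. homeomorphism (vb_proj E -` V) (\<phi> ` V \<times> UNIV) (vb_triv E \<phi> \<Phi>) g))"

text \<open>The change of vector bundle charts is smooth and of the form \<open>(x, \<xi>) \<mapsto> (\<dots>, A(x) \<cdot> \<xi>)\<close> with \<open>A(x)\<close>
  linear over the scalars.\<close>

definition vb_transition ::
  "('x::t2_space, 'a::finite_dim_inner, 'e::t2_space, 'v::finite_dim_inner, 'k::field) vbundle
     \<Rightarrow> ('x, 'a, 'e, 'v) vb_chart \<Rightarrow> ('x, 'a, 'e, 'v) vb_chart \<Rightarrow> bool" where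
  "vb_transition E = (\<lambda>(V, \<phi>, \<Phi>) (W, \<psi>, \<Psi>).
     (\<forall>x\<in>\<phi> ` (V \<inter> W).
        Vector_Spaces.linear (vb_scale E) (vb_scale E) (\<lambda>\<xi>. \<Psi> (vb_inv E (V, \<phi>, \<Phi>) x \<xi>))) \<and>
     smooth_on (\<phi> ` (V \<inter> W) \<times> UNIV)
       (\<lambda>(x, \<xi>). vb_triv E \<psi> \<Psi> (vb_inv E (V, \<phi>, \<Phi>) x \<xi>)))"

text \<open>The smooth structure of the total space is the one determined by the vector bundle charts, which
  form a maximal vector bundle atlas.\<close>

definition vector_bundle ::
  "('x::t2_space, 'a::finite_dim_inner, 'e::t2_space, 'v::finite_dim_inner,
     'k::{real_normed_field, euclidean_space}) vbundle \<Rightarrow> bool" where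
  "vector_bundle E \<longleftrightarrow>
     manifold (vb_base E) \<and>
     vector_space (vb_scale E) \<and> (\<forall>r \<xi>. vb_scale E (of_real r) \<xi> = r *\<^sub>R \<xi>) \<and>
     continuous_on UNIV (vb_proj E) \<and>
     (\<forall>c\<in>vb_charts E. is_vb_chart E c) \<and>
     (\<Union>c\<in>vb_charts E. fst c) = UNIV \<and>
     (\<forall>c\<in>vb_charts E. \<forall>d\<in>vb_charts E. vb_transition E c d) \<and>
     (\<forall>c. is_vb_chart E c \<and> (\<forall>d\<in>vb_charts E. vb_transition E c d \<and> vb_transition E d c)
        \<longrightarrow> c \<in> vb_charts E)"


subsection \<open>Sections, homomorphisms, fiber metrics\<close>

definition sec_rep :: "('x, 'a, 'e, 'v) vb_chart \<Rightarrow> ('x \<Rightarrow> 'e) \<Rightarrow> 'a \<Rightarrow> 'v" where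
  "sec_rep = (\<lambda>(V, \<phi>, \<Phi>) s x. \<Phi> (s (inv_into V \<phi> x)))"

definition sections ::
  "('x::t2_space, 'a::finite_dim_inner, 'e::t2_space, 'v::finite_dim_inner, 'k) vbundle
     \<Rightarrow> ('x \<Rightarrow> 'e) set" where
  "sections E = {s. (\<forall>p. vb_proj E (s p) = p) \<and>
     (\<forall>(V, \<phi>, \<Phi>)\<in>vb_charts E. smooth_on (\<phi> ` V) (sec_rep (V, \<phi>, \<Phi>) s))}"

definition sec_diff ::
  "('x, 'a, 'e, 'v::minus, 'k) vbundle \<Rightarrow> ('x \<Rightarrow> 'e) \<Rightarrow> ('x \<Rightarrow> 'e) \<Rightarrow> 'x \<Rightarrow> 'e" where
  "sec_diff E s t p = (THE z. vb_proj E z = p \<and>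
     (\<forall>(V, \<phi>, \<Phi>)\<in>vb_charts E. p \<in> V \<longrightarrow> \<Phi> z = \<Phi> (s p) - \<Phi> (t p)))"

text \<open>Linear differential operators: in every vector bundle chart a finite sum of iterated directional
  derivatives of bounded order with smooth, operator-valued coefficients. Lists of arbitrary directions
  replace multi-indices, so that no basis has to be chosen. Linearity is a consequence.\<close>

definition diff_ops ::
  "('x::t2_space, 'a::finite_dim_inner, 'e::t2_space, 'v::finite_dim_inner, 'k::field) vbundle
     \<Rightarrow> (('x \<Rightarrow> 'e) \<Rightarrow> ('x \<Rightarrow> 'e)) set" where
  "diff_ops E = {P. (\<forall>s\<in>sections E. P s \<in> sections E) \<and>
     (\<exists>k. \<forall>(V, \<phi>, \<Phi>)\<in>vb_charts E. \<exists>\<Lambda> a. finite \<Lambda> \<and>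
        (\<forall>vs\<in>\<Lambda>. length vs \<le> k \<and>
           (\<forall>x\<in>\<phi> ` V. Vector_Spaces.linear (vb_scale E) (vb_scale E) (a vs x)) \<and>
           (\<forall>\<xi>. smooth_on (\<phi> ` V) (\<lambda>x. a vs x \<xi>))) \<and>
        (\<forall>s\<in>sections E. \<forall>x\<in>\<phi> ` V.
           sec_rep (V, \<phi>, \<Phi>) (P s) x = (\<Sum>vs\<in>\<Lambda>. a vs x (iter_deriv (sec_rep (V, \<phi>, \<Phi>) s) vs x))))}"

text \<open>\<open>hom_base E F f\<close> is the base map induced by \<open>f\<close>; \<open>hom_rep E c d f x \<xi>\<close> is the fiber component
  \<open>f\<^sup>(\<^sup>2\<^sup>)(x) \<cdot> \<xi>\<close> of the local representative of \<open>f\<close> with respect to the charts \<open>c\<close> and \<open>d\<close>.\<close>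

definition hom_base ::
  "('x, 'a, 'e, 'v, 'k) vbundle \<Rightarrow> ('y, 'b, 'f, 'w, 'k) vbundle \<Rightarrow> ('e \<Rightarrow> 'f) \<Rightarrow> 'x \<Rightarrow> 'y" where
  "hom_base E F f p = vb_proj F (f (inv (vb_proj E) p))"

definition hom_rep ::
  "('x, 'a, 'e, 'v, 'k) vbundle \<Rightarrow> ('x, 'a, 'e, 'v) vb_chart \<Rightarrow> ('y, 'b, 'f, 'w) vb_chart
     \<Rightarrow> ('e \<Rightarrow> 'f) \<Rightarrow> 'a \<Rightarrow> 'v \<Rightarrow> 'w" where
  "hom_rep E c = (\<lambda>(W, \<psi>, \<Psi>) f x \<xi>. \<Psi> (f (vb_inv E c x \<xi>)))"

definition vb_homs ::
  "('x::t2_space, 'a::finite_dim_inner, 'e::t2_space, 'v::finite_dim_inner, 'k::field) vbundle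
     \<Rightarrow> ('y::t2_space, 'b::finite_dim_inner, 'f::t2_space, 'w::finite_dim_inner, 'k) vbundle
     \<Rightarrow> ('e \<Rightarrow> 'f) set" where
  "vb_homs E F = {f. continuous_on UNIV f \<and>
     (\<forall>z. vb_proj F (f z) = hom_base E F f (vb_proj E z)) \<and>
     (\<forall>(V, \<phi>, \<Phi>)\<in>vb_charts E. \<forall>(W, \<psi>, \<Psi>)\<in>vb_charts F.
        (\<forall>x\<in>\<phi> ` (V \<inter> hom_base E F f -` W).
           Vector_Spaces.linear (vb_scale E) (vb_scale F) (hom_rep E (V, \<phi>, \<Phi>) (W, \<psi>, \<Psi>) f x)) \<and>
        smooth_on (\<phi> ` (V \<inter> hom_base E F f -` W) \<times> UNIV)
          (\<lambda>(x, \<xi>). vb_triv F \<psi> \<Psi> (f (vb_inv E (V, \<phi>, \<Phi>) x \<xi>))))}"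

text \<open>Riemannian fiber metrics, as real inner products on the fibers (for complex bundles the real part
  of a Hermitian metric is one, with the same norm). Only values on pairs in a common fiber matter.\<close>

definition fiber_metric ::
  "('x::t2_space, 'a::finite_dim_inner, 'e::t2_space, 'v::finite_dim_inner, 'k) vbundle
     \<Rightarrow> ('e \<Rightarrow> 'e \<Rightarrow> real) \<Rightarrow> bool" where
  "fiber_metric E h \<longleftrightarrow>
     (\<forall>(V, \<phi>, \<Phi>)\<in>vb_charts E.
        let H = (\<lambda>x \<xi> \<eta>. h (vb_inv E (V, \<phi>, \<Phi>) x \<xi>) (vb_inv E (V, \<phi>, \<Phi>) x \<eta>)) in
        (\<forall>x\<in>\<phi> ` V. bilinear (H x) \<and> (\<forall>\<xi> \<eta>. H x \<xi> \<eta> = H x \<eta> \<xi>) \<and> (\<forall>\<xi>. \<xi> \<noteq> 0 \<longrightarrow> H x \<xi> \<xi> > 0)) \<and>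
        (\<forall>\<xi> \<eta>. smooth_on (\<phi> ` V) (\<lambda>x. H x \<xi> \<eta>)))"

definition fiber_norm :: "('e \<Rightarrow> 'e \<Rightarrow> real) \<Rightarrow> 'e \<Rightarrow> real" where
  "fiber_norm h z = sqrt (h z z)"


section \<open>Generalized functions\<close>

text \<open>Nets are functions on \<open>params = (0, 1]\<close>, extensional outside of it.\<close>

abbreviation params :: "real set" where
  "params \<equiv> {0<..1}"

text \<open>\<open>big_O r g\<close> means \<open>g \<epsilon> = O(\<epsilon>\<^sup>r)\<close> as \<open>\<epsilon> \<rightarrow> 0\<close>.\<close>

definition big_O :: "real \<Rightarrow> (real \<Rightarrow> ennreal) \<Rightarrow> bool" where
  "big_O r g \<longleftrightarrow>
     (\<exists>C>0. \<exists>\<epsilon>\<^sub>0>0. \<forall>\<epsilon>\<in>params. \<epsilon> < \<epsilon>\<^sub>0 \<longrightarrow> g \<epsilon> \<le> ennreal (C * \<epsilon> powr r))"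


subsection \<open>Manifold-valued generalized functions\<close>

definition EM ::
  "('x::t2_space, 'a::finite_dim_inner) chart set \<Rightarrow> ('y::t2_space, 'b::finite_dim_inner) chart set
     \<Rightarrow> (real \<Rightarrow> 'x \<Rightarrow> 'y) set" where
  "EM A B = {u \<in> params \<rightarrow>\<^sub>E smooth_maps A B.
     (\<forall>K. compact K \<longrightarrow>
        (\<exists>\<epsilon>\<^sub>0>0. \<exists>K'. compact K' \<and> (\<forall>\<epsilon>\<in>params. \<epsilon> < \<epsilon>\<^sub>0 \<longrightarrow> u \<epsilon> ` K \<subseteq> K'))) \<and>
     (\<forall>k\<ge>1. \<forall>(V, \<phi>)\<in>A. \<forall>(W, \<psi>)\<in>B. \<forall>L L'. compact L \<and> L \<subseteq> V \<and> compact L' \<and> L' \<subseteq> W \<longrightarrow>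
        (\<exists>N::nat. big_O (- real N) (\<lambda>\<epsilon>. SUP p\<in>L \<inter> u \<epsilon> -` L'.
           deriv_norm k (\<psi> \<circ> u \<epsilon> \<circ> inv_into V \<phi>) (\<phi> p))))}"

definition EM_equiv ::
  "('x::t2_space, 'a::finite_dim_inner) chart set \<Rightarrow> ('y::t2_space, 'b::finite_dim_inner) chart set
     \<Rightarrow> ((real \<Rightarrow> 'x \<Rightarrow> 'y) \<times> (real \<Rightarrow> 'x \<Rightarrow> 'y)) set" where
  "EM_equiv A B = {(u, v). u \<in> EM A B \<and> v \<in> EM A B \<and>
     (\<exists>h. riemannian_metric B h \<and>
        (\<forall>K. compact K \<longrightarrow> ((\<lambda>\<epsilon>. SUP p\<in>K. riem_dist B h (u \<epsilon> p) (v \<epsilon> p)) \<longlongrightarrow> 0) (at_right 0))) \<and>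
     (\<forall>k. \<forall>m::nat. m \<ge> 1 \<longrightarrow> (\<forall>(V, \<phi>)\<in>A. \<forall>(W, \<psi>)\<in>B. \<forall>L L'.
        compact L \<and> L \<subseteq> V \<and> compact L' \<and> L' \<subseteq> W \<longrightarrow>
        big_O (real m) (\<lambda>\<epsilon>. SUP p\<in>L \<inter> u \<epsilon> -` L' \<inter> v \<epsilon> -` L'.
          deriv_norm k (\<lambda>x. (\<psi> \<circ> u \<epsilon> \<circ> inv_into V \<phi>) x - (\<psi> \<circ> v \<epsilon> \<circ> inv_into V \<phi>) x) (\<phi> p))))}"


subsection \<open>Generalized vector bundle homomorphisms\<close>

definition EM_VB ::
  "('x::t2_space, 'a::finite_dim_inner, 'e::t2_space, 'v::finite_dim_inner, 'k::field) vbundle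
     \<Rightarrow> ('y::t2_space, 'b::finite_dim_inner, 'f::t2_space, 'w::finite_dim_inner, 'k) vbundle
     \<Rightarrow> (real \<Rightarrow> 'e \<Rightarrow> 'f) set" where
  "EM_VB E F = {u \<in> params \<rightarrow>\<^sub>E vb_homs E F.
     (\<lambda>\<epsilon>\<in>params. hom_base E F (u \<epsilon>)) \<in> EM (vb_base E) (vb_base F) \<and>
     (\<forall>k. \<forall>(V, \<phi>, \<Phi>)\<in>vb_charts E. \<forall>(W, \<psi>, \<Psi>)\<in>vb_charts F. \<forall>L L'.
        compact L \<and> L \<subseteq> V \<and> compact L' \<and> L' \<subseteq> W \<longrightarrow>
        (\<exists>N::nat. \<exists>\<epsilon>\<^sub>1>0. \<exists>C>0. \<forall>\<epsilon>\<in>params. \<epsilon> < \<epsilon>\<^sub>1 \<longrightarrow>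
           (\<forall>p\<in>L \<inter> hom_base E F (u \<epsilon>) -` L'.
              hom_deriv_norm k (hom_rep E (V, \<phi>, \<Phi>) (W, \<psi>, \<Psi>) (u \<epsilon>)) (\<phi> p)
                \<le> ennreal (C * \<epsilon> powr - real N))))}"

definition hom_equiv ::
  "('x::t2_space, 'a::finite_dim_inner, 'e::t2_space, 'v::finite_dim_inner, 'k::field) vbundle
     \<Rightarrow> ('y::t2_space, 'b::finite_dim_inner, 'f::t2_space, 'w::finite_dim_inner, 'k) vbundle
     \<Rightarrow> ((real \<Rightarrow> 'e \<Rightarrow> 'f) \<times> (real \<Rightarrow> 'e \<Rightarrow> 'f)) set" where
  "hom_equiv E F = {(u, v). u \<in> EM_VB E F \<and> v \<in> EM_VB E F \<and>
     ((\<lambda>\<epsilon>\<in>params. hom_base E F (u \<epsilon>)), (\<lambda>\<epsilon>\<in>params. hom_base E F (v \<epsilon>)))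
        \<in> EM_equiv (vb_base E) (vb_base F) \<and>
     (\<forall>k. \<forall>m::nat. m \<ge> 1 \<longrightarrow> (\<forall>(V, \<phi>, \<Phi>)\<in>vb_charts E. \<forall>(W, \<psi>, \<Psi>)\<in>vb_charts F. \<forall>L L'.
        compact L \<and> L \<subseteq> V \<and> compact L' \<and> L' \<subseteq> W \<longrightarrow>
        (\<exists>\<epsilon>\<^sub>1>0. \<exists>C>0. \<forall>\<epsilon>\<in>params. \<epsilon> < \<epsilon>\<^sub>1 \<longrightarrow>
           (\<forall>p\<in>L \<inter> hom_base E F (u \<epsilon>) -` L' \<inter> hom_base E F (v \<epsilon>) -` L'.
              hom_deriv_norm k
                (\<lambda>x \<xi>. hom_rep E (V, \<phi>, \<Phi>) (W, \<psi>, \<Psi>) (u \<epsilon>) x \<xi> -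
                        hom_rep E (V, \<phi>, \<Phi>) (W, \<psi>, \<Psi>) (v \<epsilon>) x \<xi>) (\<phi> p)
                \<le> ennreal (C * \<epsilon> powr real m)))))}"

definition Hom_G ::
  "('x::t2_space, 'a::finite_dim_inner, 'e::t2_space, 'v::finite_dim_inner, 'k::field) vbundle
     \<Rightarrow> ('y::t2_space, 'b::finite_dim_inner, 'f::t2_space, 'w::finite_dim_inner, 'k) vbundle
     \<Rightarrow> (real \<Rightarrow> 'e \<Rightarrow> 'f) set set" where
  "Hom_G E F = EM_VB E F // hom_equiv E F"


subsection \<open>Generalized sections\<close>

definition Gamma_EM ::
  "('x::t2_space, 'a::finite_dim_inner, 'e::t2_space, 'v::finite_dim_inner, 'k::field) vbundle
     \<Rightarrow> (real \<Rightarrow> 'x \<Rightarrow> 'e) set" where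
  "Gamma_EM E = {s \<in> params \<rightarrow>\<^sub>E sections E.
     \<exists>h. fiber_metric E h \<and>
       (\<forall>P\<in>diff_ops E. \<forall>K. compact K \<longrightarrow>
          (\<exists>N::nat. big_O (- real N) (\<lambda>\<epsilon>. SUP p\<in>K. ennreal (fiber_norm h (P (s \<epsilon>) p)))))}"

definition Gamma_N ::
  "('x::t2_space, 'a::finite_dim_inner, 'e::t2_space, 'v::finite_dim_inner, 'k::field) vbundle
     \<Rightarrow> (real \<Rightarrow> 'x \<Rightarrow> 'e) set" where
  "Gamma_N E = {s \<in> Gamma_EM E.
     \<exists>h. fiber_metric E h \<and>
       (\<forall>K. \<forall>m::nat. compact K \<and> m \<ge> 1 \<longrightarrow>
          big_O (real m) (\<lambda>\<epsilon>. SUP p\<in>K. ennreal (fiber_norm h (s \<epsilon> p))))}"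

definition Gamma_equiv ::
  "('x::t2_space, 'a::finite_dim_inner, 'e::t2_space, 'v::finite_dim_inner, 'k::field) vbundle
     \<Rightarrow> ((real \<Rightarrow> 'x \<Rightarrow> 'e) \<times> (real \<Rightarrow> 'x \<Rightarrow> 'e)) set" where
  "Gamma_equiv E = {(s, t). s \<in> Gamma_EM E \<and> t \<in> Gamma_EM E \<and>
     (\<lambda>\<epsilon>\<in>params. sec_diff E (s \<epsilon>) (t \<epsilon>)) \<in> Gamma_N E}"

definition Gamma_G ::
  "('x::t2_space, 'a::finite_dim_inner, 'e::t2_space, 'v::finite_dim_inner, 'k::field) vbundle
     \<Rightarrow> (real \<Rightarrow> 'x \<Rightarrow> 'e) set set" where
  "Gamma_G E = Gamma_EM E // Gamma_equiv E"


subsection \<open>Generalized points\<close>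

definition cpt_supp_nets :: "(real \<Rightarrow> 'x::t2_space) set" where
  "cpt_supp_nets = {p \<in> params \<rightarrow>\<^sub>E UNIV.
     \<exists>K. compact K \<and> (\<exists>\<epsilon>\<^sub>0>0. \<forall>\<epsilon>\<in>params. \<epsilon> < \<epsilon>\<^sub>0 \<longrightarrow> p \<epsilon> \<in> K)}"

definition point_equiv ::
  "('x::t2_space, 'a::finite_dim_inner) chart set \<Rightarrow> ((real \<Rightarrow> 'x) \<times> (real \<Rightarrow> 'x)) set" where
  "point_equiv A = {(p, q). p \<in> cpt_supp_nets \<and> q \<in> cpt_supp_nets \<and>
     (\<exists>g. riemannian_metric A g \<and>
        (\<forall>m::nat. m \<ge> 1 \<longrightarrow> big_O (real m) (\<lambda>\<epsilon>. riem_dist A g (p \<epsilon>) (q \<epsilon>))))}"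

definition gen_points ::
  "('x::t2_space, 'a::finite_dim_inner) chart set \<Rightarrow> (real \<Rightarrow> 'x) set set" where
  "gen_points A = cpt_supp_nets // point_equiv A"


subsection \<open>Generalized vector bundle points\<close>

definition vb_moderate ::
  "('x::t2_space, 'a::finite_dim_inner, 'e::t2_space, 'v::finite_dim_inner, 'k) vbundle
     \<Rightarrow> (real \<Rightarrow> 'e) set" where
  "vb_moderate E = {e \<in> params \<rightarrow>\<^sub>E UNIV.
     (\<exists>K. compact K \<and> (\<exists>\<epsilon>\<^sub>0>0. \<forall>\<epsilon>\<in>params. \<epsilon> < \<epsilon>\<^sub>0 \<longrightarrow> vb_proj E (e \<epsilon>) \<in> K)) \<and>
     (\<exists>h. fiber_metric E h \<and>
        (\<exists>\<epsilon>\<^sub>1>0. \<exists>N::nat. \<exists>C>0. \<forall>\<epsilon>\<in>params. \<epsilon> < \<epsilon>\<^sub>1 \<longrightarrow>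
           fiber_norm h (e \<epsilon>) \<le> C * \<epsilon> powr - real N))}"

definition vb_equiv ::
  "('x::t2_space, 'a::finite_dim_inner, 'e::t2_space, 'v::finite_dim_inner, 'k) vbundle
     \<Rightarrow> ((real \<Rightarrow> 'e) \<times> (real \<Rightarrow> 'e)) set" where
  "vb_equiv E = {(e, e'). e \<in> vb_moderate E \<and> e' \<in> vb_moderate E \<and>
     ((\<lambda>\<epsilon>\<in>params. vb_proj E (e \<epsilon>)), (\<lambda>\<epsilon>\<in>params. vb_proj E (e' \<epsilon>))) \<in> point_equiv (vb_base E) \<and>
     (\<forall>m::nat. m \<ge> 1 \<longrightarrow> (\<forall>(W, \<psi>, \<Psi>)\<in>vb_charts E. \<forall>L'. compact L' \<and> L' \<subseteq> W \<longrightarrow>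
        (\<exists>\<epsilon>\<^sub>1>0. \<exists>C>0. \<forall>\<epsilon>\<in>params.
           \<epsilon> < \<epsilon>\<^sub>1 \<and> vb_proj E (e \<epsilon>) \<in> L' \<and> vb_proj E (e' \<epsilon>) \<in> L' \<longrightarrow>
             norm (\<Psi> (e \<epsilon>) - \<Psi> (e' \<epsilon>)) \<le> C * \<epsilon> powr real m)))}"

definition vb_class ::
  "('x::t2_space, 'a::finite_dim_inner, 'e::t2_space, 'v::finite_dim_inner, 'k) vbundle
     \<Rightarrow> (real \<Rightarrow> 'e) \<Rightarrow> (real \<Rightarrow> 'e) set" where
  "vb_class E e = vb_equiv E `` {e}"

definition gen_vb_points ::
  "('x::t2_space, 'a::finite_dim_inner, 'e::t2_space, 'v::finite_dim_inner, 'k) vbundle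
     \<Rightarrow> (real \<Rightarrow> 'e) set set" where
  "gen_vb_points E = vb_moderate E // vb_equiv E"

end

theory Submission
  imports Defs
begin

text \<open>
  Moderateness and equivalence are compared in charts. On a compact subset of a chart domain a Riemannian
  distance is bounded above and below by the coordinate distance: straight segments give the upper bound,
  and a curve leaving a coordinate ball has length at least a multiple of the radius. So \<open>p \<sim> q\<close> implies that
  coordinate differences are \<open>O(\<epsilon>\<^sup>m)\<close>, and by the mean value theorem it suffices to bound
  first derivatives of the local representatives.
  For sections these bounds come from the differential operator \<open>s \<mapsto> \<beta> \<partial>\<^sub>v s\<close> with a bump function \<open>\<beta>\<close>
  supported in a chart. For homomorphisms they are part of the definition, but the mean value theorem also
  needs the images of a whole coordinate ball in one chart of \<open>F\<close>; this is what the hypothesis in (ii)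
  provides, and it passes to equivalent nets because \<open>d\<^sub>h(u\<^sub>\<epsilon>, v\<^sub>\<epsilon>) \<rightarrow> 0\<close> uniformly on compact sets. A fiber
  metric on \<open>F\<close>, needed for moderateness, is glued from local ones.
\<close>

section \<open>Finite-dimensional model spaces\<close>

text \<open>Equivalences of points and of base maps are witnessed by some Riemannian metric,
  possibly another one for each pair. The metric on the base of \<open>F\<close> needed for
  comparing values is the one that witnesses the equivalence of the two nets. Equivalent bundle
  points usually lie over different base points, so a change of chart applies two different matrices
  to their fiber coordinates. The error is bounded by the derivative of the transition matrix times
  the base distance times a fiber norm: a negligible factor against a moderate one. Hence it
  suffices to estimate, near each point of a compact set in \<open>X\<close>, in a single convenient
  chart of \<open>F\<close>; all other charts follow. Independence of representatives splits into
  two moves from one fixed pair: the argument changes under a fixed net (mean value theorem), and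
  the net changes at a fixed argument (the definition of equivalence).\<close>

definition fd_basis :: "'a::finite_dim_inner set" where
  "fd_basis = (SOME B. finite B \<and> (\<forall>u\<in>B. \<forall>v\<in>B. inner u v = (if u = v then 1 else 0)) \<and>
         (\<forall>x. (\<forall>u\<in>B. inner x u = 0) \<longleftrightarrow> x = 0))"

lemma fd_basis:
  shows finite_fd_basis [simp]: "finite (fd_basis :: 'a::finite_dim_inner set)"
    and inner_fd_basis: "u \<in> fd_basis \<Longrightarrow> v \<in> fd_basis \<Longrightarrow> inner u v = (if u = (v::'a) then 1 else 0)"
    and fd_basis_eq_0: "(\<And>u. u \<in> fd_basis \<Longrightarrow> inner (x::'a) u = 0) \<Longrightarrow> x = 0"
  using someI_ex[OF ex_finite_orthonormal_basis[where ?'a = 'a]]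
  unfolding fd_basis_def[symmetric] by auto

lemma norm_fd_basis [simp]: "u \<in> fd_basis \<Longrightarrow> norm (u::'a::finite_dim_inner) = 1"
  by (simp add: norm_eq_sqrt_inner inner_fd_basis)

lemma fd_expand: "(x::'a::finite_dim_inner) = (\<Sum>u\<in>fd_basis. (x \<bullet> u) *\<^sub>R u)"
proof -
  have "x - (\<Sum>u\<in>fd_basis. (x \<bullet> u) *\<^sub>R u) = 0"
  proof (rule fd_basis_eq_0)
    fix w :: 'a assume w: "w \<in> fd_basis"
    have "(\<Sum>u\<in>fd_basis. (x \<bullet> u) * (u \<bullet> w)) = (\<Sum>u\<in>fd_basis. if u = w then x \<bullet> w else 0)"
      using w by (intro sum.cong) (auto simp: inner_fd_basis)
    also have "\<dots> = x \<bullet> w" using w by simp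
    finally show "(x - (\<Sum>u\<in>fd_basis. (x \<bullet> u) *\<^sub>R u)) \<bullet> w = 0"
      by (simp add: inner_diff_left inner_sum_left)
  qed
  then show ?thesis by simp
qed

lemma linear_fd_expand:
  fixes f :: "'a::finite_dim_inner \<Rightarrow> 'b::real_vector"
  assumes "linear f" shows "f x = (\<Sum>u\<in>fd_basis. (x \<bullet> u) *\<^sub>R f u)"
proof -
  have "f x = f (\<Sum>u\<in>fd_basis. (x \<bullet> u) *\<^sub>R u)" using fd_expand[of x] by simp
  then show ?thesis using assms by (simp add: linear_sum linear_scale)
qed

text \<open>The constant is kept explicit so that bounds on finitely many basis values, which is
  what is available direction by direction, yield a bound on the whole linear map.\<close>

lemma norm_linear_fd_le:
  fixes f :: "'a::finite_dim_inner \<Rightarrow> 'b::real_normed_vector"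
  assumes "linear f" shows "norm (f x) \<le> (\<Sum>u\<in>fd_basis. norm (f u)) * norm x"
proof -
  have "norm (f x) \<le> (\<Sum>u\<in>fd_basis. norm ((x \<bullet> u) *\<^sub>R f u))"
    by (subst linear_fd_expand[OF assms]) (rule norm_sum)
  also have "\<dots> \<le> (\<Sum>u\<in>fd_basis. norm (f u) * norm x)"
  proof (rule sum_mono)
    fix u :: 'a assume "u \<in> fd_basis"
    then have "\<bar>x \<bullet> u\<bar> \<le> norm x" using Cauchy_Schwarz_ineq2[of x u] by simp
    then show "norm ((x \<bullet> u) *\<^sub>R f u) \<le> norm (f u) * norm x"
      unfolding norm_scaleR mult.commute[of "norm (f u)"] by (rule mult_right_mono) simp
  qed
  finally show ?thesis by (simp add: sum_distrib_right)
qed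

lemma linear_fd_bounded_linear:
  fixes f :: "'a::finite_dim_inner \<Rightarrow> 'b::real_normed_vector"
  assumes "linear f" shows "bounded_linear f"
proof (rule bounded_linear_intro)
  show "norm (f x) \<le> norm x * (\<Sum>u\<in>fd_basis. norm (f u))" for x
    using norm_linear_fd_le[OF assms, of x] by (simp only: mult.commute)
qed (use assms in \<open>simp_all add: linear_add linear_scale\<close>)

section \<open>Compactness in the model spaces\<close>

text \<open>Induction on the vectors: the box is the Minkowski sum of a segment and a box with one
  vector fewer, and sums of compact sets are compact.\<close>

lemma compact_coordinate_box:
  fixes B :: "'a::real_normed_vector set"
  assumes "finite B"
  shows "compact {\<Sum>u\<in>B. c u *\<^sub>R u |c. \<forall>u\<in>B. \<bar>c u\<bar> \<le> (R::real)}"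
  using assms
proof (induction B)
  case empty then show ?case by simp
next
  case (insert b B)
  let ?S = "{\<Sum>u\<in>B. c u *\<^sub>R u |c. \<forall>u\<in>B. \<bar>c u\<bar> \<le> R}"
  let ?T = "(\<lambda>t. t *\<^sub>R b) ` {-R..R}"
  have "compact ?T" by (intro compact_continuous_image continuous_intros) auto
  then have "compact {x + y |x y. x \<in> ?T \<and> y \<in> ?S}" using insert.IH by (rule compact_sums)
  also have "{x + y |x y. x \<in> ?T \<and> y \<in> ?S} = {\<Sum>u\<in>insert b B. c u *\<^sub>R u |c. \<forall>u\<in>insert b B. \<bar>c u\<bar> \<le> R}"
  proof safe
    fix c :: "'a \<Rightarrow> real" and t
    assume "\<forall>u\<in>B. \<bar>c u\<bar> \<le> R" "t \<in> {-R..R}"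
    moreover have "(\<Sum>u\<in>B. (c(b := t)) u *\<^sub>R u) = (\<Sum>u\<in>B. c u *\<^sub>R u)"
      using insert.hyps by (intro sum.cong) auto
    ultimately show "\<exists>d. t *\<^sub>R b + (\<Sum>u\<in>B. c u *\<^sub>R u) = (\<Sum>u\<in>insert b B. d u *\<^sub>R u) \<and>
        (\<forall>u\<in>insert b B. \<bar>d u\<bar> \<le> R)"
      using insert.hyps by (intro exI[of _ "c(b := t)"]) auto
  next
    fix c :: "'a \<Rightarrow> real"
    assume c: "\<forall>u\<in>insert b B. \<bar>c u\<bar> \<le> R"
    show "\<exists>x y. (\<Sum>u\<in>insert b B. c u *\<^sub>R u) = x + y \<and> x \<in> ?T \<and> y \<in> ?S"
      using insert.hyps c by (intro exI[of _ "c b *\<^sub>R b"] exI[of _ "\<Sum>u\<in>B. c u *\<^sub>R u"]) (auto simp: abs_le_iff)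
  qed
  finally show ?case .
qed

text \<open>By Cauchy-Schwarz a ball around 0 is a closed part of a coordinate box; translation
  moves the center.\<close>

lemma compact_cball_fd: "compact (cball (a::'a::finite_dim_inner) r)"
proof -
  let ?S = "{\<Sum>u\<in>fd_basis. c u *\<^sub>R u |c. \<forall>u\<in>fd_basis. \<bar>c u\<bar> \<le> r} :: 'a set"
  have "cball 0 r \<subseteq> ?S"
  proof
    fix x :: 'a assume "x \<in> cball 0 r"
    then have "\<bar>x \<bullet> u\<bar> \<le> r" if "u \<in> fd_basis" for u
      using Cauchy_Schwarz_ineq2[of x u] that by simp
    then show "x \<in> ?S" using fd_expand[of x] by blast
  qed
  then have *: "?S \<inter> cball 0 r = cball 0 r" by (rule Int_absorb1)
  have "compact (?S \<inter> cball 0 r)"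
    by (intro compact_Int_closed compact_coordinate_box) simp_all
  then have "compact (cball (0::'a) r)" unfolding * .
  then have "compact ((+) a ` cball 0 r)" by (intro compact_continuous_image continuous_intros)
  then show ?thesis by (simp only: cball_translation[of a 0 r, symmetric] add_0_right)
qed

text \<open>The thickening is the Minkowski sum of \<open>L\<close> and a closed ball. Half the
  radius of an open neighborhood is taken so that closed balls still fit inside \<open>U\<close>. It
  provides the room in which segments and mean value estimates live.\<close>

lemma compact_thickening:
  fixes L :: "'a::finite_dim_inner set"
  assumes "compact L" "open U" "L \<subseteq> U"
  obtains \<rho> where "\<rho> > 0" "compact (\<Union>x\<in>L. cball x \<rho>)" "(\<Union>x\<in>L. cball x \<rho>) \<subseteq> U"
proof -
  obtain e where e: "e > 0" "(\<Union>x\<in>L. ball x e) \<subseteq> U"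
    using compact_subset_open_imp_ball_epsilon_subset[OF assms] by blast
  have eq: "(\<Union>x\<in>L. cball x (e/2)) = {x + y |x y. x \<in> L \<and> y \<in> cball 0 (e/2)}"
  proof safe
    fix x y :: 'a assume "x \<in> L" "y \<in> cball x (e/2)"
    then show "\<exists>x' y'. y = x' + y' \<and> x' \<in> L \<and> y' \<in> cball 0 (e/2)"
      by (intro exI[of _ x] exI[of _ "y - x"]) (auto simp: dist_norm norm_minus_commute)
  next
    fix x y :: 'a assume "x \<in> L" "y \<in> cball 0 (e/2)"
    then show "x + y \<in> (\<Union>x\<in>L. cball x (e/2))" by (intro UN_I[of x]) (auto simp: dist_norm)
  qed
  have "compact (\<Union>x\<in>L. cball x (e/2))"
    unfolding eq using assms(1) compact_cball_fd by (rule compact_sums)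
  moreover have "(\<Union>x\<in>L. cball x (e/2)) \<subseteq> (\<Union>x\<in>L. ball x e)" using e(1) by force
  ultimately show thesis using that[of "e/2"] e by auto
qed

text \<open>The extreme values of \<open>H x v v\<close> on the compact set of pairs (x, unit
  vector) are the constants; homogeneity extends the bounds to all \<open>v\<close>. The same lemma
  serves fiber metrics and Riemannian metrics.\<close>

lemma posdef_family_bounds:
  fixes H :: "'p::topological_space \<Rightarrow> 'a::finite_dim_inner \<Rightarrow> 'a \<Rightarrow> real"
  assumes S: "compact S" and bil: "\<And>x. x \<in> S \<Longrightarrow> bilinear (H x)"
    and pos: "\<And>x v. x \<in> S \<Longrightarrow> v \<noteq> 0 \<Longrightarrow> H x v v > 0"
    and cont: "\<And>v w. continuous_on S (\<lambda>x. H x v w)"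
  obtains c C where "c > 0" "C > 0" "\<And>x v. x \<in> S \<Longrightarrow> c * (norm v)\<^sup>2 \<le> H x v v"
    "\<And>x v. x \<in> S \<Longrightarrow> H x v v \<le> C * (norm v)\<^sup>2"
proof -
  let ?K = "S \<times> sphere (0::'a) 1"
  \<comment> \<open>Continuity is given only for fixed vectors; the expansion in a basis makes
    \<open>H\<close> jointly continuous in the point and the vector.\<close>
  have expand: "H x v v = (\<Sum>u\<in>fd_basis. \<Sum>w\<in>fd_basis. (v \<bullet> u) * (v \<bullet> w) * H x u w)" if "x \<in> S" for x v
  proof -
    have 1: "linear (\<lambda>u. H x u v)" "\<And>u. linear (H x u)" using bil[OF that] by (auto simp: bilinear_def)
    have "H x v v = (\<Sum>u\<in>fd_basis. (v \<bullet> u) *\<^sub>R H x u v)"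
      using linear_fd_expand[OF 1(1), of v] .
    also have "\<dots> = (\<Sum>u\<in>fd_basis. (v \<bullet> u) *\<^sub>R (\<Sum>w\<in>fd_basis. (v \<bullet> w) *\<^sub>R H x u w))"
      by (intro sum.cong refl arg_cong2[where f = scaleR] linear_fd_expand[OF 1(2)])
    finally show ?thesis by (simp add: sum_distrib_left mult.assoc)
  qed
  have cl: "closed (sphere (0::'a) 1)"
    unfolding sphere_def by (intro closed_Collect_eq continuous_intros)
  have "compact (sphere (0::'a) 1)"
    using compact_Int_closed[OF compact_cball_fd[of 0 1] cl]
    by (metis Int_absorb1 sphere_cball)
  then have K: "compact ?K" using S compact_Times by blast
  have "continuous_on ?K (\<lambda>z. \<Sum>u\<in>fd_basis. \<Sum>w\<in>fd_basis. (snd z \<bullet> u) * (snd z \<bullet> w) * H (fst z) u w)"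
    by (intro continuous_intros continuous_on_compose2[OF cont]) auto
  then have cK: "continuous_on ?K (\<lambda>z. H (fst z) (snd z) (snd z))"
    by (rule continuous_on_eq) (use expand in auto)
  have hom: "H x v v = (norm v)\<^sup>2 * H x (sgn v) (sgn v)" if "x \<in> S" for x v
  proof -
    have "H x v v = H x (norm v *\<^sub>R sgn v) (norm v *\<^sub>R sgn v)"
      by (cases "v = 0") (simp_all add: sgn_div_norm)
    then show ?thesis using bil[OF that] by (simp add: bilinear_lmul bilinear_rmul power2_eq_square)
  qed
  have zero: "H x 0 0 = 0" if "x \<in> S" for x using bil[OF that] by (simp add: bilinear_lzero)
  show thesis
  proof (cases "?K = {}")
    \<comment> \<open>Either \<open>S\<close> is empty or the space is zero-dimensional; then only
      \<open>v = 0\<close> occurs and any constants will do.\<close>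
    case True
    have eq: "c * (norm v)\<^sup>2 = H x v v" if "x \<in> S" for x c and v :: 'a
    proof -
      have "sgn v \<notin> sphere 0 1" using True that by auto
      then have "v = 0" by (auto simp: norm_sgn split: if_splits)
      then show ?thesis using zero[OF that] by simp
    qed
    show thesis
    proof (rule that)
      show "(1::real) > 0" "(1::real) > 0" by simp_all
    qed (use eq[where c = 1] in simp_all)
  next
    case False
    obtain a where a: "a \<in> ?K" "\<And>z. z \<in> ?K \<Longrightarrow> H (fst a) (snd a) (snd a) \<le> H (fst z) (snd z) (snd z)"
      using continuous_attains_inf[OF K False cK] by blast
    obtain b where b: "b \<in> ?K" "\<And>z. z \<in> ?K \<Longrightarrow> H (fst z) (snd z) (snd z) \<le> H (fst b) (snd b) (snd b)"
      using continuous_attains_sup[OF K False cK] by blast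
    have "snd a \<noteq> 0" "snd b \<noteq> 0" using a(1) b(1) by auto
    then have p: "H (fst a) (snd a) (snd a) > 0" "H (fst b) (snd b) (snd b) > 0"
      using a(1) b(1) by (auto intro!: pos)
    show thesis
    proof (rule that[OF p])
      fix x :: 'p and v :: 'a assume x: "x \<in> S"
      have *: "H (fst a) (snd a) (snd a) * (norm v)\<^sup>2 \<le> H x (sgn v) (sgn v) * (norm v)\<^sup>2 \<and>
          H x (sgn v) (sgn v) * (norm v)\<^sup>2 \<le> H (fst b) (snd b) (snd b) * (norm v)\<^sup>2"
      proof (cases "v = 0")
        case False
        then have "(x, sgn v) \<in> ?K" using x by (simp add: norm_sgn)
        then show ?thesis using a(2)[of "(x, sgn v)"] b(2)[of "(x, sgn v)"] by (simp add: mult_right_mono)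
      qed simp
      show "H (fst a) (snd a) (snd a) * (norm v)\<^sup>2 \<le> H x v v"
        "H x v v \<le> H (fst b) (snd b) (snd b) * (norm v)\<^sup>2"
        using * hom[OF x, of v] by (simp_all only: mult.commute)
    qed
  qed
qed

section \<open>Calculus of smooth functions\<close>

text \<open>Smoothness cut off at a finite order. The derivative of a product or composite is built
  from functions of one order less, so closure properties are inductions on
  \<open>n\<close>.\<close>

definition diffk :: "nat \<Rightarrow> 'a::real_normed_vector set \<Rightarrow> ('a \<Rightarrow> 'b::real_normed_vector) \<Rightarrow> bool" where
  "diffk n U f \<longleftrightarrow> (\<forall>vs. length vs \<le> n \<longrightarrow> (\<forall>x\<in>U. iter_deriv f vs differentiable at x))"

lemma smooth_on_iff_diffk: "smooth_on U f \<longleftrightarrow> (\<forall>n. diffk n U f)"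
  unfolding smooth_on_def diffk_def by auto

text \<open>The recursion of \<open>iter_deriv\<close> peels off the derivative taken last; this
  peels off the one taken first, so that induction can pass from a function to its
  derivative.\<close>

lemma iter_deriv_snoc: "iter_deriv f (vs @ [v]) = iter_deriv (\<lambda>x. frechet_derivative f (at x) v) vs"
  by (induction vs) auto

lemma diffk_0: "diffk 0 U f \<longleftrightarrow> (\<forall>x\<in>U. f differentiable at x)"
  unfolding diffk_def by auto

lemma diffk_Suc: "diffk (Suc n) U f \<longleftrightarrow>
    (\<forall>x\<in>U. f differentiable at x) \<and> (\<forall>v. diffk n U (\<lambda>x. frechet_derivative f (at x) v))" (is "?L \<longleftrightarrow> ?R")
proof
  assume L: ?L
  have "diffk n U (\<lambda>x. frechet_derivative f (at x) v)" for v
    unfolding diffk_def iter_deriv_snoc[symmetric] using L unfolding diffk_def by auto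
  moreover have "\<forall>x\<in>U. f differentiable at x"
    using L unfolding diffk_def by (auto dest: spec[of _ "[]"])
  ultimately show ?R by blast
next
  assume R: ?R
  show ?L unfolding diffk_def
  proof (intro allI impI)
    fix vs :: "'a list" assume "length vs \<le> Suc n"
    then show "\<forall>x\<in>U. iter_deriv f vs differentiable at x"
      using R by (cases vs rule: rev_cases) (auto simp: iter_deriv_snoc diffk_def)
  qed
qed

lemma diffk_cong:
  assumes "open U" "\<And>x. x \<in> U \<Longrightarrow> f x = g x" "diffk n U f"
  shows "diffk n U g"
  using assms(2,3)
proof (induction n arbitrary: f g)
  have *: "(g has_derivative frechet_derivative f (at x)) (at x)"
    if "x \<in> U" "f differentiable at x" "\<And>x. x \<in> U \<Longrightarrow> f x = g x" for x and f g :: "'a \<Rightarrow> 'b"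
    using has_derivative_transform_within_open[of f _ x UNIV U g] that assms(1)
    by (simp add: frechet_derivative_works)
  {
    case 0
    have "g differentiable at x" if "x \<in> U" for x
      using 0 that by (intro differentiableI[OF *[of x f g]]) (simp_all add: diffk_0)
    then show ?case by (simp add: diffk_0)
  next
    case (Suc n)
    have "frechet_derivative g (at x) = frechet_derivative f (at x)" if "x \<in> U" for x
      using Suc.prems that by (intro frechet_derivative_at[symmetric] *[of x f g]) (simp_all add: diffk_Suc)
    then have "diffk n U (\<lambda>x. frechet_derivative g (at x) v)" for v
      using Suc.prems(2) unfolding diffk_Suc
      by (intro Suc.IH[OF _ spec[of _ v]]) (simp, blast)
    moreover have "g differentiable at x" if "x \<in> U" for x
      using Suc.prems that by (intro differentiableI[OF *[of x f g]]) (simp_all add: diffk_Suc)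
    ultimately show ?case by (simp add: diffk_Suc)
  }
qed

text \<open>The induction step of the rules below: it suffices to guess a formula for the derivative
  and to check its order in each fixed direction.\<close>

lemma diffk_SucI:
  assumes "open U" "\<And>x. x \<in> U \<Longrightarrow> (f has_derivative f' x) (at x)" "\<And>v. diffk n U (\<lambda>x. f' x v)"
  shows "diffk (Suc n) U f"
  unfolding diffk_Suc
proof (intro conjI allI ballI)
  show "f differentiable at x" if "x \<in> U" for x using assms(2)[OF that] by (auto simp: differentiable_def)
  show "diffk n U (\<lambda>x. frechet_derivative f (at x) v)" for v
    by (rule diffk_cong[OF assms(1) _ assms(3)]) (simp add: frechet_derivative_at[OF assms(2), symmetric])
qed

lemma diffk_has_derivative:
  "diffk n U f \<Longrightarrow> x \<in> U \<Longrightarrow> (f has_derivative frechet_derivative f (at x)) (at x)"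
  by (cases n) (auto simp: diffk_0 diffk_Suc frechet_derivative_works)

lemma diffk_decr: "diffk (Suc n) U f \<Longrightarrow> diffk n U f"
  unfolding diffk_def by auto

lemma diffk_const: "open U \<Longrightarrow> diffk n U (\<lambda>x. c)"
proof (induction n arbitrary: c)
  case (Suc n) then show ?case by (intro diffk_SucI[where f' = "\<lambda>_ _. 0"]) auto
qed (simp add: diffk_0)

lemma diffk_bounded_linear: "open U \<Longrightarrow> bounded_linear f \<Longrightarrow> diffk n U f"
  by (cases n) (auto simp: diffk_0 bounded_linear_imp_differentiable intro!: diffk_SucI[where f' = "\<lambda>_. f"]
      diffk_const bounded_linear_imp_has_derivative)

lemma diffk_compose_linear:
  assumes "open U" "bounded_linear l" "diffk n U f"
  shows "diffk n U (\<lambda>x. l (f x))"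
  using assms(3)
proof (induction n arbitrary: f)
  case 0 then show ?case using bounded_linear.has_derivative[OF assms(2)] by (fastforce simp: diffk_0 differentiable_def)
next
  case (Suc n)
  show ?case
  proof (rule diffk_SucI[OF assms(1)])
    show "((\<lambda>x. l (f x)) has_derivative (\<lambda>v. l (frechet_derivative f (at x) v))) (at x)" if "x \<in> U" for x
      using bounded_linear.has_derivative[OF assms(2) diffk_has_derivative[OF Suc.prems that]] .
    show "diffk n U (\<lambda>x. l (frechet_derivative f (at x) v))" for v
      using Suc by (simp add: diffk_Suc)
  qed
qed

lemma diffk_add:
  assumes "open U" "diffk n U f" "diffk n U g"
  shows "diffk n U (\<lambda>x. f x + g x)"
  using assms(2,3)
proof (induction n arbitrary: f g)
  case 0 then show ?case by (simp add: diffk_0)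
next
  case (Suc n)
  show ?case
  proof (rule diffk_SucI[OF assms(1)])
    show "((\<lambda>x. f x + g x) has_derivative
       (\<lambda>v. frechet_derivative f (at x) v + frechet_derivative g (at x) v)) (at x)" if "x \<in> U" for x
      using Suc.prems that by (intro has_derivative_add diffk_has_derivative)
    show "diffk n U (\<lambda>x. frechet_derivative f (at x) v + frechet_derivative g (at x) v)" for v
      using Suc by (simp add: diffk_Suc)
  qed
qed

lemma diffk_sum:
  assumes "open U" "\<And>i. i \<in> I \<Longrightarrow> diffk n U (f i)"
  shows "diffk n U (\<lambda>x. \<Sum>i\<in>I. f i x)"
  using assms(2) by (induction I rule: infinite_finite_induct) (auto simp: diffk_const diffk_add assms(1))

lemma diffk_bilinear:
  assumes "open U" "bounded_bilinear b" "diffk n U f" "diffk n U g"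
  shows "diffk n U (\<lambda>x. b (f x) (g x))"
  using assms(3,4)
proof (induction n arbitrary: f g)
  case 0 then show ?case
    using bounded_bilinear.FDERIV[OF assms(2)] by (fastforce simp: diffk_0 differentiable_def)
next
  case (Suc n)
  show ?case
  proof (rule diffk_SucI[OF assms(1)])
    show "((\<lambda>x. b (f x) (g x)) has_derivative
       (\<lambda>v. b (f x) (frechet_derivative g (at x) v) + b (frechet_derivative f (at x) v) (g x))) (at x)"
      if "x \<in> U" for x
      using Suc.prems that by (intro bounded_bilinear.FDERIV[OF assms(2)] diffk_has_derivative)
    show "diffk n U (\<lambda>x. b (f x) (frechet_derivative g (at x) v) + b (frechet_derivative f (at x) v) (g x))" for v
      using Suc.prems[THEN diffk_decr] Suc.prems[unfolded diffk_Suc]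
      by (intro diffk_add assms(1) Suc.IH) blast+
  qed
qed

text \<open>In the chain rule the outer derivative is applied to a direction that varies with
  \<open>x\<close>. Finite dimension of the intermediate space turns this into a finite sum of
  products to which the bilinear rule and the induction hypothesis apply.\<close>

lemma diffk_compose:
  fixes g :: "'a::real_normed_vector \<Rightarrow> 'b::finite_dim_inner"
  assumes "open U" "open W" "diffk n U g" "diffk n W f" "\<And>x. x \<in> U \<Longrightarrow> g x \<in> W"
  shows "diffk n U (\<lambda>x. f (g x))"
  using assms(3,4)
proof (induction n arbitrary: f)
  case 0
  then show ?case
    using differentiable_chain_at[unfolded o_def] assms(5) unfolding diffk_0 by blast
next
  case (Suc n)
  show ?case
  proof (rule diffk_SucI[OF assms(1)])
    fix x assume x: "x \<in> U"
    let ?f' = "frechet_derivative f (at (g x))" and ?g' = "frechet_derivative g (at x)"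
    have "((\<lambda>x. f (g x)) has_derivative (\<lambda>v. ?f' (?g' v))) (at x)"
      using diff_chain_at[OF diffk_has_derivative[OF Suc.prems(1) x] diffk_has_derivative[OF Suc.prems(2) assms(5)[OF x]]]
      by (simp add: o_def)
    \<comment> \<open>The expansion separates the moving direction \<open>?g' v\<close> from values
      of the outer derivative in fixed directions.\<close>
    moreover have "linear ?f'"
      using diffk_has_derivative[OF Suc.prems(2) assms(5)[OF x]] by (rule has_derivative_linear)
    then have "(\<lambda>v. ?f' (?g' v)) = (\<lambda>v. \<Sum>u\<in>fd_basis. (?g' v \<bullet> u) *\<^sub>R ?f' u)"
      by (intro ext linear_fd_expand)
    ultimately show "((\<lambda>x. f (g x)) has_derivative (\<lambda>v. \<Sum>u\<in>fd_basis. (?g' v \<bullet> u) *\<^sub>R ?f' u)) (at x)"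
      by (rule has_derivative_eq_rhs)
  next
    fix v
    have 1: "diffk n U (\<lambda>x. frechet_derivative g (at x) v)" using Suc.prems by (simp add: diffk_Suc)
    have 2: "diffk n U (\<lambda>x. frechet_derivative f (at (g x)) u)" for u
      using Suc.prems(1)[THEN diffk_decr] Suc.prems(2)[unfolded diffk_Suc] by (intro Suc.IH) blast+
    show "diffk n U (\<lambda>x. \<Sum>u\<in>fd_basis. (frechet_derivative g (at x) v \<bullet> u) *\<^sub>R frechet_derivative f (at (g x)) u)"
      by (intro diffk_sum assms(1) diffk_bilinear[OF assms(1) bounded_bilinear_scaleR]
          diffk_bilinear[OF assms(1) bounded_bilinear_inner] 1 2 diffk_const)
  qed
qed

lemma smooth_on_cong:
  "open U \<Longrightarrow> (\<And>x. x \<in> U \<Longrightarrow> f x = g x) \<Longrightarrow> smooth_on U f \<Longrightarrow> smooth_on U g"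
  unfolding smooth_on_iff_diffk using diffk_cong by metis

lemma smooth_on_subset: "smooth_on U f \<Longrightarrow> V \<subseteq> U \<Longrightarrow> smooth_on V f"
  unfolding smooth_on_def by blast

lemma smooth_on_local:
  assumes "\<And>x. x \<in> U \<Longrightarrow> \<exists>N. x \<in> N \<and> smooth_on N f"
  shows "smooth_on U f"
  using assms unfolding smooth_on_def by blast

lemma smooth_on_const: "open U \<Longrightarrow> smooth_on U (\<lambda>x. c)"
  by (simp add: smooth_on_iff_diffk diffk_const)

lemma smooth_on_bounded_linear: "open U \<Longrightarrow> bounded_linear f \<Longrightarrow> smooth_on U f"
  by (simp add: smooth_on_iff_diffk diffk_bounded_linear)

lemma smooth_on_compose_linear:
  "open U \<Longrightarrow> bounded_linear l \<Longrightarrow> smooth_on U f \<Longrightarrow> smooth_on U (\<lambda>x. l (f x))"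
  by (simp add: smooth_on_iff_diffk diffk_compose_linear)

lemma smooth_on_add: "open U \<Longrightarrow> smooth_on U f \<Longrightarrow> smooth_on U g \<Longrightarrow> smooth_on U (\<lambda>x. f x + g x)"
  by (simp add: smooth_on_iff_diffk diffk_add)

lemma smooth_on_minus: "open U \<Longrightarrow> smooth_on U f \<Longrightarrow> smooth_on U (\<lambda>x. - f x)"
  using smooth_on_compose_linear[OF _ bounded_linear_minus[OF bounded_linear_ident]] by blast

lemma smooth_on_diff: "open U \<Longrightarrow> smooth_on U f \<Longrightarrow> smooth_on U g \<Longrightarrow> smooth_on U (\<lambda>x. f x - g x)"
  using smooth_on_add[of U f "\<lambda>x. - g x"] smooth_on_minus[of U g] by simp

lemma smooth_on_sum:
  "open U \<Longrightarrow> (\<And>i. i \<in> I \<Longrightarrow> smooth_on U (f i)) \<Longrightarrow> smooth_on U (\<lambda>x. \<Sum>i\<in>I. f i x)"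
  by (simp add: smooth_on_iff_diffk diffk_sum)

lemma smooth_on_bilinear:
  "open U \<Longrightarrow> bounded_bilinear b \<Longrightarrow> smooth_on U f \<Longrightarrow> smooth_on U g \<Longrightarrow> smooth_on U (\<lambda>x. b (f x) (g x))"
  by (simp add: smooth_on_iff_diffk diffk_bilinear)

lemmas smooth_on_scaleR = smooth_on_bilinear[OF _ bounded_bilinear_scaleR]
lemmas smooth_on_inner = smooth_on_bilinear[OF _ bounded_bilinear_inner]

lemma smooth_on_compose:
  fixes g :: "'a::real_normed_vector \<Rightarrow> 'b::finite_dim_inner"
  assumes "open U" "open W" "smooth_on U g" "smooth_on W f" "\<And>x. x \<in> U \<Longrightarrow> g x \<in> W"
  shows "smooth_on U (\<lambda>x. f (g x))"
  using diffk_compose[OF assms(1,2), of _ g f] assms(3-5) unfolding smooth_on_iff_diffk by blast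

lemma smooth_on_frechet_derivative:
  "smooth_on U f \<Longrightarrow> smooth_on U (\<lambda>x. frechet_derivative f (at x) v)"
  unfolding smooth_on_iff_diffk using diffk_Suc by blast

lemma smooth_on_has_derivative:
  "smooth_on U f \<Longrightarrow> x \<in> U \<Longrightarrow> (f has_derivative frechet_derivative f (at x)) (at x)"
  unfolding smooth_on_iff_diffk using diffk_has_derivative by blast

lemma smooth_on_continuous_on: "smooth_on U f \<Longrightarrow> continuous_on U f"
  by (meson continuous_at_imp_continuous_on has_derivative_continuous smooth_on_has_derivative)

text \<open>Bundle charts and homomorphisms are jointly smooth in base point and fiber vector,
  whereas the estimates differentiate in the base point for a fixed fiber vector. The slice is
  differentiated in the directions \<open>(v, 0)\<close>.\<close>

lemma smooth_on_Pair_slice: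
  fixes f :: "'a::real_normed_vector \<times> 'c::real_normed_vector \<Rightarrow> 'b::real_normed_vector"
  assumes "open U" "smooth_on (U \<times> UNIV) f"
  shows "smooth_on U (\<lambda>x. f (x, \<xi>))"
proof -
  have "diffk n U (\<lambda>x. f (x, \<xi>))" if "diffk n (U \<times> UNIV) f" for n
    using that
  proof (induction n arbitrary: f)
    have *: "((\<lambda>x. f (x, \<xi>)) has_derivative (\<lambda>v. frechet_derivative f (at (x, \<xi>)) (v, 0))) (at x)"
      if "f differentiable at (x, \<xi>)" for f :: "'a \<times> 'c \<Rightarrow> 'b" and x
    proof -
      have "((\<lambda>x. (x, \<xi>)) has_derivative (\<lambda>v. (v, 0))) (at x)" by (intro derivative_eq_intros) auto
      then show ?thesis using that diff_chain_at[of "\<lambda>x. (x, \<xi>)"] by (fastforce simp: frechet_derivative_works o_def)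
    qed
    {
      case 0 then show ?case using * by (fastforce simp: diffk_0 differentiable_def)
    next
      case (Suc n)
      show ?case
        using Suc.prems Suc.IH[of "\<lambda>z. frechet_derivative f (at z) (_, 0)"]
        by (intro diffk_SucI[OF assms(1) *]) (simp_all add: diffk_Suc)
    }
  qed
  then show ?thesis using assms(2) by (simp add: smooth_on_iff_diffk)
qed

lemma mean_value_cball:
  fixes f :: "'a::real_normed_vector \<Rightarrow> 'b::real_normed_vector"
  assumes der: "\<And>x. x \<in> cball a \<rho> \<Longrightarrow> f differentiable at x"
    and bound: "\<And>x v. x \<in> cball a \<rho> \<Longrightarrow> norm (frechet_derivative f (at x) v) \<le> B * norm v"
    and y: "y \<in> cball a \<rho>"
  shows "norm (f a - f y) \<le> B * norm (a - y)"
proof (cases "a = y")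
  case False
  have a: "a \<in> cball a \<rho>" using y order_trans[OF zero_le_dist, of a y \<rho>] by simp
  \<comment> \<open>That \<open>B\<close> is nonnegative follows from the bound itself, because
    \<open>a - y\<close> is a nonzero direction.\<close>
  have "0 \<le> B * norm (a - y)" by (rule order_trans[OF norm_ge_zero bound[OF a]])
  then have B: "B \<ge> 0" using False by (simp add: zero_le_mult_iff)
  show ?thesis
  proof (rule differentiable_bound[OF convex_cball])
    show "(f has_derivative frechet_derivative f (at x)) (at x within cball a \<rho>)" if "x \<in> cball a \<rho>" for x
      by (rule has_derivative_at_withinI[OF frechet_derivative_works[THEN iffD1, OF der[OF that]]])
    show "onorm (frechet_derivative f (at x)) \<le> B" if "x \<in> cball a \<rho>" for x
      by (rule onorm_bound[OF B bound[OF that]])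
  qed (rule a y)+
qed simp

section \<open>Bump functions on manifolds\<close>

text \<open>The function exp(-1/t), continued by 0, together with all polynomials in 1/t as factors.
  The factors make the family closed under differentiation.\<close>

definition flat_fun :: "real poly \<Rightarrow> real \<Rightarrow> real" where
  "flat_fun p t = (if t > 0 then poly p (inverse t) * exp (- inverse t) else 0)"

lemma tendsto_poly_times_exp_minus: "((\<lambda>y. poly p y * exp (- y)) \<longlongrightarrow> 0) (at_top :: real filter)"
proof -
  have "((\<lambda>y. \<Sum>i\<le>degree p. coeff p i * (y ^ i / exp y)) \<longlongrightarrow> (\<Sum>i\<le>degree p. coeff p i * 0)) (at_top :: real filter)"
    by (intro tendsto_intros tendsto_power_div_exp_0)
  then show ?thesis by (simp add: poly_altdef sum_distrib_right exp_minus divide_inverse mult.assoc)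
qed

text \<open>With y = 1/t the derivative of p(y) exp(-y) is y^2 (p(y) - p'(y)) exp(-y); this is where
  the new polynomial comes from. At 0 both one-sided difference quotients tend to 0.\<close>

lemma flat_fun_has_derivative:
  "(flat_fun p has_real_derivative flat_fun ([:0, 0, 1:] * (p - pderiv p)) t) (at t)"
proof -
  consider "t > 0" | "t < 0" | "t = 0" by linarith
  then show ?thesis
  proof cases
    case 1
    have "((\<lambda>t. poly p (inverse t) * exp (- inverse t)) has_real_derivative
        flat_fun ([:0, 0, 1:] * (p - pderiv p)) t) (at t)"
      using 1 by (auto intro!: derivative_eq_intros simp: flat_fun_def field_simps power2_eq_square)
    then show ?thesis
      by (rule has_field_derivative_transform_within_open[where S = "{0<..}"]) (use 1 in \<open>auto simp: flat_fun_def\<close>)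
  next
    case 2
    have "((\<lambda>t. 0) has_real_derivative flat_fun ([:0, 0, 1:] * (p - pderiv p)) t) (at t)"
      using 2 by (simp add: flat_fun_def)
    then show ?thesis
      by (rule has_field_derivative_transform_within_open[where S = "{..<0}"]) (use 2 in \<open>auto simp: flat_fun_def\<close>)
  next
    case 3
    \<comment> \<open>Dividing by \<open>h\<close> multiplies the polynomial by its variable 1/h,
      hence \<open>pCons 0 p\<close>; the exponential wins as 1/h grows.\<close>
    have "((\<lambda>h. poly (pCons 0 p) (inverse h) * exp (- inverse h)) \<longlongrightarrow> 0) (at_right 0)"
      using filterlim_compose[OF tendsto_poly_times_exp_minus filterlim_inverse_at_top_right] .
    then have "((\<lambda>h. flat_fun p h / h) \<longlongrightarrow> 0) (at_right 0)"
      by (rule Lim_transform_eventually)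
        (auto simp: eventually_at_right_less flat_fun_def divide_inverse intro!: eventually_mono[OF eventually_at_right_less])
    moreover have "((\<lambda>h. flat_fun p h / h) \<longlongrightarrow> 0) (at_left 0)"
      by (rule Lim_transform_eventually[OF tendsto_const])
        (auto simp: flat_fun_def eventually_at_filter)
    ultimately have "((\<lambda>h. flat_fun p h / h) \<longlongrightarrow> 0) (at 0)"
      by (simp add: filterlim_split_at)
    then show ?thesis using 3 by (simp add: DERIV_def flat_fun_def)
  qed
qed

lemma flat_fun_smooth: "smooth_on UNIV (flat_fun p)"
proof -
  have "diffk n UNIV (flat_fun p)" for n
  proof (induction n arbitrary: p)
    case 0
    show ?case
      unfolding diffk_0
      by (intro ballI differentiableI[OF flat_fun_has_derivative[unfolded has_field_derivative_def]])
  next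
    case (Suc n)
    show ?case
      by (rule diffk_SucI[OF open_UNIV flat_fun_has_derivative[unfolded has_field_derivative_def]])
        (rule diffk_bilinear[OF open_UNIV bounded_bilinear_mult Suc diffk_const[OF open_UNIV]])
  qed
  then show ?thesis by (simp add: smooth_on_iff_diffk)
qed

text \<open>The finite subcover argument as an induction rule. Its cases are those of an estimate
  whose constants are found near each point and can be merged for two sets.\<close>

lemma compact_local_induct [consumes 1, case_names local empty union mono]:
  assumes "compact K" and loc: "\<And>p. p \<in> K \<Longrightarrow> \<exists>U. open U \<and> p \<in> U \<and> Q U"
    and empty: "Q {}" and un: "\<And>A B. Q A \<Longrightarrow> Q B \<Longrightarrow> Q (A \<union> B)" and mono: "\<And>A B. A \<subseteq> B \<Longrightarrow> Q B \<Longrightarrow> Q A"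
  shows "Q K"
proof -
  obtain U where U: "\<And>p. p \<in> K \<Longrightarrow> open (U p) \<and> p \<in> U p \<and> Q (U p)" using loc by metis
  obtain C where C: "C \<subseteq> K" "finite C" "K \<subseteq> (\<Union>p\<in>C. U p)"
    using compactE_image[OF assms(1), of K U] U by blast
  have "Q (\<Union>p\<in>C. U p)" using C(2,1)
  proof (induction C rule: finite_induct)
    case (insert p C)
    then have "Q (U p \<union> (\<Union>p\<in>C. U p))" using U[of p] by (intro un) auto
    then show ?case by simp
  qed (simp add: empty)
  then show ?thesis using C(3) mono by blast
qed

section \<open>Charts\<close>

lemma
  assumes "manifold A" "(V, \<phi>) \<in> A"
  shows chart_open: "open V" and chart_open_image: "open (\<phi> ` V)"
    and chart_inj_on: "inj_on \<phi> V"
    and chart_continuous_on: "continuous_on V \<phi>"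
    and chart_continuous_on_inv: "continuous_on (\<phi> ` V) (inv_into V \<phi>)"
proof -
  have c: "is_chart (V, \<phi>)" using assms unfolding manifold_def by blast
  then obtain \<phi>' where h: "homeomorphism V (\<phi> ` V) \<phi> \<phi>'" by (auto simp: is_chart_def)
  show "open V" "open (\<phi> ` V)" using c by (auto simp: is_chart_def)
  show i: "inj_on \<phi> V" using homeomorphism_apply1[OF h] by (rule inj_on_inverseI)
  show "continuous_on V \<phi>" using h by (simp add: homeomorphism_def)
  have "continuous_on (\<phi> ` V) \<phi>'" using h by (simp add: homeomorphism_def)
  then show "continuous_on (\<phi> ` V) (inv_into V \<phi>)"
    by (rule continuous_on_eq) (use h i in \<open>auto simp: homeomorphism_apply1\<close>)
qed

lemma chart_inv:
  assumes "manifold A" "(V, \<phi>) \<in> A" "p \<in> V"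
  shows "inv_into V \<phi> (\<phi> p) = p"
  using assms chart_inj_on by (metis inv_into_f_f)

lemma chart_open_image_Int:
  assumes "manifold A" "(V, \<phi>) \<in> A" "open U"
  shows "open (\<phi> ` (V \<inter> U))"
proof -
  have "\<phi> ` (V \<inter> U) = \<phi> ` V \<inter> inv_into V \<phi> -` U"
    using assms by (auto simp: chart_inv[OF assms(1,2)])
  then show ?thesis
    using continuous_open_preimage[OF chart_continuous_on_inv[OF assms(1,2)] chart_open_image[OF assms(1,2)] assms(3)]
    by simp
qed

lemma chart_compatible:
  assumes "manifold A" "(V, \<phi>) \<in> A" "(W, \<psi>) \<in> A"
  shows "smooth_on (\<phi> ` (V \<inter> W)) (\<psi> \<circ> inv_into V \<phi>)"
proof -
  have "compatible (V, \<phi>) (W, \<psi>)" using assms unfolding manifold_def by blast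
  then show ?thesis by (simp add: compatible_def)
qed

lemma chart_at:
  assumes "manifold A" obtains V \<phi> where "(V, \<phi>) \<in> A" "p \<in> V"
proof -
  have "(\<Union>c\<in>A. fst c) = UNIV" using assms unfolding manifold_def by blast
  then obtain c where "c \<in> A" "p \<in> fst c" by blast
  then show thesis using that by (cases c) auto
qed

lemma chart_compact_preimage:
  assumes "manifold A" "(V, \<phi>) \<in> A" "compact M" "M \<subseteq> \<phi> ` V"
  shows "compact (V \<inter> \<phi> -` M)"
proof -
  have "V \<inter> \<phi> -` M = inv_into V \<phi> ` M"
  proof (intro set_eqI iffI)
    fix q assume "q \<in> V \<inter> \<phi> -` M"
    then show "q \<in> inv_into V \<phi> ` M" using chart_inv[OF assms(1,2), of q] by (auto intro!: image_eqI[of _ _ "\<phi> q"])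
  next
    fix q assume "q \<in> inv_into V \<phi> ` M"
    then show "q \<in> V \<inter> \<phi> -` M" using assms(4) chart_inv[OF assms(1,2)] by auto
  qed
  then show ?thesis
    using compact_continuous_image[OF continuous_on_subset[OF chart_continuous_on_inv[OF assms(1,2)] assms(4)] assms(3)]
    by simp
qed

lemma chart_open_preimage:
  assumes "manifold A" "(V, \<phi>) \<in> A" "open M"
  shows "open (V \<inter> \<phi> -` M)"
  using continuous_open_preimage[OF chart_continuous_on[OF assms(1,2)] chart_open[OF assms(1,2)] assms(3)] .

lemma chart_compact_image:
  assumes "manifold A" "(V, \<phi>) \<in> A" "compact L" "L \<subseteq> V"
  shows "compact (\<phi> ` L)"
  using assms by (intro compact_continuous_image) (auto intro: continuous_on_subset chart_continuous_on)

text \<open>The expression of \<open>F\<close> in the new chart is the old one composed with the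
  transition map; \<open>U\<close> restricts both to an open part of the overlap.\<close>

lemma smooth_on_change_chart:
  assumes "manifold A" "(V, \<phi>) \<in> A" "(W, \<psi>) \<in> A" "open U"
    and "smooth_on (\<phi> ` (V \<inter> W \<inter> U)) (\<lambda>x. F (inv_into V \<phi> x))"
  shows "smooth_on (\<psi> ` (V \<inter> W \<inter> U)) (\<lambda>x. F (inv_into W \<psi> x))"
proof -
  note m [simp] = chart_inv[OF assms(1,2)] chart_inv[OF assms(1,3)]
  have o: "open (V \<inter> W \<inter> U)" using assms chart_open by (metis open_Int)
  have oV: "open (\<phi> ` (V \<inter> W \<inter> U))" and oW: "open (\<psi> ` (V \<inter> W \<inter> U))"
    using chart_open_image_Int[OF assms(1,2) o] chart_open_image_Int[OF assms(1,3) o]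
    by (simp_all add: Int_absorb1 le_infI1 Int_ac)
  have "smooth_on (\<psi> ` (V \<inter> W \<inter> U)) (\<lambda>x. F (inv_into V \<phi> ((\<phi> \<circ> inv_into W \<psi>) x)))"
    by (rule smooth_on_compose[OF oW oV smooth_on_subset[OF chart_compatible[OF assms(1,3,2)]] assms(5)]) auto
  then show ?thesis by (rule smooth_on_cong[OF oW, rotated]) auto
qed

text \<open>Since \<open>S\<close> lies in \<open>V\<close>, the set \<open>V\<close> and the
  complement of \<open>S\<close> cover everything. \<open>F\<close> vanishes on the complement,
  which is open, and smoothness is local.\<close>

lemma smooth_on_extend_zero:
  assumes "manifold A" "(W, \<psi>) \<in> A" "closed S" "S \<subseteq> V" "\<And>p. p \<notin> S \<Longrightarrow> F p = 0"
    and "smooth_on (\<psi> ` (V \<inter> W)) (\<lambda>x. F (inv_into W \<psi> x))"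
  shows "smooth_on (\<psi> ` W) (\<lambda>x. F (inv_into W \<psi> x))"
proof (rule smooth_on_local)
  note m [simp] = chart_inv[OF assms(1,2)]
  fix x assume "x \<in> \<psi> ` W"
  then obtain q where q: "q \<in> W" "x = \<psi> q" by blast
  show "\<exists>N. x \<in> N \<and> smooth_on N (\<lambda>x. F (inv_into W \<psi> x))"
  proof (cases "q \<in> V")
    case True
    then show ?thesis using assms(6) q by (intro exI[of _ "\<psi> ` (V \<inter> W)"]) auto
  next
    case False
    have o: "open (\<psi> ` (W \<inter> - S))" using assms by (intro chart_open_image_Int[OF assms(1,2)]) auto
    have "smooth_on (\<psi> ` (W \<inter> - S)) (\<lambda>x. F (inv_into W \<psi> x))"
      by (rule smooth_on_cong[OF o _ smooth_on_const[OF o, of 0]]) (auto simp: assms(5))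
    then show ?thesis using False q assms(4) by (intro exI[of _ "\<psi> ` (W \<inter> - S)"] conjI) auto
  qed
qed

section \<open>Smooth functions and bump functions\<close>

definition smooth_fun :: "('x::t2_space, 'a::finite_dim_inner) chart set \<Rightarrow> ('x \<Rightarrow> 'b::real_normed_vector) \<Rightarrow> bool" where
  "smooth_fun A f \<longleftrightarrow> (\<forall>(V, \<phi>)\<in>A. smooth_on (\<phi> ` V) (\<lambda>x. f (inv_into V \<phi> x)))"

lemma smooth_funD: "smooth_fun A f \<Longrightarrow> (V, \<phi>) \<in> A \<Longrightarrow> smooth_on (\<phi> ` V) (\<lambda>x. f (inv_into V \<phi> x))"
  unfolding smooth_fun_def by blast

lemma smooth_fun_continuous:
  assumes "manifold A" "smooth_fun A f" shows "continuous_on UNIV f"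
proof -
  have "isCont f p" for p
  proof -
    obtain V \<phi> where c: "(V, \<phi>) \<in> A" "p \<in> V" using chart_at[OF assms(1)] .
    have "continuous_on (\<phi> ` V) (\<lambda>x. f (inv_into V \<phi> x))"
      using assms(2) c by (intro smooth_on_continuous_on) (auto simp: smooth_fun_def)
    then have "continuous_on V (\<lambda>p. f (inv_into V \<phi> (\<phi> p)))"
      using chart_continuous_on[OF assms(1) c(1)] by (rule continuous_on_compose2) auto
    then have "continuous_on V f" by (rule continuous_on_eq) (simp add: chart_inv[OF assms(1) c(1)])
    then show ?thesis using c(2) chart_open[OF assms(1) c(1)] by (simp add: continuous_on_eq_continuous_at)
  qed
  then show ?thesis by (simp add: continuous_at_imp_continuous_on)
qed

lemma manifold_bump:
  fixes A :: "('x::t2_space, 'a::finite_dim_inner) chart set"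
  assumes A: "manifold A" and c: "(V, \<phi>) \<in> A" and p: "p \<in> V" "p \<in> U" "open U"
  obtains \<beta> :: "'x \<Rightarrow> real" and S where "smooth_fun A \<beta>" "\<And>q. \<beta> q \<ge> 0" "\<beta> p > 0" "compact S" "S \<subseteq> V \<inter> U" "\<And>q. q \<notin> S \<Longrightarrow> \<beta> q = 0"
proof -
  note [simp] = chart_inv[OF A c]
  obtain r where r: "r > 0" "cball (\<phi> p) r \<subseteq> \<phi> ` (V \<inter> U)"
    using chart_open_image_Int[OF A c p(3)] p open_contains_cball by blast
  \<comment> \<open>The squared norm is used because it is smooth at the center too. The function is
    positive exactly on the open coordinate ball of radius \<open>r\<close> around
    \<open>p\<close>.\<close>
  define \<beta> where "\<beta> q = (if q \<in> V then flat_fun 1 (r\<^sup>2 - (\<phi> q - \<phi> p) \<bullet> (\<phi> q - \<phi> p)) else 0)" for q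
  define S where "S = V \<inter> \<phi> -` cball (\<phi> p) r"
  have S: "compact S" unfolding S_def by (rule chart_compact_preimage[OF A c compact_cball_fd]) (use r(2) in auto)
  have SU: "S \<subseteq> V \<inter> U"
  proof
    fix q assume q: "q \<in> S"
    then have "\<phi> q \<in> \<phi> ` (V \<inter> U)" using r(2) by (auto simp: S_def)
    then show "q \<in> V \<inter> U" using q chart_inj_on[OF A c] by (auto simp: S_def dest: inj_onD)
  qed
  have zero: "\<beta> q = 0" if "q \<notin> S" for q
  proof -
    have "(\<phi> q - \<phi> p) \<bullet> (\<phi> q - \<phi> p) > r\<^sup>2" if "q \<in> V"
      using \<open>q \<notin> S\<close> that r(1) by (auto simp: S_def dist_norm norm_minus_commute power_strict_mono dot_square_norm)
    then show ?thesis by (auto simp: \<beta>_def flat_fun_def)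
  qed
  have o: "open (\<phi> ` V)" by (rule chart_open_image[OF A c])
  have "smooth_on (\<phi> ` V) (\<lambda>x. flat_fun 1 (r\<^sup>2 - (x - \<phi> p) \<bullet> (x - \<phi> p)))"
    by (rule smooth_on_compose[OF o open_UNIV _ flat_fun_smooth])
      (auto intro!: smooth_on_diff smooth_on_inner smooth_on_const smooth_on_bounded_linear[OF _ bounded_linear_ident] o)
  then have "smooth_on (\<phi> ` V) (\<lambda>x. \<beta> (inv_into V \<phi> x))"
    by (rule smooth_on_cong[OF o, rotated]) (auto simp: \<beta>_def)
  then have "smooth_fun A \<beta>"
    unfolding smooth_fun_def
  proof safe
    fix W and \<psi> :: "'x \<Rightarrow> 'a" assume d: "(W, \<psi>) \<in> A"
    have "smooth_on (\<psi> ` (V \<inter> W)) (\<lambda>x. \<beta> (inv_into W \<psi> x))"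
      using smooth_on_change_chart[OF A c d open_UNIV, of \<beta>]
        smooth_on_subset[OF \<open>smooth_on (\<phi> ` V) (\<lambda>x. \<beta> (inv_into V \<phi> x))\<close>, of "\<phi> ` (V \<inter> W)"] by auto
    then show "smooth_on (\<psi> ` W) (\<lambda>x. \<beta> (inv_into W \<psi> x))"
      using SU by (intro smooth_on_extend_zero[OF A d compact_imp_closed[OF S] _ zero]) auto
  qed
  then show thesis
    using r(1) p by (intro that[OF \<open>smooth_fun A \<beta>\<close> _ _ S SU zero]) (auto simp: \<beta>_def flat_fun_def)
qed

text \<open>Local compactness, read off a bump function: its set of positivity is open and lies in
  its compact support.\<close>

lemma manifold_compact_nhd:
  fixes A :: "('x::t2_space, 'a::finite_dim_inner) chart set"
  assumes A: "manifold A" and "(p::'x) \<in> U" "open U"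
  obtains N K where "open N" "p \<in> N" "N \<subseteq> K" "compact K" "K \<subseteq> U"
proof -
  obtain V \<phi> where "(V, \<phi>) \<in> A" "p \<in> V" using chart_at[OF A] .
  then obtain \<beta> :: "_ \<Rightarrow> real" and S where "smooth_fun A \<beta>" "\<beta> p > 0" "compact S" "S \<subseteq> V \<inter> U" "\<And>q. q \<notin> S \<Longrightarrow> \<beta> q = 0"
    using manifold_bump[OF A _ _ assms(2,3)] by metis
  moreover from this(1) have "open {q. \<beta> q > 0}"
    by (intro open_Collect_less continuous_on_const smooth_fun_continuous[OF A])
  moreover have "{q. \<beta> q > 0} \<subseteq> S" using \<open>\<And>q. q \<notin> S \<Longrightarrow> \<beta> q = 0\<close> by force
  ultimately show thesis by (intro that[of "{q. \<beta> q > 0}" S]) auto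
qed

lemma smooth_fun_add:
  "manifold A \<Longrightarrow> smooth_fun A f \<Longrightarrow> smooth_fun A g \<Longrightarrow> smooth_fun A (\<lambda>x. f x + g x)"
  unfolding smooth_fun_def using chart_open_image by (fast intro: smooth_on_add)

lemma smooth_fun_0: "manifold A \<Longrightarrow> smooth_fun A (\<lambda>x. 0)"
  unfolding smooth_fun_def using chart_open_image by (fast intro: smooth_on_const)

text \<open>Add bump functions around points of \<open>C\<close>. As all of them are nonnegative, a
  sum is positive wherever one summand is, and its support lies in the union of the two.\<close>

lemma manifold_bump_compact:
  fixes A :: "('x::t2_space, 'a::finite_dim_inner) chart set"
  assumes A: "manifold A" and "compact C" "C \<subseteq> U" "open U"
  obtains \<beta> :: "'x \<Rightarrow> real" and S where "smooth_fun A \<beta>" "\<And>q. \<beta> q \<ge> 0" "\<And>q. q \<in> C \<Longrightarrow> \<beta> q > 0"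
    "compact S" "S \<subseteq> U" "\<And>q. q \<notin> S \<Longrightarrow> \<beta> q = 0"
proof -
  let ?Q = "\<lambda>C. \<exists>\<beta> S. smooth_fun A \<beta> \<and> (\<forall>q. \<beta> q \<ge> (0::real)) \<and> (\<forall>q\<in>C. \<beta> q > 0) \<and> compact S \<and> S \<subseteq> U
    \<and> (\<forall>q. q \<notin> S \<longrightarrow> \<beta> q = 0)"
  have "?Q C" using assms(2)
  proof (induction rule: compact_local_induct)
    case (local p)
    obtain V \<phi> where c: "(V, \<phi>) \<in> A" "p \<in> V" using chart_at[OF A] .
    obtain \<beta> S where "smooth_fun A \<beta>" "\<And>q. \<beta> q \<ge> (0::real)" "\<beta> p > 0" "compact S" "S \<subseteq> V \<inter> U" "\<And>q. q \<notin> S \<Longrightarrow> \<beta> q = 0"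
      using manifold_bump[OF A c _ assms(4)] local assms(3) by blast
    moreover from this(1) have "open {q. \<beta> q > 0}"
      by (intro open_Collect_less continuous_on_const smooth_fun_continuous[OF A])
    ultimately show ?case by (intro exI[of _ "{q. \<beta> q > 0}"]) auto
  next
    case empty then show ?case by (intro exI[of _ "\<lambda>_. 0"] exI[of _ "{}"]) (auto simp: smooth_fun_0[OF A])
  next
    case (union A' B)
    then obtain \<beta> S \<beta>' S' where "smooth_fun A \<beta>" "\<And>q. \<beta> q \<ge> (0::real)" "\<And>q. q \<in> A' \<Longrightarrow> \<beta> q > 0" "compact S" "S \<subseteq> U" "\<And>q. q \<notin> S \<Longrightarrow> \<beta> q = 0"
      "smooth_fun A \<beta>'" "\<And>q. \<beta>' q \<ge> (0::real)" "\<And>q. q \<in> B \<Longrightarrow> \<beta>' q > 0" "compact S'" "S' \<subseteq> U" "\<And>q. q \<notin> S' \<Longrightarrow> \<beta>' q = 0"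
      by metis
    then show ?case
      by (intro exI[of _ "\<lambda>q. \<beta> q + \<beta>' q"] exI[of _ "S \<union> S'"])
        (auto intro: smooth_fun_add[OF A] compact_Un add_pos_nonneg add_nonneg_pos)
  next
    case (mono A' B) then show ?case by (meson subsetD)
  qed
  then show thesis using that by metis
qed

text \<open>
  The cover is refined twice: the second refinement yields, for each member of the first, a compact set
  inside it on which its bump function can be required to be positive, and these compact sets still cover.
\<close>

lemma manifold_bump_family:
  fixes A :: "('x::t2_space, 'a::finite_dim_inner) chart set"
  assumes A: "manifold A" and cover: "\<And>p. \<exists>U\<in>\<U>. open U \<and> p \<in> U"
  obtains \<V> and f :: "'x set \<Rightarrow> 'x \<Rightarrow> real" and S where
    "\<And>p. \<exists>N. open N \<and> p \<in> N \<and> finite {B \<in> \<V>. B \<inter> N \<noteq> {}}"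
    "\<And>B. B \<in> \<V> \<Longrightarrow> \<exists>U\<in>\<U>. B \<subseteq> U"
    "\<And>B. B \<in> \<V> \<Longrightarrow> smooth_fun A (f B)" "\<And>B p. B \<in> \<V> \<Longrightarrow> f B p \<ge> 0"
    "\<And>B. B \<in> \<V> \<Longrightarrow> compact (S B)" "\<And>B. B \<in> \<V> \<Longrightarrow> S B \<subseteq> B"
    "\<And>B p. B \<in> \<V> \<Longrightarrow> p \<notin> S B \<Longrightarrow> f B p = 0"
    "\<And>p. \<exists>B\<in>\<V>. f B p > 0"
proof -
  have "paracompact_space (euclidean :: 'x topology)" using A unfolding manifold_def by blast
  then have refine: "\<exists>\<V>. (\<forall>V\<in>\<V>. open V) \<and> \<Union>\<V> = UNIV \<and> (\<forall>V\<in>\<V>. \<exists>U\<in>\<U>. V \<subseteq> U) \<and> locally_finite_in euclidean \<V>"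
    if "\<forall>U\<in>\<U>. open U" "\<Union>\<U> = UNIV" for \<U> :: "'x set set"
    using that unfolding paracompact_space_def by simp
  \<comment> \<open>The members of the first refinement are to lie in compact sets as well, which
    makes closed subsets of them compact.\<close>
  let ?N = "{N. open N \<and> (\<exists>U\<in>\<U>. N \<subseteq> U) \<and> (\<exists>K. compact K \<and> N \<subseteq> K)}"
  have cov: "\<Union>?N = UNIV"
  proof (intro UNIV_eq_I[symmetric])
    fix p
    obtain U where U: "U \<in> \<U>" "open U" "p \<in> U" using cover by blast
    obtain N K where "open N" "p \<in> N" "N \<subseteq> K" "compact K" "K \<subseteq> U"
      using manifold_compact_nhd[OF A U(3,2)] .
    with U(1) show "p \<in> \<Union>?N" by blast
  qed
  have "\<forall>U\<in>?N. open U" by simp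
  from refine[OF this cov] obtain \<V> where V0: "\<forall>B\<in>\<V>. open B" and V: "\<Union>\<V> = UNIV" "locally_finite_in euclidean \<V>"
    and V'': "\<forall>B\<in>\<V>. \<exists>N\<in>?N. B \<subseteq> N"
    by (elim exE conjE) (rule that)
  have Vo: "open B" if "B \<in> \<V>" for B using V0 that by blast
  have V': "(\<exists>U\<in>\<U>. B \<subseteq> U) \<and> (\<exists>K. compact K \<and> B \<subseteq> K)" if B: "B \<in> \<V>" for B
  proof -
    obtain N where N: "N \<in> ?N" "B \<subseteq> N" using bspec[OF V'' B] ..
    then obtain U K where "U \<in> \<U>" "N \<subseteq> U" "compact K" "N \<subseteq> K" by blast
    with N(2) show ?thesis by (intro conjI bexI[of _ U] exI[of _ K]) auto
  qed
  let ?M = "{N. open N \<and> (\<exists>B\<in>\<V>. closure N \<subseteq> B)}"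
  have cov: "\<Union>?M = UNIV"
  proof (intro UNIV_eq_I[symmetric])
    fix p
    have "p \<in> \<Union>\<V>" by (simp add: V(1))
    then obtain B where B: "B \<in> \<V>" "p \<in> B" by (rule UnionE)
    obtain N K where N: "open N" "p \<in> N" "N \<subseteq> K" "compact K" "K \<subseteq> B"
      using manifold_compact_nhd[OF A B(2) Vo[OF B(1)]] .
    have "closure N \<subseteq> B" using closure_minimal[OF N(3) compact_imp_closed[OF N(4)]] N(5) by (rule order_trans)
    with N B(1) show "p \<in> \<Union>?M" by blast
  qed
  have "\<forall>U\<in>?M. open U" by simp
  from refine[OF this cov] obtain \<W> where W: "\<Union>\<W> = UNIV" "locally_finite_in euclidean \<W>"
    and W': "\<forall>N\<in>\<W>. \<exists>M\<in>?M. N \<subseteq> M"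
    by (elim exE conjE) (rule that)
  \<comment> \<open>The part of \<open>B\<close> that the second cover assigns to it: all members
    whose closure stays in \<open>B\<close>.\<close>
  define C where "C B = closure (\<Union>{N \<in> \<W>. closure N \<subseteq> B})" for B
  have C: "compact (C B) \<and> C B \<subseteq> B" if B: "B \<in> \<V>" for B
  proof -
    have "locally_finite_in euclidean {N \<in> \<W>. closure N \<subseteq> B}"
      by (rule locally_finite_in_subset[OF W(2)]) auto
    \<comment> \<open>Local finiteness lets the closure commute with the union, so
      \<open>C B\<close> does not leave \<open>B\<close>.\<close>
    then have "C B = \<Union>(closure ` {N \<in> \<W>. closure N \<subseteq> B})"
      unfolding C_def using closure_of_locally_finite_Union[of "euclidean :: 'x topology"] by fastforce
    then have CB: "C B \<subseteq> B" by blast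
    obtain K where "compact K" "B \<subseteq> K" using V'[OF B] by blast
    moreover have "closed (C B)" by (simp add: C_def)
    ultimately have "compact (K \<inter> C B)" "K \<inter> C B = C B" using CB compact_Int_closed by blast+
    with CB show ?thesis by simp
  qed
  have "\<exists>\<beta> S. smooth_fun A \<beta> \<and> (\<forall>q. \<beta> q \<ge> (0::real)) \<and> (\<forall>q\<in>C B. \<beta> q > 0) \<and>
    compact S \<and> S \<subseteq> B \<and> (\<forall>q. q \<notin> S \<longrightarrow> \<beta> q = 0)" if "B \<in> \<V>" for B
    using manifold_bump_compact[OF A conjunct1[OF C[OF that]] conjunct2[OF C[OF that]] Vo[OF that]] by metis
  then obtain f S where f: "\<And>B. B \<in> \<V> \<Longrightarrow> smooth_fun A (f B) \<and> (\<forall>q. f B q \<ge> (0::real)) \<and> (\<forall>q\<in>C B. f B q > 0) \<and>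
    compact (S B) \<and> S B \<subseteq> B \<and> (\<forall>q. q \<notin> S B \<longrightarrow> f B q = 0)"
    by metis
  show thesis
  proof (rule that[of \<V> f S])
    show "\<exists>N. open N \<and> p \<in> N \<and> finite {B \<in> \<V>. B \<inter> N \<noteq> {}}" for p
      using V(2) unfolding locally_finite_in_def by simp
    show "\<exists>B\<in>\<V>. f B p > 0" for p
    proof -
      have "p \<in> \<Union>\<W>" by (simp add: W(1))
      then obtain N where N: "N \<in> \<W>" "p \<in> N" by (rule UnionE)
      obtain M where M: "M \<in> ?M" "N \<subseteq> M" using bspec[OF W' N(1)] ..
      then obtain B where B: "B \<in> \<V>" "closure M \<subseteq> B" by auto
      have "closure N \<subseteq> B" using closure_mono[OF M(2)] B(2) by (rule order_trans)
      then have "N \<subseteq> \<Union>{N \<in> \<W>. closure N \<subseteq> B}" using N(1) by (intro Union_upper) simp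
      then have "p \<in> C B" using N(2) closure_subset unfolding C_def by (meson subsetD)
      then show ?thesis using f[OF B(1)] B(1) by (intro bexI[of _ B]) simp_all
    qed
  qed (use f V' in blast)+
qed

section \<open>Vector bundles\<close>

text \<open>Linearity over the scalars of the bundle contains real linearity through the embedding
  \<open>of_real\<close>; analysis uses only the latter.\<close>

lemma Vector_Spaces_linear_imp_linear:
  fixes f :: "'v::real_vector \<Rightarrow> 'w::real_vector" and s1 :: "'k::real_normed_field \<Rightarrow> 'v \<Rightarrow> 'v"
  assumes "Vector_Spaces.linear s1 s2 f"
    and "\<And>r \<xi>. s1 (of_real r) \<xi> = r *\<^sub>R \<xi>" "\<And>r \<xi>. s2 (of_real r) \<xi> = r *\<^sub>R \<xi>"
  shows "linear f"
proof -
  interpret l: Vector_Spaces.linear s1 s2 f by fact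
  show ?thesis
    using l.add l.scale[of "of_real _"] by (intro linearI) (simp_all add: assms(2,3))
qed

text \<open>Smoothness of \<open>T\<close> is known only on fixed vectors; expanding the moving
  argument \<open>g x\<close> in a basis reduces the claim to that case.\<close>

lemma smooth_on_linear_apply:
  fixes g :: "'a::real_normed_vector \<Rightarrow> 'v::finite_dim_inner"
  assumes "open U" "\<And>x. x \<in> U \<Longrightarrow> linear (T x)" "\<And>\<xi>. smooth_on U (\<lambda>x. T x \<xi>)" "smooth_on U g"
  shows "smooth_on U (\<lambda>x. T x (g x))"
proof (rule smooth_on_cong[OF assms(1)])
  show "smooth_on U (\<lambda>x. \<Sum>u\<in>fd_basis. (g x \<bullet> u) *\<^sub>R T x u)"
    by (intro smooth_on_sum smooth_on_scaleR smooth_on_inner smooth_on_const assms)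
  show "(\<Sum>u\<in>fd_basis. (g x \<bullet> u) *\<^sub>R T x u) = T x (g x)" if "x \<in> U" for x
    using linear_fd_expand[OF assms(2)[OF that], of "g x"] by simp
qed

lemma vector_bundle_manifold: "vector_bundle E \<Longrightarrow> manifold (vb_base E)"
  unfolding vector_bundle_def by blast

lemma vector_bundle_scale: "vector_bundle E \<Longrightarrow> vb_scale E (of_real r) \<xi> = r *\<^sub>R \<xi>"
  unfolding vector_bundle_def by blast

lemma vector_bundle_vector_space: "vector_bundle E \<Longrightarrow> vector_space (vb_scale E)"
  unfolding vector_bundle_def by blast

lemma vb_chart_at:
  assumes "vector_bundle E" obtains V \<phi> \<Phi> where "(V, \<phi>, \<Phi>) \<in> vb_charts E" "p \<in> V"
proof -
  have "(\<Union>c\<in>vb_charts E. fst c) = UNIV" using assms unfolding vector_bundle_def by blast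
  then obtain c where "c \<in> vb_charts E" "p \<in> fst c" by blast
  then show thesis using that by (cases c) auto
qed

lemma
  assumes "vector_bundle E" "(V, \<phi>, \<Phi>) \<in> vb_charts E"
  shows vb_chart_base: "(V, \<phi>) \<in> vb_base E"
    and vb_proj_inv: "p \<in> V \<Longrightarrow> vb_proj E (vb_inv E (V, \<phi>, \<Phi>) (\<phi> p) \<xi>) = p"
    and vb_fiber_inv: "p \<in> V \<Longrightarrow> \<Phi> (vb_inv E (V, \<phi>, \<Phi>) (\<phi> p) \<xi>) = \<xi>"
    and vb_inv_fiber: "vb_proj E z \<in> V \<Longrightarrow> vb_inv E (V, \<phi>, \<Phi>) (\<phi> (vb_proj E z)) (\<Phi> z) = z"
proof -
  have "is_vb_chart E (V, \<phi>, \<Phi>)" using assms unfolding vector_bundle_def by blast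
  then obtain g where b: "(V, \<phi>) \<in> vb_base E"
    and h: "homeomorphism (vb_proj E -` V) (\<phi> ` V \<times> UNIV) (vb_triv E \<phi> \<Phi>) g"
    unfolding is_vb_chart_def by blast
  show "(V, \<phi>) \<in> vb_base E" by (rule b)
  have inj: "inj_on (vb_triv E \<phi> \<Phi>) (vb_proj E -` V)"
    using homeomorphism_apply1[OF h] by (rule inj_on_inverseI)
  show "vb_inv E (V, \<phi>, \<Phi>) (\<phi> (vb_proj E z)) (\<Phi> z) = z" if "vb_proj E z \<in> V"
    using inv_into_f_f[OF inj, of z] that by (simp add: vb_inv_def vb_triv_def)
  have i: "inj_on \<phi> V" using chart_inj_on[OF vector_bundle_manifold[OF assms(1)] b] .
  have "vb_proj E (vb_inv E (V, \<phi>, \<Phi>) (\<phi> p) \<xi>) = p \<and> \<Phi> (vb_inv E (V, \<phi>, \<Phi>) (\<phi> p) \<xi>) = \<xi>" if p: "p \<in> V"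
  proof -
    have "(\<phi> p, \<xi>) \<in> vb_triv E \<phi> \<Phi> ` (vb_proj E -` V)"
      using homeomorphism_image1[OF h] p by blast
    then obtain z where z: "vb_proj E z \<in> V" "vb_triv E \<phi> \<Phi> z = (\<phi> p, \<xi>)" by auto
    then have "vb_inv E (V, \<phi>, \<Phi>) (\<phi> p) \<xi> = z"
      using inv_into_f_f[OF inj, of z] by (simp add: vb_inv_def)
    then show ?thesis using i p z by (auto simp: vb_triv_def dest: inj_onD)
  qed
  then show "p \<in> V \<Longrightarrow> vb_proj E (vb_inv E (V, \<phi>, \<Phi>) (\<phi> p) \<xi>) = p"
    and "p \<in> V \<Longrightarrow> \<Phi> (vb_inv E (V, \<phi>, \<Phi>) (\<phi> p) \<xi>) = \<xi>" by blast+
qed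

lemma vb_transition_charts:
  assumes "vector_bundle E" "(V, \<phi>, \<Phi>) \<in> vb_charts E" "(W, \<psi>, \<Psi>) \<in> vb_charts E"
  shows "vb_transition E (V, \<phi>, \<Phi>) (W, \<psi>, \<Psi>)"
  using assms unfolding vector_bundle_def by blast

lemma vb_transition_linear_scale:
  assumes "vector_bundle E" "(V, \<phi>, \<Phi>) \<in> vb_charts E" "(W, \<psi>, \<Psi>) \<in> vb_charts E" "p \<in> V" "p \<in> W"
  shows "Vector_Spaces.linear (vb_scale E) (vb_scale E) (\<lambda>\<xi>. \<Psi> (vb_inv E (V, \<phi>, \<Phi>) (\<phi> p) \<xi>))"
  using vb_transition_charts[OF assms(1-3)] assms(4,5) by (simp add: vb_transition_def)

lemma vb_transition_linear:
  assumes "vector_bundle E" "(V, \<phi>, \<Phi>) \<in> vb_charts E" "(W, \<psi>, \<Psi>) \<in> vb_charts E" "p \<in> V" "p \<in> W"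
  shows "linear (\<lambda>\<xi>. \<Psi> (vb_inv E (V, \<phi>, \<Phi>) (\<phi> p) \<xi>))"
  by (rule Vector_Spaces_linear_imp_linear[OF vb_transition_linear_scale[OF assms]])
    (simp_all add: vector_bundle_scale[OF assms(1)])

lemma vb_transition_smooth:
  assumes "vector_bundle E" "(V, \<phi>, \<Phi>) \<in> vb_charts E" "(W, \<psi>, \<Psi>) \<in> vb_charts E"
  shows "smooth_on (\<phi> ` (V \<inter> W)) (\<lambda>x. \<Psi> (vb_inv E (V, \<phi>, \<Phi>) x \<xi>))"
proof -
  have o: "open (\<phi> ` (V \<inter> W))"
    using vector_bundle_manifold[OF assms(1)] vb_chart_base[OF assms(1,2)] vb_chart_base[OF assms(1,3)]
    by (intro chart_open_image_Int chart_open)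
  have "smooth_on (\<phi> ` (V \<inter> W) \<times> UNIV) (\<lambda>(x, \<xi>). vb_triv E \<psi> \<Psi> (vb_inv E (V, \<phi>, \<Phi>) x \<xi>))"
    using vb_transition_charts[OF assms] by (simp add: vb_transition_def)
  from smooth_on_compose_linear[OF o bounded_linear_snd smooth_on_Pair_slice[OF o this, of \<xi>]]
  show ?thesis by (simp add: vb_triv_def)
qed

section \<open>Fiber metrics\<close>

text \<open>Each \<open>B\<close> of a locally finite family lies in a bundle chart; the inner
  product of the typical fiber is pulled back by that chart and multiplied by the bump function of
  \<open>B\<close>. The sum is definite because at each point one weight is positive and none is
  negative.\<close>

lemma vector_bundle_fiber_metric_ex:
  assumes E: "vector_bundle E" shows "\<exists>h. fiber_metric E h"
proof -
  note A = vector_bundle_manifold[OF E]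
  let ?U = "fst ` vb_charts E"
  have cov: "\<exists>U\<in>?U. open U \<and> p \<in> U" for p
  proof -
    obtain V \<phi> \<Phi> where c: "(V, \<phi>, \<Phi>) \<in> vb_charts E" "p \<in> V" using vb_chart_at[OF E] .
    then show ?thesis using chart_open[OF A vb_chart_base[OF E c(1)]] by (intro bexI[of _ V]) force+
  qed
  obtain \<V> f S where
    lf: "\<And>p. \<exists>N. open N \<and> p \<in> N \<and> finite {B \<in> \<V>. B \<inter> N \<noteq> {}}"
    and sub: "\<And>B. B \<in> \<V> \<Longrightarrow> \<exists>U\<in>?U. B \<subseteq> U"
    and f: "\<And>B. B \<in> \<V> \<Longrightarrow> smooth_fun (vb_base E) (f B)" "\<And>B p. B \<in> \<V> \<Longrightarrow> f B p \<ge> (0::real)"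
    and S: "\<And>B. B \<in> \<V> \<Longrightarrow> compact (S B)" "\<And>B. B \<in> \<V> \<Longrightarrow> S B \<subseteq> B"
    and f0: "\<And>B p. B \<in> \<V> \<Longrightarrow> p \<notin> S B \<Longrightarrow> f B p = 0"
    and fpos: "\<And>p. \<exists>B\<in>\<V>. f B p > 0"
    by (rule manifold_bump_family[OF A cov]) (rule that)
  have "\<exists>V \<phi> \<Phi>. (V, \<phi>, \<Phi>) \<in> vb_charts E \<and> B \<subseteq> V" if "B \<in> \<V>" for B
    using sub[OF that] by force
  then obtain cV c\<phi> c\<Phi> where c: "\<And>B. B \<in> \<V> \<Longrightarrow> (cV B, c\<phi> B, c\<Phi> B) \<in> vb_charts E"
    and cV: "\<And>B. B \<in> \<V> \<Longrightarrow> B \<subseteq> cV B" by metis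
  have in_cV: "p \<in> cV B" if "B \<in> \<V>" "f B p \<noteq> 0" for B p
    using that f0 S(2) cV by blast
  have fin: "finite {B \<in> \<V>. f B p \<noteq> 0}" for p
  proof -
    obtain N where "p \<in> N" "finite {B \<in> \<V>. B \<inter> N \<noteq> {}}" using lf by blast
    moreover have "{B \<in> \<V>. f B p \<noteq> 0} \<subseteq> {B \<in> \<V>. B \<inter> N \<noteq> {}}" using \<open>p \<in> N\<close> f0 S(2) by blast
    ultimately show ?thesis using finite_subset by blast
  qed
  \<comment> \<open>Only indices with nonzero weight are summed: these are finitely many, and
    exactly for them the point is sure to lie in the domain of the chosen chart.\<close>
  define h where "h z w = (\<Sum>B | B \<in> \<V> \<and> f B (vb_proj E z) \<noteq> 0. f B (vb_proj E z) * (c\<Phi> B z \<bullet> c\<Phi> B w))" for z w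
  have "fiber_metric E h"
    unfolding fiber_metric_def Let_def
  proof safe
    fix V \<phi> \<Phi> assume d: "(V, \<phi>, \<Phi>) \<in> vb_charts E"
    note dA = vb_chart_base[OF E d]
    let ?I = "vb_inv E (V, \<phi>, \<Phi>)"
    have H: "h (?I (\<phi> p) \<xi>) (?I (\<phi> p) \<eta>) =
        (\<Sum>B | B \<in> \<V> \<and> f B p \<noteq> 0. f B p * (c\<Phi> B (?I (\<phi> p) \<xi>) \<bullet> c\<Phi> B (?I (\<phi> p) \<eta>)))" if "p \<in> V" for p \<xi> \<eta>
      using vb_proj_inv[OF E d that] by (simp add: h_def)
    have lin: "linear (\<lambda>\<xi>. c\<Phi> B (?I (\<phi> p) \<xi>))" if "B \<in> \<V>" "f B p \<noteq> 0" "p \<in> V" for B p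
      using vb_transition_linear[OF E d c[OF that(1)] that(3) in_cV[OF that(1,2)]] .
    {
      fix p assume p: "p \<in> V"
      note lin_add = linear_add[OF lin[OF _ _ p]] and lin_scale = linear_scale[OF lin[OF _ _ p]]
      show "bilinear (\<lambda>\<xi> \<eta>. h (?I (\<phi> p) \<xi>) (?I (\<phi> p) \<eta>))"
        unfolding H[OF p] bilinear_def
        by (auto intro!: linearI simp: lin_add lin_scale inner_add_left inner_add_right sum.distrib[symmetric]
            sum_distrib_left distrib_left mult.left_commute intro!: sum.cong)
      show "h (?I (\<phi> p) \<xi>) (?I (\<phi> p) \<eta>) = h (?I (\<phi> p) \<eta>) (?I (\<phi> p) \<xi>)" for \<xi> \<eta>
        unfolding H[OF p] by (simp add: inner_commute)
      show "h (?I (\<phi> p) \<xi>) (?I (\<phi> p) \<xi>) > 0" if "\<xi> \<noteq> 0" for \<xi>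
      proof -
        obtain B where B: "B \<in> \<V>" "f B p > 0" using fpos by blast
        then have pB: "p \<in> cV B" using in_cV[of B p] by simp
        \<comment> \<open>The transition back to the chart \<open>\<Phi>\<close> is linear, so a
          vanishing coordinate in one chart would force \<open>\<xi> = 0\<close>.\<close>
        have "c\<Phi> B (?I (\<phi> p) \<xi>) \<noteq> 0"
        proof
          assume "c\<Phi> B (?I (\<phi> p) \<xi>) = 0"
          then have "?I (\<phi> p) \<xi> = vb_inv E (cV B, c\<phi> B, c\<Phi> B) (c\<phi> B p) 0"
            using vb_inv_fiber[OF E c[OF B(1)], of "?I (\<phi> p) \<xi>"] pB by (simp add: vb_proj_inv[OF E d p])
          then have "\<xi> = \<Phi> (vb_inv E (cV B, c\<phi> B, c\<Phi> B) (c\<phi> B p) 0)"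
            using vb_fiber_inv[OF E d p, of \<xi>] by simp
          also have "\<dots> = 0" using vb_transition_linear[OF E c[OF B(1)] d pB p] by (rule linear_0)
          finally show False using that by simp
        qed
        then have "f B p * (c\<Phi> B (?I (\<phi> p) \<xi>) \<bullet> c\<Phi> B (?I (\<phi> p) \<xi>)) > 0" using B(2) by simp
        then show ?thesis
          unfolding H[OF p] using B f(2) by (intro sum_pos2[OF fin, of B]) auto
      qed
    next
      fix \<xi> \<eta>
      show "smooth_on (\<phi> ` V) (\<lambda>x. h (?I x \<xi>) (?I x \<eta>))"
      proof (rule smooth_on_local)
        fix x assume "x \<in> \<phi> ` V"
        then obtain p where p: "p \<in> V" "x = \<phi> p" by blast
        obtain N where N: "open N" "p \<in> N" "finite {B \<in> \<V>. B \<inter> N \<noteq> {}}" using lf by blast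
        let ?F = "\<lambda>B p. f B p * (c\<Phi> B (?I (\<phi> p) \<xi>) \<bullet> c\<Phi> B (?I (\<phi> p) \<eta>))"
        have o: "open (\<phi> ` (V \<inter> N))" by (rule chart_open_image_Int[OF A dA N(1)])
        \<comment> \<open>On the overlap of the two charts this is a product of smooth functions;
          elsewhere the bump function vanishes, so it extends by zero.\<close>
        have sm: "smooth_on (\<phi> ` V) (\<lambda>x. ?F B (inv_into V \<phi> x))" if B: "B \<in> \<V>" for B
        proof (rule smooth_on_extend_zero[OF A dA compact_imp_closed[OF S(1)[OF B]]])
          have o: "open (\<phi> ` (cV B \<inter> V))"
            unfolding Int_commute[of "cV B"] by (intro chart_open_image_Int[OF A dA] chart_open[OF A vb_chart_base[OF E c[OF B]]])
          have "smooth_on (\<phi> ` (V \<inter> cV B)) (\<lambda>x. f B (inv_into V \<phi> x))"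
            by (rule smooth_on_subset[OF smooth_funD[OF f(1)[OF B] dA]]) auto
          then have "smooth_on (\<phi> ` (cV B \<inter> V)) (\<lambda>x. f B (inv_into V \<phi> x) * (c\<Phi> B (?I x \<xi>) \<bullet> c\<Phi> B (?I x \<eta>)))"
            using vb_transition_smooth[OF E d c[OF B]] unfolding Int_commute[of V]
            by (intro smooth_on_bilinear[OF o bounded_bilinear_mult] smooth_on_inner o)
          then show "smooth_on (\<phi> ` (cV B \<inter> V)) (\<lambda>x. ?F B (inv_into V \<phi> x))"
            by (rule smooth_on_cong[OF o, rotated]) (auto simp: chart_inv[OF A dA])
        qed (use S(2)[OF B] cV[OF B] f0[OF B] in auto)
        \<comment> \<open>The index set in \<open>h\<close> moves with the point. Over
          \<open>N\<close> it is replaced by the fixed finite set of all \<open>B\<close> that meet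
          \<open>N\<close>, which only adds zero terms.\<close>
        have "smooth_on (\<phi> ` (V \<inter> N)) (\<lambda>x. \<Sum>B | B \<in> \<V> \<and> B \<inter> N \<noteq> {}. ?F B (inv_into V \<phi> x))"
          by (intro smooth_on_sum o smooth_on_subset[OF sm]) auto
        then have "smooth_on (\<phi> ` (V \<inter> N)) (\<lambda>x. h (?I x \<xi>) (?I x \<eta>))"
        proof (rule smooth_on_cong[OF o, rotated])
          fix y assume "y \<in> \<phi> ` (V \<inter> N)"
          then obtain q where q: "q \<in> V" "q \<in> N" "y = \<phi> q" by blast
          have "B \<inter> N \<noteq> {}" if "B \<in> \<V>" "f B q \<noteq> 0" for B
          proof -
            have "q \<in> S B" using f0 that by blast
            then show ?thesis using S(2)[OF that(1)] q(2) by auto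
          qed
          then have "(\<Sum>B | B \<in> \<V> \<and> f B q \<noteq> 0. ?F B q) = (\<Sum>B | B \<in> \<V> \<and> B \<inter> N \<noteq> {}. ?F B q)"
            using N(3) by (intro sum.mono_neutral_left) auto
          then show "(\<Sum>B | B \<in> \<V> \<and> B \<inter> N \<noteq> {}. ?F B (inv_into V \<phi> y)) = h (?I y \<xi>) (?I y \<eta>)"
            using q by (simp add: H chart_inv[OF A dA])
        qed
        then show "\<exists>N. x \<in> N \<and> smooth_on N (\<lambda>x. h (?I x \<xi>) (?I x \<eta>))"
          using p N(2) by (intro exI[of _ "\<phi> ` (V \<inter> N)"]) auto
      qed
    }
  qed
  then show ?thesis by (rule exI[of _ h])
qed

text \<open>Any fiber metric is comparable with the coordinate norm over a compact part of a chart.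
  All passages between the metric in a definition and chart estimates rest on this.\<close>

lemma fiber_norm_bounds:
  assumes E: "vector_bundle E" and h: "fiber_metric E h" and d: "(V, \<phi>, \<Phi>) \<in> vb_charts E"
    and L: "compact L" "L \<subseteq> V"
  obtains c C where "c > 0" "C > 0" "\<And>z. vb_proj E z \<in> L \<Longrightarrow> c * norm (\<Phi> z) \<le> fiber_norm h z"
    "\<And>z. vb_proj E z \<in> L \<Longrightarrow> fiber_norm h z \<le> C * norm (\<Phi> z)"
proof -
  let ?I = "vb_inv E (V, \<phi>, \<Phi>)"
  define H where "H x \<xi> \<eta> = h (?I x \<xi>) (?I x \<eta>)" for x \<xi> \<eta>
  have *: "(\<forall>x\<in>\<phi> ` V. bilinear (H x) \<and> (\<forall>\<xi> \<eta>. H x \<xi> \<eta> = H x \<eta> \<xi>) \<and> (\<forall>\<xi>. \<xi> \<noteq> 0 \<longrightarrow> H x \<xi> \<xi> > 0)) \<and>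
        (\<forall>\<xi> \<eta>. smooth_on (\<phi> ` V) (\<lambda>x. H x \<xi> \<eta>))"
    using bspec[OF h[unfolded fiber_metric_def Let_def] d] unfolding H_def[abs_def] prod.case .
  have H: "bilinear (H x)" "\<xi> \<noteq> 0 \<Longrightarrow> H x \<xi> \<xi> > 0" if "x \<in> \<phi> ` V" for x \<xi>
    using bspec[OF conjunct1[OF *] that] by simp_all
  have Hs: "smooth_on (\<phi> ` V) (\<lambda>x. H x \<xi> \<eta>)" for \<xi> \<eta>
    using conjunct2[OF *] by simp
  note M = vector_bundle_manifold[OF E] vb_chart_base[OF E d]
  have "compact (\<phi> ` L)" by (rule chart_compact_image[OF M L])
  moreover have "continuous_on (\<phi> ` L) (\<lambda>x. H x \<xi> \<eta>)" for \<xi> \<eta>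
    by (rule continuous_on_subset[OF smooth_on_continuous_on[OF Hs]]) (use L(2) in auto)
  moreover have "\<And>x. x \<in> \<phi> ` L \<Longrightarrow> x \<in> \<phi> ` V" using L(2) by auto
  ultimately have cont: "compact (\<phi> ` L)" "\<And>\<xi> \<eta>. continuous_on (\<phi> ` L) (\<lambda>x. H x \<xi> \<eta>)"
    and HL: "\<And>x. x \<in> \<phi> ` L \<Longrightarrow> bilinear (H x)" "\<And>x \<xi>. x \<in> \<phi> ` L \<Longrightarrow> \<xi> \<noteq> 0 \<Longrightarrow> H x \<xi> \<xi> > 0"
    using H by simp_all
  obtain c C where cC: "c > 0" "C > 0" "\<And>x v. x \<in> \<phi> ` L \<Longrightarrow> c * (norm v)\<^sup>2 \<le> H x v v"
    "\<And>x v. x \<in> \<phi> ` L \<Longrightarrow> H x v v \<le> C * (norm v)\<^sup>2"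
    by (rule posdef_family_bounds[OF cont(1) HL cont(2)]) (assumption | rule that; assumption)+
  show thesis
  proof (rule that[of "sqrt c" "sqrt C"])
    fix z assume z: "vb_proj E z \<in> L"
    then have "?I (\<phi> (vb_proj E z)) (\<Phi> z) = z" using L(2) by (intro vb_inv_fiber[OF E d]) auto
    then have "c * (norm (\<Phi> z))\<^sup>2 \<le> h z z" "h z z \<le> C * (norm (\<Phi> z))\<^sup>2"
      using cC(3,4)[of "\<phi> (vb_proj E z)" "\<Phi> z"] z by (simp_all add: H_def)
    from this[THEN real_sqrt_le_mono]
    show "sqrt c * norm (\<Phi> z) \<le> fiber_norm h z" "fiber_norm h z \<le> sqrt C * norm (\<Phi> z)"
      by (simp_all add: fiber_norm_def real_sqrt_mult)
  qed (use cC in auto)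
qed

section \<open>Riemannian distance\<close>

text \<open>
  \<open>s\<close> need not be measurable: the speed of a curve is defined through chosen charts, so all integrals of it
  are treated as lower integrals.
\<close>

lemma ftc_le_nn_integral:
  fixes f :: "real \<Rightarrow> real"
  assumes ab: "a \<le> b" and S: "finite S" and cont: "continuous_on {a..b} f"
    and der: "\<And>t. t \<in> {a<..<b} - S \<Longrightarrow> (f has_real_derivative f' t) (at t)"
    and le: "\<And>t. t \<in> {a<..<b} - S \<Longrightarrow> ennreal (f' t) \<le> s t"
  shows "ennreal (f b - f a) \<le> (\<integral>\<^sup>+t\<in>{a..b}. s t \<partial>lborel)"
proof -
  \<comment> \<open>Set to 0 at the endpoints and exceptional points, where no derivative is given;
    the gauge integral still evaluates to the increment of \<open>f\<close>. Its positive part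
    \<open>G\<close> is Lebesgue measurable and lies below \<open>s\<close>.\<close>
  define g where "g t = (if t \<in> {a<..<b} - S then f' t else 0)" for t
  define G where "G t = max 0 (g t * indicator {a..b} t)" for t :: real
  have g: "(g has_integral (f b - f a)) {a..b}"
    by (rule fundamental_theorem_of_calculus_interior_strong[OF S ab _ cont])
      (use der in \<open>auto simp: g_def has_real_derivative_iff_has_vector_derivative\<close>)
  have "(\<lambda>x. g x * indicator {a..b} x) = (\<lambda>x. if x \<in> {a..b} then g x else 0)"
    by (auto simp: indicator_def)
  then have g': "((\<lambda>x. g x * indicator {a..b} x) has_integral (f b - f a)) UNIV"
    using g by (simp only: has_integral_restrict_UNIV)
  have Gm: "G \<in> borel_measurable lebesgue"
    using has_integral_implies_lebesgue_measurable_real[OF g] unfolding G_def[abs_def] by measurable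
  have GS: "(\<integral>\<^sup>+t. ennreal (G t) \<partial>lebesgue) \<le> (\<integral>\<^sup>+t\<in>{a..b}. s t \<partial>lborel)"
    unfolding nn_integral_completion
  proof (rule nn_integral_mono)
    fix t :: real
    show "ennreal (G t) \<le> s t * indicator {a..b} t"
      using le[of t] by (auto simp: G_def g_def indicator_def max_def)
  qed
  show ?thesis
  proof (cases "(\<integral>\<^sup>+t. ennreal (G t) \<partial>lebesgue) < \<infinity>")
    \<comment> \<open>A finite integral makes \<open>G\<close> Lebesgue integrable, so it can be
      compared with the gauge integral of \<open>g\<close>. An infinite one leaves nothing to
      show.\<close>
    case True
    then have int: "integrable lebesgue G"
      by (intro integrableI_nonneg Gm) (auto simp: G_def)
    have "f b - f a \<le> integral\<^sup>L lebesgue G"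
      by (rule has_integral_le[OF g' has_integral_integral_lebesgue[OF int]]) (simp add: G_def)
    then have "ennreal (f b - f a) \<le> ennreal (integral\<^sup>L lebesgue G)" by (rule ennreal_leI)
    also have "\<dots> = (\<integral>\<^sup>+t. ennreal (G t) \<partial>lebesgue)"
      by (rule nn_integral_eq_integral[OF int, symmetric]) (simp add: G_def)
    finally show ?thesis using GS by (rule order_trans)
  next
    case False
    then have "(\<integral>\<^sup>+t\<in>{a..b}. s t \<partial>lborel) = \<infinity>" using GS by (simp add: top_unique less_top[symmetric])
    then show ?thesis by simp
  qed
qed

section \<open>Piecewise C1 curves and their speed\<close>

text \<open>The neighbors are the largest element up to \<open>t\<close> and the smallest one beyond
  it; 0 and 1 guarantee that both exist.\<close>

lemma finite_set_gap:
  fixes S :: "real set"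
  assumes "finite S" "{0, 1} \<subseteq> S" "0 \<le> t" "t < 1"
  obtains a b where "a \<in> S" "b \<in> S" "a \<le> t" "t < b" "{a<..<b} \<inter> S = {}"
proof
  let ?L = "{s \<in> S. s \<le> t}" and ?R = "{s \<in> S. t < s}"
  have L: "finite ?L" "0 \<in> ?L" and R: "finite ?R" "1 \<in> ?R" using assms by auto
  have "?L \<noteq> {}" "?R \<noteq> {}" using L(2) R(2) by blast+
  then have "Max ?L \<in> ?L" "Min ?R \<in> ?R" using Max_in[OF L(1)] Min_in[OF R(1)] by blast+
  then show "Max ?L \<in> S" "Max ?L \<le> t" "Min ?R \<in> S" "t < Min ?R" by auto
  show "{Max ?L<..<Min ?R} \<inter> S = {}"
  proof (rule ccontr)
    assume "{Max ?L<..<Min ?R} \<inter> S \<noteq> {}"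
    then obtain s where s: "s \<in> S" "Max ?L < s" "s < Min ?R" by auto
    show False
    proof (cases "s \<le> t")
      case True then show False using s(1,2) Max_ge[OF L(1), of s] by simp
    next
      case False then show False using s(1,3) Min_le[OF R(1), of s] by simp
    qed
  qed
qed

lemma piecewise_C1_curve_continuous:
  assumes "piecewise_C1_curve A \<gamma>" shows "continuous_on {0..1} \<gamma>"
proof -
  obtain S where S: "finite S" "{0, 1} \<subseteq> S" "S \<subseteq> {0..1}"
    and C': "\<forall>a\<in>S. \<forall>b\<in>S. a < b \<and> {a<..<b} \<inter> S = {} \<longrightarrow> C1_curve_on A a b \<gamma>"
    using assms unfolding piecewise_C1_curve_def by (elim exE conjE) (rule that)
  have C: "C1_curve_on A a b \<gamma>" if "a \<in> S" "b \<in> S" "a < b" "{a<..<b} \<inter> S = {}" for a b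
    using bspec[OF bspec[OF C' that(1)] that(2)] that by simp
  define I where "I = {i \<in> S \<times> S. fst i < snd i \<and> {fst i<..<snd i} \<inter> S = {}}"
  have "continuous_on (\<Union>i\<in>I. {fst i..snd i}) \<gamma>"
  proof (rule continuous_on_closed_Union)
    show "finite I" using S(1) by (auto simp: I_def)
    show "continuous_on {fst i..snd i} \<gamma>" if "i \<in> I" for i
      using C[of "fst i" "snd i"] that by (auto simp: I_def C1_curve_on_def)
  qed auto
  moreover have "{0..1} \<subseteq> (\<Union>i\<in>I. {fst i..snd i})"
  proof
    fix t :: real assume t: "t \<in> {0..1}"
    have "\<exists>a b. a \<in> S \<and> b \<in> S \<and> a \<le> t \<and> t \<le> b \<and> a < b \<and> {a<..<b} \<inter> S = {}"
    proof (cases "t < 1")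
      case True
      then obtain a b where "a \<in> S" "b \<in> S" "a \<le> t" "t < b" "{a<..<b} \<inter> S = {}"
        using finite_set_gap[OF S(1,2), of t] t by auto
      then show ?thesis by (intro exI[of _ a] exI[of _ b]) auto
    next
      case False
      \<comment> \<open>For \<open>t = 1\<close> no element lies to the right; the last piece, from
        the largest element below 1, contains it.\<close>
      let ?L = "{s \<in> S. s < 1}"
      have L: "finite ?L" "0 \<in> ?L" using S by auto
      have "?L \<noteq> {}" using L(2) by blast
      then have "Max ?L \<in> ?L" by (rule Max_in[OF L(1)])
      moreover have "{Max ?L<..<1} \<inter> S = {}"
      proof (rule ccontr)
        assume "{Max ?L<..<1} \<inter> S \<noteq> {}"
        then obtain s where "s \<in> S" "Max ?L < s" "s < 1" by auto
        then show False using Max_ge[OF L(1), of s] by simp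
      qed
      ultimately show ?thesis using t False S(2) by (intro exI[of _ "Max ?L"] exI[of _ 1]) auto
    qed
    then obtain a b where "(a, b) \<in> I" "t \<in> {a..b}" by (auto simp: I_def)
    then show "t \<in> (\<Union>i\<in>I. {fst i..snd i})" by force
  qed
  ultimately show ?thesis by (rule continuous_on_subset)
qed

text \<open>A point that is not a breakpoint is interior to its piece, where the derivative within
  the piece is two-sided, as \<open>speed\<close> requires.\<close>

lemma piecewise_C1_curve_derivative:
  assumes "piecewise_C1_curve A \<gamma>"
  obtains S where "finite S" "\<And>t V \<phi>. t \<in> {0<..<1} - S \<Longrightarrow> (V, \<phi>) \<in> A \<Longrightarrow> \<gamma> t \<in> V \<Longrightarrow>
     \<exists>D. ((\<phi> \<circ> \<gamma>) has_vector_derivative D) (at t)"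
proof -
  obtain S where S: "finite S" "{0, 1} \<subseteq> S" "S \<subseteq> {0..1}"
    and C': "\<forall>a\<in>S. \<forall>b\<in>S. a < b \<and> {a<..<b} \<inter> S = {} \<longrightarrow> C1_curve_on A a b \<gamma>"
    using assms unfolding piecewise_C1_curve_def by (elim exE conjE) (rule that)
  have C: "C1_curve_on A a b \<gamma>" if "a \<in> S" "b \<in> S" "a < b" "{a<..<b} \<inter> S = {}" for a b
    using bspec[OF bspec[OF C' that(1)] that(2)] that by simp
  show thesis
  proof (rule that[OF S(1)])
    fix t V \<phi> assume t: "t \<in> {0<..<1} - S" and c: "(V, \<phi>) \<in> A" "\<gamma> t \<in> V"
    obtain a b where ab: "a \<in> S" "b \<in> S" "a \<le> t" "t < b" "{a<..<b} \<inter> S = {}"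
      using finite_set_gap[OF S(1,2), of t] t by auto
    then have t': "t \<in> {a<..<b}" using t by (cases "a = t") auto
    have "C1_curve_on A a b \<gamma>" using C ab t' by auto
    then obtain D where D: "\<forall>t\<in>{a..b} \<inter> \<gamma> -` V. ((\<phi> \<circ> \<gamma>) has_vector_derivative D t) (at t within {a..b})"
      using c(1) unfolding C1_curve_on_def by blast
    have "((\<phi> \<circ> \<gamma>) has_vector_derivative D t) (at t within {a..b})" using bspec[OF D, of t] c(2) t' by simp
    moreover have "at t within {a..b} = at t" using t' by (intro at_within_interior) simp
    ultimately show "\<exists>D. ((\<phi> \<circ> \<gamma>) has_vector_derivative D) (at t)" by auto
  qed
qed

text \<open>\<open>speed\<close> evaluates the metric in an arbitrarily selected chart. The chain
  rule transforms the velocity and the transformation law transforms the metric in the opposite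
  way.\<close>

lemma speed_chart:
  assumes A: "manifold A" and g: "riemannian_metric A g" and c: "(V, \<phi>) \<in> A" "\<gamma> t \<in> V" and cont: "isCont \<gamma> t"
    and D: "((\<phi> \<circ> \<gamma>) has_vector_derivative D) (at t)"
  shows "speed A g \<gamma> t = sqrt (g (V, \<phi>) (\<gamma> t) D D)"
proof -
  obtain W \<psi> where w: "(SOME c. c \<in> A \<and> \<gamma> t \<in> fst c) = (W, \<psi>)" by fastforce
  have "(W, \<psi>) \<in> A \<and> \<gamma> t \<in> fst (W, \<psi>)"
    unfolding w[symmetric] by (rule someI[of _ "(V, \<phi>)"]) (use c in auto)
  then have d: "(W, \<psi>) \<in> A" "\<gamma> t \<in> W" by auto
  define T where "T = frechet_derivative (\<psi> \<circ> inv_into V \<phi>) (at (\<phi> (\<gamma> t)))"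
  have "((\<psi> \<circ> inv_into V \<phi>) has_derivative T) (at ((\<phi> \<circ> \<gamma>) t))"
    unfolding T_def o_apply[of \<phi> \<gamma>] by (rule smooth_on_has_derivative[OF chart_compatible[OF A c(1) d(1)]]) (use c d in auto)
  then have X: "((\<psi> \<circ> inv_into V \<phi> \<circ> (\<phi> \<circ> \<gamma>)) has_vector_derivative T D) (at t)"
    using vector_derivative_diff_chain_within[OF D] has_derivative_at_withinI by blast
  have "eventually (\<lambda>s. \<gamma> s \<in> V) (nhds t)"
    using cont c(2) chart_open[OF A c(1)] by (simp add: continuous_at topological_tendstoD eventually_nhds_conv_at isCont_def)
  then obtain N where N: "open N" "t \<in> N" "\<And>s. s \<in> N \<Longrightarrow> \<gamma> s \<in> V" unfolding eventually_nhds by blast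
  have "((\<psi> \<circ> \<gamma>) has_vector_derivative T D) (at t)"
    by (rule has_vector_derivative_transform_within_open[OF X N(1,2)]) (simp add: N(3) chart_inv[OF A c(1)])
  then have "vector_derivative (\<psi> \<circ> \<gamma>) (at t) = T D" by (rule vector_derivative_at)
  moreover have "g (V, \<phi>) (\<gamma> t) D D = g (W, \<psi>) (\<gamma> t) (T D) (T D)"
  proof -
    have "\<forall>(V, \<phi>)\<in>A. \<forall>(W, \<psi>)\<in>A. \<forall>p\<in>V \<inter> W. \<forall>v w.
        g (V, \<phi>) p v w = (let T = frechet_derivative (\<psi> \<circ> inv_into V \<phi>) (at (\<phi> p)) in g (W, \<psi>) p (T v) (T w))"
      using g unfolding riemannian_metric_def by (rule conjunct2)
    from bspec[OF this c(1)] d(1) c(2) d(2) show ?thesis by (fastforce simp: T_def Let_def)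
  qed
  ultimately show ?thesis by (simp add: speed_def w Let_def)
qed

text \<open>The compactness argument for fiber metrics again, now with the points of
  \<open>L\<close> themselves as parameters.\<close>

lemma riemannian_metric_bounds:
  assumes A: "manifold A" and g: "riemannian_metric A g" and c: "(V, \<phi>) \<in> A" and L: "compact L" "L \<subseteq> V"
  obtains k K where "k > 0" "K > 0" "\<And>p v. p \<in> L \<Longrightarrow> k * norm v \<le> sqrt (g (V, \<phi>) p v v)"
    "\<And>p v. p \<in> L \<Longrightarrow> sqrt (g (V, \<phi>) p v v) \<le> K * norm v"
proof -
  have "\<forall>(V, \<phi>)\<in>A.
        (\<forall>p\<in>V. bilinear (g (V, \<phi>) p) \<and> (\<forall>v w. g (V, \<phi>) p v w = g (V, \<phi>) p w v) \<and>
               (\<forall>v. v \<noteq> 0 \<longrightarrow> g (V, \<phi>) p v v > 0)) \<and>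
        (\<forall>v w. smooth_on (\<phi> ` V) (\<lambda>x. g (V, \<phi>) (inv_into V \<phi> x) v w))"
    using g unfolding riemannian_metric_def by (rule conjunct1)
  from bspec[OF this c] have H: "\<And>p. p \<in> V \<Longrightarrow> bilinear (g (V, \<phi>) p)" "\<And>p v. p \<in> V \<Longrightarrow> v \<noteq> 0 \<Longrightarrow> g (V, \<phi>) p v v > 0"
    "\<And>v w. smooth_on (\<phi> ` V) (\<lambda>x. g (V, \<phi>) (inv_into V \<phi> x) v w)"
    by simp_all
  have cont: "continuous_on L (\<lambda>p. g (V, \<phi>) p v w)" for v w
  proof -
    have "continuous_on L (\<lambda>p. g (V, \<phi>) (inv_into V \<phi> (\<phi> p)) v w)"
      by (rule continuous_on_compose2[OF smooth_on_continuous_on[OF H(3)]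
            continuous_on_subset[OF chart_continuous_on[OF A c] L(2)]]) (use L in auto)
    then show ?thesis by (rule continuous_on_eq) (use L in \<open>auto simp: chart_inv[OF A c]\<close>)
  qed
  have HL: "\<And>p. p \<in> L \<Longrightarrow> bilinear (g (V, \<phi>) p)" "\<And>p v. p \<in> L \<Longrightarrow> v \<noteq> 0 \<Longrightarrow> g (V, \<phi>) p v v > 0"
    using H(1,2) L(2) by blast+
  obtain k K where k: "k > 0" "K > 0" "\<And>x v. x \<in> L \<Longrightarrow> k * (norm v)\<^sup>2 \<le> g (V, \<phi>) x v v"
    "\<And>x v. x \<in> L \<Longrightarrow> g (V, \<phi>) x v v \<le> K * (norm v)\<^sup>2"
    by (rule posdef_family_bounds[OF L(1) HL cont]) (assumption | rule that; assumption)+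
  show thesis
  proof (rule that[of "sqrt k" "sqrt K"])
    fix p v assume "p \<in> L"
    from k(3,4)[OF this, of v, THEN real_sqrt_le_mono]
    show "sqrt k * norm v \<le> sqrt (g (V, \<phi>) p v v)" "sqrt (g (V, \<phi>) p v v) \<le> sqrt K * norm v"
      by (simp_all add: real_sqrt_mult)
  qed (use k in auto)
qed

section \<open>Distance and coordinates\<close>

text \<open>Project the coordinate curve to the direction of its total displacement. The derivative
  of this real function is at most the norm of the velocity, hence at most speed / \<open>k\<close>,
  and its increment is the whole coordinate distance.\<close>

lemma curve_length_lower:
  assumes A: "manifold A" and g: "riemannian_metric A g" and c: "(V, \<phi>) \<in> A" and \<gamma>: "piecewise_C1_curve A \<gamma>"
    and \<tau>: "0 \<le> \<tau>" "\<tau> \<le> 1" and k: "k > 0"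
    and in_V: "\<And>t. t \<in> {0..\<tau>} \<Longrightarrow> \<gamma> t \<in> V"
    and lower: "\<And>t v. t \<in> {0..\<tau>} \<Longrightarrow> k * norm v \<le> sqrt (g (V, \<phi>) (\<gamma> t) v v)"
  shows "ennreal (k * norm (\<phi> (\<gamma> \<tau>) - \<phi> (\<gamma> 0))) \<le> (\<integral>\<^sup>+t\<in>{0..1}. ennreal (speed A g \<gamma> t) \<partial>lborel)"
proof -
  obtain S where S: "finite S" "\<And>t V \<phi>. t \<in> {0<..<1} - S \<Longrightarrow> (V, \<phi>) \<in> A \<Longrightarrow> \<gamma> t \<in> V \<Longrightarrow>
     \<exists>D. ((\<phi> \<circ> \<gamma>) has_vector_derivative D) (at t)"
    using piecewise_C1_curve_derivative[OF \<gamma>] by blast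
  have "\<exists>D. ((\<phi> \<circ> \<gamma>) has_vector_derivative D) (at t)" if "t \<in> {0<..<\<tau>} - S" for t
    using S(2)[OF _ c in_V[of t]] that \<tau> by auto
  then obtain D where D: "\<And>t. t \<in> {0<..<\<tau>} - S \<Longrightarrow> ((\<phi> \<circ> \<gamma>) has_vector_derivative D t) (at t)" by metis
  \<comment> \<open>If the endpoints coincide in coordinates, \<open>n\<close> is 0 and the claim is
    trivial.\<close>
  define n where "n = sgn (\<phi> (\<gamma> \<tau>) - \<phi> (\<gamma> 0))"
  let ?f = "\<lambda>t. k * (\<phi> (\<gamma> t) \<bullet> n)"
  have \<gamma>c: "continuous_on {0..1} \<gamma>" by (rule piecewise_C1_curve_continuous[OF \<gamma>])
  have "ennreal (?f \<tau> - ?f 0) \<le> (\<integral>\<^sup>+t\<in>{0..\<tau>}. ennreal (speed A g \<gamma> t) \<partial>lborel)"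
  proof (rule ftc_le_nn_integral[OF \<tau>(1) S(1), where f' = "\<lambda>t. k * (D t \<bullet> n)"])
    have "continuous_on {0..\<tau>} (\<lambda>t. \<phi> (\<gamma> t))"
      by (rule continuous_on_compose2[OF chart_continuous_on[OF A c] continuous_on_subset[OF \<gamma>c]])
        (use \<tau> in_V in auto)
    then show "continuous_on {0..\<tau>} ?f" by (intro continuous_intros)
  next
    fix t assume t: "t \<in> {0<..<\<tau>} - S"
    have "((\<lambda>x. k * ((\<phi> \<circ> \<gamma>) x \<bullet> n)) has_derivative (\<lambda>x. k * ((x *\<^sub>R D t) \<bullet> n))) (at t)"
      by (intro has_derivative_mult_right has_derivative_inner_left D[OF t, unfolded has_vector_derivative_def])
    then show "(?f has_real_derivative k * (D t \<bullet> n)) (at t)"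
      unfolding has_field_derivative_def o_def by (rule has_derivative_eq_rhs) (auto simp: fun_eq_iff)
    have "isCont \<gamma> t" using \<gamma>c t \<tau> by (intro continuous_on_interior[OF \<gamma>c]) auto
    then have sp: "speed A g \<gamma> t = sqrt (g (V, \<phi>) (\<gamma> t) (D t) (D t))"
      using t by (intro speed_chart[OF A g c in_V _ D[OF t]]) auto
    have "norm n \<le> 1" by (simp add: n_def norm_sgn)
    then have "D t \<bullet> n \<le> norm (D t)"
      using norm_cauchy_schwarz[of "D t" n] mult_left_mono[of "norm n" 1 "norm (D t)"] by simp
    then have "k * (D t \<bullet> n) \<le> k * norm (D t)" using k by simp
    also have "\<dots> \<le> speed A g \<gamma> t" unfolding sp using t by (intro lower) auto
    finally show "ennreal (k * (D t \<bullet> n)) \<le> ennreal (speed A g \<gamma> t)" by (rule ennreal_leI)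
  qed
  also have "\<dots> \<le> (\<integral>\<^sup>+t\<in>{0..1}. ennreal (speed A g \<gamma> t) \<partial>lborel)"
    using \<tau> by (intro nn_integral_mono) (auto simp: indicator_def)
  also have "?f \<tau> - ?f 0 = k * ((\<phi> (\<gamma> \<tau>) - \<phi> (\<gamma> 0)) \<bullet> n)"
    by (simp add: inner_diff_left algebra_simps)
  also have "(\<phi> (\<gamma> \<tau>) - \<phi> (\<gamma> 0)) \<bullet> n = norm (\<phi> (\<gamma> \<tau>) - \<phi> (\<gamma> 0))"
    by (cases "\<phi> (\<gamma> \<tau>) = \<phi> (\<gamma> 0)") (simp_all add: n_def sgn_div_norm dot_square_norm power2_eq_square)
  finally show ?thesis .
qed

lemma riem_dist_lower:
  assumes A: "manifold A" and g: "riemannian_metric A g" and c: "(V, \<phi>) \<in> A" and L: "compact L" "L \<subseteq> V"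
  obtains k \<delta> where "k > 0" "\<delta> > 0" "\<And>p q. p \<in> L \<Longrightarrow> riem_dist A g p q < ennreal \<delta> \<Longrightarrow>
    q \<in> V \<and> ennreal (k * norm (\<phi> p - \<phi> q)) \<le> riem_dist A g p q"
proof -
  obtain \<rho> where \<rho>: "\<rho> > 0" "compact (\<Union>x\<in>\<phi> ` L. cball x \<rho>)" "(\<Union>x\<in>\<phi> ` L. cball x \<rho>) \<subseteq> \<phi> ` V"
    using compact_thickening[OF chart_compact_image[OF A c L] chart_open_image[OF A c]] L(2) by blast
  \<comment> \<open>One constant \<open>k\<close> has to serve all starting points in
    \<open>L\<close>, so the metric is bounded below on a compact set that contains all the
    balls.\<close>
  define M where "M = V \<inter> \<phi> -` (\<Union>x\<in>\<phi> ` L. cball x \<rho>)"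
  have M: "compact M" "M \<subseteq> V" unfolding M_def using chart_compact_preimage[OF A c \<rho>(2,3)] by auto
  obtain k where k: "k > 0" "\<And>p v. p \<in> M \<Longrightarrow> k * norm v \<le> sqrt (g (V, \<phi>) p v v)"
    by (rule riemannian_metric_bounds[OF A g c M]) (rule that)
  let ?len = "\<lambda>\<gamma>. \<integral>\<^sup>+t\<in>{0..1}. ennreal (speed A g \<gamma> t) \<partial>lborel"
  have *: "(\<gamma> 1 \<in> V \<and> norm (\<phi> (\<gamma> 0) - \<phi> (\<gamma> 1)) < \<rho> \<and> ennreal (k * norm (\<phi> (\<gamma> 0) - \<phi> (\<gamma> 1))) \<le> ?len \<gamma>)
      \<or> ennreal (k * \<rho>) \<le> ?len \<gamma>"
    if \<gamma>: "piecewise_C1_curve A \<gamma>" and p: "\<gamma> 0 \<in> L" for \<gamma>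
  proof -
    define S where "S = V \<inter> \<phi> -` cball (\<phi> (\<gamma> 0)) \<rho>"
    define U where "U = V \<inter> \<phi> -` ball (\<phi> (\<gamma> 0)) \<rho>"
    have SM: "S \<subseteq> M" using p by (auto simp: S_def M_def)
    have "compact S" unfolding S_def
      by (rule chart_compact_preimage[OF A c compact_cball_fd]) (use \<rho>(3) p in auto)
    then have S: "closed S" by (rule compact_imp_closed)
    have U: "open U" unfolding U_def by (rule chart_open_preimage[OF A c]) simp
    have US: "U \<subseteq> S" by (auto simp: U_def S_def)
    note \<gamma>c = piecewise_C1_curve_continuous[OF \<gamma>]
    have lower: "ennreal (k * norm (\<phi> (\<gamma> \<tau>) - \<phi> (\<gamma> 0))) \<le> ?len \<gamma>"
      if "0 \<le> \<tau>" "\<tau> \<le> 1" "\<And>t. t \<in> {0..\<tau>} \<Longrightarrow> \<gamma> t \<in> S" for \<tau>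
      by (rule curve_length_lower[OF A g c \<gamma> that(1,2) k(1)]) (use that(3) SM M(2) k(2) in blast)+
    \<comment> \<open>The times at which the curve is outside the open ball; the minimum of this
      compact set is the first exit time.\<close>
    define T where "T = {t \<in> {0..1}. \<gamma> t \<notin> U}"
    show ?thesis
    proof (cases "T = {}")
      case True
      then have "\<gamma> t \<in> U" if "t \<in> {0..1}" for t using that by (auto simp: T_def)
      then have in_U: "\<gamma> 1 \<in> U" "\<And>t. t \<in> {0..1} \<Longrightarrow> \<gamma> t \<in> S" using US by auto
      have "ennreal (k * norm (\<phi> (\<gamma> 1) - \<phi> (\<gamma> 0))) \<le> ?len \<gamma>" by (rule lower) (use in_U in auto)
      then show ?thesis using in_U(1) by (simp add: U_def dist_norm norm_minus_commute)
    next
      case False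
      have "T = {0..1} \<inter> \<gamma> -` (- U)" by (auto simp: T_def)
      then have "closed T" using continuous_closed_preimage[OF \<gamma>c closed_atLeastAtMost closed_Compl[OF U]] by simp
      then have "compact T" by (rule compact_eq_bounded_closed[THEN iffD2, OF conjI[rotated]])
          (auto simp: T_def intro: bounded_subset[of "{0..1::real}"])
      then obtain \<tau> where \<tau>: "\<tau> \<in> T" "\<And>t. t \<in> T \<Longrightarrow> \<tau> \<le> t"
        using compact_attains_inf[OF _ False] by blast
      have \<tau>1: "0 \<le> \<tau>" "\<tau> \<le> 1" "\<gamma> \<tau> \<notin> U" using \<tau>(1) by (auto simp: T_def)
      have inU: "\<gamma> t \<in> U" if "0 \<le> t" "t < \<tau>" for t using \<tau>(2)[of t] that \<tau>1 by (auto simp: T_def)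
      have "\<gamma> 0 \<in> U" using p L(2) \<rho>(1) by (auto simp: U_def)
      then have "\<tau> \<noteq> 0" using \<tau>1 by auto
      then have "0 < \<tau>" using \<tau>1 by simp
      \<comment> \<open>At the first exit time the curve is a limit of points of the closed ball,
        hence still in the chart, but no longer in the open ball.\<close>
      have "\<gamma> \<tau> \<in> S"
      proof -
        have "closed ({0..1} \<inter> \<gamma> -` S)" using continuous_closed_preimage[OF \<gamma>c _ S] by simp
        moreover have "{0<..<\<tau>} \<subseteq> {0..1} \<inter> \<gamma> -` S" using inU US \<tau>1 by force
        ultimately have "closure {0<..<\<tau>} \<subseteq> {0..1} \<inter> \<gamma> -` S" by (rule closure_minimal[rotated])
        moreover have "\<tau> \<in> closure {0<..<\<tau>}" using \<open>0 < \<tau>\<close> by simp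
        ultimately show ?thesis by blast
      qed
      then have "\<gamma> t \<in> S" if "t \<in> {0..\<tau>}" for t using inU[of t] US that by (cases "t = \<tau>") auto
      then have "ennreal (k * norm (\<phi> (\<gamma> \<tau>) - \<phi> (\<gamma> 0))) \<le> ?len \<gamma>" by (rule lower[OF \<tau>1(1,2)])
      moreover have "\<rho> \<le> norm (\<phi> (\<gamma> \<tau>) - \<phi> (\<gamma> 0))"
        using \<open>\<gamma> \<tau> \<in> S\<close> \<tau>1(3) by (auto simp: U_def S_def dist_norm norm_minus_commute)
      then have "ennreal (k * \<rho>) \<le> ennreal (k * norm (\<phi> (\<gamma> \<tau>) - \<phi> (\<gamma> 0)))"
        using k(1) by (intro ennreal_leI mult_left_mono) auto
      ultimately show ?thesis by (meson order_trans)
    qed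
  qed
  show thesis
  proof (rule that[of k "k * \<rho>"])
    fix p q assume p: "p \<in> L" and d: "riem_dist A g p q < ennreal (k * \<rho>)"
    let ?\<Gamma> = "{\<gamma>. piecewise_C1_curve A \<gamma> \<and> \<gamma> 0 = p \<and> \<gamma> 1 = q}"
    obtain \<gamma> where "\<gamma> \<in> ?\<Gamma>" "?len \<gamma> < ennreal (k * \<rho>)"
      using d unfolding riem_dist_def INF_less_iff by blast
    then have q: "q \<in> V" "norm (\<phi> p - \<phi> q) < \<rho>" using *[of \<gamma>] p by auto
    \<comment> \<open>The infimum runs over all curves. One short curve has shown that the
      coordinate distance is below \<open>\<rho>\<close>, so a curve of length at least
      \<open>k * \<rho>\<close> satisfies the bound as well.\<close>
    have "ennreal (k * norm (\<phi> p - \<phi> q)) \<le> ?len \<gamma>" if "\<gamma> \<in> ?\<Gamma>" for \<gamma>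
    proof -
      have "ennreal (k * norm (\<phi> p - \<phi> q)) \<le> ennreal (k * \<rho>)"
        using q(2) k(1) by (intro ennreal_leI mult_left_mono) auto
      then show ?thesis using *[of \<gamma>] that p by auto
    qed
    then show "q \<in> V \<and> ennreal (k * norm (\<phi> p - \<phi> q)) \<le> riem_dist A g p q"
      using q(1) unfolding riem_dist_def by (intro conjI INF_greatest)
  qed (use k \<rho> in auto)
qed

text \<open>The segment between the coordinates stays in the thickening of \<open>L\<close>, where
  the metric is bounded above, and it is continuously differentiable in every other chart because
  transition maps are smooth.\<close>

lemma riem_dist_upper:
  assumes A: "manifold A" and g: "riemannian_metric A g" and c: "(V, \<phi>) \<in> A" and L: "compact L" "L \<subseteq> V"
  obtains K \<delta> where "K > 0" "\<delta> > 0" "\<And>p q. p \<in> L \<Longrightarrow> q \<in> V \<Longrightarrow> norm (\<phi> p - \<phi> q) < \<delta> \<Longrightarrow>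
    riem_dist A g p q \<le> ennreal (K * norm (\<phi> p - \<phi> q))"
proof -
  obtain \<rho> where \<rho>: "\<rho> > 0" "compact (\<Union>x\<in>\<phi> ` L. cball x \<rho>)" "(\<Union>x\<in>\<phi> ` L. cball x \<rho>) \<subseteq> \<phi> ` V"
    using compact_thickening[OF chart_compact_image[OF A c L] chart_open_image[OF A c]] L(2) by blast
  define M where "M = V \<inter> \<phi> -` (\<Union>x\<in>\<phi> ` L. cball x \<rho>)"
  have M: "compact M" "M \<subseteq> V" unfolding M_def using chart_compact_preimage[OF A c \<rho>(2,3)] by auto
  obtain K where K: "K > 0" "\<And>p v. p \<in> M \<Longrightarrow> sqrt (g (V, \<phi>) p v v) \<le> K * norm v"
    by (rule riemannian_metric_bounds[OF A g c M]) (rule that)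
  show thesis
  proof (rule that[OF K(1) \<rho>(1)])
    fix p q assume p: "p \<in> L" and q: "q \<in> V" "norm (\<phi> p - \<phi> q) < \<rho>"
    define l where "l t = \<phi> p + t *\<^sub>R (\<phi> q - \<phi> p)" for t :: real
    define \<gamma> where "\<gamma> t = inv_into V \<phi> (l t)" for t
    have lc: "continuous_on S l" for S unfolding l_def by (intro continuous_intros)
    have ld: "(l has_vector_derivative (\<phi> q - \<phi> p)) (at t within S)" for t S
      unfolding l_def has_vector_derivative_def by (auto intro!: derivative_eq_intros)
    have lM: "l t \<in> (\<Union>x\<in>\<phi> ` L. cball x \<rho>)" if "t \<in> {0..1}" for t
    proof -
      have "norm (t *\<^sub>R (\<phi> q - \<phi> p)) \<le> 1 * norm (\<phi> q - \<phi> p)" using that unfolding norm_scaleR by (intro mult_right_mono) auto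
      then have "l t \<in> cball (\<phi> p) \<rho>" using q(2) by (auto simp: l_def dist_norm norm_minus_commute)
      then show ?thesis using p by blast
    qed
    have lV: "l t \<in> \<phi> ` V" if "t \<in> {0..1}" for t using lM[OF that] \<rho>(3) by blast
    have \<gamma>V: "\<gamma> t \<in> V" "\<phi> (\<gamma> t) = l t" if "t \<in> {0..1}" for t
      using lV[OF that] unfolding \<gamma>_def by (auto simp: inv_into_into f_inv_into_f)
    have \<gamma>M: "\<gamma> t \<in> M" if "t \<in> {0..1}" for t using \<gamma>V[OF that] lM[OF that] by (auto simp: M_def)
    have \<gamma>cont: "continuous_on {0..1} \<gamma>" unfolding \<gamma>_def
      by (rule continuous_on_compose2[OF chart_continuous_on_inv[OF A c] lc]) (use lV in auto)
    have "C1_curve_on A 0 1 \<gamma>"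
      unfolding C1_curve_on_def
    proof (intro conjI \<gamma>cont ballI, safe)
      fix W \<psi> assume d: "(W, \<psi>) \<in> A"
      let ?f = "\<psi> \<circ> inv_into V \<phi>"
      have in_VW: "l t \<in> \<phi> ` (V \<inter> W)" if "t \<in> {0..1} \<inter> \<gamma> -` W" for t
        using \<gamma>V[of t] that by (intro image_eqI[of _ _ "\<gamma> t"]) auto
      note sm = chart_compatible[OF A c d]
      show "\<exists>D. continuous_on ({0..1} \<inter> \<gamma> -` W) D \<and>
         (\<forall>t\<in>{0..1} \<inter> \<gamma> -` W. ((\<psi> \<circ> \<gamma>) has_vector_derivative D t) (at t within {0..1}))"
      proof (intro exI[of _ "\<lambda>t. frechet_derivative ?f (at (l t)) (\<phi> q - \<phi> p)"] conjI ballI)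
        show "continuous_on ({0..1} \<inter> \<gamma> -` W) (\<lambda>t. frechet_derivative ?f (at (l t)) (\<phi> q - \<phi> p))"
          by (rule continuous_on_compose2[OF smooth_on_continuous_on[OF smooth_on_frechet_derivative[OF sm]] lc])
            (use in_VW in auto)
        fix t assume t: "t \<in> {0..1} \<inter> \<gamma> -` W"
        have "((?f \<circ> l) has_vector_derivative frechet_derivative ?f (at (l t)) (\<phi> q - \<phi> p)) (at t within {0..1})"
          by (rule vector_derivative_diff_chain_within[OF ld has_derivative_at_withinI[OF smooth_on_has_derivative[OF sm in_VW[OF t]]]])
        then show "((\<psi> \<circ> \<gamma>) has_vector_derivative frechet_derivative ?f (at (l t)) (\<phi> q - \<phi> p)) (at t within {0..1})"
          by (simp add: o_def \<gamma>_def)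
      qed
    qed
    then have "piecewise_C1_curve A \<gamma>"
      unfolding piecewise_C1_curve_def by (intro exI[of _ "{0, 1}"]) auto
    moreover have "\<gamma> 0 = p" "\<gamma> 1 = q" using p L(2) q(1) by (auto simp: \<gamma>_def l_def chart_inv[OF A c])
    ultimately have "riem_dist A g p q \<le> (\<integral>\<^sup>+t\<in>{0..1}. ennreal (speed A g \<gamma> t) \<partial>lborel)"
      unfolding riem_dist_def by (intro INF_lower) auto
    also have "\<dots> \<le> (\<integral>\<^sup>+t\<in>{0..1::real}. ennreal (K * norm (\<phi> p - \<phi> q)) \<partial>lborel)"
    proof (rule nn_integral_mono_AE)
      \<comment> \<open>\<open>speed\<close> uses a two-sided derivative, which is controlled only
        at interior times; the two endpoints form a null set.\<close>
      have "AE t in lborel. t \<notin> {0, 1::real}" by (rule AE_not_in) (auto intro: finite_imp_null_set_lborel)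
      then show "AE t in lborel. ennreal (speed A g \<gamma> t) * indicator {0..1} t
          \<le> ennreal (K * norm (\<phi> p - \<phi> q)) * indicator {0..1} t"
      proof eventually_elim
        fix t :: real assume t: "t \<notin> {0, 1}"
        show "ennreal (speed A g \<gamma> t) * indicator {0..1} t \<le> ennreal (K * norm (\<phi> p - \<phi> q)) * indicator {0..1} t"
        proof (cases "t \<in> {0..1}")
          case True
          then have t': "t \<in> {0<..<1}" using t by auto
          have "((\<phi> \<circ> \<gamma>) has_vector_derivative (\<phi> q - \<phi> p)) (at t)"
            by (rule has_vector_derivative_transform_within_open[OF ld open_greaterThanLessThan t'])
              (simp add: \<gamma>V)
          moreover have "isCont \<gamma> t" using t' by (intro continuous_on_interior[OF \<gamma>cont]) auto
          ultimately have "speed A g \<gamma> t = sqrt (g (V, \<phi>) (\<gamma> t) (\<phi> q - \<phi> p) (\<phi> q - \<phi> p))"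
            using \<gamma>V(1)[OF True] by (intro speed_chart[OF A g c])
          also have "\<dots> \<le> K * norm (\<phi> q - \<phi> p)" by (rule K(2)[OF \<gamma>M[OF True]])
          finally show ?thesis using True by (simp add: ennreal_leI norm_minus_commute)
        qed simp
      qed
    qed
    also have "\<dots> = ennreal (K * norm (\<phi> p - \<phi> q))" by (simp add: nn_integral_cmult_indicator)
    finally show "riem_dist A g p q \<le> ennreal (K * norm (\<phi> p - \<phi> q))" .
  qed
qed

text \<open>
  Gives symmetry, transitivity and independence of the metric at once, up to constants and locally
  uniformly, without reversing or concatenating curves.
\<close>

lemma riem_dist_euclidean:
  assumes A: "manifold A" and g: "riemannian_metric A g1" "riemannian_metric A g2" "riemannian_metric A g3"
    and K: "compact K"
  obtains C \<delta> where "C > 0" "\<delta> > 0" "\<And>p q r. p \<in> K \<Longrightarrow> riem_dist A g1 p q < ennreal \<delta> \<Longrightarrow>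
    riem_dist A g2 p r < ennreal \<delta> \<Longrightarrow> riem_dist A g3 q r \<le> ennreal C * (riem_dist A g1 p q + riem_dist A g2 p r)"
proof -
  let ?Q = "\<lambda>K. \<exists>C>0. \<exists>\<delta>>0. \<forall>p\<in>K. \<forall>q r. riem_dist A g1 p q < ennreal \<delta> \<longrightarrow>
    riem_dist A g2 p r < ennreal \<delta> \<longrightarrow> riem_dist A g3 q r \<le> ennreal C * (riem_dist A g1 p q + riem_dist A g2 p r)"
  have "?Q K" using K
  proof (induction rule: compact_local_induct)
    case (local p0)
    obtain V \<phi> where c: "(V, \<phi>) \<in> A" "p0 \<in> V" using chart_at[OF A] .
    obtain N L where N: "open N" "p0 \<in> N" "N \<subseteq> L" and L: "compact L" "L \<subseteq> V"
      using manifold_compact_nhd[OF A c(2) chart_open[OF A c(1)]] .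
    obtain \<rho> where \<rho>: "\<rho> > 0" "compact (\<Union>x\<in>\<phi> ` L. cball x \<rho>)" "(\<Union>x\<in>\<phi> ` L. cball x \<rho>) \<subseteq> \<phi> ` V"
      using compact_thickening[OF chart_compact_image[OF A c(1) L] chart_open_image[OF A c(1)]] L(2) by blast
    define M where "M = V \<inter> \<phi> -` (\<Union>x\<in>\<phi> ` L. cball x \<rho>)"
    have M: "compact M" "M \<subseteq> V" unfolding M_def using chart_compact_preimage[OF A c(1) \<rho>(2,3)] by auto
    obtain k1 \<delta>1 where 1: "k1 > 0" "\<delta>1 > 0" "\<And>p q. p \<in> L \<Longrightarrow> riem_dist A g1 p q < ennreal \<delta>1 \<Longrightarrow>
      q \<in> V \<and> ennreal (k1 * norm (\<phi> p - \<phi> q)) \<le> riem_dist A g1 p q"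
      by (rule riem_dist_lower[OF A g(1) c(1) L]) (rule that)
    obtain k2 \<delta>2 where 2: "k2 > 0" "\<delta>2 > 0" "\<And>p q. p \<in> L \<Longrightarrow> riem_dist A g2 p q < ennreal \<delta>2 \<Longrightarrow>
      q \<in> V \<and> ennreal (k2 * norm (\<phi> p - \<phi> q)) \<le> riem_dist A g2 p q"
      by (rule riem_dist_lower[OF A g(2) c(1) L]) (rule that)
    obtain C \<delta>3 where 3: "C > 0" "\<delta>3 > 0" "\<And>p q. p \<in> M \<Longrightarrow> q \<in> V \<Longrightarrow> norm (\<phi> p - \<phi> q) < \<delta>3 \<Longrightarrow>
      riem_dist A g3 p q \<le> ennreal (C * norm (\<phi> p - \<phi> q))"
      by (rule riem_dist_upper[OF A g(3) c(1) M]) (rule that)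
    define k where "k = min k1 k2"
    \<comment> \<open>Below \<open>k * \<rho>\<close> the point \<open>q\<close> lies in
      \<open>M\<close>, where the upper bound is available; below \<open>k * \<delta>3 / 2\<close>
      for both points, \<open>q\<close> and \<open>r\<close> are closer than
      \<open>\<delta>3\<close> in coordinates.\<close>
    define \<delta> where "\<delta> = min (min \<delta>1 \<delta>2) (k * min \<rho> (\<delta>3 / 2))"
    have pos: "k > 0" "\<delta> > 0" using 1 2 3 \<rho>(1) by (auto simp: k_def \<delta>_def)
    have "riem_dist A g3 q r \<le> ennreal (C / k) * (riem_dist A g1 p q + riem_dist A g2 p r)"
      if p: "p \<in> N" and q: "riem_dist A g1 p q < ennreal \<delta>" and r: "riem_dist A g2 p r < ennreal \<delta>" for p q r
    proof -
      have pL: "p \<in> L" using p N by blast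
      have le: "ennreal \<delta> \<le> ennreal \<delta>1" "ennreal \<delta> \<le> ennreal \<delta>2" by (auto simp: \<delta>_def intro: ennreal_leI)
      have q': "q \<in> V" "ennreal (k1 * norm (\<phi> p - \<phi> q)) \<le> riem_dist A g1 p q"
        using 1(3)[OF pL order_less_le_trans[OF q le(1)]] by auto
      have r': "r \<in> V" "ennreal (k2 * norm (\<phi> p - \<phi> r)) \<le> riem_dist A g2 p r"
        using 2(3)[OF pL order_less_le_trans[OF r le(2)]] by auto
      have q'': "ennreal (k * norm (\<phi> p - \<phi> q)) \<le> riem_dist A g1 p q"
        by (rule order_trans[OF ennreal_leI q'(2)]) (auto simp: k_def intro: mult_right_mono)
      have r'': "ennreal (k * norm (\<phi> p - \<phi> r)) \<le> riem_dist A g2 p r"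
        by (rule order_trans[OF ennreal_leI r'(2)]) (auto simp: k_def intro: mult_right_mono)
      have small: "norm (\<phi> p - \<phi> s) < min \<rho> (\<delta>3 / 2)" if "ennreal (k * norm (\<phi> p - \<phi> s)) < ennreal \<delta>" for s
      proof -
        have "k * norm (\<phi> p - \<phi> s) < \<delta>" using that pos by (simp add: ennreal_less_iff)
        also have "\<delta> \<le> k * min \<rho> (\<delta>3 / 2)" by (simp add: \<delta>_def)
        finally show ?thesis using pos(1) by simp
      qed
      note sq = small[OF order_le_less_trans[OF q'' q]] and sr = small[OF order_le_less_trans[OF r'' r]]
      have "q \<in> M" using q'(1) sq pL by (auto simp: M_def dist_norm intro!: bexI[of _ p])
      moreover have tri: "norm (\<phi> q - \<phi> r) \<le> norm (\<phi> p - \<phi> q) + norm (\<phi> p - \<phi> r)"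
        using norm_triangle_ineq4[of "\<phi> p - \<phi> r" "\<phi> p - \<phi> q"] by simp
      ultimately have "riem_dist A g3 q r \<le> ennreal (C * norm (\<phi> q - \<phi> r))"
        using sq sr by (intro 3(3) r'(1)) auto
      also have "\<dots> \<le> ennreal (C / k * (k * norm (\<phi> p - \<phi> q) + k * norm (\<phi> p - \<phi> r)))"
        using tri 3(1) pos(1) by (intro ennreal_leI) (simp add: distrib_left[symmetric])
      also have "\<dots> = ennreal (C / k) * (ennreal (k * norm (\<phi> p - \<phi> q)) + ennreal (k * norm (\<phi> p - \<phi> r)))"
        using 3(1) pos(1) by (simp only: ennreal_mult ennreal_plus divide_nonneg_pos less_imp_le
            mult_nonneg_nonneg norm_ge_zero add_nonneg_nonneg)
      also have "\<dots> \<le> ennreal (C / k) * (riem_dist A g1 p q + riem_dist A g2 p r)"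
        by (intro mult_left_mono add_mono q'' r'') simp
      finally show ?thesis .
    qed
    then show ?case using N(1,2) pos 3(1) by (intro exI[of _ N] conjI exI[of _ "C / k"] exI[of _ \<delta>]) auto
  next
    case empty show ?case by (auto intro!: exI[of _ "1::real"])
  next
    case (union X Y)
    obtain C1 \<delta>1 where 1: "C1 > 0" "\<delta>1 > 0" "\<forall>p\<in>X. \<forall>q r. riem_dist A g1 p q < ennreal \<delta>1 \<longrightarrow>
      riem_dist A g2 p r < ennreal \<delta>1 \<longrightarrow> riem_dist A g3 q r \<le> ennreal C1 * (riem_dist A g1 p q + riem_dist A g2 p r)"
      using union(1) by blast
    obtain C2 \<delta>2 where 2: "C2 > 0" "\<delta>2 > 0" "\<forall>p\<in>Y. \<forall>q r. riem_dist A g1 p q < ennreal \<delta>2 \<longrightarrow>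
      riem_dist A g2 p r < ennreal \<delta>2 \<longrightarrow> riem_dist A g3 q r \<le> ennreal C2 * (riem_dist A g1 p q + riem_dist A g2 p r)"
      using union(2) by blast
    have le: "ennreal (min \<delta>1 \<delta>2) \<le> ennreal \<delta>1" "ennreal (min \<delta>1 \<delta>2) \<le> ennreal \<delta>2" by (auto intro: ennreal_leI)
    have leC: "ennreal C1 * x \<le> ennreal (max C1 C2) * x" "ennreal C2 * x \<le> ennreal (max C1 C2) * x" for x
      by (auto intro!: mult_right_mono ennreal_leI)
    show ?case
    proof (rule exI[of _ "max C1 C2"], rule conjI[rotated], rule exI[of _ "min \<delta>1 \<delta>2"], intro conjI ballI allI impI)
      fix p q r assume *: "p \<in> X \<union> Y" "riem_dist A g1 p q < ennreal (min \<delta>1 \<delta>2)" "riem_dist A g2 p r < ennreal (min \<delta>1 \<delta>2)"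
      from *(2,3) le have "riem_dist A g1 p q < ennreal \<delta>1" "riem_dist A g2 p r < ennreal \<delta>1"
        "riem_dist A g1 p q < ennreal \<delta>2" "riem_dist A g2 p r < ennreal \<delta>2" by (auto intro: order_less_le_trans)
      then show "riem_dist A g3 q r \<le> ennreal (max C1 C2) * (riem_dist A g1 p q + riem_dist A g2 p r)"
        using *(1) 1(3) 2(3) leC by (meson UnE order_trans)
    qed (use 1 2 in auto)
  next
    case (mono X Y) then show ?case by (meson subsetD)
  qed
  then show thesis using that by blast
qed

section \<open>Asymptotic estimates\<close>

text \<open>Every clause of the form "for all small parameters" becomes a filter statement, so that
  finitely many of them can be intersected.\<close>

lemma params_eventually:
  "(\<exists>\<epsilon>\<^sub>0>0. \<forall>\<epsilon>\<in>params. \<epsilon> < \<epsilon>\<^sub>0 \<longrightarrow> P \<epsilon>) \<longleftrightarrow> eventually P (at_right (0::real))"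
proof
  assume "\<exists>\<epsilon>\<^sub>0>0. \<forall>\<epsilon>\<in>params. \<epsilon> < \<epsilon>\<^sub>0 \<longrightarrow> P \<epsilon>"
  then obtain \<epsilon>0 where "\<epsilon>0 > 0" "\<forall>\<epsilon>\<in>params. \<epsilon> < \<epsilon>0 \<longrightarrow> P \<epsilon>" by blast
  then show "eventually P (at_right 0)"
    unfolding eventually_at_right_field by (intro exI[of _ "min \<epsilon>0 1"]) auto
qed (auto simp: eventually_at_right_field)

lemma eventually_params: "\<forall>\<^sub>F \<epsilon> in at_right 0. \<epsilon> \<in> params"
  unfolding params_eventually[symmetric] by (intro exI[of _ 1]) auto

text \<open>The predicate restricts an estimate to those \<open>\<epsilon>\<close> for which the points lie in a given set, so that
  estimates can be localized by compactness.\<close>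

definition negl_on :: "(real \<Rightarrow> bool) \<Rightarrow> (real \<Rightarrow> real) \<Rightarrow> bool" where
  "negl_on P f \<longleftrightarrow> (\<forall>m::nat. m \<ge> 1 \<longrightarrow> (\<exists>C>0. \<forall>\<^sub>F \<epsilon> in at_right 0. P \<epsilon> \<longrightarrow> f \<epsilon> \<le> C * \<epsilon> powr real m))"

text \<open>The extended version is for Riemannian distances, which may be infinite.\<close>

definition enegl_on :: "(real \<Rightarrow> bool) \<Rightarrow> (real \<Rightarrow> ennreal) \<Rightarrow> bool" where
  "enegl_on P f \<longleftrightarrow> (\<forall>m::nat. m \<ge> 1 \<longrightarrow> (\<exists>C>0. \<forall>\<^sub>F \<epsilon> in at_right 0. P \<epsilon> \<longrightarrow> f \<epsilon> \<le> ennreal (C * \<epsilon> powr real m)))"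

definition moder_on :: "(real \<Rightarrow> bool) \<Rightarrow> (real \<Rightarrow> real) \<Rightarrow> bool" where
  "moder_on P f \<longleftrightarrow> (\<exists>N::nat. \<exists>C>0. \<forall>\<^sub>F \<epsilon> in at_right 0. P \<epsilon> \<longrightarrow> f \<epsilon> \<le> C * \<epsilon> powr - real N)"

lemma big_O_iff: "big_O r g \<longleftrightarrow> (\<exists>C>0. \<forall>\<^sub>F \<epsilon> in at_right 0. g \<epsilon> \<le> ennreal (C * \<epsilon> powr r))"
  unfolding big_O_def params_eventually ..

lemma big_O_enegl: "(\<forall>m::nat. m \<ge> 1 \<longrightarrow> big_O (real m) g) \<longleftrightarrow> enegl_on (\<lambda>_. True) g"
  unfolding big_O_iff enegl_on_def by simp

text \<open>A negative value of \<open>f\<close> is truncated to 0 by \<open>ennreal\<close>, which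
  is harmless because the bound is nonnegative.\<close>

lemma negl_on_enegl: "negl_on P f \<longleftrightarrow> enegl_on P (\<lambda>\<epsilon>. ennreal (f \<epsilon>))"
  unfolding negl_on_def enegl_on_def
proof (intro all_cong ex_cong1 conj_cong refl)
  fix C :: real and m :: nat assume "C > 0"
  then show "(\<forall>\<^sub>F \<epsilon> in at_right 0. P \<epsilon> \<longrightarrow> f \<epsilon> \<le> C * \<epsilon> powr real m) \<longleftrightarrow>
      (\<forall>\<^sub>F \<epsilon> in at_right 0. P \<epsilon> \<longrightarrow> ennreal (f \<epsilon>) \<le> ennreal (C * \<epsilon> powr real m))"
    by (intro eventually_subst always_eventually) (simp add: ennreal_le_iff)
qed

lemma enegl_on_mono:
  assumes "enegl_on P f" "\<forall>\<^sub>F \<epsilon> in at_right 0. Q \<epsilon> \<longrightarrow> P \<epsilon> \<and> g \<epsilon> \<le> f \<epsilon>"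
  shows "enegl_on Q g"
  unfolding enegl_on_def
proof (intro allI impI)
  fix m :: nat assume "m \<ge> 1"
  then obtain C where "C > 0" "\<forall>\<^sub>F \<epsilon> in at_right 0. P \<epsilon> \<longrightarrow> f \<epsilon> \<le> ennreal (C * \<epsilon> powr real m)"
    using assms(1) unfolding enegl_on_def by blast
  moreover from this(2) assms(2) have "\<forall>\<^sub>F \<epsilon> in at_right 0. Q \<epsilon> \<longrightarrow> g \<epsilon> \<le> ennreal (C * \<epsilon> powr real m)"
    by eventually_elim (auto intro: order_trans)
  ultimately show "\<exists>C>0. \<forall>\<^sub>F \<epsilon> in at_right 0. Q \<epsilon> \<longrightarrow> g \<epsilon> \<le> ennreal (C * \<epsilon> powr real m)" by blast
qed

lemma enegl_on_Un:
  assumes "enegl_on P f" "enegl_on Q f" shows "enegl_on (\<lambda>\<epsilon>. P \<epsilon> \<or> Q \<epsilon>) f"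
  unfolding enegl_on_def
proof (intro allI impI)
  fix m :: nat assume m: "m \<ge> 1"
  obtain C where C: "C > 0" "\<forall>\<^sub>F \<epsilon> in at_right 0. P \<epsilon> \<longrightarrow> f \<epsilon> \<le> ennreal (C * \<epsilon> powr real m)"
    using assms(1) m unfolding enegl_on_def by blast
  obtain D where D: "D > 0" "\<forall>\<^sub>F \<epsilon> in at_right 0. Q \<epsilon> \<longrightarrow> f \<epsilon> \<le> ennreal (D * \<epsilon> powr real m)"
    using assms(2) m unfolding enegl_on_def by blast
  have le: "ennreal (C * x) \<le> ennreal (max C D * x)" "ennreal (D * x) \<le> ennreal (max C D * x)" if "x \<ge> 0" for x
    using that by (auto intro!: ennreal_leI mult_right_mono)
  from C(2) D(2) have "\<forall>\<^sub>F \<epsilon> in at_right 0. P \<epsilon> \<or> Q \<epsilon> \<longrightarrow> f \<epsilon> \<le> ennreal (max C D * \<epsilon> powr real m)"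
    by eventually_elim (use le in \<open>auto intro: order_trans\<close>)
  then show "\<exists>C>0. \<forall>\<^sub>F \<epsilon> in at_right 0. P \<epsilon> \<or> Q \<epsilon> \<longrightarrow> f \<epsilon> \<le> ennreal (C * \<epsilon> powr real m)"
    using C(1) by (intro exI[of _ "max C D"]) auto
qed

lemma enegl_on_add:
  assumes "enegl_on P f" "enegl_on P g" shows "enegl_on P (\<lambda>\<epsilon>. f \<epsilon> + g \<epsilon>)"
  unfolding enegl_on_def
proof (intro allI impI)
  fix m :: nat assume m: "m \<ge> 1"
  obtain C where C: "C > 0" "\<forall>\<^sub>F \<epsilon> in at_right 0. P \<epsilon> \<longrightarrow> f \<epsilon> \<le> ennreal (C * \<epsilon> powr real m)"
    using assms(1) m unfolding enegl_on_def by blast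
  obtain D where D: "D > 0" "\<forall>\<^sub>F \<epsilon> in at_right 0. P \<epsilon> \<longrightarrow> g \<epsilon> \<le> ennreal (D * \<epsilon> powr real m)"
    using assms(2) m unfolding enegl_on_def by blast
  from C(2) D(2) have "\<forall>\<^sub>F \<epsilon> in at_right 0. P \<epsilon> \<longrightarrow> f \<epsilon> + g \<epsilon> \<le> ennreal ((C + D) * \<epsilon> powr real m)"
  proof eventually_elim
    case (elim \<epsilon>)
    have "ennreal ((C + D) * \<epsilon> powr real m) = ennreal (C * \<epsilon> powr real m) + ennreal (D * \<epsilon> powr real m)"
      using C(1) D(1) by (simp add: distrib_right ennreal_plus)
    then show ?case using elim add_mono by auto
  qed
  then show "\<exists>C>0. \<forall>\<^sub>F \<epsilon> in at_right 0. P \<epsilon> \<longrightarrow> f \<epsilon> + g \<epsilon> \<le> ennreal (C * \<epsilon> powr real m)"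
    using C(1) D(1) by (intro exI[of _ "C + D"]) auto
qed

lemma enegl_on_cmult:
  assumes "enegl_on P f" "c > 0" shows "enegl_on P (\<lambda>\<epsilon>. ennreal c * f \<epsilon>)"
  unfolding enegl_on_def
proof (intro allI impI)
  fix m :: nat assume m: "m \<ge> 1"
  obtain C where C: "C > 0" "\<forall>\<^sub>F \<epsilon> in at_right 0. P \<epsilon> \<longrightarrow> f \<epsilon> \<le> ennreal (C * \<epsilon> powr real m)"
    using assms(1) m unfolding enegl_on_def by blast
  from C(2) have "\<forall>\<^sub>F \<epsilon> in at_right 0. P \<epsilon> \<longrightarrow> ennreal c * f \<epsilon> \<le> ennreal ((c * C) * \<epsilon> powr real m)"
  proof eventually_elim
    case (elim \<epsilon>)
    have "ennreal ((c * C) * \<epsilon> powr real m) = ennreal c * ennreal (C * \<epsilon> powr real m)"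
      using C(1) assms(2) by (simp add: mult.assoc flip: ennreal_mult)
    then show ?case using elim by (auto intro: mult_left_mono)
  qed
  then show "\<exists>C>0. \<forall>\<^sub>F \<epsilon> in at_right 0. P \<epsilon> \<longrightarrow> ennreal c * f \<epsilon> \<le> ennreal (C * \<epsilon> powr real m)"
    using C(1) assms(2) by (intro exI[of _ "c * C"]) auto
qed

lemma enegl_on_small:
  assumes "enegl_on P f" "\<delta> > 0" shows "\<forall>\<^sub>F \<epsilon> in at_right 0. P \<epsilon> \<longrightarrow> f \<epsilon> < ennreal \<delta>"
proof -
  obtain C where C: "C > 0" "\<forall>\<^sub>F \<epsilon> in at_right 0. P \<epsilon> \<longrightarrow> f \<epsilon> \<le> ennreal (C * \<epsilon> powr real 1)"
    using assms(1) unfolding enegl_on_def by blast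
  have "\<forall>\<^sub>F \<epsilon> in at_right 0. \<epsilon> < \<delta> / C" 
    using C(1) assms(2) unfolding eventually_at_right_field by (intro exI[of _ "\<delta> / C"]) auto
  with C(2) eventually_params show ?thesis
  proof eventually_elim
    case (elim \<epsilon>)
    then have "C * \<epsilon> powr real 1 < \<delta>" using C(1) by (simp add: field_simps)
    then have "ennreal (C * \<epsilon> powr real 1) < ennreal \<delta>" using C(1) elim assms(2) by (intro ennreal_lessI) auto
    then show ?case using elim by (auto intro: order_le_less_trans)
  qed
qed

lemma enegl_on_False: "enegl_on (\<lambda>_. False) f" and moder_on_False: "moder_on (\<lambda>_. False) f'"
  unfolding enegl_on_def moder_on_def by (auto intro: exI[of _ "1::real"])

lemma negl_on_small:
  assumes "negl_on P f" "\<delta> > 0" shows "\<forall>\<^sub>F \<epsilon> in at_right 0. P \<epsilon> \<longrightarrow> f \<epsilon> < \<delta>"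
  using enegl_on_small[OF assms(1)[unfolded negl_on_enegl] assms(2)]
proof eventually_elim
  case (elim \<epsilon>) then show ?case using assms(2) by (cases "f \<epsilon> \<ge> 0") (auto simp: ennreal_less_iff)
qed

lemma ennreal_add_le: "ennreal (x + y) \<le> ennreal x + ennreal y"
proof -
  have "ennreal (x + y) \<le> ennreal (max 0 x + max 0 y)" by (intro ennreal_leI) auto
  also have "\<dots> = ennreal (max 0 x) + ennreal (max 0 y)" by (intro ennreal_plus) auto
  finally show ?thesis by (simp add: max_def ennreal_neg split: if_splits)
qed

lemma negl_on_mono:
  assumes "negl_on P f" "\<forall>\<^sub>F \<epsilon> in at_right 0. Q \<epsilon> \<longrightarrow> P \<epsilon> \<and> g \<epsilon> \<le> f \<epsilon>"
  shows "negl_on Q g"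
  using assms(1) unfolding negl_on_enegl
  by (rule enegl_on_mono) (use assms(2) in \<open>auto elim!: eventually_mono intro: ennreal_leI\<close>)

lemma negl_on_Un: "negl_on P f \<Longrightarrow> negl_on Q f \<Longrightarrow> negl_on (\<lambda>\<epsilon>. P \<epsilon> \<or> Q \<epsilon>) f"
  unfolding negl_on_enegl by (rule enegl_on_Un)

lemma negl_on_add:
  assumes "negl_on P f" "negl_on P g" shows "negl_on P (\<lambda>\<epsilon>. f \<epsilon> + g \<epsilon>)"
  using enegl_on_add[OF assms[unfolded negl_on_enegl]] unfolding negl_on_enegl
  by (rule enegl_on_mono) (simp add: ennreal_add_le)

lemma moder_on_mono:
  assumes "moder_on P f" "\<forall>\<^sub>F \<epsilon> in at_right 0. Q \<epsilon> \<longrightarrow> P \<epsilon> \<and> g \<epsilon> \<le> f \<epsilon>"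
  shows "moder_on Q g"
proof -
  obtain N :: nat and C where "C > 0" "\<forall>\<^sub>F \<epsilon> in at_right 0. P \<epsilon> \<longrightarrow> f \<epsilon> \<le> C * \<epsilon> powr - real N"
    using assms(1) unfolding moder_on_def by blast
  moreover from this(2) assms(2) have "\<forall>\<^sub>F \<epsilon> in at_right 0. Q \<epsilon> \<longrightarrow> g \<epsilon> \<le> C * \<epsilon> powr - real N"
    by eventually_elim auto
  ultimately show ?thesis unfolding moder_on_def by blast
qed

text \<open>Since parameters are at most 1, a larger exponent \<open>N\<close> gives a weaker bound;
  this is what lets two moderate bounds share one exponent.\<close>

lemma powr_minus_mono: "\<epsilon> \<in> params \<Longrightarrow> N \<le> M \<Longrightarrow> \<epsilon> powr - real N \<le> \<epsilon> powr - real M"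
  by (intro powr_mono') auto

lemma moder_on_Un:
  assumes "moder_on P f" "moder_on Q f" shows "moder_on (\<lambda>\<epsilon>. P \<epsilon> \<or> Q \<epsilon>) f"
proof -
  obtain N :: nat and C where C: "C > 0" "\<forall>\<^sub>F \<epsilon> in at_right 0. P \<epsilon> \<longrightarrow> f \<epsilon> \<le> C * \<epsilon> powr - real N"
    using assms(1) unfolding moder_on_def by blast
  obtain M :: nat and D where D: "D > 0" "\<forall>\<^sub>F \<epsilon> in at_right 0. Q \<epsilon> \<longrightarrow> f \<epsilon> \<le> D * \<epsilon> powr - real M"
    using assms(2) unfolding moder_on_def by blast
  from C(2) D(2) eventually_params
  have "\<forall>\<^sub>F \<epsilon> in at_right 0. P \<epsilon> \<or> Q \<epsilon> \<longrightarrow> f \<epsilon> \<le> max C D * \<epsilon> powr - real (max N M)"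
  proof eventually_elim
    case (elim \<epsilon>)
    have "C * \<epsilon> powr - real N \<le> max C D * \<epsilon> powr - real (max N M)"
      "D * \<epsilon> powr - real M \<le> max C D * \<epsilon> powr - real (max N M)"
      using C(1) D(1) elim by (auto intro!: mult_mono powr_minus_mono simp del: of_nat_max)
    with elim show ?case by (auto intro: order_trans)
  qed
  then show ?thesis using C(1) unfolding moder_on_def by (intro exI[of _ "max N M"] exI[of _ "max C D"]) auto
qed

lemma moder_on_mult:
  assumes "moder_on P f" "moder_on P g" "\<And>\<epsilon>. g \<epsilon> \<ge> 0" shows "moder_on P (\<lambda>\<epsilon>. f \<epsilon> * g \<epsilon>)"
proof -
  obtain N :: nat and C where C: "C > 0" "\<forall>\<^sub>F \<epsilon> in at_right 0. P \<epsilon> \<longrightarrow> f \<epsilon> \<le> C * \<epsilon> powr - real N"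
    using assms(1) unfolding moder_on_def by blast
  obtain M :: nat and D where D: "D > 0" "\<forall>\<^sub>F \<epsilon> in at_right 0. P \<epsilon> \<longrightarrow> g \<epsilon> \<le> D * \<epsilon> powr - real M"
    using assms(2) unfolding moder_on_def by blast
  from C(2) D(2) have "\<forall>\<^sub>F \<epsilon> in at_right 0. P \<epsilon> \<longrightarrow> f \<epsilon> * g \<epsilon> \<le> (C * D) * \<epsilon> powr - real (N + M)"
  proof eventually_elim
    case (elim \<epsilon>)
    show ?case
    proof
      assume "P \<epsilon>"
      then have "f \<epsilon> * g \<epsilon> \<le> (C * \<epsilon> powr - real N) * (D * \<epsilon> powr - real M)"
        using elim C(1) assms(3) by (intro mult_mono) auto
      also have "\<dots> = (C * D) * \<epsilon> powr - real (N + M)" by (simp add: powr_add powr_diff powr_minus field_simps)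
      finally show "f \<epsilon> * g \<epsilon> \<le> (C * D) * \<epsilon> powr - real (N + M)" .
    qed
  qed
  then show ?thesis using C(1) D(1) unfolding moder_on_def by (intro exI[of _ "N + M"] exI[of _ "C * D"]) auto
qed

lemma negl_on_mult:
  assumes "moder_on P f" "negl_on P g" "\<And>\<epsilon>. g \<epsilon> \<ge> 0" shows "negl_on P (\<lambda>\<epsilon>. f \<epsilon> * g \<epsilon>)"
  unfolding negl_on_def
proof (intro allI impI)
  fix m :: nat assume m: "m \<ge> 1"
  obtain N :: nat and C where C: "C > 0" "\<forall>\<^sub>F \<epsilon> in at_right 0. P \<epsilon> \<longrightarrow> f \<epsilon> \<le> C * \<epsilon> powr - real N"
    using assms(1) unfolding moder_on_def by blast
  \<comment> \<open>Order \<open>m + N\<close> of the negligible factor pays for the growth of order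
    \<open>N\<close> of the moderate one.\<close>
  have "m + N \<ge> 1" using m by simp
  then obtain D where D: "D > 0" "\<forall>\<^sub>F \<epsilon> in at_right 0. P \<epsilon> \<longrightarrow> g \<epsilon> \<le> D * \<epsilon> powr real (m + N)"
    using assms(2) unfolding negl_on_def by blast
  from C(2) D(2) eventually_params have "\<forall>\<^sub>F \<epsilon> in at_right 0. P \<epsilon> \<longrightarrow> f \<epsilon> * g \<epsilon> \<le> (C * D) * \<epsilon> powr real m"
  proof eventually_elim
    case (elim \<epsilon>)
    show ?case
    proof
      assume "P \<epsilon>"
      then have "f \<epsilon> * g \<epsilon> \<le> (C * \<epsilon> powr - real N) * (D * \<epsilon> powr real (m + N))"
        using elim C(1) assms(3) by (intro mult_mono) auto
      also have "\<dots> = (C * D) * (\<epsilon> powr - real N * \<epsilon> powr real (m + N))" by simp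
      also have "\<epsilon> powr - real N * \<epsilon> powr real (m + N) = \<epsilon> powr real m"
        unfolding powr_add[symmetric] by simp
      finally show "f \<epsilon> * g \<epsilon> \<le> (C * D) * \<epsilon> powr real m" .
    qed
  qed
  then show "\<exists>C>0. \<forall>\<^sub>F \<epsilon> in at_right 0. P \<epsilon> \<longrightarrow> f \<epsilon> * g \<epsilon> \<le> C * \<epsilon> powr real m"
    using C(1) D(1) by (intro exI[of _ "C * D"]) auto
qed

lemma moder_on_const: "moder_on P (\<lambda>_. c)"
proof -
  have "\<forall>\<^sub>F \<epsilon> in at_right 0. P \<epsilon> \<longrightarrow> c \<le> max 1 c * \<epsilon> powr - real 0"
    using eventually_params by eventually_elim simp
  then show ?thesis unfolding moder_on_def by (intro exI[of _ 0] exI[of _ "max 1 c"]) auto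
qed

lemma moder_on_add:
  assumes "moder_on P f" "moder_on P g" shows "moder_on P (\<lambda>\<epsilon>. f \<epsilon> + g \<epsilon>)"
proof -
  obtain N :: nat and C where C: "C > 0" "\<forall>\<^sub>F \<epsilon> in at_right 0. P \<epsilon> \<longrightarrow> f \<epsilon> \<le> C * \<epsilon> powr - real N"
    using assms(1) unfolding moder_on_def by blast
  obtain M :: nat and D where D: "D > 0" "\<forall>\<^sub>F \<epsilon> in at_right 0. P \<epsilon> \<longrightarrow> g \<epsilon> \<le> D * \<epsilon> powr - real M"
    using assms(2) unfolding moder_on_def by blast
  from C(2) D(2) eventually_params
  have "\<forall>\<^sub>F \<epsilon> in at_right 0. P \<epsilon> \<longrightarrow> f \<epsilon> + g \<epsilon> \<le> (C + D) * \<epsilon> powr - real (max N M)"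
  proof eventually_elim
    case (elim \<epsilon>)
    have "C * \<epsilon> powr - real N \<le> C * \<epsilon> powr - real (max N M)" "D * \<epsilon> powr - real M \<le> D * \<epsilon> powr - real (max N M)"
      using C(1) D(1) elim by (auto intro!: mult_left_mono powr_minus_mono simp del: of_nat_max)
    with elim show ?case by (auto simp: distrib_right)
  qed
  then show ?thesis using C(1) D(1) unfolding moder_on_def by (intro exI[of _ "max N M"] exI[of _ "C + D"]) auto
qed

lemma moder_on_sum: "finite I \<Longrightarrow> (\<And>i. i \<in> I \<Longrightarrow> moder_on P (f i)) \<Longrightarrow> moder_on P (\<lambda>\<epsilon>. \<Sum>i\<in>I. f i \<epsilon>)"
  by (induction I rule: finite_induct) (auto intro: moder_on_add moder_on_const)

lemma moder_on_powr: "C > 0 \<Longrightarrow> moder_on P (\<lambda>\<epsilon>. C * \<epsilon> powr - real N)"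
  unfolding moder_on_def by (intro exI[of _ N] exI[of _ C]) auto

section \<open>Generalized points in charts\<close>

text \<open>\<open>M\<close> contains whole coordinate balls, as the mean value theorem needs, and
  captures every chart point close to \<open>L\<close>, as needed when only one of two equivalent
  nets is known to lie in \<open>L\<close>.\<close>

lemma chart_thickening:
  assumes A: "manifold A" and c: "(V, \<phi>) \<in> A" and L: "compact L" "L \<subseteq> V"
  obtains \<rho> M where "\<rho> > 0" "compact M" "M \<subseteq> V" "L \<subseteq> M" "\<And>p. p \<in> L \<Longrightarrow> cball (\<phi> p) \<rho> \<subseteq> \<phi> ` M"
    "\<And>p q. p \<in> L \<Longrightarrow> q \<in> V \<Longrightarrow> norm (\<phi> p - \<phi> q) < \<rho> \<Longrightarrow> q \<in> M"
proof -
  obtain \<rho> where \<rho>: "\<rho> > 0" "compact (\<Union>x\<in>\<phi> ` L. cball x \<rho>)" "(\<Union>x\<in>\<phi> ` L. cball x \<rho>) \<subseteq> \<phi> ` V"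
    using compact_thickening[OF chart_compact_image[OF A c L] chart_open_image[OF A c]] L(2) by blast
  define M where "M = V \<inter> \<phi> -` (\<Union>x\<in>\<phi> ` L. cball x \<rho>)"
  have M: "compact M" "M \<subseteq> V" unfolding M_def using chart_compact_preimage[OF A c \<rho>(2,3)] by auto
  have "L \<subseteq> M"
  proof
    fix p assume "p \<in> L"
    then show "p \<in> M" using L(2) \<rho>(1) by (auto simp: M_def intro!: bexI[of _ p])
  qed
  moreover have "cball (\<phi> p) \<rho> \<subseteq> \<phi> ` M" if "p \<in> L" for p
  proof
    fix x assume x: "x \<in> cball (\<phi> p) \<rho>"
    then have "x \<in> \<phi> ` V" using \<rho>(3) that by blast
    then obtain q where "q \<in> V" "x = \<phi> q" by blast
    then show "x \<in> \<phi> ` M" using x that by (intro image_eqI[of _ _ q]) (auto simp: M_def)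
  qed
  moreover have "q \<in> M" if "p \<in> L" "q \<in> V" "norm (\<phi> p - \<phi> q) < \<rho>" for p q
    using that by (auto simp: M_def dist_norm intro!: bexI[of _ p])
  ultimately show thesis using that[OF \<rho>(1) M] by blast
qed

text \<open>The coordinate upper bound at two equal points is 0.\<close>

lemma riem_dist_self:
  assumes "manifold A" "riemannian_metric A g" shows "riem_dist A g p p = 0"
proof -
  obtain V \<phi> where c: "(V, \<phi>) \<in> A" "p \<in> V" using chart_at[OF assms(1)] .
  obtain K \<delta> where "\<delta> > 0" "\<And>q r. q \<in> {p} \<Longrightarrow> r \<in> V \<Longrightarrow> norm (\<phi> q - \<phi> r) < \<delta> \<Longrightarrow>
    riem_dist A g q r \<le> ennreal (K * norm (\<phi> q - \<phi> r))"
    by (rule riem_dist_upper[OF assms c(1), of "{p}"]) (use c(2) in \<open>auto intro: that\<close>)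
  from this(2)[of p p] this(1) c(2) show ?thesis by simp
qed

lemma cpt_supp_netsD:
  assumes "p \<in> cpt_supp_nets" obtains K where "compact K" "\<forall>\<^sub>F \<epsilon> in at_right 0. p \<epsilon> \<in> K"
  using assms unfolding cpt_supp_nets_def params_eventually by blast

lemma point_equivD:
  assumes "(p, q) \<in> point_equiv A"
  obtains g where "riemannian_metric A g" "enegl_on (\<lambda>_. True) (\<lambda>\<epsilon>. riem_dist A g (p \<epsilon>) (q \<epsilon>))"
    "p \<in> cpt_supp_nets" "q \<in> cpt_supp_nets"
  using assms unfolding point_equiv_def big_O_enegl by blast

lemma point_equivI:
  assumes "riemannian_metric A g" "enegl_on (\<lambda>_. True) (\<lambda>\<epsilon>. riem_dist A g (p \<epsilon>) (q \<epsilon>))"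
    "p \<in> cpt_supp_nets" "q \<in> cpt_supp_nets"
  shows "(p, q) \<in> point_equiv A"
  using assms unfolding point_equiv_def big_O_enegl by blast

text \<open>The two given equivalences may use different metrics. The three-metric estimate on a
  compact set containing \<open>p\<close> yields the conclusion in the first of them.\<close>

lemma point_equiv_euclidean:
  assumes A: "manifold A" and pq: "(p, q) \<in> point_equiv A" and pr: "(p, r) \<in> point_equiv A"
  shows "(q, r) \<in> point_equiv A"
proof -
  obtain g1 where 1: "riemannian_metric A g1" "enegl_on (\<lambda>_. True) (\<lambda>\<epsilon>. riem_dist A g1 (p \<epsilon>) (q \<epsilon>))"
    "p \<in> cpt_supp_nets" "q \<in> cpt_supp_nets" by (rule point_equivD[OF pq])
  obtain g2 where 2: "riemannian_metric A g2" "enegl_on (\<lambda>_. True) (\<lambda>\<epsilon>. riem_dist A g2 (p \<epsilon>) (r \<epsilon>))"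
    "r \<in> cpt_supp_nets" by (rule point_equivD[OF pr])
  obtain K where K: "compact K" "\<forall>\<^sub>F \<epsilon> in at_right 0. p \<epsilon> \<in> K" by (rule cpt_supp_netsD[OF 1(3)])
  obtain C \<delta> where C: "C > 0" "\<delta> > 0" "\<And>p q r. p \<in> K \<Longrightarrow> riem_dist A g1 p q < ennreal \<delta> \<Longrightarrow>
    riem_dist A g2 p r < ennreal \<delta> \<Longrightarrow> riem_dist A g1 q r \<le> ennreal C * (riem_dist A g1 p q + riem_dist A g2 p r)"
    by (rule riem_dist_euclidean[OF A 1(1) 2(1) 1(1) K(1)]) (rule that; assumption)
  have "enegl_on (\<lambda>_. True) (\<lambda>\<epsilon>. riem_dist A g1 (q \<epsilon>) (r \<epsilon>))"
  proof (rule enegl_on_mono[OF enegl_on_cmult[OF enegl_on_add[OF 1(2) 2(2)] C(1)]])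
    show "\<forall>\<^sub>F \<epsilon> in at_right 0. True \<longrightarrow> True \<and> riem_dist A g1 (q \<epsilon>) (r \<epsilon>)
        \<le> ennreal C * (riem_dist A g1 (p \<epsilon>) (q \<epsilon>) + riem_dist A g2 (p \<epsilon>) (r \<epsilon>))"
      using K(2) enegl_on_small[OF 1(2) C(2)] enegl_on_small[OF 2(2) C(2)]
      by eventually_elim (use C(3) in simp)
  qed
  then show ?thesis using 1 2 by (intro point_equivI)
qed

text \<open>A Euclidean relation that is reflexive at \<open>p\<close> can be reversed there; the
  metric for reflexivity is taken from the given pair.\<close>

lemma point_equiv_sym: assumes A: "manifold A" and pq: "(p, q) \<in> point_equiv A" shows "(q, p) \<in> point_equiv A"
proof -
  obtain g where g: "riemannian_metric A g" "p \<in> cpt_supp_nets" by (rule point_equivD[OF pq])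
  have "(p, p) \<in> point_equiv A"
    by (rule point_equivI[OF g(1) _ g(2,2)]) (auto simp: riem_dist_self[OF A g(1)] enegl_on_def intro: exI[of _ "1::real"])
  then show ?thesis by (rule point_equiv_euclidean[OF A pq])
qed

text \<open>Only \<open>p\<close> is localized in \<open>L\<close>. The lower bound for distances
  then forces \<open>q\<close> into the chart domain for small parameters and turns a negligible
  distance into negligible coordinate differences.\<close>

lemma point_equiv_chart:
  assumes A: "manifold A" and pq: "(p, q) \<in> point_equiv A" and c: "(V, \<phi>) \<in> A" and L: "compact L" "L \<subseteq> V"
  shows "negl_on (\<lambda>\<epsilon>. p \<epsilon> \<in> L) (\<lambda>\<epsilon>. norm (\<phi> (p \<epsilon>) - \<phi> (q \<epsilon>)))"
    and "\<forall>\<^sub>F \<epsilon> in at_right 0. p \<epsilon> \<in> L \<longrightarrow> q \<epsilon> \<in> V"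
proof -
  obtain g where g: "riemannian_metric A g" "enegl_on (\<lambda>_. True) (\<lambda>\<epsilon>. riem_dist A g (p \<epsilon>) (q \<epsilon>))"
    by (rule point_equivD[OF pq])
  obtain k \<delta> where k: "k > 0" "\<delta> > 0" "\<And>p q. p \<in> L \<Longrightarrow> riem_dist A g p q < ennreal \<delta> \<Longrightarrow>
    q \<in> V \<and> ennreal (k * norm (\<phi> p - \<phi> q)) \<le> riem_dist A g p q"
    by (rule riem_dist_lower[OF A g(1) c L]) (rule that; assumption)
  have ev: "\<forall>\<^sub>F \<epsilon> in at_right 0. p \<epsilon> \<in> L \<longrightarrow> q \<epsilon> \<in> V \<and>
      ennreal (k * norm (\<phi> (p \<epsilon>) - \<phi> (q \<epsilon>))) \<le> riem_dist A g (p \<epsilon>) (q \<epsilon>)"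
    using enegl_on_small[OF g(2) k(2)] by eventually_elim (use k(3) in simp)
  then show "\<forall>\<^sub>F \<epsilon> in at_right 0. p \<epsilon> \<in> L \<longrightarrow> q \<epsilon> \<in> V" by eventually_elim simp
  have k': "1 / k > 0" using k(1) by simp
  have "enegl_on (\<lambda>\<epsilon>. p \<epsilon> \<in> L) (\<lambda>\<epsilon>. ennreal (norm (\<phi> (p \<epsilon>) - \<phi> (q \<epsilon>))))"
  proof (rule enegl_on_mono[OF enegl_on_cmult[OF g(2) k']])
    from ev show "\<forall>\<^sub>F \<epsilon> in at_right 0. p \<epsilon> \<in> L \<longrightarrow> True \<and> ennreal (norm (\<phi> (p \<epsilon>) - \<phi> (q \<epsilon>)))
      \<le> ennreal (1 / k) * riem_dist A g (p \<epsilon>) (q \<epsilon>)"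
    proof eventually_elim
      case (elim \<epsilon>)
      have "ennreal (norm (\<phi> (p \<epsilon>) - \<phi> (q \<epsilon>))) = ennreal (1 / k) * ennreal (k * norm (\<phi> (p \<epsilon>) - \<phi> (q \<epsilon>)))"
        using k(1) by (simp flip: ennreal_mult)
      then show ?case using elim by (auto intro: mult_left_mono)
    qed
  qed
  then show "negl_on (\<lambda>\<epsilon>. p \<epsilon> \<in> L) (\<lambda>\<epsilon>. norm (\<phi> (p \<epsilon>) - \<phi> (q \<epsilon>)))" unfolding negl_on_enegl .
qed

text \<open>The passage back: negligible coordinate differences are eventually small enough for the
  straight-segment bound, in any metric.\<close>

lemma riem_dist_negl_chart:
  assumes A: "manifold A" and g: "riemannian_metric A g" and c: "(V, \<phi>) \<in> A" and L: "compact L" "L \<subseteq> V"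
    and n: "negl_on P (\<lambda>\<epsilon>. norm (\<phi> (p \<epsilon>) - \<phi> (q \<epsilon>)))"
    and ev: "\<forall>\<^sub>F \<epsilon> in at_right 0. P \<epsilon> \<longrightarrow> p \<epsilon> \<in> L \<and> q \<epsilon> \<in> V"
  shows "enegl_on P (\<lambda>\<epsilon>. riem_dist A g (p \<epsilon>) (q \<epsilon>))"
proof -
  obtain K \<delta> where K: "K > 0" "\<delta> > 0" "\<And>p q. p \<in> L \<Longrightarrow> q \<in> V \<Longrightarrow> norm (\<phi> p - \<phi> q) < \<delta> \<Longrightarrow>
    riem_dist A g p q \<le> ennreal (K * norm (\<phi> p - \<phi> q))"
    by (rule riem_dist_upper[OF A g c L]) (rule that; assumption)
  show ?thesis
  proof (rule enegl_on_mono[OF enegl_on_cmult[OF n[unfolded negl_on_enegl] K(1)]])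
    show "\<forall>\<^sub>F \<epsilon> in at_right 0. P \<epsilon> \<longrightarrow> P \<epsilon> \<and> riem_dist A g (p \<epsilon>) (q \<epsilon>)
        \<le> ennreal K * ennreal (norm (\<phi> (p \<epsilon>) - \<phi> (q \<epsilon>)))"
      using ev negl_on_small[OF n K(2)] by eventually_elim (use K(1,3) in \<open>simp add: ennreal_mult\<close>)
  qed
qed

section \<open>Bundle points in filter form\<close>

lemma ex_swap_params:
  "(\<exists>\<epsilon>\<^sub>1>0. \<exists>C>0. \<forall>\<epsilon>\<in>params. \<epsilon> < \<epsilon>\<^sub>1 \<longrightarrow> P C \<epsilon>) \<longleftrightarrow> (\<exists>C>0. \<forall>\<^sub>F \<epsilon> in at_right (0::real). P (C::real) \<epsilon>)"
  unfolding params_eventually[symmetric] by blast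

lemma vb_moderate_iff:
  "e \<in> vb_moderate E \<longleftrightarrow> e \<in> params \<rightarrow>\<^sub>E UNIV \<and>
     (\<exists>K. compact K \<and> (\<forall>\<^sub>F \<epsilon> in at_right 0. vb_proj E (e \<epsilon>) \<in> K)) \<and>
     (\<exists>h. fiber_metric E h \<and> moder_on (\<lambda>_. True) (\<lambda>\<epsilon>. fiber_norm h (e \<epsilon>)))"
proof -
  have "(\<exists>\<epsilon>\<^sub>1>0. \<exists>N::nat. \<exists>C>0. \<forall>\<epsilon>\<in>params. \<epsilon> < \<epsilon>\<^sub>1 \<longrightarrow> fiber_norm h (e \<epsilon>) \<le> C * \<epsilon> powr - real N)
      \<longleftrightarrow> moder_on (\<lambda>_. True) (\<lambda>\<epsilon>. fiber_norm h (e \<epsilon>))" for h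
    unfolding moder_on_def ex_swap_params[symmetric] by blast
  then show ?thesis unfolding vb_moderate_def params_eventually by simp
qed

lemma vb_equiv_iff:
  "(e, e') \<in> vb_equiv E \<longleftrightarrow> e \<in> vb_moderate E \<and> e' \<in> vb_moderate E \<and>
     ((\<lambda>\<epsilon>\<in>params. vb_proj E (e \<epsilon>)), (\<lambda>\<epsilon>\<in>params. vb_proj E (e' \<epsilon>))) \<in> point_equiv (vb_base E) \<and>
     (\<forall>(W, \<psi>, \<Psi>)\<in>vb_charts E. \<forall>L. compact L \<and> L \<subseteq> W \<longrightarrow>
        negl_on (\<lambda>\<epsilon>. vb_proj E (e \<epsilon>) \<in> L \<and> vb_proj E (e' \<epsilon>) \<in> L) (\<lambda>\<epsilon>. norm (\<Psi> (e \<epsilon>) - \<Psi> (e' \<epsilon>))))"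
proof -
  have *: "(\<exists>\<epsilon>\<^sub>1>0. \<exists>C>0. \<forall>\<epsilon>\<in>params.
           \<epsilon> < \<epsilon>\<^sub>1 \<and> vb_proj E (e \<epsilon>) \<in> L' \<and> vb_proj E (e' \<epsilon>) \<in> L' \<longrightarrow>
             norm (\<Psi> (e \<epsilon>) - \<Psi> (e' \<epsilon>)) \<le> C * \<epsilon> powr real m) \<longleftrightarrow>
      (\<exists>C>0. \<forall>\<^sub>F \<epsilon> in at_right 0. vb_proj E (e \<epsilon>) \<in> L' \<and> vb_proj E (e' \<epsilon>) \<in> L' \<longrightarrow>
             norm (\<Psi> (e \<epsilon>) - \<Psi> (e' \<epsilon>)) \<le> C * \<epsilon> powr real m)" for L' and \<Psi> :: "_ \<Rightarrow> 'd" and m :: nat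
    unfolding ex_swap_params[symmetric] by (simp only: imp_conjL)
  show ?thesis
    unfolding vb_equiv_def negl_on_def mem_Collect_eq prod.case * by blast
qed

section \<open>Equivalence of vector bundle points\<close>

lemma vb_equivD:
  assumes "(e, e') \<in> vb_equiv E"
  shows "e \<in> vb_moderate E" "e' \<in> vb_moderate E"
    and "((\<lambda>\<epsilon>\<in>params. vb_proj E (e \<epsilon>)), (\<lambda>\<epsilon>\<in>params. vb_proj E (e' \<epsilon>))) \<in> point_equiv (vb_base E)"
    and "(W, \<psi>, \<Psi>) \<in> vb_charts E \<Longrightarrow> compact L \<Longrightarrow> L \<subseteq> W \<Longrightarrow>
      negl_on (\<lambda>\<epsilon>. vb_proj E (e \<epsilon>) \<in> L \<and> vb_proj E (e' \<epsilon>) \<in> L) (\<lambda>\<epsilon>. norm (\<Psi> (e \<epsilon>) - \<Psi> (e' \<epsilon>)))"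
proof -
  note * = assms[unfolded vb_equiv_iff]
  show "e \<in> vb_moderate E" "e' \<in> vb_moderate E"
    and "((\<lambda>\<epsilon>\<in>params. vb_proj E (e \<epsilon>)), (\<lambda>\<epsilon>\<in>params. vb_proj E (e' \<epsilon>))) \<in> point_equiv (vb_base E)"
    by (rule *[THEN conjunct1], rule *[THEN conjunct2, THEN conjunct1],
        rule *[THEN conjunct2, THEN conjunct2, THEN conjunct1])
  show "negl_on (\<lambda>\<epsilon>. vb_proj E (e \<epsilon>) \<in> L \<and> vb_proj E (e' \<epsilon>) \<in> L) (\<lambda>\<epsilon>. norm (\<Psi> (e \<epsilon>) - \<Psi> (e' \<epsilon>)))"
    if "(W, \<psi>, \<Psi>) \<in> vb_charts E" "compact L" "L \<subseteq> W"
    using bspec[OF *[THEN conjunct2, THEN conjunct2, THEN conjunct2] that(1)] that(2,3) by simp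
qed

lemma vb_equivI:
  assumes "e \<in> vb_moderate E" "e' \<in> vb_moderate E"
    and "((\<lambda>\<epsilon>\<in>params. vb_proj E (e \<epsilon>)), (\<lambda>\<epsilon>\<in>params. vb_proj E (e' \<epsilon>))) \<in> point_equiv (vb_base E)"
    and "\<And>W \<psi> \<Psi> L. (W, \<psi>, \<Psi>) \<in> vb_charts E \<Longrightarrow> compact L \<Longrightarrow> L \<subseteq> W \<Longrightarrow>
      negl_on (\<lambda>\<epsilon>. vb_proj E (e \<epsilon>) \<in> L \<and> vb_proj E (e' \<epsilon>) \<in> L) (\<lambda>\<epsilon>. norm (\<Psi> (e \<epsilon>) - \<Psi> (e' \<epsilon>)))"
  shows "(e, e') \<in> vb_equiv E"
  unfolding vb_equiv_iff
proof (intro conjI assms(1-3) ballI, clarify)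
  fix W \<psi> \<Psi> L assume "(W, \<psi>, \<Psi>) \<in> vb_charts E" "compact L" "L \<subseteq> W"
  then show "negl_on (\<lambda>\<epsilon>. vb_proj E (e \<epsilon>) \<in> L \<and> vb_proj E (e' \<epsilon>) \<in> L) (\<lambda>\<epsilon>. norm (\<Psi> (e \<epsilon>) - \<Psi> (e' \<epsilon>)))"
    by (rule assms(4))
qed

text \<open>The restriction only makes the nets extensional; small parameters lie in
  \<open>params\<close>, so the estimates may be made for the plain formulas.\<close>

lemma vb_equiv_restrictI:
  assumes "(\<lambda>\<epsilon>\<in>params. z \<epsilon>) \<in> vb_moderate E" "(\<lambda>\<epsilon>\<in>params. z' \<epsilon>) \<in> vb_moderate E"
    and "((\<lambda>\<epsilon>\<in>params. vb_proj E (z \<epsilon>)), (\<lambda>\<epsilon>\<in>params. vb_proj E (z' \<epsilon>))) \<in> point_equiv (vb_base E)"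
    and n: "\<And>W \<psi> \<Psi> L. (W, \<psi>, \<Psi>) \<in> vb_charts E \<Longrightarrow> compact L \<Longrightarrow> L \<subseteq> W \<Longrightarrow>
      negl_on (\<lambda>\<epsilon>. vb_proj E (z \<epsilon>) \<in> L \<and> vb_proj E (z' \<epsilon>) \<in> L) (\<lambda>\<epsilon>. norm (\<Psi> (z \<epsilon>) - \<Psi> (z' \<epsilon>)))"
  shows "((\<lambda>\<epsilon>\<in>params. z \<epsilon>), (\<lambda>\<epsilon>\<in>params. z' \<epsilon>)) \<in> vb_equiv E"
proof (rule vb_equivI[OF assms(1,2)])
  have "(\<lambda>\<epsilon>\<in>params. vb_proj E ((\<lambda>\<epsilon>\<in>params. f \<epsilon>) \<epsilon>)) = (\<lambda>\<epsilon>\<in>params. vb_proj E (f \<epsilon>))" for f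
    by (rule restrict_ext) simp
  then show "((\<lambda>\<epsilon>\<in>params. vb_proj E ((\<lambda>\<epsilon>\<in>params. z \<epsilon>) \<epsilon>)), (\<lambda>\<epsilon>\<in>params. vb_proj E ((\<lambda>\<epsilon>\<in>params. z' \<epsilon>) \<epsilon>)))
      \<in> point_equiv (vb_base E)"
    using assms(3) by simp
  fix W \<psi> \<Psi> L assume d: "(W, \<psi>, \<Psi>) \<in> vb_charts E" "compact L" "L \<subseteq> W"
  show "negl_on (\<lambda>\<epsilon>. vb_proj E ((\<lambda>\<epsilon>\<in>params. z \<epsilon>) \<epsilon>) \<in> L \<and> vb_proj E ((\<lambda>\<epsilon>\<in>params. z' \<epsilon>) \<epsilon>) \<in> L)
      (\<lambda>\<epsilon>. norm (\<Psi> ((\<lambda>\<epsilon>\<in>params. z \<epsilon>) \<epsilon>) - \<Psi> ((\<lambda>\<epsilon>\<in>params. z' \<epsilon>) \<epsilon>)))"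
    by (rule negl_on_mono[OF n[OF d]]) (use eventually_params in eventually_elim, simp)
qed

lemma vb_moderate_restrictI:
  assumes "compact K" "\<forall>\<^sub>F \<epsilon> in at_right 0. vb_proj E (z \<epsilon>) \<in> K" "fiber_metric E h"
    and "moder_on (\<lambda>_. True) (\<lambda>\<epsilon>. fiber_norm h (z \<epsilon>))"
  shows "(\<lambda>\<epsilon>\<in>params. z \<epsilon>) \<in> vb_moderate E"
proof -
  have "\<forall>\<^sub>F \<epsilon> in at_right 0. vb_proj E ((\<lambda>\<epsilon>\<in>params. z \<epsilon>) \<epsilon>) \<in> K"
    using assms(2) eventually_params by eventually_elim simp
  moreover have "moder_on (\<lambda>_. True) (\<lambda>\<epsilon>. fiber_norm h ((\<lambda>\<epsilon>\<in>params. z \<epsilon>) \<epsilon>))"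
    by (rule moder_on_mono[OF assms(4)]) (use eventually_params in eventually_elim, simp)
  ultimately show ?thesis
    unfolding vb_moderate_iff using assms(1,3) by (intro conjI exI[of _ K] exI[of _ h]) auto
qed

lemma vb_equiv_sym:
  assumes E: "vector_bundle E" and e: "(e, e') \<in> vb_equiv E" shows "(e', e) \<in> vb_equiv E"
proof (rule vb_equivI)
  show "e' \<in> vb_moderate E" "e \<in> vb_moderate E" by (rule vb_equivD[OF e])+
  show "((\<lambda>\<epsilon>\<in>params. vb_proj E (e' \<epsilon>)), (\<lambda>\<epsilon>\<in>params. vb_proj E (e \<epsilon>))) \<in> point_equiv (vb_base E)"
    by (rule point_equiv_sym[OF vector_bundle_manifold[OF E] vb_equivD(3)[OF e]])
  fix W \<psi> \<Psi> L assume d: "(W, \<psi>, \<Psi>) \<in> vb_charts E" "compact L" "L \<subseteq> W"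
  show "negl_on (\<lambda>\<epsilon>. vb_proj E (e' \<epsilon>) \<in> L \<and> vb_proj E (e \<epsilon>) \<in> L) (\<lambda>\<epsilon>. norm (\<Psi> (e' \<epsilon>) - \<Psi> (e \<epsilon>)))"
    by (rule negl_on_mono[OF vb_equivD(4)[OF e d]]) (simp add: norm_minus_commute)
qed

text \<open>The triangle inequality in a chart passes through \<open>e\<close>, whose base point
  need not lie in \<open>L\<close> when those of \<open>e1\<close> and \<open>e2\<close> do.
  Equivalence of base points puts it into a slightly larger compact \<open>M\<close> of the same
  chart, where both hypotheses apply.\<close>

lemma vb_equiv_euclidean:
  assumes E: "vector_bundle E" and e1: "(e, e1) \<in> vb_equiv E" and e2: "(e, e2) \<in> vb_equiv E"
  shows "(e1, e2) \<in> vb_equiv E"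
proof -
  note A = vector_bundle_manifold[OF E] and pe = vb_equivD(3)[OF e1] vb_equivD(3)[OF e2]
  have "negl_on (\<lambda>\<epsilon>. vb_proj E (e1 \<epsilon>) \<in> L \<and> vb_proj E (e2 \<epsilon>) \<in> L) (\<lambda>\<epsilon>. norm (\<Psi> (e1 \<epsilon>) - \<Psi> (e2 \<epsilon>)))"
    if d: "(W, \<psi>, \<Psi>) \<in> vb_charts E" and L: "compact L" "L \<subseteq> W" for W \<psi> \<Psi> L
  proof -
    note c = vb_chart_base[OF E d]
    obtain \<rho> M where M: "\<rho> > 0" "compact M" "M \<subseteq> W" "L \<subseteq> M"
      "\<And>p q. p \<in> L \<Longrightarrow> q \<in> W \<Longrightarrow> norm (\<psi> p - \<psi> q) < \<rho> \<Longrightarrow> q \<in> M"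
      by (rule chart_thickening[OF A c L]) (rule that; assumption)
    have n: "negl_on (\<lambda>\<epsilon>. vb_proj E (e \<epsilon>) \<in> M \<and> vb_proj E (e1 \<epsilon>) \<in> M) (\<lambda>\<epsilon>. norm (\<Psi> (e \<epsilon>) - \<Psi> (e1 \<epsilon>)))"
      "negl_on (\<lambda>\<epsilon>. vb_proj E (e \<epsilon>) \<in> M \<and> vb_proj E (e2 \<epsilon>) \<in> M) (\<lambda>\<epsilon>. norm (\<Psi> (e \<epsilon>) - \<Psi> (e2 \<epsilon>)))"
      by (rule vb_equivD(4)[OF e1 d M(2,3)], rule vb_equivD(4)[OF e2 d M(2,3)])
    let ?Q = "\<lambda>\<epsilon>. vb_proj E (e \<epsilon>) \<in> M \<and> vb_proj E (e1 \<epsilon>) \<in> M \<and> vb_proj E (e2 \<epsilon>) \<in> M"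
    have "negl_on ?Q (\<lambda>\<epsilon>. norm (\<Psi> (e \<epsilon>) - \<Psi> (e1 \<epsilon>)) + norm (\<Psi> (e \<epsilon>) - \<Psi> (e2 \<epsilon>)))"
      by (rule negl_on_add; rule negl_on_mono, rule n) simp_all
    then show ?thesis
    proof (rule negl_on_mono)
      \<comment> \<open>The chart estimate localizes its first net, so the equivalence is reversed
        to start from \<open>e1\<close>.\<close>
      note ps = point_equiv_sym[OF A pe(1)]
      note near = negl_on_small[OF point_equiv_chart(1)[OF A ps c L] M(1)] point_equiv_chart(2)[OF A ps c L]
      show "\<forall>\<^sub>F \<epsilon> in at_right 0. vb_proj E (e1 \<epsilon>) \<in> L \<and> vb_proj E (e2 \<epsilon>) \<in> L \<longrightarrow>
          ?Q \<epsilon> \<and> norm (\<Psi> (e1 \<epsilon>) - \<Psi> (e2 \<epsilon>)) \<le> norm (\<Psi> (e \<epsilon>) - \<Psi> (e1 \<epsilon>)) + norm (\<Psi> (e \<epsilon>) - \<Psi> (e2 \<epsilon>))"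
        using near eventually_params
      proof eventually_elim
        case (elim \<epsilon>)
        have "norm (\<Psi> (e1 \<epsilon>) - \<Psi> (e2 \<epsilon>)) \<le> norm (\<Psi> (e \<epsilon>) - \<Psi> (e1 \<epsilon>)) + norm (\<Psi> (e \<epsilon>) - \<Psi> (e2 \<epsilon>))"
          using norm_triangle_ineq4[of "\<Psi> (e \<epsilon>) - \<Psi> (e2 \<epsilon>)" "\<Psi> (e \<epsilon>) - \<Psi> (e1 \<epsilon>)"] by simp
        with elim M(4,5) show ?case by auto
      qed
    qed
  qed
  then show ?thesis
    by (rule vb_equivI[OF vb_equivD(2)[OF e1] vb_equivD(2)[OF e2] point_equiv_euclidean[OF A pe]])
qed

lemma vb_class_eq:
  assumes E: "vector_bundle E" and e: "(e, e') \<in> vb_equiv E" shows "vb_class E e = vb_class E e'"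
  unfolding vb_class_def
proof (intro set_eqI iffI)
  show "f \<in> vb_equiv E `` {e'}" if "f \<in> vb_equiv E `` {e}" for f
    using vb_equiv_euclidean[OF E e] that by blast
  show "f \<in> vb_equiv E `` {e}" if "f \<in> vb_equiv E `` {e'}" for f
    using vb_equiv_euclidean[OF E vb_equiv_sym[OF E e]] that by blast
qed

section \<open>Fiberwise operations\<close>

text \<open>The difference is formed in one chart; linearity of the transition maps shows that it
  has the right coordinates in all the others. This justifies the definite description in
  \<open>sec_diff\<close>.\<close>

lemma vb_fiber_diff_ex1:
  assumes E: "vector_bundle E" and z: "vb_proj E z1 = p" "vb_proj E z2 = p"
  shows "\<exists>!z. vb_proj E z = p \<and> (\<forall>(V, \<phi>, \<Phi>)\<in>vb_charts E. p \<in> V \<longrightarrow> \<Phi> z = \<Phi> z1 - \<Phi> z2)"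
proof -
  obtain V \<phi> \<Phi> where c: "(V, \<phi>, \<Phi>) \<in> vb_charts E" "p \<in> V" using vb_chart_at[OF E] .
  let ?z = "vb_inv E (V, \<phi>, \<Phi>) (\<phi> p) (\<Phi> z1 - \<Phi> z2)"
  have eq: "vb_inv E (V, \<phi>, \<Phi>) (\<phi> p) (\<Phi> z) = z" if "vb_proj E z = p" for z
    using vb_inv_fiber[OF E c(1), of z] that c(2) by simp
  show ?thesis
  proof (rule ex1I[of _ ?z])
    show "vb_proj E ?z = p \<and> (\<forall>(V, \<phi>, \<Phi>)\<in>vb_charts E. p \<in> V \<longrightarrow> \<Phi> ?z = \<Phi> z1 - \<Phi> z2)"
    proof (intro conjI ballI, rule vb_proj_inv[OF E c], clarify)
      fix W \<psi> \<Psi> assume d: "(W, \<psi>, \<Psi>) \<in> vb_charts E" "p \<in> W"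
      show "\<Psi> ?z = \<Psi> z1 - \<Psi> z2"
        using linear_diff[OF vb_transition_linear[OF E c(1) d(1) c(2) d(2)], of "\<Phi> z1" "\<Phi> z2"] eq z by simp
    qed
  next
    fix z assume *: "vb_proj E z = p \<and> (\<forall>(V, \<phi>, \<Phi>)\<in>vb_charts E. p \<in> V \<longrightarrow> \<Phi> z = \<Phi> z1 - \<Phi> z2)"
    have "\<Phi> z = \<Phi> z1 - \<Phi> z2" using bspec[OF conjunct2[OF *] c(1)] c(2) by simp
    then show "z = ?z" using eq[of z] * by simp
  qed
qed

lemma sec_diff_chart:
  assumes E: "vector_bundle E" and st: "s \<in> sections E" "t \<in> sections E"
  shows "vb_proj E (sec_diff E s t p) = p"
    and "(V, \<phi>, \<Phi>) \<in> vb_charts E \<Longrightarrow> p \<in> V \<Longrightarrow> \<Phi> (sec_diff E s t p) = \<Phi> (s p) - \<Phi> (t p)"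
proof -
  have pr: "vb_proj E (s p) = p" "vb_proj E (t p) = p" using st unfolding sections_def by blast+
  have *: "vb_proj E (sec_diff E s t p) = p \<and>
      (\<forall>(V, \<phi>, \<Phi>)\<in>vb_charts E. p \<in> V \<longrightarrow> \<Phi> (sec_diff E s t p) = \<Phi> (s p) - \<Phi> (t p))"
    unfolding sec_diff_def by (rule theI'[OF vb_fiber_diff_ex1[OF E pr]])
  then show "vb_proj E (sec_diff E s t p) = p" by (rule conjunct1)
  show "\<Phi> (sec_diff E s t p) = \<Phi> (s p) - \<Phi> (t p)" if "(V, \<phi>, \<Phi>) \<in> vb_charts E" "p \<in> V"
    using bspec[OF conjunct2[OF *] that(1)] that(2) by simp
qed

text \<open>The zero of a fiber, obtained as the difference of an element with itself.\<close>

lemma vb_zero_ex: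
  assumes E: "vector_bundle E"
  shows "\<exists>z. vb_proj E z = p \<and> (\<forall>V \<phi> \<Phi>. (V, \<phi>, \<Phi>) \<in> vb_charts E \<longrightarrow> p \<in> V \<longrightarrow> \<Phi> z = 0)"
proof -
  obtain V \<phi> \<Phi> where c: "(V, \<phi>, \<Phi>) \<in> vb_charts E" "p \<in> V" using vb_chart_at[OF E] .
  let ?y = "vb_inv E (V, \<phi>, \<Phi>) (\<phi> p) 0"
  have y: "vb_proj E ?y = p" by (rule vb_proj_inv[OF E c])
  obtain z where z: "vb_proj E z = p \<and> (\<forall>(V, \<phi>, \<Phi>)\<in>vb_charts E. p \<in> V \<longrightarrow> \<Phi> z = \<Phi> ?y - \<Phi> ?y)"
    by (rule ex1E[OF vb_fiber_diff_ex1[OF E y y]]) (rule that)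
  have "\<Psi> z = 0" if "(W, \<psi>, \<Psi>) \<in> vb_charts E" "p \<in> W" for W \<psi> \<Psi>
    using bspec[OF conjunct2[OF z] that(1)] that(2) by simp
  then show ?thesis using conjunct1[OF z] by (intro exI[of _ z] conjI allI impI)
qed

text \<open>The product rule for a matrix-valued function applied to a vector-valued one, where
  smoothness of the matrix is given only on fixed vectors. Both sides are expanded in a basis of the
  fiber.\<close>

lemma has_derivative_linear_apply:
  fixes r :: "'a::real_normed_vector \<Rightarrow> 'v::finite_dim_inner" and T :: "'a \<Rightarrow> 'v \<Rightarrow> 'w::real_normed_vector"
  assumes U: "open U" "x \<in> U" and lin: "\<And>y. y \<in> U \<Longrightarrow> linear (T y)" and sm: "\<And>\<xi>. smooth_on U (\<lambda>y. T y \<xi>)"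
    and r: "(r has_derivative r') (at x)"
  shows "((\<lambda>y. T y (r y)) has_derivative (\<lambda>v. T x (r' v) + frechet_derivative (\<lambda>y. T y (r x)) (at x) v)) (at x)"
proof -
  let ?T' = "\<lambda>w. frechet_derivative (\<lambda>y. T y w) (at x)"
  have T': "((\<lambda>y. T y w) has_derivative ?T' w) (at x)" for w
    by (rule smooth_on_has_derivative[OF sm U(2)])
  have "((\<lambda>y. \<Sum>w\<in>fd_basis. (\<xi> \<bullet> w) *\<^sub>R T y w) has_derivative (\<lambda>v. \<Sum>w\<in>fd_basis. (\<xi> \<bullet> w) *\<^sub>R ?T' w v)) (at x)" for \<xi>
    by (intro has_derivative_sum has_derivative_scaleR_right T')
  then have "((\<lambda>y. T y \<xi>) has_derivative (\<lambda>v. \<Sum>w\<in>fd_basis. (\<xi> \<bullet> w) *\<^sub>R ?T' w v)) (at x)" for \<xi>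
    by (rule has_derivative_transform_within_open[OF _ U]) (use linear_fd_expand[OF lin] in simp)
  \<comment> \<open>The derivative of \<open>T\<close> depends linearly on the vector; this
    identifies the basis sum with a single derivative at the end.\<close>
  then have eq: "?T' \<xi> = (\<lambda>v. \<Sum>w\<in>fd_basis. (\<xi> \<bullet> w) *\<^sub>R ?T' w v)" for \<xi>
    by (rule frechet_derivative_at[symmetric])
  have "((\<lambda>y. \<Sum>w\<in>fd_basis. (r y \<bullet> w) *\<^sub>R T y w) has_derivative
      (\<lambda>v. \<Sum>w\<in>fd_basis. (r x \<bullet> w) *\<^sub>R ?T' w v + (r' v \<bullet> w) *\<^sub>R T x w)) (at x)"
    by (intro has_derivative_sum has_derivative_scaleR has_derivative_inner_left r T')
  then have "((\<lambda>y. T y (r y)) has_derivative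
      (\<lambda>v. \<Sum>w\<in>fd_basis. (r x \<bullet> w) *\<^sub>R ?T' w v + (r' v \<bullet> w) *\<^sub>R T x w)) (at x)"
    by (rule has_derivative_transform_within_open[OF _ U]) (use linear_fd_expand[OF lin] in simp)
  moreover have "(\<Sum>w\<in>fd_basis. (r x \<bullet> w) *\<^sub>R ?T' w v + (r' v \<bullet> w) *\<^sub>R T x w) = T x (r' v) + ?T' (r x) v" for v
    using fun_cong[OF eq[of "r x"], of v] linear_fd_expand[OF lin[OF U(2)], of "r' v"] by (simp add: sum.distrib)
  ultimately show ?thesis by simp
qed

lemma smooth_on_bump_mult:
  assumes A: "manifold A" and c: "(V, \<phi>) \<in> A" "(W, \<psi>) \<in> A" and \<beta>: "smooth_fun A \<beta>"
    and S: "closed S" "S \<subseteq> V" "\<And>p. p \<notin> S \<Longrightarrow> \<beta> p = (0::real)"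
    and H: "smooth_on (\<phi> ` (V \<inter> W)) (\<lambda>x. H (inv_into V \<phi> x))"
  shows "smooth_on (\<psi> ` W) (\<lambda>x. \<beta> (inv_into W \<psi> x) *\<^sub>R H (inv_into W \<psi> x))"
proof (rule smooth_on_extend_zero[OF A c(2) S(1,2)])
  have o: "open (\<psi> ` (V \<inter> W))"
    unfolding Int_commute[of V] by (rule chart_open_image_Int[OF A c(2) chart_open[OF A c(1)]])
  have "smooth_on (\<psi> ` (V \<inter> W)) (\<lambda>x. H (inv_into W \<psi> x))"
    using smooth_on_change_chart[OF A c open_UNIV, of H] H by simp
  moreover have "smooth_on (\<psi> ` (V \<inter> W)) (\<lambda>x. \<beta> (inv_into W \<psi> x))"
    by (rule smooth_on_subset[OF smooth_funD[OF \<beta> c(2)]]) auto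
  ultimately show "smooth_on (\<psi> ` (V \<inter> W)) (\<lambda>x. \<beta> (inv_into W \<psi> x) *\<^sub>R H (inv_into W \<psi> x))"
    by (intro smooth_on_scaleR o)
qed (simp add: S(3))

text \<open>Multiplication by a possibly complex scalar commutes with real scalars; its boundedness
  allows it to be pulled through a derivative.\<close>

lemma vb_scale_bounded_linear:
  assumes E: "vector_bundle E" shows "bounded_linear (vb_scale E r)"
proof (rule linear_fd_bounded_linear, rule linearI)
  interpret vector_space "vb_scale E" by (rule vector_bundle_vector_space[OF E])
  show "vb_scale E r (x + y) = vb_scale E r x + vb_scale E r y" for x y by (rule scale_right_distrib)
  show "vb_scale E r (t *\<^sub>R x) = t *\<^sub>R vb_scale E r x" for t x
    unfolding vector_bundle_scale[OF E, symmetric] scale_scale by (simp add: mult.commute)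
qed

section \<open>First-order differential operators\<close>

lemma
  assumes "s \<in> sections E"
  shows section_proj: "vb_proj E (s p) = p"
    and section_smooth: "(V, \<phi>, \<Phi>) \<in> vb_charts E \<Longrightarrow> smooth_on (\<phi> ` V) (sec_rep (V, \<phi>, \<Phi>) s)"
  using assms unfolding sections_def by blast+

lemma sec_rep_apply: "sec_rep (V, \<phi>, \<Phi>) s = (\<lambda>x. \<Phi> (s (inv_into V \<phi> x)))"
  by (simp add: sec_rep_def fun_eq_iff)

text \<open>The operator of order 0 that gives bounds on the values of a moderate net of
  sections.\<close>

lemma diff_ops_id: 
  fixes E :: "('x::t2_space, 'a::finite_dim_inner, 'e::t2_space, 'v::finite_dim_inner,
                'k::{real_normed_field, euclidean_space}) vbundle"
  assumes E: "vector_bundle E" shows "(\<lambda>s. s) \<in> diff_ops E"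
proof -
  have "\<exists>\<Lambda> a. finite \<Lambda> \<and>
        (\<forall>vs\<in>\<Lambda>. length vs \<le> 0 \<and> (\<forall>x\<in>\<phi> ` V. Vector_Spaces.linear (vb_scale E) (vb_scale E) (a vs x)) \<and>
           (\<forall>\<xi>. smooth_on (\<phi> ` V) (\<lambda>x. a vs x \<xi>))) \<and>
        (\<forall>s\<in>sections E. \<forall>x\<in>\<phi> ` V.
           sec_rep (V, \<phi>, \<Phi>) s x = (\<Sum>vs\<in>\<Lambda>. a vs x (iter_deriv (sec_rep (V, \<phi>, \<Phi>) s) vs x)))"
    if d: "(V, \<phi>, \<Phi>) \<in> vb_charts E" for V \<phi> \<Phi>
  proof (rule exI[of _ "{[]}"], rule exI[of _ "\<lambda>_ _ \<xi>. \<xi>"], intro conjI ballI allI)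
    show "Vector_Spaces.linear (vb_scale E) (vb_scale E) (\<lambda>\<xi>. \<xi>)"
      using vector_bundle_vector_space[OF E] by (simp add: Vector_Spaces.linear_iff)
    show "smooth_on (\<phi> ` V) (\<lambda>x. \<xi>)" for \<xi> :: 'v
      by (rule smooth_on_const[OF chart_open_image[OF vector_bundle_manifold[OF E] vb_chart_base[OF E d]]])
  qed auto
  then show ?thesis
    unfolding diff_ops_def mem_Collect_eq
    by (intro conjI ballI exI[of _ 0]) (auto simp only: split_paired_all prod.case)
qed

text \<open>In its own chart the operator is a derivative times a bump function, continued by the
  zero section. What must be shown is that it has the form of a differential operator in every chart
  \<open>W\<close>: the representative in \<open>V\<close> is a matrix times the representative in
  \<open>W\<close> after the coordinate change, and the product rule produces a term of order 0 and
  a term of order 1.\<close>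

lemma diff_ops_bump_derivative:
  fixes E :: "('x::t2_space, 'a::finite_dim_inner, 'e::t2_space, 'v::finite_dim_inner,
                'k::{real_normed_field, euclidean_space}) vbundle"
  assumes E: "vector_bundle E" and c: "(V, \<phi>, \<Phi>) \<in> vb_charts E"
    and \<beta>: "smooth_fun (vb_base E) \<beta>" and S: "closed S" "S \<subseteq> V" "\<And>p. p \<notin> S \<Longrightarrow> \<beta> p = (0::real)"
  obtains P where "P \<in> diff_ops E" "\<And>s p. s \<in> sections E \<Longrightarrow> p \<in> V \<Longrightarrow>
    \<Phi> (P s p) = \<beta> p *\<^sub>R frechet_derivative (sec_rep (V, \<phi>, \<Phi>) s) (at (\<phi> p)) v"
proof -
  note A = vector_bundle_manifold[OF E] and cA = vb_chart_base[OF E c]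
  interpret vector_space "vb_scale E" by (rule vector_bundle_vector_space[OF E])
  let ?I = "vb_inv E (V, \<phi>, \<Phi>)"
  define D where "D s x = frechet_derivative (sec_rep (V, \<phi>, \<Phi>) s) (at x) v" for s x
  obtain Z where Z: "\<And>p. vb_proj E (Z p) = p" "\<And>p W \<psi> \<Psi>. (W, \<psi>, \<Psi>) \<in> vb_charts E \<Longrightarrow> p \<in> W \<Longrightarrow> \<Psi> (Z p) = 0"
    using vb_zero_ex[OF E] by metis
  define P where "P s p = (if p \<in> V then ?I (\<phi> p) (\<beta> p *\<^sub>R D s (\<phi> p)) else Z p)" for s p
  have Pproj: "vb_proj E (P s p) = p" for s p
    by (simp add: P_def Z vb_proj_inv[OF E c])
  have Prep: "\<Psi> (P s p) = \<beta> p *\<^sub>R \<Psi> (?I (\<phi> p) (D s (\<phi> p)))" if d: "(W, \<psi>, \<Psi>) \<in> vb_charts E" "p \<in> W" for W \<psi> \<Psi> s p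
  proof (cases "p \<in> V")
    case True
    then show ?thesis using linear_scale[OF vb_transition_linear[OF E c d(1) True d(2)]] by (simp add: P_def)
  next
    case False
    then have "\<beta> p = 0" using S by blast
    then show ?thesis using False Z(2)[OF d] by (simp add: P_def)
  qed
  have "P s \<in> sections E" if s: "s \<in> sections E" for s
    unfolding sections_def mem_Collect_eq
  proof (intro conjI allI ballI Pproj, clarify)
    fix W \<psi> \<Psi> assume d: "(W, \<psi>, \<Psi>) \<in> vb_charts E"
    note dA = vb_chart_base[OF E d]
    have o: "open (\<phi> ` (V \<inter> W))" by (rule chart_open_image_Int[OF A cA chart_open[OF A dA]])
    have Dsm: "smooth_on (\<phi> ` (V \<inter> W)) (D s)"
      unfolding D_def[abs_def]
      by (rule smooth_on_frechet_derivative[OF smooth_on_subset[OF section_smooth[OF s c]]]) auto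
    have "smooth_on (\<phi> ` (V \<inter> W)) (\<lambda>x. \<Psi> (?I x (D s x)))"
      by (rule smooth_on_linear_apply[OF o _ vb_transition_smooth[OF E c d] Dsm])
        (use vb_transition_linear[OF E c d] in auto)
    then have "smooth_on (\<phi> ` (V \<inter> W)) (\<lambda>x. \<Psi> (?I (\<phi> (inv_into V \<phi> x)) (D s (\<phi> (inv_into V \<phi> x)))))"
      by (rule smooth_on_cong[OF o, rotated]) (auto simp: chart_inv[OF A cA])
    then have "smooth_on (\<psi> ` W) (\<lambda>x. \<beta> (inv_into W \<psi> x) *\<^sub>R \<Psi> (?I (\<phi> (inv_into W \<psi> x)) (D s (\<phi> (inv_into W \<psi> x)))))"
      by (intro smooth_on_bump_mult[OF A cA dA \<beta> S(1,2)] S(3))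
    then show "smooth_on (\<psi> ` W) (sec_rep (W, \<psi>, \<Psi>) (P s))"
      by (rule smooth_on_cong[OF chart_open_image[OF A dA], rotated])
        (auto simp: sec_rep_apply Prep[OF d] chart_inv[OF A dA])
  qed
  moreover have "\<exists>\<Lambda> a. finite \<Lambda> \<and>
        (\<forall>vs\<in>\<Lambda>. length vs \<le> 1 \<and> (\<forall>x\<in>\<psi> ` W. Vector_Spaces.linear (vb_scale E) (vb_scale E) (a vs x)) \<and>
           (\<forall>\<xi>. smooth_on (\<psi> ` W) (\<lambda>x. a vs x \<xi>))) \<and>
        (\<forall>s\<in>sections E. \<forall>x\<in>\<psi> ` W.
           sec_rep (W, \<psi>, \<Psi>) (P s) x = (\<Sum>vs\<in>\<Lambda>. a vs x (iter_deriv (sec_rep (W, \<psi>, \<Psi>) s) vs x)))"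
    if d: "(W, \<psi>, \<Psi>) \<in> vb_charts E" for W \<psi> \<Psi>
  proof -
    note dA = vb_chart_base[OF E d]
    let ?J = "vb_inv E (W, \<psi>, \<Psi>)" and ?\<tau> = "\<psi> \<circ> inv_into V \<phi>"
    define U where "U = \<phi> ` (V \<inter> W)"
    have o: "open U" unfolding U_def by (rule chart_open_image_Int[OF A cA chart_open[OF A dA]])
    have oW: "open (\<psi> ` (W \<inter> V))" by (rule chart_open_image_Int[OF A dA chart_open[OF A cA]])
    have U: "\<phi> p \<in> U" if "p \<in> V" "p \<in> W" for p using that by (auto simp: U_def)
    have \<tau>: "?\<tau> (\<phi> p) = \<psi> p" if "p \<in> V" for p using that by (simp add: chart_inv[OF A cA])
    have \<tau>sm: "smooth_on U ?\<tau>" unfolding U_def by (rule chart_compatible[OF A cA dA])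
    \<comment> \<open>\<open>T\<close> is the fiber transition from \<open>V\<close> to
      \<open>W\<close> and \<open>C\<close> the one from \<open>W\<close> to \<open>V\<close>; both
      are functions of the coordinates of \<open>V\<close>.\<close>
    define T where "T x \<xi> = \<Psi> (?I x \<xi>)" for x \<xi>
    define C where "C x \<xi> = \<Phi> (?J (?\<tau> x) \<xi>)" for x \<xi>
    have Tlin: "linear (T x)" if "x \<in> U" for x
      using that vb_transition_linear[OF E c d] by (auto simp: U_def T_def[abs_def])
    have Clin: "linear (C x)" if "x \<in> U" for x
      using that vb_transition_linear[OF E d c] by (auto simp: U_def C_def[abs_def] chart_inv[OF A cA])
    have Tsm: "smooth_on U (\<lambda>x. T x \<xi>)" for \<xi>
      unfolding U_def T_def by (rule vb_transition_smooth[OF E c d])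
    have Csm: "smooth_on U (\<lambda>x. C x \<xi>)" for \<xi>
      unfolding C_def by (rule smooth_on_compose[OF o oW \<tau>sm vb_transition_smooth[OF E d c]])
        (auto simp: U_def chart_inv[OF A cA])
    have TC: "T (\<phi> p) (C (\<phi> p) \<xi>) = \<xi>" if p: "p \<in> V" "p \<in> W" for p \<xi>
    proof -
      have "?I (\<phi> p) (\<Phi> (?J (\<psi> p) \<xi>)) = ?J (\<psi> p) \<xi>"
        using vb_inv_fiber[OF E c, of "?J (\<psi> p) \<xi>"] p by (simp add: vb_proj_inv[OF E d])
      then show ?thesis using p by (simp add: T_def C_def chart_inv[OF A cA] vb_fiber_inv[OF E d])
    qed
    \<comment> \<open>The derivative of the matrix \<open>C\<close>; it causes the term of order
      0.\<close>
    define G where "G x \<xi> = frechet_derivative (\<lambda>y. C y \<xi>) (at x) v" for x \<xi>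
    have Gder: "((\<lambda>y. C y \<xi>) has_derivative frechet_derivative (\<lambda>y. C y \<xi>) (at x)) (at x)" if "x \<in> U" for x \<xi>
      by (rule smooth_on_has_derivative[OF Csm that])
    have Gadd: "G x (\<xi> + \<eta>) = G x \<xi> + G x \<eta>" if x: "x \<in> U" for x \<xi> \<eta>
    proof -
      have "((\<lambda>y. C y (\<xi> + \<eta>)) has_derivative
        (\<lambda>w. frechet_derivative (\<lambda>y. C y \<xi>) (at x) w + frechet_derivative (\<lambda>y. C y \<eta>) (at x) w)) (at x)"
        by (rule has_derivative_transform_within_open[OF has_derivative_add[OF Gder[OF x] Gder[OF x]] o x])
          (simp add: linear_add[OF Clin])
      from frechet_derivative_at[OF this] show ?thesis unfolding G_def by (metis)
    qed
    \<comment> \<open>Coefficients of a differential operator must be linear over the bundle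
      scalars, not only over the reals; the scalar is moved through the derivative.\<close>
    have Gscale: "G x (vb_scale E r \<xi>) = vb_scale E r (G x \<xi>)" if x: "x \<in> U" for x r \<xi>
    proof -
      have Ck: "C y (vb_scale E r \<xi>) = vb_scale E r (C y \<xi>)" if "y \<in> U" for y
        using that vb_transition_linear_scale[OF E d c]
        by (auto simp: U_def C_def chart_inv[OF A cA] Vector_Spaces.linear_iff)
      have "((\<lambda>y. C y (vb_scale E r \<xi>)) has_derivative
        (\<lambda>w. vb_scale E r (frechet_derivative (\<lambda>y. C y \<xi>) (at x) w))) (at x)"
        by (rule has_derivative_transform_within_open[OF
              bounded_linear.has_derivative[OF vb_scale_bounded_linear[OF E] Gder[OF x]] o x]) (simp add: Ck)
      from frechet_derivative_at[OF this] show ?thesis unfolding G_def by metis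
    qed
    \<comment> \<open>The empty list carries the matrix \<open>T G\<close> of order 0. A singleton
      \<open>[u]\<close> carries a scalar, the \<open>u\<close>-component of the direction
      \<open>v\<close> transported to \<open>W\<close>; longer lists do not occur in the
      sum.\<close>
    define a where "a vs x \<xi> = (let p = inv_into W \<psi> x in \<beta> p *\<^sub>R
       (case vs of [] \<Rightarrow> T (\<phi> p) (G (\<phi> p) \<xi>)
        | u # _ \<Rightarrow> (frechet_derivative ?\<tau> (at (\<phi> p)) v \<bullet> u) *\<^sub>R \<xi>))" for vs x \<xi>
    have rscale: "t *\<^sub>R vb_scale E r \<xi> = vb_scale E r (t *\<^sub>R \<xi>)" for t r \<xi>
      using linear_scale[OF bounded_linear.linear[OF vb_scale_bounded_linear[OF E]]] by metis
    have alin: "Vector_Spaces.linear (vb_scale E) (vb_scale E) (a vs x)" if xW: "x \<in> \<psi> ` W" for vs x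
    proof -
      obtain p where p: "p \<in> W" "x = \<psi> p" using xW by blast
      have ap: "a vs x \<xi> = \<beta> p *\<^sub>R (case vs of [] \<Rightarrow> T (\<phi> p) (G (\<phi> p) \<xi>)
        | u # _ \<Rightarrow> (frechet_derivative ?\<tau> (at (\<phi> p)) v \<bullet> u) *\<^sub>R \<xi>)" for vs \<xi>
        using p by (simp add: a_def chart_inv[OF A dA])
      have "a vs x (\<xi> + \<eta>) = a vs x \<xi> + a vs x \<eta> \<and> a vs x (vb_scale E r \<xi>) = vb_scale E r (a vs x \<xi>)" for \<xi> \<eta> r
      proof (cases "p \<in> V")
        case False
        then have "\<beta> p = 0" using S by blast
        then show ?thesis by (simp add: ap)
      next
        case True
        note x = U[OF True p(1)]
        have "T (\<phi> p) (vb_scale E r \<xi>) = vb_scale E r (T (\<phi> p) \<xi>)" for r \<xi>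
          using vb_transition_linear_scale[OF E c d True p(1)] by (simp add: T_def Vector_Spaces.linear_iff)
        then show ?thesis
          by (cases vs) (simp_all add: ap Gadd[OF x] Gscale[OF x] linear_add[OF Tlin[OF x]] scaleR_add_right rscale)
      qed
      then show ?thesis using vector_space_axioms by (simp add: Vector_Spaces.linear_iff)
    qed
    have asm: "smooth_on (\<psi> ` W) (\<lambda>x. a vs x \<xi>)" for vs \<xi>
      unfolding a_def Let_def
    proof (rule smooth_on_bump_mult[OF A cA dA \<beta> S])
      have "smooth_on U (\<lambda>x. case vs of [] \<Rightarrow> T x (G x \<xi>) | u # _ \<Rightarrow> (frechet_derivative ?\<tau> (at x) v \<bullet> u) *\<^sub>R \<xi>)"
      proof (cases vs)
        case Nil
        have Gsm: "smooth_on U (\<lambda>x. G x \<xi>)" unfolding G_def by (rule smooth_on_frechet_derivative[OF Csm])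
        show ?thesis unfolding Nil list.case by (rule smooth_on_linear_apply[OF o Tlin Tsm Gsm])
      next
        case (Cons u us)
        then show ?thesis
          by (auto intro!: smooth_on_scaleR smooth_on_inner smooth_on_const o smooth_on_frechet_derivative[OF \<tau>sm])
      qed
      then show "smooth_on (\<phi> ` (V \<inter> W)) (\<lambda>x. case vs of [] \<Rightarrow> T (\<phi> (inv_into V \<phi> x)) (G (\<phi> (inv_into V \<phi> x)) \<xi>)
         | u # _ \<Rightarrow> (frechet_derivative ?\<tau> (at (\<phi> (inv_into V \<phi> x))) v \<bullet> u) *\<^sub>R \<xi>)"
        unfolding U_def[symmetric]
        by (rule smooth_on_cong[OF o, rotated]) (auto simp: U_def chart_inv[OF A cA] split: list.split)
    qed
    have rep: "sec_rep (W, \<psi>, \<Psi>) (P s) x =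
        (\<Sum>vs\<in>insert [] ((\<lambda>u. [u]) ` fd_basis). a vs x (iter_deriv (sec_rep (W, \<psi>, \<Psi>) s) vs x))"
      if s: "s \<in> sections E" and xW: "x \<in> \<psi> ` W" for s x
    proof -
      obtain p where p: "p \<in> W" "x = \<psi> p" using xW by blast
      let ?s = "sec_rep (W, \<psi>, \<Psi>) s"
      have inj: "inj_on (\<lambda>u. [u]) (fd_basis :: 'a set)" by (auto simp: inj_on_def)
      have L: "sec_rep (W, \<psi>, \<Psi>) (P s) x = \<beta> p *\<^sub>R T (\<phi> p) (D s (\<phi> p))"
        using p by (simp add: sec_rep_apply chart_inv[OF A dA] Prep[OF d] T_def)
      have R: "(\<Sum>vs\<in>insert [] ((\<lambda>u. [u]) ` fd_basis). a vs x (iter_deriv ?s vs x)) =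
        \<beta> p *\<^sub>R (T (\<phi> p) (G (\<phi> p) (?s (\<psi> p))) +
          (\<Sum>u\<in>fd_basis. (frechet_derivative ?\<tau> (at (\<phi> p)) v \<bullet> u) *\<^sub>R frechet_derivative ?s (at (\<psi> p)) u))"
        using p by (subst sum.insert)
          (auto simp: sum.reindex[OF inj] a_def chart_inv[OF A dA] scaleR_add_right scaleR_sum_right)
      show ?thesis
      proof (cases "p \<in> V")
        case False
        then have "\<beta> p = 0" using S by blast
        then show ?thesis unfolding L R by simp
      next
        case True
        note x = U[OF True p(1)]
        let ?\<tau>' = "frechet_derivative ?\<tau> (at (\<phi> p))" and ?s' = "frechet_derivative ?s (at (\<psi> p))"
        have s': "(?s has_derivative ?s') (at (?\<tau> (\<phi> p)))"
          unfolding \<tau>[OF True] by (rule smooth_on_has_derivative[OF section_smooth[OF s d]]) (use p in auto)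
        have "((\<lambda>y. ?s (?\<tau> y)) has_derivative (\<lambda>w. ?s' (?\<tau>' w))) (at (\<phi> p))"
          using diff_chain_at[OF smooth_on_has_derivative[OF \<tau>sm x] s'] by (simp add: o_def)
        from has_derivative_linear_apply[OF o x Clin Csm this]
        have "((\<lambda>y. C y (?s (?\<tau> y))) has_derivative
          (\<lambda>w. C (\<phi> p) (?s' (?\<tau>' w)) + frechet_derivative (\<lambda>y. C y (?s (?\<tau> (\<phi> p)))) (at (\<phi> p)) w)) (at (\<phi> p))" .
        then have "(sec_rep (V, \<phi>, \<Phi>) s has_derivative
          (\<lambda>w. C (\<phi> p) (?s' (?\<tau>' w)) + frechet_derivative (\<lambda>y. C y (?s (?\<tau> (\<phi> p)))) (at (\<phi> p)) w)) (at (\<phi> p))"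
        proof (rule has_derivative_transform_within_open[OF _ o x])
          fix y assume "y \<in> U"
          then obtain q where q: "q \<in> V" "q \<in> W" "y = \<phi> q" by (auto simp: U_def)
          have "?J (\<psi> q) (\<Psi> (s q)) = s q"
            using vb_inv_fiber[OF E d, of "s q"] q by (simp add: section_proj[OF s])
          then show "C y (?s (?\<tau> y)) = sec_rep (V, \<phi>, \<Phi>) s y"
            using q by (simp add: C_def sec_rep_apply chart_inv[OF A cA] chart_inv[OF A dA])
        qed
        from fun_cong[OF frechet_derivative_at[OF this], of v]
        have "D s (\<phi> p) = C (\<phi> p) (?s' (?\<tau>' v)) + G (\<phi> p) (?s (\<psi> p))"
          using \<tau>[OF True] by (simp add: D_def G_def)
        \<comment> \<open>\<open>T\<close> cancels \<open>C\<close> in the first-order part, which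
          explains why its coefficients are scalars.\<close>
        then have "T (\<phi> p) (D s (\<phi> p)) = ?s' (?\<tau>' v) + T (\<phi> p) (G (\<phi> p) (?s (\<psi> p)))"
          by (simp add: linear_add[OF Tlin[OF x]] TC[OF True p(1)])
        then show ?thesis
          unfolding L R using linear_fd_expand[OF has_derivative_linear[OF s'], of "?\<tau>' v"] by simp
      qed
    qed
    show ?thesis
      by (rule exI[of _ "insert [] ((\<lambda>u. [u]) ` fd_basis)"], rule exI[of _ a])
        (use alin asm rep in auto)
  qed
  ultimately have "P \<in> diff_ops E"
    unfolding diff_ops_def mem_Collect_eq
    by (intro conjI ballI exI[of _ 1]) (auto simp only: split_paired_all prod.case)
  moreover have "\<Phi> (P s p) = \<beta> p *\<^sub>R frechet_derivative (sec_rep (V, \<phi>, \<Phi>) s) (at (\<phi> p)) v" if "p \<in> V" for s p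
    unfolding Prep[OF c that] vb_fiber_inv[OF E c that] D_def ..
  ultimately show thesis using that by blast
qed

section \<open>Point values of generalized sections\<close>

lemma SUP_ennreal_le:
  assumes "(SUP p\<in>K. ennreal (f p)) \<le> ennreal c" "c \<ge> 0" "p \<in> K" shows "f p \<le> c"
proof -
  have "ennreal (f p) \<le> (SUP p\<in>K. ennreal (f p))" by (rule SUP_upper[OF assms(3)])
  also note assms(1)
  finally show ?thesis using assms(2) by (simp add: ennreal_le_iff)
qed

lemma Gamma_EM_sections: "s \<in> Gamma_EM E \<Longrightarrow> \<epsilon> \<in> params \<Longrightarrow> s \<epsilon> \<in> sections E"
  unfolding Gamma_EM_def by blast

text \<open>One fiber metric serves all operators and compact sets; the suprema are unpacked into
  pointwise bounds with uniform constants.\<close>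

lemma Gamma_EM_bound:
  assumes "s \<in> Gamma_EM E"
  obtains h where "fiber_metric E h" "\<And>P K. P \<in> diff_ops E \<Longrightarrow> compact K \<Longrightarrow>
    \<exists>N::nat. \<exists>C>0. \<forall>\<^sub>F \<epsilon> in at_right 0. \<forall>p\<in>K. fiber_norm h (P (s \<epsilon>) p) \<le> C * \<epsilon> powr - real N"
proof -
  obtain h where h: "fiber_metric E h" "\<forall>P\<in>diff_ops E. \<forall>K. compact K \<longrightarrow>
      (\<exists>N::nat. big_O (- real N) (\<lambda>\<epsilon>. SUP p\<in>K. ennreal (fiber_norm h (P (s \<epsilon>) p))))"
    using assms unfolding Gamma_EM_def mem_Collect_eq by (elim conjE exE) (rule that)
  show thesis
  proof (rule that[OF h(1)])
    fix P and K :: "'a set" assume P: "P \<in> diff_ops E" "compact K"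
    obtain N :: nat where "big_O (- real N) (\<lambda>\<epsilon>. SUP p\<in>K. ennreal (fiber_norm h (P (s \<epsilon>) p)))"
      using bspec[OF h(2) P(1)] P(2) by blast
    then obtain C where C: "C > 0"
      "\<forall>\<^sub>F \<epsilon> in at_right 0. (SUP p\<in>K. ennreal (fiber_norm h (P (s \<epsilon>) p))) \<le> ennreal (C * \<epsilon> powr - real N)"
      unfolding big_O_iff by blast
    have "\<forall>\<^sub>F \<epsilon> in at_right 0. \<forall>p\<in>K. fiber_norm h (P (s \<epsilon>) p) \<le> C * \<epsilon> powr - real N"
      using C(2) by eventually_elim (use C(1) in \<open>auto intro: SUP_ennreal_le\<close>)
    with C(1) show "\<exists>N::nat. \<exists>C>0. \<forall>\<^sub>F \<epsilon> in at_right 0. \<forall>p\<in>K. fiber_norm h (P (s \<epsilon>) p) \<le> C * \<epsilon> powr - real N"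
      by blast
  qed
qed

text \<open>The uniform bound for the identity operator, on a compact set that eventually contains
  \<open>p\<close>.\<close>

lemma section_value_moderate:
  assumes E: "vector_bundle E" and s: "s \<in> Gamma_EM E" and p: "p \<in> cpt_supp_nets"
  shows "(\<lambda>\<epsilon>\<in>params. s \<epsilon> (p \<epsilon>)) \<in> vb_moderate E"
proof -
  obtain K where K: "compact K" "\<forall>\<^sub>F \<epsilon> in at_right 0. p \<epsilon> \<in> K" by (rule cpt_supp_netsD[OF p])
  obtain h where h: "fiber_metric E h" "\<And>P K. P \<in> diff_ops E \<Longrightarrow> compact K \<Longrightarrow>
    \<exists>N::nat. \<exists>C>0. \<forall>\<^sub>F \<epsilon> in at_right 0. \<forall>p\<in>K. fiber_norm h (P (s \<epsilon>) p) \<le> C * \<epsilon> powr - real N"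
    by (rule Gamma_EM_bound[OF s]) (rule that; assumption)
  obtain N :: nat and C where C: "C > 0" "\<forall>\<^sub>F \<epsilon> in at_right 0. \<forall>p\<in>K. fiber_norm h (s \<epsilon> p) \<le> C * \<epsilon> powr - real N"
    using h(2)[OF diff_ops_id[OF E] K(1)] by blast
  have "\<forall>\<^sub>F \<epsilon> in at_right 0. fiber_norm h (s \<epsilon> (p \<epsilon>)) \<le> C * \<epsilon> powr - real N"
    using C(2) K(2) by eventually_elim simp
  then have m: "moder_on (\<lambda>_. True) (\<lambda>\<epsilon>. fiber_norm h (s \<epsilon> (p \<epsilon>)))"
    using C(1) unfolding moder_on_def by (intro exI[of _ N] exI[of _ C]) simp
  have "\<forall>\<^sub>F \<epsilon> in at_right 0. vb_proj E (s \<epsilon> (p \<epsilon>)) \<in> K"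
    using K(2) eventually_params by eventually_elim (simp add: section_proj[OF Gamma_EM_sections[OF s]])
  then show ?thesis by (rule vb_moderate_restrictI[OF K(1) _ h(1) m])
qed

lemma section_value_proj:
  assumes "s \<in> Gamma_EM E" "p \<in> cpt_supp_nets"
  shows "(\<lambda>\<epsilon>\<in>params. vb_proj E (s \<epsilon> (p \<epsilon>))) = p"
proof -
  have "p \<in> extensional params" using assms(2) by (auto simp: cpt_supp_nets_def PiE_def)
  then have "(\<lambda>\<epsilon>\<in>params. p \<epsilon>) = p" by (rule extensional_restrict)
  moreover have "(\<lambda>\<epsilon>\<in>params. vb_proj E (s \<epsilon> (p \<epsilon>))) = (\<lambda>\<epsilon>\<in>params. p \<epsilon>)"
    by (rule restrict_ext) (rule section_proj[OF Gamma_EM_sections[OF assms(1)]])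
  ultimately show ?thesis by simp
qed

text \<open>The bump function is positive on \<open>L\<close>, so dividing by its minimum there
  turns the bound for the operator into one for the plain directional derivative.\<close>

lemma Gamma_EM_derivative_bound:
  fixes E :: "('x::t2_space, 'a::finite_dim_inner, 'e::t2_space, 'v::finite_dim_inner,
                'k::{real_normed_field, euclidean_space}) vbundle"
  assumes E: "vector_bundle E" and s: "s \<in> Gamma_EM E" and d: "(V, \<phi>, \<Phi>) \<in> vb_charts E"
    and L: "compact L" "L \<subseteq> V"
  shows "\<exists>N::nat. \<exists>C>0. \<forall>\<^sub>F \<epsilon> in at_right 0. \<forall>p\<in>L.
    norm (frechet_derivative (sec_rep (V, \<phi>, \<Phi>) (s \<epsilon>)) (at (\<phi> p)) v) \<le> C * \<epsilon> powr - real N"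
proof (cases "L = {}")
  case True
  then show ?thesis by (auto intro: exI[of _ "1::real"])
next
  case False
  note A = vector_bundle_manifold[OF E] and dA = vb_chart_base[OF E d]
  obtain \<beta> :: "'x \<Rightarrow> real" and S where \<beta>: "smooth_fun (vb_base E) \<beta>" "\<And>q. q \<in> L \<Longrightarrow> \<beta> q > 0"
    and S: "compact S" "S \<subseteq> V" "\<And>q. q \<notin> S \<Longrightarrow> \<beta> q = 0"
    by (rule manifold_bump_compact[OF A L chart_open[OF A dA]]) (rule that; assumption)
  \<comment> \<open>The minimum of the bump function over \<open>L\<close>; it is positive and
    enters the constant. The empty \<open>L\<close> was set aside because it has no minimum.\<close>
  obtain q where q: "q \<in> L" "\<And>p. p \<in> L \<Longrightarrow> \<beta> q \<le> \<beta> p"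
    using continuous_attains_inf[OF L(1) False continuous_on_subset[OF smooth_fun_continuous[OF A \<beta>(1)]]] by auto
  obtain P where P: "P \<in> diff_ops E" "\<And>s p. s \<in> sections E \<Longrightarrow> p \<in> V \<Longrightarrow>
    \<Phi> (P s p) = \<beta> p *\<^sub>R frechet_derivative (sec_rep (V, \<phi>, \<Phi>) s) (at (\<phi> p)) v"
    by (rule diff_ops_bump_derivative[OF E d \<beta>(1) compact_imp_closed[OF S(1)] S(2,3)]) (assumption | rule that; assumption)+
  obtain h where h: "fiber_metric E h" "\<And>P K. P \<in> diff_ops E \<Longrightarrow> compact K \<Longrightarrow>
    \<exists>N::nat. \<exists>C>0. \<forall>\<^sub>F \<epsilon> in at_right 0. \<forall>p\<in>K. fiber_norm h (P (s \<epsilon>) p) \<le> C * \<epsilon> powr - real N"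
    by (rule Gamma_EM_bound[OF s]) (rule that; assumption)
  obtain c where c: "c > 0" "\<And>z. vb_proj E z \<in> L \<Longrightarrow> c * norm (\<Phi> z) \<le> fiber_norm h z"
    by (rule fiber_norm_bounds[OF E h(1) d L]) (rule that; assumption)
  obtain N :: nat and C where C: "C > 0" "\<forall>\<^sub>F \<epsilon> in at_right 0. \<forall>p\<in>L. fiber_norm h (P (s \<epsilon>) p) \<le> C * \<epsilon> powr - real N"
    using h(2)[OF P(1) L(1)] by blast
  have pos: "c * \<beta> q > 0" using c(1) \<beta>(2)[OF q(1)] by simp
  from C(2) eventually_params have "\<forall>\<^sub>F \<epsilon> in at_right 0. \<forall>p\<in>L.
    norm (frechet_derivative (sec_rep (V, \<phi>, \<Phi>) (s \<epsilon>)) (at (\<phi> p)) v) \<le> (C / (c * \<beta> q)) * \<epsilon> powr - real N"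
  proof eventually_elim
    case (elim \<epsilon>)
    show ?case
    proof
      fix p assume p: "p \<in> L"
      have se: "s \<epsilon> \<in> sections E" by (rule Gamma_EM_sections[OF s elim(2)])
      have Ps: "P (s \<epsilon>) \<in> sections E" using P(1) se unfolding diff_ops_def by blast
      let ?n = "norm (frechet_derivative (sec_rep (V, \<phi>, \<Phi>) (s \<epsilon>)) (at (\<phi> p)) v)"
      have "(c * \<beta> q) * ?n \<le> (c * \<beta> p) * ?n"
        using q(2)[OF p] c(1) by (intro mult_right_mono mult_left_mono) auto
      also have "\<dots> = c * norm (\<Phi> (P (s \<epsilon>) p))"
        using P(2)[OF se, of p] p L(2) \<beta>(2)[OF p] by auto
      also have "\<dots> \<le> fiber_norm h (P (s \<epsilon>) p)" by (rule c(2)) (simp add: section_proj[OF Ps] p)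
      also have "\<dots> \<le> C * \<epsilon> powr - real N" using elim p by blast
      finally show "?n \<le> (C / (c * \<beta> q)) * \<epsilon> powr - real N" using pos by (simp add: field_simps)
    qed
  qed
  then show ?thesis using C(1) pos by (intro exI[of _ N] exI[of _ "C / (c * \<beta> q)"] conjI) (auto simp only: divide_pos_pos)
qed

text \<open>Mean value theorem on a coordinate ball around \<open>p\<close> that contains
  \<open>q\<close>: a moderate derivative times a negligible displacement.\<close>

lemma section_value_point_equiv:
  assumes E: "vector_bundle E" and s: "s \<in> Gamma_EM E" and pq: "(p, q) \<in> point_equiv (vb_base E)"
  shows "((\<lambda>\<epsilon>\<in>params. s \<epsilon> (p \<epsilon>)), (\<lambda>\<epsilon>\<in>params. s \<epsilon> (q \<epsilon>))) \<in> vb_equiv E"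
proof -
  note A = vector_bundle_manifold[OF E]
  have pn: "p \<in> cpt_supp_nets" "q \<in> cpt_supp_nets" using pq by (auto simp: point_equiv_def)
  show ?thesis
  proof (rule vb_equiv_restrictI)
    show "(\<lambda>\<epsilon>\<in>params. s \<epsilon> (p \<epsilon>)) \<in> vb_moderate E" "(\<lambda>\<epsilon>\<in>params. s \<epsilon> (q \<epsilon>)) \<in> vb_moderate E"
      by (rule section_value_moderate[OF E s pn(1)], rule section_value_moderate[OF E s pn(2)])
    show "((\<lambda>\<epsilon>\<in>params. vb_proj E (s \<epsilon> (p \<epsilon>))),
      (\<lambda>\<epsilon>\<in>params. vb_proj E (s \<epsilon> (q \<epsilon>)))) \<in> point_equiv (vb_base E)"
      unfolding section_value_proj[OF s pn(1)] section_value_proj[OF s pn(2)] by (rule pq)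
    fix W \<psi> \<Psi> L assume d: "(W, \<psi>, \<Psi>) \<in> vb_charts E" and L: "compact L" "L \<subseteq> W"
    note dA = vb_chart_base[OF E d]
    obtain \<rho> M where M: "\<rho> > 0" "compact M" "M \<subseteq> W" "\<And>p. p \<in> L \<Longrightarrow> cball (\<psi> p) \<rho> \<subseteq> \<psi> ` M"
      by (rule chart_thickening[OF A dA L]) (rule that; assumption)
    let ?D = "\<lambda>\<epsilon>. frechet_derivative (sec_rep (W, \<psi>, \<Psi>) (s \<epsilon>))"
    have "\<forall>u. \<exists>N C. C > 0 \<and> (\<forall>\<^sub>F \<epsilon> in at_right 0. \<forall>p\<in>M. norm (?D \<epsilon> (at (\<psi> p)) u) \<le> C * \<epsilon> powr - real N)"
      using Gamma_EM_derivative_bound[OF E s d M(2,3)] by (intro allI)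
    from choice[OF this] obtain N where
      "\<forall>u. \<exists>C. C > 0 \<and> (\<forall>\<^sub>F \<epsilon> in at_right 0. \<forall>p\<in>M. norm (?D \<epsilon> (at (\<psi> p)) u) \<le> C * \<epsilon> powr - real (N u))" ..
    from choice[OF this] obtain C where C': "\<forall>u. C u > 0 \<and>
      (\<forall>\<^sub>F \<epsilon> in at_right 0. \<forall>p\<in>M. norm (?D \<epsilon> (at (\<psi> p)) u) \<le> C u * \<epsilon> powr - real (N u))" ..
    have C: "C u > 0"
      "\<forall>\<^sub>F \<epsilon> in at_right 0. \<forall>p\<in>M. norm (?D \<epsilon> (at (\<psi> p)) u) \<le> C u * \<epsilon> powr - real (N u)" for u
      by (rule C'[rule_format, THEN conjunct1], rule C'[rule_format, THEN conjunct2])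
    \<comment> \<open>Exponent and constant depend on the direction; summing over the finite basis
      bounds the operator norm of the derivative.\<close>
    define B where "B \<epsilon> = (\<Sum>u\<in>fd_basis. C u * \<epsilon> powr - real (N u))" for \<epsilon>
    have "moder_on (\<lambda>\<epsilon>. p \<epsilon> \<in> L) B"
      unfolding B_def[abs_def] by (intro moder_on_sum finite_fd_basis moder_on_powr C(1))
    then have n: "negl_on (\<lambda>\<epsilon>. p \<epsilon> \<in> L) (\<lambda>\<epsilon>. B \<epsilon> * norm (\<psi> (p \<epsilon>) - \<psi> (q \<epsilon>)))"
      by (rule negl_on_mult[OF _ point_equiv_chart(1)[OF A pq dA L]]) simp
    have all: "\<forall>\<^sub>F \<epsilon> in at_right 0. \<forall>u\<in>fd_basis. \<forall>p\<in>M. norm (?D \<epsilon> (at (\<psi> p)) u) \<le> C u * \<epsilon> powr - real (N u)"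
      by (intro eventually_ball_finite ballI C(2) finite_fd_basis)
    show "negl_on (\<lambda>\<epsilon>. vb_proj E (s \<epsilon> (p \<epsilon>)) \<in> L \<and> vb_proj E (s \<epsilon> (q \<epsilon>)) \<in> L)
      (\<lambda>\<epsilon>. norm (\<Psi> (s \<epsilon> (p \<epsilon>)) - \<Psi> (s \<epsilon> (q \<epsilon>))))"
    proof (rule negl_on_mono[OF n])
      note near = negl_on_small[OF point_equiv_chart(1)[OF A pq dA L] M(1)]
      show "\<forall>\<^sub>F \<epsilon> in at_right 0. vb_proj E (s \<epsilon> (p \<epsilon>)) \<in> L \<and> vb_proj E (s \<epsilon> (q \<epsilon>)) \<in> L
        \<longrightarrow> p \<epsilon> \<in> L \<and> norm (\<Psi> (s \<epsilon> (p \<epsilon>)) - \<Psi> (s \<epsilon> (q \<epsilon>)))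
          \<le> B \<epsilon> * norm (\<psi> (p \<epsilon>) - \<psi> (q \<epsilon>))"
        using near all eventually_params
      proof eventually_elim
        case (elim \<epsilon>)
        have se: "s \<epsilon> \<in> sections E" by (rule Gamma_EM_sections[OF s elim(3)])
        have "norm (\<Psi> (s \<epsilon> (p \<epsilon>)) - \<Psi> (s \<epsilon> (q \<epsilon>))) \<le> B \<epsilon> * norm (\<psi> (p \<epsilon>) - \<psi> (q \<epsilon>))"
          if pL: "p \<epsilon> \<in> L" and qL: "q \<epsilon> \<in> L"
        proof -
          let ?f = "sec_rep (W, \<psi>, \<Psi>) (s \<epsilon>)"
          have der: "(?f has_derivative ?D \<epsilon> (at x)) (at x)" if "x \<in> \<psi> ` W" for x
            by (rule smooth_on_has_derivative[OF section_smooth[OF se d] that])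
          have "norm (?f (\<psi> (p \<epsilon>)) - ?f (\<psi> (q \<epsilon>))) \<le> B \<epsilon> * norm (\<psi> (p \<epsilon>) - \<psi> (q \<epsilon>))"
          proof (rule mean_value_cball)
            fix x assume "x \<in> cball (\<psi> (p \<epsilon>)) \<rho>"
            then obtain r where r: "r \<in> M" "x = \<psi> r" using M(4)[OF pL] by blast
            then have x: "x \<in> \<psi> ` W" using M(3) by blast
            show "?f differentiable at x" by (rule differentiableI[OF der[OF x]])
            fix v
            have "norm (?D \<epsilon> (at x) v) \<le> (\<Sum>u\<in>fd_basis. norm (?D \<epsilon> (at x) u)) * norm v"
              by (rule norm_linear_fd_le[OF has_derivative_linear[OF der[OF x]]])
            also have "\<dots> \<le> B \<epsilon> * norm v"
              unfolding B_def using elim(2) r by (intro mult_right_mono sum_mono) auto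
            finally show "norm (?D \<epsilon> (at x) v) \<le> B \<epsilon> * norm v" .
          next
            show "\<psi> (q \<epsilon>) \<in> cball (\<psi> (p \<epsilon>)) \<rho>" using elim(1) pL by (simp add: dist_norm)
          qed
          moreover have "p \<epsilon> \<in> W" "q \<epsilon> \<in> W" using pL qL L(2) by blast+
          ultimately show ?thesis by (simp add: sec_rep_apply chart_inv[OF A dA])
        qed
        then show ?case using elim(3) by (simp add: section_proj[OF se])
      qed
    qed
  qed
qed

text \<open>Both values lie over the same base point, so the difference of their coordinates is the
  coordinate of \<open>sec_diff\<close>, which is negligible uniformly on \<open>L\<close>.\<close>

lemma section_value_Gamma_equiv:
  assumes E: "vector_bundle E" and st: "(s, t) \<in> Gamma_equiv E" and pp: "(p, p) \<in> point_equiv (vb_base E)"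
  shows "((\<lambda>\<epsilon>\<in>params. s \<epsilon> (p \<epsilon>)), (\<lambda>\<epsilon>\<in>params. t \<epsilon> (p \<epsilon>))) \<in> vb_equiv E"
proof -
  have s: "s \<in> Gamma_EM E" and t: "t \<in> Gamma_EM E"
    and dN: "(\<lambda>\<epsilon>\<in>params. sec_diff E (s \<epsilon>) (t \<epsilon>)) \<in> Gamma_N E"
    using st by (auto simp: Gamma_equiv_def)
  have pn: "p \<in> cpt_supp_nets" using pp by (auto simp: point_equiv_def)
  obtain h where h: "fiber_metric E h" "\<forall>K. \<forall>m::nat. compact K \<and> m \<ge> 1 \<longrightarrow>
      big_O (real m) (\<lambda>\<epsilon>. SUP p\<in>K. ennreal (fiber_norm h ((\<lambda>\<epsilon>\<in>params. sec_diff E (s \<epsilon>) (t \<epsilon>)) \<epsilon> p)))"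
    using dN unfolding Gamma_N_def mem_Collect_eq by (elim conjE exE) (rule that)
  show ?thesis
  proof (rule vb_equiv_restrictI)
    show "(\<lambda>\<epsilon>\<in>params. s \<epsilon> (p \<epsilon>)) \<in> vb_moderate E" "(\<lambda>\<epsilon>\<in>params. t \<epsilon> (p \<epsilon>)) \<in> vb_moderate E"
      by (rule section_value_moderate[OF E s pn], rule section_value_moderate[OF E t pn])
    show "((\<lambda>\<epsilon>\<in>params. vb_proj E (s \<epsilon> (p \<epsilon>))),
      (\<lambda>\<epsilon>\<in>params. vb_proj E (t \<epsilon> (p \<epsilon>)))) \<in> point_equiv (vb_base E)"
      unfolding section_value_proj[OF s pn] section_value_proj[OF t pn] by (rule pp)
    fix W \<psi> \<Psi> L assume d: "(W, \<psi>, \<Psi>) \<in> vb_charts E" and L: "compact L" "L \<subseteq> W"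
    obtain c where c: "c > 0" "\<And>z. vb_proj E z \<in> L \<Longrightarrow> c * norm (\<Psi> z) \<le> fiber_norm h z"
      by (rule fiber_norm_bounds[OF E h(1) d L]) (rule that; assumption)
    show "negl_on (\<lambda>\<epsilon>. vb_proj E (s \<epsilon> (p \<epsilon>)) \<in> L \<and> vb_proj E (t \<epsilon> (p \<epsilon>)) \<in> L)
      (\<lambda>\<epsilon>. norm (\<Psi> (s \<epsilon> (p \<epsilon>)) - \<Psi> (t \<epsilon> (p \<epsilon>))))"
      unfolding negl_on_def
    proof (intro allI impI)
      fix m :: nat assume "m \<ge> 1"
      then obtain C where C: "C > 0" "\<forall>\<^sub>F \<epsilon> in at_right 0.
        (SUP p\<in>L. ennreal (fiber_norm h ((\<lambda>\<epsilon>\<in>params. sec_diff E (s \<epsilon>) (t \<epsilon>)) \<epsilon> p))) \<le> ennreal (C * \<epsilon> powr real m)"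
        using h(2)[rule_format, of L m] L(1) unfolding big_O_iff by blast
      from C(2) eventually_params
      have "\<forall>\<^sub>F \<epsilon> in at_right 0. vb_proj E (s \<epsilon> (p \<epsilon>)) \<in> L \<and> vb_proj E (t \<epsilon> (p \<epsilon>)) \<in> L \<longrightarrow>
        norm (\<Psi> (s \<epsilon> (p \<epsilon>)) - \<Psi> (t \<epsilon> (p \<epsilon>))) \<le> (C / c) * \<epsilon> powr real m"
      proof eventually_elim
        case (elim \<epsilon>)
        note se = Gamma_EM_sections[OF s elim(2)] and te = Gamma_EM_sections[OF t elim(2)]
        have "norm (\<Psi> (s \<epsilon> (p \<epsilon>)) - \<Psi> (t \<epsilon> (p \<epsilon>))) \<le> (C / c) * \<epsilon> powr real m" if pL: "p \<epsilon> \<in> L"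
        proof -
          let ?z = "sec_diff E (s \<epsilon>) (t \<epsilon>) (p \<epsilon>)"
          have "c * norm (\<Psi> ?z) \<le> fiber_norm h ?z" by (rule c(2)) (simp add: sec_diff_chart(1)[OF E se te] pL)
          also have "fiber_norm h ?z \<le> C * \<epsilon> powr real m"
            by (rule SUP_ennreal_le[OF _ _ pL]) (use elim C(1) in simp_all)
          finally have "norm (\<Psi> ?z) \<le> (C / c) * \<epsilon> powr real m" using c(1) by (simp add: field_simps)
          moreover have "p \<epsilon> \<in> W" using pL L(2) by blast
          ultimately show ?thesis using sec_diff_chart(2)[OF E se te d] by simp
        qed
        then show ?case using elim(2) by (simp add: section_proj[OF se] section_proj[OF te])
      qed
      then show "\<exists>C>0. \<forall>\<^sub>F \<epsilon> in at_right 0. vb_proj E (s \<epsilon> (p \<epsilon>)) \<in> L \<and> vb_proj E (t \<epsilon> (p \<epsilon>)) \<in> L \<longrightarrow>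
        norm (\<Psi> (s \<epsilon> (p \<epsilon>)) - \<Psi> (t \<epsilon> (p \<epsilon>))) \<le> C * \<epsilon> powr real m"
        using C(1) c(1) by (intro exI[of _ "C / c"]) simp
    qed
  qed
qed

lemma section_value_class:
  assumes E: "vector_bundle E" and s: "(s, t) \<in> Gamma_equiv E" and p: "(p, q) \<in> point_equiv (vb_base E)"
  shows "vb_class E (\<lambda>\<epsilon>\<in>params. t \<epsilon> (q \<epsilon>)) = vb_class E (\<lambda>\<epsilon>\<in>params. s \<epsilon> (p \<epsilon>))"
proof -
  have "s \<in> Gamma_EM E" using s by (simp add: Gamma_equiv_def)
  \<comment> \<open>The point changes under \<open>s\<close>, afterwards the section changes at
    \<open>q\<close>. Reflexivity at \<open>q\<close> comes from the Euclidean property applied to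
    the given pair twice.\<close>
  from vb_class_eq[OF E section_value_point_equiv[OF E this p]]
    vb_class_eq[OF E section_value_Gamma_equiv[OF E s point_equiv_euclidean[OF vector_bundle_manifold[OF E] p p]]]
  show ?thesis by simp
qed

section \<open>Local estimates for nets of homomorphisms\<close>

lemma deriv_norm_0: "deriv_norm 0 f x = ennreal (norm (f x))"
proof -
  have "{vs. length vs = 0 \<and> (\<forall>v\<in>set vs. norm v \<le> 1)} = {[]}" by auto
  then show ?thesis by (simp add: deriv_norm_def)
qed

text \<open>The supremum runs over directions of norm at most 1; any \<open>w\<close> is
  \<open>norm w\<close> times \<open>sgn w\<close>, and for \<open>w = 0\<close> both sides
  vanish.\<close>

lemma deriv_norm_1:
  assumes "f differentiable at x" "deriv_norm 1 f x \<le> ennreal c" "c \<ge> 0"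
  shows "norm (frechet_derivative f (at x) w) \<le> c * norm w"
proof -
  have lin: "linear (frechet_derivative f (at x))" by (rule linear_frechet_derivative[OF assms(1)])
  have "ennreal (norm (iter_deriv f [sgn w] x)) \<le> deriv_norm 1 f x"
    unfolding deriv_norm_def by (rule SUP_upper) (simp add: norm_sgn)
  from order_trans[OF this assms(2)] have "norm (frechet_derivative f (at x) (sgn w)) \<le> c"
    using assms(3) by (simp add: ennreal_le_iff)
  then have "norm w * norm (frechet_derivative f (at x) (sgn w)) \<le> norm w * c" by (rule mult_left_mono) simp
  moreover have "frechet_derivative f (at x) w = norm w *\<^sub>R frechet_derivative f (at x) (sgn w)"
    unfolding linear_scale[OF lin, symmetric] by (cases "w = 0") (simp_all add: sgn_div_norm)
  ultimately show ?thesis by (simp add: mult.commute)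
qed

lemma hom_deriv_norm_0:
  assumes "linear (T x)" "hom_deriv_norm 0 T x \<le> ennreal c" "c \<ge> 0"
  shows "norm (T x \<xi>) \<le> c * norm \<xi>"
proof -
  have "ennreal (norm (T x (sgn \<xi>))) \<le> hom_deriv_norm 0 T x"
    unfolding hom_deriv_norm_def deriv_norm_0 by (rule SUP_upper) (simp add: norm_sgn)
  from order_trans[OF this assms(2)] have "norm (T x (sgn \<xi>)) \<le> c" using assms(3) by (simp add: ennreal_le_iff)
  then have "norm \<xi> * norm (T x (sgn \<xi>)) \<le> norm \<xi> * c" by (rule mult_left_mono) simp
  moreover have "T x \<xi> = norm \<xi> *\<^sub>R T x (sgn \<xi>)"
    unfolding linear_scale[OF assms(1), symmetric] by (cases "\<xi> = 0") (simp_all add: sgn_div_norm)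
  ultimately show ?thesis by (simp add: mult.commute)
qed

text \<open>The fiber vector is normalized as well. Rescaling it must commute with differentiation
  in the base point, hence linearity is assumed on a neighborhood and not only at
  \<open>x\<close>.\<close>

lemma hom_deriv_norm_1:
  assumes U: "open U" "x \<in> U" and lin: "\<And>y. y \<in> U \<Longrightarrow> linear (T y)"
    and der: "\<And>\<xi>. (\<lambda>y. T y \<xi>) differentiable at x" and c: "hom_deriv_norm 1 T x \<le> ennreal c" "c \<ge> 0"
  shows "norm (frechet_derivative (\<lambda>y. T y \<xi>) (at x) w) \<le> c * norm \<xi> * norm w"
proof -
  have "deriv_norm 1 (\<lambda>y. T y (sgn \<xi>)) x \<le> hom_deriv_norm 1 T x"
    unfolding hom_deriv_norm_def by (rule SUP_upper) (simp add: norm_sgn)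
  from deriv_norm_1[OF der order_trans[OF this c(1)] c(2)]
  have 1: "norm (frechet_derivative (\<lambda>y. T y (sgn \<xi>)) (at x) w) \<le> c * norm w" .
  have "((\<lambda>y. norm \<xi> *\<^sub>R T y (sgn \<xi>)) has_derivative
      (\<lambda>w. norm \<xi> *\<^sub>R frechet_derivative (\<lambda>y. T y (sgn \<xi>)) (at x) w)) (at x)"
    by (rule has_derivative_scaleR_right[OF frechet_derivative_works[THEN iffD1, OF der]])
  then have "((\<lambda>y. T y \<xi>) has_derivative
      (\<lambda>w. norm \<xi> *\<^sub>R frechet_derivative (\<lambda>y. T y (sgn \<xi>)) (at x) w)) (at x)"
  proof (rule has_derivative_transform_within_open[OF _ U])
    fix y assume y: "y \<in> U"
    show "norm \<xi> *\<^sub>R T y (sgn \<xi>) = T y \<xi>"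
      unfolding linear_scale[OF lin[OF y], symmetric] by (cases "\<xi> = 0") (simp_all add: sgn_div_norm)
  qed
  note eq = fun_cong[OF frechet_derivative_at[OF this], of w]
  have "norm (frechet_derivative (\<lambda>y. T y \<xi>) (at x) w) = norm \<xi> * norm (frechet_derivative (\<lambda>y. T y (sgn \<xi>)) (at x) w)"
    unfolding eq[symmetric] by simp
  also have "\<dots> \<le> norm \<xi> * (c * norm w)" using 1 by (rule mult_left_mono) simp
  finally show ?thesis by (simp add: mult_ac)
qed

section \<open>Nets of base maps\<close>

lemma EM_smooth_maps: "u \<in> EM A B \<Longrightarrow> \<epsilon> \<in> params \<Longrightarrow> u \<epsilon> \<in> smooth_maps A B"
  unfolding EM_def mem_Collect_eq by (elim conjE) (rule PiE_mem)

lemma EM_compact: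
  assumes "u \<in> EM A B" "compact K"
  obtains K' where "compact K'" "\<forall>\<^sub>F \<epsilon> in at_right 0. \<forall>p\<in>K. u \<epsilon> p \<in> K'"
proof -
  obtain \<epsilon>0 K' where "\<epsilon>0 > 0" "compact K'" "\<forall>\<epsilon>\<in>params. \<epsilon> < \<epsilon>0 \<longrightarrow> u \<epsilon> ` K \<subseteq> K'"
    using assms(1)[unfolded EM_def mem_Collect_eq, THEN conjunct2, THEN conjunct1, rule_format, OF assms(2)] by blast
  then have "\<forall>\<^sub>F \<epsilon> in at_right 0. u \<epsilon> ` K \<subseteq> K'" unfolding params_eventually[symmetric] by blast
  then have "\<forall>\<^sub>F \<epsilon> in at_right 0. \<forall>p\<in>K. u \<epsilon> p \<in> K'" by eventually_elim blast
  then show thesis using that \<open>compact K'\<close> by blast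
qed

lemma EM_deriv_bound:
  fixes A :: "('x::t2_space, 'a::finite_dim_inner) chart set" and B :: "('y::t2_space, 'b::finite_dim_inner) chart set"
  assumes u: "u \<in> EM A B" and k: "k \<ge> 1" and c: "(V, \<phi>) \<in> A" "(W, \<psi>) \<in> B"
    and L: "compact L" "L \<subseteq> V" "compact M" "M \<subseteq> W"
  obtains N :: nat and C where "C > 0" "\<forall>\<^sub>F \<epsilon> in at_right 0. \<forall>p\<in>L. u \<epsilon> p \<in> M \<longrightarrow>
    deriv_norm k (\<psi> \<circ> u \<epsilon> \<circ> inv_into V \<phi>) (\<phi> p) \<le> ennreal (C * \<epsilon> powr - real N)"
proof -
  note 1 = u[unfolded EM_def mem_Collect_eq, THEN conjunct2, THEN conjunct2, THEN spec, THEN mp, OF k]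
  note 2 = bspec[OF bspec[OF 1 c(1), unfolded prod.case] c(2), unfolded prod.case]
  obtain N :: nat where "big_O (- real N) (\<lambda>\<epsilon>. SUP p\<in>L \<inter> u \<epsilon> -` M. deriv_norm k (\<psi> \<circ> u \<epsilon> \<circ> inv_into V \<phi>) (\<phi> p))"
    using 2[rule_format, of L M] L by blast
  then obtain C where C: "C > 0" "\<forall>\<^sub>F \<epsilon> in at_right 0.
    (SUP p\<in>L \<inter> u \<epsilon> -` M. deriv_norm k (\<psi> \<circ> u \<epsilon> \<circ> inv_into V \<phi>) (\<phi> p)) \<le> ennreal (C * \<epsilon> powr - real N)"
    unfolding big_O_iff by blast
  have "\<forall>\<^sub>F \<epsilon> in at_right 0. \<forall>p\<in>L. u \<epsilon> p \<in> M \<longrightarrow>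
    deriv_norm k (\<psi> \<circ> u \<epsilon> \<circ> inv_into V \<phi>) (\<phi> p) \<le> ennreal (C * \<epsilon> powr - real N)"
    using C(2)
  proof (eventually_elim, intro ballI impI)
    fix \<epsilon> p assume *: "(SUP p\<in>L \<inter> u \<epsilon> -` M. deriv_norm k (\<psi> \<circ> u \<epsilon> \<circ> inv_into V \<phi>) (\<phi> p)) \<le> ennreal (C * \<epsilon> powr - real N)"
      and p: "p \<in> L" "u \<epsilon> p \<in> M"
    show "deriv_norm k (\<psi> \<circ> u \<epsilon> \<circ> inv_into V \<phi>) (\<phi> p) \<le> ennreal (C * \<epsilon> powr - real N)"
      by (rule order_trans[OF SUP_upper *]) (use p in simp)
  qed
  then show thesis using that C(1) by blast
qed

text \<open>Besides uniform closeness this supplies a Riemannian metric on the target whenever two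
  nets are equivalent.\<close>

lemma EM_equiv_close:
  assumes "(u, w) \<in> EM_equiv A B" "compact K"
  obtains h where "riemannian_metric B h"
    "\<And>\<delta>. \<delta> > 0 \<Longrightarrow> \<forall>\<^sub>F \<epsilon> in at_right 0. \<forall>p\<in>K. riem_dist B h (u \<epsilon> p) (w \<epsilon> p) < ennreal \<delta>"
proof -
  obtain h where h: "riemannian_metric B h"
    "\<forall>K. compact K \<longrightarrow> ((\<lambda>\<epsilon>. SUP p\<in>K. riem_dist B h (u \<epsilon> p) (w \<epsilon> p)) \<longlongrightarrow> 0) (at_right 0)"
    using assms(1) unfolding EM_equiv_def mem_Collect_eq prod.case by (elim conjE exE) (rule that)
  show thesis
  proof (rule that[OF h(1)])
    fix \<delta> :: real assume "\<delta> > 0"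
    then have "0 < ennreal \<delta>" by simp
    from order_tendstoD(2)[OF mp[OF spec[OF h(2)] assms(2)] this]
    show "\<forall>\<^sub>F \<epsilon> in at_right 0. \<forall>p\<in>K. riem_dist B h (u \<epsilon> p) (w \<epsilon> p) < ennreal \<delta>"
    proof (eventually_elim, intro ballI)
      fix \<epsilon> p assume *: "(SUP p\<in>K. riem_dist B h (u \<epsilon> p) (w \<epsilon> p)) < ennreal \<delta>" "p \<in> K"
      show "riem_dist B h (u \<epsilon> p) (w \<epsilon> p) < ennreal \<delta>"
        by (rule order_le_less_trans[OF SUP_upper[OF *(2)] *(1)])
    qed
  qed
qed

lemma EM_equiv_EM:
  assumes "(u, w) \<in> EM_equiv A B" shows "u \<in> EM A B" "w \<in> EM A B"
  by (rule assms[unfolded EM_equiv_def mem_Collect_eq prod.case, THEN conjunct1],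
      rule assms[unfolded EM_equiv_def mem_Collect_eq prod.case, THEN conjunct2, THEN conjunct1])

text \<open>The instance \<open>k = 0\<close> of the derivative estimate for equivalent nets,
  evaluated along a net of points.\<close>

lemma EM_equiv_chart:
  fixes A :: "('x::t2_space, 'a::finite_dim_inner) chart set" and B :: "('y::t2_space, 'b::finite_dim_inner) chart set"
  assumes A: "manifold A" and u: "(u, w) \<in> EM_equiv A B" and c: "(V, \<phi>) \<in> A" "(W, \<psi>) \<in> B"
    and L: "compact L" "L \<subseteq> V" "compact M" "M \<subseteq> W"
  shows "negl_on (\<lambda>\<epsilon>. p \<epsilon> \<in> L \<and> u \<epsilon> (p \<epsilon>) \<in> M \<and> w \<epsilon> (p \<epsilon>) \<in> M) (\<lambda>\<epsilon>. norm (\<psi> (u \<epsilon> (p \<epsilon>)) - \<psi> (w \<epsilon> (p \<epsilon>))))"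
  unfolding negl_on_def
proof (intro allI impI)
  fix m :: nat assume m: "m \<ge> 1"
  note 1 = u[unfolded EM_equiv_def mem_Collect_eq prod.case, THEN conjunct2, THEN conjunct2, THEN conjunct2,
      THEN spec[of _ 0], THEN spec[of _ m], THEN mp, OF m]
  note 2 = bspec[OF bspec[OF 1 c(1), unfolded prod.case] c(2), unfolded prod.case, unfolded deriv_norm_0, rule_format, of L M]
  obtain C where C: "C > 0" "\<forall>\<^sub>F \<epsilon> in at_right 0. (SUP p\<in>L \<inter> u \<epsilon> -` M \<inter> w \<epsilon> -` M.
      ennreal (norm ((\<psi> \<circ> u \<epsilon> \<circ> inv_into V \<phi>) (\<phi> p) - (\<psi> \<circ> w \<epsilon> \<circ> inv_into V \<phi>) (\<phi> p)))) \<le> ennreal (C * \<epsilon> powr real m)"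
    using 2 L unfolding big_O_iff by blast
  have "\<forall>\<^sub>F \<epsilon> in at_right 0. p \<epsilon> \<in> L \<and> u \<epsilon> (p \<epsilon>) \<in> M \<and> w \<epsilon> (p \<epsilon>) \<in> M \<longrightarrow>
     norm (\<psi> (u \<epsilon> (p \<epsilon>)) - \<psi> (w \<epsilon> (p \<epsilon>))) \<le> C * \<epsilon> powr real m"
    using C(2)
  proof (eventually_elim, intro impI)
    fix \<epsilon>
    assume *: "(SUP p\<in>L \<inter> u \<epsilon> -` M \<inter> w \<epsilon> -` M. ennreal (norm ((\<psi> \<circ> u \<epsilon> \<circ> inv_into V \<phi>) (\<phi> p)
        - (\<psi> \<circ> w \<epsilon> \<circ> inv_into V \<phi>) (\<phi> p)))) \<le> ennreal (C * \<epsilon> powr real m)"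
      and p: "p \<epsilon> \<in> L \<and> u \<epsilon> (p \<epsilon>) \<in> M \<and> w \<epsilon> (p \<epsilon>) \<in> M"
    have "norm ((\<psi> \<circ> u \<epsilon> \<circ> inv_into V \<phi>) (\<phi> (p \<epsilon>)) - (\<psi> \<circ> w \<epsilon> \<circ> inv_into V \<phi>) (\<phi> (p \<epsilon>))) \<le> C * \<epsilon> powr real m"
      by (rule SUP_ennreal_le[OF *]) (use p C(1) in simp_all)
    moreover have "p \<epsilon> \<in> V" using p L(2) by blast
    ultimately show "norm (\<psi> (u \<epsilon> (p \<epsilon>)) - \<psi> (w \<epsilon> (p \<epsilon>))) \<le> C * \<epsilon> powr real m"
      by (simp add: chart_inv[OF A c(1)])
  qed
  then show "\<exists>C>0. \<forall>\<^sub>F \<epsilon> in at_right 0. p \<epsilon> \<in> L \<and> u \<epsilon> (p \<epsilon>) \<in> M \<and> w \<epsilon> (p \<epsilon>) \<in> M \<longrightarrow>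
     norm (\<psi> (u \<epsilon> (p \<epsilon>)) - \<psi> (w \<epsilon> (p \<epsilon>))) \<le> C * \<epsilon> powr real m"
    using C(1) by (intro exI[of _ C] conjI)
qed

text \<open>A uniform version of openness: \<open>\<delta>\<close> is chosen so that the lower bound
  for distances applies and yields a coordinate difference below the width of the
  thickening.\<close>

lemma riem_dist_stay:
  assumes A: "manifold A" and g: "riemannian_metric A g" and c: "(V, \<phi>) \<in> A" and L: "compact L" "L \<subseteq> V"
  obtains M \<delta> where "compact M" "L \<subseteq> M" "M \<subseteq> V" "\<delta> > 0" "\<And>p q. p \<in> L \<Longrightarrow> riem_dist A g p q < ennreal \<delta> \<Longrightarrow> q \<in> M"
proof -
  obtain \<rho> M where M: "\<rho> > 0" "compact M" "M \<subseteq> V" "L \<subseteq> M"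
    "\<And>p q. p \<in> L \<Longrightarrow> q \<in> V \<Longrightarrow> norm (\<phi> p - \<phi> q) < \<rho> \<Longrightarrow> q \<in> M"
    by (rule chart_thickening[OF A c L]) (rule that; assumption)
  obtain k \<delta> where k: "k > 0" "\<delta> > 0" "\<And>p q. p \<in> L \<Longrightarrow> riem_dist A g p q < ennreal \<delta> \<Longrightarrow>
    q \<in> V \<and> ennreal (k * norm (\<phi> p - \<phi> q)) \<le> riem_dist A g p q"
    by (rule riem_dist_lower[OF A g c L]) (rule that; assumption)
  show thesis
  proof (rule that[OF M(2,4,3)])
    show "min \<delta> (k * \<rho>) > 0" using k M(1) by simp
    fix p q assume p: "p \<in> L" and d: "riem_dist A g p q < ennreal (min \<delta> (k * \<rho>))"
    have le: "ennreal (min \<delta> (k * \<rho>)) \<le> ennreal \<delta>" "ennreal (min \<delta> (k * \<rho>)) \<le> ennreal (k * \<rho>)"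
      by (auto intro: ennreal_leI)
    note q = k(3)[OF p order_less_le_trans[OF d le(1)]]
    have "ennreal (k * norm (\<phi> p - \<phi> q)) < ennreal (k * \<rho>)"
      using q order_less_le_trans[OF d le(2)] by (auto intro: order_le_less_trans)
    then have "norm (\<phi> p - \<phi> q) < \<rho>" using k(1) by (simp add: ennreal_less_iff)
    then show "q \<in> M" using q p by (intro M(5)) auto
  qed
qed

text \<open>If \<open>u\<close> stays in \<open>M\<close>, smallness of the distance from
  \<open>u\<close> to \<open>w\<close> keeps \<open>w\<close> close. The other direction needs the
  distance from \<open>w\<close> to \<open>u\<close>; it is bounded by the three-metric estimate
  with the first point in a compact set \<open>K'\<close> that contains the images under
  \<open>u\<close>.\<close>

lemma EM_equiv_stay:
  fixes B :: "('y::t2_space, 'b::finite_dim_inner) chart set"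
  assumes B: "manifold B" and u: "(u, w) \<in> EM_equiv A B" and K: "compact K" and c: "(W, \<psi>) \<in> B"
    and M: "compact M" "M \<subseteq> W"
  shows "\<forall>\<^sub>F \<epsilon> in at_right 0. \<forall>p\<in>K. u \<epsilon> p \<in> M \<Longrightarrow>
      \<exists>M'. compact M' \<and> M \<subseteq> M' \<and> M' \<subseteq> W \<and> (\<forall>\<^sub>F \<epsilon> in at_right 0. \<forall>p\<in>K. w \<epsilon> p \<in> M')"
    and "\<forall>\<^sub>F \<epsilon> in at_right 0. \<forall>p\<in>K. w \<epsilon> p \<in> M \<Longrightarrow>
      \<exists>M'. compact M' \<and> M \<subseteq> M' \<and> M' \<subseteq> W \<and> (\<forall>\<^sub>F \<epsilon> in at_right 0. \<forall>p\<in>K. u \<epsilon> p \<in> M')"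
proof -
  obtain h where h: "riemannian_metric B h"
    "\<And>\<delta>. \<delta> > 0 \<Longrightarrow> \<forall>\<^sub>F \<epsilon> in at_right 0. \<forall>p\<in>K. riem_dist B h (u \<epsilon> p) (w \<epsilon> p) < ennreal \<delta>"
    by (rule EM_equiv_close[OF u K]) (rule that; assumption)
  obtain M' \<delta> where M': "compact M'" "M \<subseteq> M'" "M' \<subseteq> W" "\<delta> > 0"
    "\<And>p q. p \<in> M \<Longrightarrow> riem_dist B h p q < ennreal \<delta> \<Longrightarrow> q \<in> M'"
    by (rule riem_dist_stay[OF B h(1) c M]) (rule that; assumption)
  {
    assume "\<forall>\<^sub>F \<epsilon> in at_right 0. \<forall>p\<in>K. u \<epsilon> p \<in> M"
    with h(2)[OF M'(4)] have "\<forall>\<^sub>F \<epsilon> in at_right 0. \<forall>p\<in>K. w \<epsilon> p \<in> M'"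
      by eventually_elim (use M'(5) in blast)
    then show "\<exists>M'. compact M' \<and> M \<subseteq> M' \<and> M' \<subseteq> W \<and> (\<forall>\<^sub>F \<epsilon> in at_right 0. \<forall>p\<in>K. w \<epsilon> p \<in> M')"
      using M'(1-3) by (intro exI[of _ M'] conjI)
  next
    assume wM: "\<forall>\<^sub>F \<epsilon> in at_right 0. \<forall>p\<in>K. w \<epsilon> p \<in> M"
    obtain K' where K': "compact K'" "\<forall>\<^sub>F \<epsilon> in at_right 0. \<forall>p\<in>K. u \<epsilon> p \<in> K'"
      by (rule EM_compact[OF EM_equiv_EM(1)[OF u] K])
    obtain C \<delta>' where C: "C > 0" "\<delta>' > 0" "\<And>p q r. p \<in> K' \<Longrightarrow> riem_dist B h p q < ennreal \<delta>' \<Longrightarrow>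
      riem_dist B h p r < ennreal \<delta>' \<Longrightarrow> riem_dist B h q r \<le> ennreal C * (riem_dist B h p q + riem_dist B h p r)"
      by (rule riem_dist_euclidean[OF B h(1) h(1) h(1) K'(1)]) (rule that; assumption)
    \<comment> \<open>Reversing the distance costs the factor \<open>C\<close>, so
      \<open>\<delta> / C\<close> leads to a reversed distance below
      \<open>\<delta>\<close>.\<close>
    have "min \<delta>' (\<delta> / C) > 0" using M'(4) C by simp
    from h(2)[OF this] wM K'(2) have "\<forall>\<^sub>F \<epsilon> in at_right 0. \<forall>p\<in>K. u \<epsilon> p \<in> M'"
    proof (eventually_elim, intro ballI)
      fix \<epsilon> p assume *: "\<forall>p\<in>K. riem_dist B h (u \<epsilon> p) (w \<epsilon> p) < ennreal (min \<delta>' (\<delta> / C))"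
        "\<forall>p\<in>K. w \<epsilon> p \<in> M" "\<forall>p\<in>K. u \<epsilon> p \<in> K'" and p: "p \<in> K"
      have le: "ennreal (min \<delta>' (\<delta> / C)) \<le> ennreal \<delta>'" "ennreal (min \<delta>' (\<delta> / C)) \<le> ennreal (\<delta> / C)"
        by (auto intro: ennreal_leI)
      have d: "riem_dist B h (u \<epsilon> p) (w \<epsilon> p) < ennreal \<delta>'" "riem_dist B h (u \<epsilon> p) (w \<epsilon> p) < ennreal (\<delta> / C)"
        using *(1) p le by (auto intro: order_less_le_trans)
      have "riem_dist B h (u \<epsilon> p) (u \<epsilon> p) < ennreal \<delta>'" using C(2) by (simp add: riem_dist_self[OF B h(1)])
      from C(3)[OF _ d(1) this] *(3) p
      have "riem_dist B h (w \<epsilon> p) (u \<epsilon> p) \<le> ennreal C * riem_dist B h (u \<epsilon> p) (w \<epsilon> p)"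
        by (simp add: riem_dist_self[OF B h(1)])
      also have "\<dots> < ennreal C * ennreal (\<delta> / C)"
        using d(2) C(1) by (intro ennreal_mult_strict_left_mono) auto
      also have "\<dots> = ennreal \<delta>" using C(1) M'(4) by (simp flip: ennreal_mult)
      finally show "u \<epsilon> p \<in> M'" using M'(5) *(2) p by blast
    qed
    then show "\<exists>M'. compact M' \<and> M \<subseteq> M' \<and> M' \<subseteq> W \<and> (\<forall>\<^sub>F \<epsilon> in at_right 0. \<forall>p\<in>K. u \<epsilon> p \<in> M')"
      using M'(1-3) by (intro exI[of _ M'] conjI)
  }
qed

section \<open>Change of bundle chart in the target\<close>

text \<open>The bounds reduce to sums of finitely many continuous functions on the compact set
  \<open>S\<close>, taken over basis vectors of the fiber and of the model space.\<close>

lemma smooth_linear_family_bounds: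
  fixes T :: "'a::finite_dim_inner \<Rightarrow> 'v::finite_dim_inner \<Rightarrow> 'w::real_normed_vector"
  assumes U: "open U" and lin: "\<And>y. y \<in> U \<Longrightarrow> linear (T y)" and sm: "\<And>\<xi>. smooth_on U (\<lambda>y. T y \<xi>)"
    and S: "compact S" "S \<subseteq> U"
  obtains C where "C > 0" "\<And>x \<xi>. x \<in> S \<Longrightarrow> norm (T x \<xi>) \<le> C * norm \<xi>"
    "\<And>x \<xi> w. x \<in> S \<Longrightarrow> norm (frechet_derivative (\<lambda>y. T y \<xi>) (at x) w) \<le> C * norm \<xi> * norm w"
proof -
  let ?D = "\<lambda>x \<xi>. frechet_derivative (\<lambda>y. T y \<xi>) (at x)"
  have bdd: "\<exists>C. \<forall>x\<in>S. f x \<le> C" if "continuous_on S f" for f :: "'a \<Rightarrow> real"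
  proof -
    have "bdd_above (f ` S)" by (intro bounded_imp_bdd_above compact_imp_bounded compact_continuous_image that S(1))
    then show ?thesis by (auto simp: bdd_above_def)
  qed
  have "continuous_on S (\<lambda>x. \<Sum>u\<in>fd_basis. norm (T x u))"
    by (intro continuous_intros continuous_on_subset[OF smooth_on_continuous_on[OF sm] S(2)])
  then obtain C1 where C1: "\<And>x. x \<in> S \<Longrightarrow> (\<Sum>u\<in>fd_basis. norm (T x u)) \<le> C1" using bdd by blast
  have "continuous_on S (\<lambda>x. \<Sum>u\<in>fd_basis. \<Sum>w\<in>fd_basis. norm (?D x u w))"
    by (intro continuous_intros continuous_on_subset[OF smooth_on_continuous_on[OF smooth_on_frechet_derivative[OF sm]] S(2)])
  then obtain C2 where C2: "\<And>x. x \<in> S \<Longrightarrow> (\<Sum>u\<in>fd_basis. \<Sum>w\<in>fd_basis. norm (?D x u w)) \<le> C2" using bdd by blast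
  show thesis
  proof (rule that[of "max 1 (max C1 C2)"])
    fix x assume x: "x \<in> S"
    then have xU: "x \<in> U" using S by blast
    show "norm (T x \<xi>) \<le> max 1 (max C1 C2) * norm \<xi>" for \<xi>
      using C1[OF x] by (intro order_trans[OF norm_linear_fd_le[OF lin[OF xU]]] mult_right_mono) auto
    have D: "((\<lambda>y. T y \<xi>) has_derivative ?D x \<xi>) (at x)" for \<xi>
      by (rule smooth_on_has_derivative[OF sm xU])
    \<comment> \<open>Linearity in the fiber vector is not automatic for a derivative taken
      separately for each vector; it is inherited from \<open>T\<close> near
      \<open>x\<close>.\<close>
    have "linear (\<lambda>\<xi>. ?D x \<xi> w)" for w
    proof (rule linearI)
      fix \<xi> \<eta> r
      have "((\<lambda>y. T y (\<xi> + \<eta>)) has_derivative (\<lambda>w. ?D x \<xi> w + ?D x \<eta> w)) (at x)"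
        by (rule has_derivative_transform_within_open[OF has_derivative_add[OF D D] U xU]) (simp add: linear_add[OF lin])
      from fun_cong[OF frechet_derivative_at[OF this], of w] show "?D x (\<xi> + \<eta>) w = ?D x \<xi> w + ?D x \<eta> w" by (rule sym)
      have "((\<lambda>y. T y (r *\<^sub>R \<xi>)) has_derivative (\<lambda>w. r *\<^sub>R ?D x \<xi> w)) (at x)"
        by (rule has_derivative_transform_within_open[OF has_derivative_scaleR_right[OF D] U xU]) (simp add: linear_scale[OF lin])
      from fun_cong[OF frechet_derivative_at[OF this], of w] show "?D x (r *\<^sub>R \<xi>) w = r *\<^sub>R ?D x \<xi> w" by (rule sym)
    qed
    note lin\<xi> = this
    have linw: "linear (?D x \<xi>)" for \<xi> by (rule has_derivative_linear[OF D])
    show "norm (?D x \<xi> w) \<le> max 1 (max C1 C2) * norm \<xi> * norm w" for \<xi> w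
    proof -
      have "norm (?D x \<xi> w) \<le> (\<Sum>u\<in>fd_basis. norm (?D x u w)) * norm \<xi>" by (rule norm_linear_fd_le[OF lin\<xi>])
      also have "\<dots> \<le> (\<Sum>u\<in>fd_basis. (\<Sum>w\<in>fd_basis. norm (?D x u w)) * norm w) * norm \<xi>"
        by (intro mult_right_mono sum_mono norm_linear_fd_le[OF linw]) simp
      also have "\<dots> = (\<Sum>u\<in>fd_basis. \<Sum>w\<in>fd_basis. norm (?D x u w)) * norm w * norm \<xi>"
        by (simp add: sum_distrib_right)
      also have "\<dots> \<le> max 1 (max C1 C2) * norm w * norm \<xi>"
        using C2[OF x] by (intro mult_right_mono) auto
      finally show ?thesis by (simp add: mult_ac)
    qed
  qed simp
qed

text \<open>With the transition matrix T and base coordinates x, x' the difference is T(x)(\<xi> -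
  \<xi>') + (T(x) - T(x')) \<xi>'. The second term appears because the base points differ; it is
  bounded by the mean value theorem, which explains the product of fiber norm and base distance and
  the radius \<open>\<rho>\<close>.\<close>

lemma vb_chart_change_estimate:
  assumes F: "vector_bundle F" and c: "(W, \<psi>, \<Psi>) \<in> vb_charts F" and d: "(W2, \<psi>2, \<Psi>2) \<in> vb_charts F"
    and K: "compact K" "K \<subseteq> W" "K \<subseteq> W2"
  obtains C \<rho> where "C > 0" "\<rho> > 0" "\<And>z z'. vb_proj F z \<in> K \<Longrightarrow> vb_proj F z' \<in> K \<Longrightarrow>
    norm (\<psi> (vb_proj F z) - \<psi> (vb_proj F z')) < \<rho> \<Longrightarrow>
    norm (\<Psi>2 z - \<Psi>2 z') \<le> C * (norm (\<Psi> z - \<Psi> z') + norm (\<Psi> z') * norm (\<psi> (vb_proj F z) - \<psi> (vb_proj F z')))"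
proof -
  note A = vector_bundle_manifold[OF F] and cA = vb_chart_base[OF F c] and dA = vb_chart_base[OF F d]
  define U where "U = \<psi> ` (W \<inter> W2)"
  define T where "T x \<xi> = \<Psi>2 (vb_inv F (W, \<psi>, \<Psi>) x \<xi>)" for x \<xi>
  have o: "open U" unfolding U_def by (rule chart_open_image_Int[OF A cA chart_open[OF A dA]])
  have lin: "linear (T x)" if "x \<in> U" for x
    using that vb_transition_linear[OF F c d] by (auto simp: U_def T_def[abs_def])
  have sm: "smooth_on U (\<lambda>x. T x \<xi>)" for \<xi>
    unfolding U_def T_def by (rule vb_transition_smooth[OF F c d])
  have "\<psi> ` K \<subseteq> U" using K(2,3) by (auto simp: U_def)
  from compact_thickening[OF chart_compact_image[OF A cA K(1,2)] o this]
  obtain \<rho> where \<rho>: "\<rho> > 0" "compact (\<Union>x\<in>\<psi> ` K. cball x \<rho>)" "(\<Union>x\<in>\<psi> ` K. cball x \<rho>) \<subseteq> U" .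
  obtain C where C: "C > 0" "\<And>x \<xi>. x \<in> (\<Union>x\<in>\<psi> ` K. cball x \<rho>) \<Longrightarrow> norm (T x \<xi>) \<le> C * norm \<xi>"
    "\<And>x \<xi> w. x \<in> (\<Union>x\<in>\<psi> ` K. cball x \<rho>) \<Longrightarrow> norm (frechet_derivative (\<lambda>y. T y \<xi>) (at x) w) \<le> C * norm \<xi> * norm w"
    by (rule smooth_linear_family_bounds[OF o lin sm \<rho>(2,3)]) (assumption | rule that; assumption)+
  show thesis
  proof (rule that[OF C(1) \<rho>(1)])
    fix z z' assume z: "vb_proj F z \<in> K" "vb_proj F z' \<in> K"
      and d: "norm (\<psi> (vb_proj F z) - \<psi> (vb_proj F z')) < \<rho>"
    let ?x = "\<psi> (vb_proj F z)" and ?x' = "\<psi> (vb_proj F z')"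
    have cb: "cball ?x \<rho> \<subseteq> (\<Union>x\<in>\<psi> ` K. cball x \<rho>)" using z by blast
    have x: "?x \<in> cball ?x \<rho>" "?x' \<in> cball ?x \<rho>" using \<rho>(1) d by (auto simp: dist_norm)
    have xU: "?x \<in> U" using x(1) cb \<rho>(3) by blast
    have eq: "\<Psi>2 z = T ?x (\<Psi> z)" "\<Psi>2 z' = T ?x' (\<Psi> z')"
      using vb_inv_fiber[OF F c] z K(2) by (auto simp: T_def subset_iff)
    have "norm (T ?x (\<Psi> z')  - T ?x' (\<Psi> z')) \<le> C * norm (\<Psi> z') * norm (?x - ?x')"
    proof (rule mean_value_cball[OF _ _ x(2)])
      fix y assume y: "y \<in> cball ?x \<rho>"
      then have "y \<in> U" using cb \<rho>(3) by blast
      then show "(\<lambda>x. T x (\<Psi> z')) differentiable at y" by (rule differentiableI[OF smooth_on_has_derivative[OF sm]])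
      show "norm (frechet_derivative (\<lambda>x. T x (\<Psi> z')) (at y) v) \<le> C * norm (\<Psi> z') * norm v" for v
        by (rule C(3)) (use y cb in blast)
    qed
    moreover have "norm (T ?x (\<Psi> z - \<Psi> z')) \<le> C * norm (\<Psi> z - \<Psi> z')"
      by (rule C(2)) (use x(1) cb in blast)
    moreover have "\<Psi>2 z - \<Psi>2 z' = T ?x (\<Psi> z - \<Psi> z') + (T ?x (\<Psi> z')  - T ?x' (\<Psi> z'))"
      unfolding eq linear_diff[OF lin[OF xU]] by simp
    ultimately show "norm (\<Psi>2 z - \<Psi>2 z') \<le> C * (norm (\<Psi> z - \<Psi> z') + norm (\<Psi> z') * norm (?x - ?x'))"
      using norm_triangle_ineq[of "T ?x (\<Psi> z - \<Psi> z')" "T ?x (\<Psi> z')  - T ?x' (\<Psi> z')"]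
      by (simp add: distrib_left mult.assoc)
  qed
qed

lemma vb_moderate_chart:
  assumes F: "vector_bundle F" and z: "z \<in> vb_moderate F" and c: "(W, \<psi>, \<Psi>) \<in> vb_charts F"
    and M: "compact M" "M \<subseteq> W"
  shows "moder_on (\<lambda>\<epsilon>. vb_proj F (z \<epsilon>) \<in> M) (\<lambda>\<epsilon>. norm (\<Psi> (z \<epsilon>)))"
proof -
  obtain h where h: "fiber_metric F h" "moder_on (\<lambda>_. True) (\<lambda>\<epsilon>. fiber_norm h (z \<epsilon>))"
    using z unfolding vb_moderate_iff by (elim conjE exE) (rule that)
  obtain k where k: "k > 0" "\<And>z. vb_proj F z \<in> M \<Longrightarrow> k * norm (\<Psi> z) \<le> fiber_norm h z"
    by (rule fiber_norm_bounds[OF F h(1) c M]) (rule that; assumption)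
  have "moder_on (\<lambda>_. True) (\<lambda>\<epsilon>. fiber_norm h (z \<epsilon>) * (1 / k))"
    by (rule moder_on_mult[OF h(2) moder_on_const]) (use k(1) in simp)
  then show ?thesis
    by (rule moder_on_mono) (use k in \<open>simp add: field_simps\<close>)
qed

lemma vb_moderate_cpt_supp:
  assumes "(\<lambda>\<epsilon>\<in>params. z \<epsilon>) \<in> vb_moderate F" shows "(\<lambda>\<epsilon>\<in>params. vb_proj F (z \<epsilon>)) \<in> cpt_supp_nets"
proof -
  obtain K where K: "compact K" "\<forall>\<^sub>F \<epsilon> in at_right 0. vb_proj F ((\<lambda>\<epsilon>\<in>params. z \<epsilon>) \<epsilon>) \<in> K"
    using assms unfolding vb_moderate_iff by (elim conjE exE) (rule that)
  have "\<forall>\<^sub>F \<epsilon> in at_right 0. (\<lambda>\<epsilon>\<in>params. vb_proj F (z \<epsilon>)) \<epsilon> \<in> K"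
    using K(2) eventually_params by eventually_elim simp
  with K(1) have "\<exists>K. compact K \<and> (\<forall>\<^sub>F \<epsilon> in at_right 0. (\<lambda>\<epsilon>\<in>params. vb_proj F (z \<epsilon>)) \<epsilon> \<in> K)" by blast
  then show ?thesis unfolding cpt_supp_nets_def params_eventually by (intro CollectI conjI) simp_all
qed

text \<open>Near every point of \<open>K\<close> one chart of \<open>F\<close>, chosen at will,
  suffices. Base distances follow from the upper bound in that chart, fiber coordinates in any other
  chart from the chart change estimate. The net \<open>p\<close> in \<open>X\<close> serves to
  localize.\<close>

lemma vb_equiv_local:
  fixes F :: "('y::t2_space, 'b::finite_dim_inner, 'f::t2_space, 'w::finite_dim_inner,
                'k::{real_normed_field, euclidean_space}) vbundle" and p :: "real \<Rightarrow> 'x::t2_space"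
  assumes F: "vector_bundle F" and g: "riemannian_metric (vb_base F) g"
    and z: "(\<lambda>\<epsilon>\<in>params. z \<epsilon>) \<in> vb_moderate F" "(\<lambda>\<epsilon>\<in>params. z' \<epsilon>) \<in> vb_moderate F"
    and K: "compact K" "\<forall>\<^sub>F \<epsilon> in at_right 0. p \<epsilon> \<in> K"
    and loc: "\<And>p0. p0 \<in> K \<Longrightarrow> \<exists>U W \<psi> \<Psi> M. open U \<and> p0 \<in> U \<and> (W, \<psi>, \<Psi>) \<in> vb_charts F \<and> compact M \<and> M \<subseteq> W \<and>
      (\<forall>\<^sub>F \<epsilon> in at_right 0. p \<epsilon> \<in> U \<longrightarrow> vb_proj F (z \<epsilon>) \<in> M \<and> vb_proj F (z' \<epsilon>) \<in> M) \<and>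
      negl_on (\<lambda>\<epsilon>. p \<epsilon> \<in> U) (\<lambda>\<epsilon>. norm (\<psi> (vb_proj F (z \<epsilon>)) - \<psi> (vb_proj F (z' \<epsilon>)))) \<and>
      negl_on (\<lambda>\<epsilon>. p \<epsilon> \<in> U) (\<lambda>\<epsilon>. norm (\<Psi> (z \<epsilon>) - \<Psi> (z' \<epsilon>)))"
  shows "((\<lambda>\<epsilon>\<in>params. z \<epsilon>), (\<lambda>\<epsilon>\<in>params. z' \<epsilon>)) \<in> vb_equiv F"
proof (rule vb_equiv_restrictI[OF z])
  note A = vector_bundle_manifold[OF F]
  have "enegl_on (\<lambda>\<epsilon>. p \<epsilon> \<in> K) (\<lambda>\<epsilon>. riem_dist (vb_base F) g (vb_proj F (z \<epsilon>)) (vb_proj F (z' \<epsilon>)))"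
    using K(1)
  proof (induction rule: compact_local_induct)
    case (local p0)
    obtain U W \<psi> \<Psi> M where l: "open U" "p0 \<in> U" "(W, \<psi>, \<Psi>) \<in> vb_charts F" "compact M" "M \<subseteq> W"
      "\<forall>\<^sub>F \<epsilon> in at_right 0. p \<epsilon> \<in> U \<longrightarrow> vb_proj F (z \<epsilon>) \<in> M \<and> vb_proj F (z' \<epsilon>) \<in> M"
      "negl_on (\<lambda>\<epsilon>. p \<epsilon> \<in> U) (\<lambda>\<epsilon>. norm (\<psi> (vb_proj F (z \<epsilon>)) - \<psi> (vb_proj F (z' \<epsilon>))))"
      using loc[OF local] by (elim conjE exE) (rule that)
    have "\<forall>\<^sub>F \<epsilon> in at_right 0. p \<epsilon> \<in> U \<longrightarrow> vb_proj F (z \<epsilon>) \<in> M \<and> vb_proj F (z' \<epsilon>) \<in> W"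
      using l(6) by eventually_elim (use l(5) in blast)
    from riem_dist_negl_chart[OF A g vb_chart_base[OF F l(3)] l(4,5,7) this]
    show ?case using l(1,2) by (intro exI[of _ U] conjI)
  next
    case empty show ?case using enegl_on_False by simp
  next
    case (union X Y) then show ?case using enegl_on_Un[of "\<lambda>\<epsilon>. p \<epsilon> \<in> X"] by simp
  next
    case (mono X Y) show ?case by (rule enegl_on_mono[OF mono(2) always_eventually]) (use mono(1) in auto)
  qed
  then have "enegl_on (\<lambda>_. True) (\<lambda>\<epsilon>. riem_dist (vb_base F) g
    ((\<lambda>\<epsilon>\<in>params. vb_proj F (z \<epsilon>)) \<epsilon>) ((\<lambda>\<epsilon>\<in>params. vb_proj F (z' \<epsilon>)) \<epsilon>))"
  proof (rule enegl_on_mono)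
    show "\<forall>\<^sub>F \<epsilon> in at_right 0. True \<longrightarrow> p \<epsilon> \<in> K \<and> riem_dist (vb_base F) g
      ((\<lambda>\<epsilon>\<in>params. vb_proj F (z \<epsilon>)) \<epsilon>) ((\<lambda>\<epsilon>\<in>params. vb_proj F (z' \<epsilon>)) \<epsilon>)
      \<le> riem_dist (vb_base F) g (vb_proj F (z \<epsilon>)) (vb_proj F (z' \<epsilon>))"
      using K(2) eventually_params by eventually_elim simp
  qed
  then show "((\<lambda>\<epsilon>\<in>params. vb_proj F (z \<epsilon>)), (\<lambda>\<epsilon>\<in>params. vb_proj F (z' \<epsilon>))) \<in> point_equiv (vb_base F)"
    using vb_moderate_cpt_supp[OF z(1)] vb_moderate_cpt_supp[OF z(2)] by (rule point_equivI[OF g])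
next
  note A = vector_bundle_manifold[OF F]
  fix W2 \<psi>2 \<Psi>2 L assume d: "(W2, \<psi>2, \<Psi>2) \<in> vb_charts F" and L: "compact L" "L \<subseteq> W2"
  let ?R = "\<lambda>\<epsilon>. vb_proj F (z \<epsilon>) \<in> L \<and> vb_proj F (z' \<epsilon>) \<in> L"
  have "negl_on (\<lambda>\<epsilon>. p \<epsilon> \<in> K \<and> ?R \<epsilon>) (\<lambda>\<epsilon>. norm (\<Psi>2 (z \<epsilon>) - \<Psi>2 (z' \<epsilon>)))"
    using K(1)
  proof (induction rule: compact_local_induct)
    case (local p0)
    obtain U W \<psi> \<Psi> M where l: "open U" "p0 \<in> U" "(W, \<psi>, \<Psi>) \<in> vb_charts F" "compact M" "M \<subseteq> W"
      "\<forall>\<^sub>F \<epsilon> in at_right 0. p \<epsilon> \<in> U \<longrightarrow> vb_proj F (z \<epsilon>) \<in> M \<and> vb_proj F (z' \<epsilon>) \<in> M"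
      "negl_on (\<lambda>\<epsilon>. p \<epsilon> \<in> U) (\<lambda>\<epsilon>. norm (\<psi> (vb_proj F (z \<epsilon>)) - \<psi> (vb_proj F (z' \<epsilon>))))"
      "negl_on (\<lambda>\<epsilon>. p \<epsilon> \<in> U) (\<lambda>\<epsilon>. norm (\<Psi> (z \<epsilon>) - \<Psi> (z' \<epsilon>)))"
      using loc[OF local] by (elim conjE exE) (rule that)
    \<comment> \<open>Both charts are defined on this set, and it contains both base points whenever
      they lie in \<open>L\<close>.\<close>
    have MI: "compact (M \<inter> L)" "M \<inter> L \<subseteq> W" "M \<inter> L \<subseteq> W2"
      using compact_Int[OF l(4) L(1)] l(5) L(2) by auto
    obtain C \<rho> where C: "C > 0" "\<rho> > 0" "\<And>z z'. vb_proj F z \<in> M \<inter> L \<Longrightarrow> vb_proj F z' \<in> M \<inter> L \<Longrightarrow>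
      norm (\<psi> (vb_proj F z) - \<psi> (vb_proj F z')) < \<rho> \<Longrightarrow>
      norm (\<Psi>2 z - \<Psi>2 z') \<le> C * (norm (\<Psi> z - \<Psi> z') + norm (\<Psi> z') * norm (\<psi> (vb_proj F z) - \<psi> (vb_proj F z')))"
      by (rule vb_chart_change_estimate[OF F l(3) d MI]) (rule that; assumption)
    \<comment> \<open>Moderateness of \<open>z'\<close> keeps the mixed term of the chart change
      negligible.\<close>
    have "moder_on (\<lambda>\<epsilon>. p \<epsilon> \<in> U) (\<lambda>\<epsilon>. norm (\<Psi> (z' \<epsilon>)))"
      by (rule moder_on_mono[OF vb_moderate_chart[OF F z(2) l(3-5)]])
        (use l(6) eventually_params in eventually_elim, simp)
    then have "negl_on (\<lambda>\<epsilon>. p \<epsilon> \<in> U) (\<lambda>\<epsilon>. norm (\<Psi> (z' \<epsilon>)) * norm (\<psi> (vb_proj F (z \<epsilon>)) - \<psi> (vb_proj F (z' \<epsilon>))))"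
      by (rule negl_on_mult[OF _ l(7)]) simp
    from negl_on_add[OF l(8) this]
    have "negl_on (\<lambda>\<epsilon>. p \<epsilon> \<in> U) (\<lambda>\<epsilon>. C * (norm (\<Psi> (z \<epsilon>) - \<Psi> (z' \<epsilon>))
        + norm (\<Psi> (z' \<epsilon>)) * norm (\<psi> (vb_proj F (z \<epsilon>)) - \<psi> (vb_proj F (z' \<epsilon>)))))"
      by (rule negl_on_mult[OF moder_on_const]) simp
    then have "negl_on (\<lambda>\<epsilon>. p \<epsilon> \<in> U \<and> ?R \<epsilon>) (\<lambda>\<epsilon>. norm (\<Psi>2 (z \<epsilon>) - \<Psi>2 (z' \<epsilon>)))"
    proof (rule negl_on_mono)
      show "\<forall>\<^sub>F \<epsilon> in at_right 0. p \<epsilon> \<in> U \<and> ?R \<epsilon> \<longrightarrow> p \<epsilon> \<in> U \<and> norm (\<Psi>2 (z \<epsilon>) - \<Psi>2 (z' \<epsilon>)) \<le>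
        C * (norm (\<Psi> (z \<epsilon>) - \<Psi> (z' \<epsilon>)) + norm (\<Psi> (z' \<epsilon>)) * norm (\<psi> (vb_proj F (z \<epsilon>)) - \<psi> (vb_proj F (z' \<epsilon>))))"
        using l(6) negl_on_small[OF l(7) C(2)] by eventually_elim (intro impI conjI C(3); simp)
    qed
    then show ?case using l(1,2) by (intro exI[of _ U] conjI)
  next
    case empty show ?case using enegl_on_False unfolding negl_on_enegl by simp
  next
    case (union X Y)
    from negl_on_Un[OF union] show ?case by (rule negl_on_mono) auto
  next
    case (mono X Y) show ?case by (rule negl_on_mono[OF mono(2) always_eventually]) (use mono(1) in auto)
  qed
  then show "negl_on ?R (\<lambda>\<epsilon>. norm (\<Psi>2 (z \<epsilon>) - \<Psi>2 (z' \<epsilon>)))"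
    by (rule negl_on_mono) (use K(2) in \<open>auto elim: eventually_mono\<close>)
qed

section \<open>Nets of homomorphisms in charts\<close>

lemma EM_VB_homs: "u \<in> EM_VB E F \<Longrightarrow> \<epsilon> \<in> params \<Longrightarrow> u \<epsilon> \<in> vb_homs E F"
  unfolding EM_VB_def mem_Collect_eq by (elim conjE) (rule PiE_mem)

lemma EM_VB_base: "u \<in> EM_VB E F \<Longrightarrow> (\<lambda>\<epsilon>\<in>params. hom_base E F (u \<epsilon>)) \<in> EM (vb_base E) (vb_base F)"
  unfolding EM_VB_def mem_Collect_eq by (elim conjE)

lemma vb_homs_proj: "f \<in> vb_homs E F \<Longrightarrow> vb_proj F (f z) = hom_base E F f (vb_proj E z)"
  unfolding vb_homs_def mem_Collect_eq by (elim conjE) (rule spec)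

lemma vb_homs_chart:
  assumes "f \<in> vb_homs E F" "(V, \<phi>, \<Phi>) \<in> vb_charts E" "(W, \<psi>, \<Psi>) \<in> vb_charts F"
  shows "p \<in> V \<Longrightarrow> hom_base E F f p \<in> W \<Longrightarrow>
      Vector_Spaces.linear (vb_scale E) (vb_scale F) (hom_rep E (V, \<phi>, \<Phi>) (W, \<psi>, \<Psi>) f (\<phi> p))"
    and "smooth_on (\<phi> ` (V \<inter> hom_base E F f -` W) \<times> UNIV)
          (\<lambda>(x, \<xi>). vb_triv F \<psi> \<Psi> (f (vb_inv E (V, \<phi>, \<Phi>) x \<xi>)))"
proof -
  note 1 = assms(1)[unfolded vb_homs_def mem_Collect_eq, THEN conjunct2, THEN conjunct2]
  note 2 = bspec[OF bspec[OF 1 assms(2), unfolded prod.case] assms(3), unfolded prod.case]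
  show "smooth_on (\<phi> ` (V \<inter> hom_base E F f -` W) \<times> UNIV)
          (\<lambda>(x, \<xi>). vb_triv F \<psi> \<Psi> (f (vb_inv E (V, \<phi>, \<Phi>) x \<xi>)))"
    by (rule 2[THEN conjunct2])
  show "Vector_Spaces.linear (vb_scale E) (vb_scale F) (hom_rep E (V, \<phi>, \<Phi>) (W, \<psi>, \<Psi>) f (\<phi> p))"
    if "p \<in> V" "hom_base E F f p \<in> W"
    by (rule bspec[OF 2[THEN conjunct1]]) (use that in auto)
qed

lemma hom_rep_linear:
  assumes E: "vector_bundle E" and F: "vector_bundle F" and "f \<in> vb_homs E F" "(V, \<phi>, \<Phi>) \<in> vb_charts E"
    "(W, \<psi>, \<Psi>) \<in> vb_charts F" "p \<in> V" "hom_base E F f p \<in> W"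
  shows "linear (hom_rep E (V, \<phi>, \<Phi>) (W, \<psi>, \<Psi>) f (\<phi> p))"
  by (rule Vector_Spaces_linear_imp_linear[OF vb_homs_chart(1)[OF assms(3-7)]])
    (simp_all add: vector_bundle_scale[OF E] vector_bundle_scale[OF F])

lemma hom_rep_apply:
  assumes E: "vector_bundle E" "(V, \<phi>, \<Phi>) \<in> vb_charts E" "vb_proj E z \<in> V"
  shows "hom_rep E (V, \<phi>, \<Phi>) (W, \<psi>, \<Psi>) f (\<phi> (vb_proj E z)) (\<Phi> z) = \<Psi> (f z)"
  by (simp add: hom_rep_def vb_inv_fiber[OF assms])

lemma hom_rep_smooth:
  assumes "open (\<phi> ` (V \<inter> hom_base E F f -` W))"
    and "f \<in> vb_homs E F" "(V, \<phi>, \<Phi>) \<in> vb_charts E" "(W, \<psi>, \<Psi>) \<in> vb_charts F"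
  shows "smooth_on (\<phi> ` (V \<inter> hom_base E F f -` W)) (\<lambda>x. hom_rep E (V, \<phi>, \<Phi>) (W, \<psi>, \<Psi>) f x \<xi>)"
  using smooth_on_compose_linear[OF assms(1) bounded_linear_snd
      smooth_on_Pair_slice[OF assms(1) vb_homs_chart(2)[OF assms(2-4)], of \<xi>]]
  by (simp add: hom_rep_def vb_triv_def)

lemma EM_VB_bound:
  fixes E :: "('x::t2_space, 'a::finite_dim_inner, 'e::t2_space, 'v::finite_dim_inner, 'k::field) vbundle"
    and F :: "('y::t2_space, 'b::finite_dim_inner, 'f::t2_space, 'w::finite_dim_inner, 'k) vbundle"
  assumes u: "u \<in> EM_VB E F" and c: "(V, \<phi>, \<Phi>) \<in> vb_charts E" "(W, \<psi>, \<Psi>) \<in> vb_charts F"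
    and L: "compact L" "L \<subseteq> V" "compact M" "M \<subseteq> W"
  obtains N :: nat and C where "C > 0" "\<forall>\<^sub>F \<epsilon> in at_right 0. \<forall>p\<in>L. hom_base E F (u \<epsilon>) p \<in> M \<longrightarrow>
    hom_deriv_norm k (hom_rep E (V, \<phi>, \<Phi>) (W, \<psi>, \<Psi>) (u \<epsilon>)) (\<phi> p) \<le> ennreal (C * \<epsilon> powr - real N)"
proof -
  note 1 = u[unfolded EM_VB_def mem_Collect_eq, THEN conjunct2, THEN conjunct2, THEN spec[of _ k]]
  note 2 = bspec[OF bspec[OF 1 c(1), unfolded prod.case] c(2), unfolded prod.case]
  have "compact L \<and> L \<subseteq> V \<and> compact M \<and> M \<subseteq> W" using L by simp
  from mp[OF 2[THEN spec[of _ L], THEN spec[of _ M]] this]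
  obtain N :: nat and \<epsilon>1 C where C: "\<epsilon>1 > 0" "C > 0" "\<forall>\<epsilon>\<in>params. \<epsilon> < \<epsilon>1 \<longrightarrow>
      (\<forall>p\<in>L \<inter> hom_base E F (u \<epsilon>) -` M.
        hom_deriv_norm k (hom_rep E (V, \<phi>, \<Phi>) (W, \<psi>, \<Psi>) (u \<epsilon>)) (\<phi> p) \<le> ennreal (C * \<epsilon> powr - real N))"
    by (elim exE conjE) (rule that)
  have "\<forall>\<^sub>F \<epsilon> in at_right 0. \<forall>p\<in>L \<inter> hom_base E F (u \<epsilon>) -` M.
        hom_deriv_norm k (hom_rep E (V, \<phi>, \<Phi>) (W, \<psi>, \<Psi>) (u \<epsilon>)) (\<phi> p) \<le> ennreal (C * \<epsilon> powr - real N)"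
    unfolding params_eventually[symmetric] using C(1,3) by (intro exI[of _ \<epsilon>1] conjI)
  then have "\<forall>\<^sub>F \<epsilon> in at_right 0. \<forall>p\<in>L. hom_base E F (u \<epsilon>) p \<in> M \<longrightarrow>
    hom_deriv_norm k (hom_rep E (V, \<phi>, \<Phi>) (W, \<psi>, \<Psi>) (u \<epsilon>)) (\<phi> p) \<le> ennreal (C * \<epsilon> powr - real N)"
    by eventually_elim simp
  then show thesis by (rule that[OF C(2)])
qed

lemma hom_equivD:
  assumes "(u, w) \<in> hom_equiv E F"
  shows "u \<in> EM_VB E F" "w \<in> EM_VB E F"
    "((\<lambda>\<epsilon>\<in>params. hom_base E F (u \<epsilon>)), (\<lambda>\<epsilon>\<in>params. hom_base E F (w \<epsilon>))) \<in> EM_equiv (vb_base E) (vb_base F)"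
  using assms unfolding hom_equiv_def mem_Collect_eq prod.case by simp_all

lemma hom_equiv_bound:
  fixes E :: "('x::t2_space, 'a::finite_dim_inner, 'e::t2_space, 'v::finite_dim_inner, 'k::field) vbundle"
    and F :: "('y::t2_space, 'b::finite_dim_inner, 'f::t2_space, 'w::finite_dim_inner, 'k) vbundle"
  assumes u: "(u, w) \<in> hom_equiv E F" and m: "m \<ge> 1" and c: "(V, \<phi>, \<Phi>) \<in> vb_charts E" "(W, \<psi>, \<Psi>) \<in> vb_charts F"
    and L: "compact L" "L \<subseteq> V" "compact M" "M \<subseteq> W"
  obtains C where "C > 0" "\<forall>\<^sub>F \<epsilon> in at_right 0. \<forall>p\<in>L. hom_base E F (u \<epsilon>) p \<in> M \<longrightarrow> hom_base E F (w \<epsilon>) p \<in> M \<longrightarrow>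
    hom_deriv_norm k (\<lambda>x \<xi>. hom_rep E (V, \<phi>, \<Phi>) (W, \<psi>, \<Psi>) (u \<epsilon>) x \<xi> - hom_rep E (V, \<phi>, \<Phi>) (W, \<psi>, \<Psi>) (w \<epsilon>) x \<xi>) (\<phi> p)
      \<le> ennreal (C * \<epsilon> powr real m)"
proof -
  note 1 = u[unfolded hom_equiv_def mem_Collect_eq prod.case, THEN conjunct2, THEN conjunct2, THEN conjunct2,
      THEN spec[of _ k], THEN spec[of _ m], THEN mp, OF m]
  note 2 = bspec[OF bspec[OF 1 c(1), unfolded prod.case] c(2), unfolded prod.case]
  have "compact L \<and> L \<subseteq> V \<and> compact M \<and> M \<subseteq> W" using L by simp
  from mp[OF 2[THEN spec[of _ L], THEN spec[of _ M]] this]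
  obtain \<epsilon>1 C where C: "\<epsilon>1 > 0" "C > 0" "\<forall>\<epsilon>\<in>params. \<epsilon> < \<epsilon>1 \<longrightarrow>
      (\<forall>p\<in>L \<inter> hom_base E F (u \<epsilon>) -` M \<inter> hom_base E F (w \<epsilon>) -` M.
        hom_deriv_norm k (\<lambda>x \<xi>. hom_rep E (V, \<phi>, \<Phi>) (W, \<psi>, \<Psi>) (u \<epsilon>) x \<xi> - hom_rep E (V, \<phi>, \<Phi>) (W, \<psi>, \<Psi>) (w \<epsilon>) x \<xi>) (\<phi> p)
          \<le> ennreal (C * \<epsilon> powr real m))"
    by (elim exE conjE) (rule that)
  have "\<forall>\<^sub>F \<epsilon> in at_right 0. \<forall>p\<in>L \<inter> hom_base E F (u \<epsilon>) -` M \<inter> hom_base E F (w \<epsilon>) -` M.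
        hom_deriv_norm k (\<lambda>x \<xi>. hom_rep E (V, \<phi>, \<Phi>) (W, \<psi>, \<Psi>) (u \<epsilon>) x \<xi> - hom_rep E (V, \<phi>, \<Phi>) (W, \<psi>, \<Psi>) (w \<epsilon>) x \<xi>) (\<phi> p)
          \<le> ennreal (C * \<epsilon> powr real m)"
    unfolding params_eventually[symmetric] using C(1,3) by (intro exI[of _ \<epsilon>1] conjI)
  then have "\<forall>\<^sub>F \<epsilon> in at_right 0. \<forall>p\<in>L. hom_base E F (u \<epsilon>) p \<in> M \<longrightarrow> hom_base E F (w \<epsilon>) p \<in> M \<longrightarrow>
    hom_deriv_norm k (\<lambda>x \<xi>. hom_rep E (V, \<phi>, \<Phi>) (W, \<psi>, \<Psi>) (u \<epsilon>) x \<xi> - hom_rep E (V, \<phi>, \<Phi>) (W, \<psi>, \<Psi>) (w \<epsilon>) x \<xi>) (\<phi> p)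
      \<le> ennreal (C * \<epsilon> powr real m)"
    by eventually_elim simp
  then show thesis by (rule that[OF C(2)])
qed

section \<open>Point values of generalized homomorphisms\<close>

text \<open>The hypothesis on \<open>v\<close> in part (ii), in a form that passes to equivalent nets.\<close>

definition chart_bounded ::
  "('x::t2_space, 'a::finite_dim_inner, 'e::t2_space, 'v::finite_dim_inner, 'k) vbundle
     \<Rightarrow> ('y::t2_space, 'b::finite_dim_inner, 'f::t2_space, 'w::finite_dim_inner, 'k) vbundle
     \<Rightarrow> (real \<Rightarrow> 'e \<Rightarrow> 'f) \<Rightarrow> bool" where
  "chart_bounded E F v \<longleftrightarrow> (\<forall>K. compact K \<longrightarrow> (\<exists>W \<psi> \<Psi> M. (W, \<psi>, \<Psi>) \<in> vb_charts F \<and> compact M \<and> M \<subseteq> W \<and>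
     (\<forall>\<^sub>F \<epsilon> in at_right 0. \<forall>p\<in>K. hom_base E F (v \<epsilon>) p \<in> M)))"

lemma chart_boundedD:
  assumes "chart_bounded E F v" "compact K"
  obtains W \<psi> \<Psi> M where "(W, \<psi>, \<Psi>) \<in> vb_charts F" "compact M" "M \<subseteq> W"
    "\<forall>\<^sub>F \<epsilon> in at_right 0. \<forall>p\<in>K. hom_base E F (v \<epsilon>) p \<in> M"
  using assms(1)[unfolded chart_bounded_def, THEN spec[of _ K], THEN mp, OF assms(2)] by (elim exE conjE) (rule that)

lemma restrict_params_ball:
  "(\<forall>\<^sub>F \<epsilon> in at_right 0. \<forall>p\<in>K. (\<lambda>\<epsilon>\<in>params. f \<epsilon>) \<epsilon> p \<in> M) \<longleftrightarrow> (\<forall>\<^sub>F \<epsilon> in at_right 0. \<forall>p\<in>K. f \<epsilon> p \<in> M)"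
  by (rule eventually_subst) (use eventually_params in eventually_elim, simp)

text \<open>Equivalent nets remain in the same chart and only the compact set grows, so that both
  can be compared in one pair of charts.\<close>

lemma hom_equiv_chart_bounded:
  fixes E :: "('x::t2_space, 'a::finite_dim_inner, 'e::t2_space, 'v::finite_dim_inner,
                'k::{real_normed_field, euclidean_space}) vbundle"
    and F :: "('y::t2_space, 'b::finite_dim_inner, 'f::t2_space, 'w::finite_dim_inner, 'k) vbundle"
  assumes F: "vector_bundle F" and u: "(u, w) \<in> hom_equiv E F" and K: "compact K"
    and c: "(W, \<psi>, \<Psi>) \<in> vb_charts F" and M: "compact M" "M \<subseteq> W"
  shows "\<forall>\<^sub>F \<epsilon> in at_right 0. \<forall>p\<in>K. hom_base E F (u \<epsilon>) p \<in> M \<Longrightarrow>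
      \<exists>M'. compact M' \<and> M \<subseteq> M' \<and> M' \<subseteq> W \<and> (\<forall>\<^sub>F \<epsilon> in at_right 0. \<forall>p\<in>K. hom_base E F (w \<epsilon>) p \<in> M')"
    and "\<forall>\<^sub>F \<epsilon> in at_right 0. \<forall>p\<in>K. hom_base E F (w \<epsilon>) p \<in> M \<Longrightarrow>
      \<exists>M'. compact M' \<and> M \<subseteq> M' \<and> M' \<subseteq> W \<and> (\<forall>\<^sub>F \<epsilon> in at_right 0. \<forall>p\<in>K. hom_base E F (u \<epsilon>) p \<in> M')"
  using EM_equiv_stay[OF vector_bundle_manifold[OF F] hom_equivD(3)[OF u] K vb_chart_base[OF F c] M]
  unfolding restrict_params_ball by blast+

lemma chart_bounded_equiv:
  fixes E :: "('x::t2_space, 'a::finite_dim_inner, 'e::t2_space, 'v::finite_dim_inner,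
                'k::{real_normed_field, euclidean_space}) vbundle"
    and F :: "('y::t2_space, 'b::finite_dim_inner, 'f::t2_space, 'w::finite_dim_inner, 'k) vbundle"
  assumes F: "vector_bundle F" and u: "(u, w) \<in> hom_equiv E F"
  shows "chart_bounded E F u \<longleftrightarrow> chart_bounded E F w"
proof
  assume cb: "chart_bounded E F u"
  show "chart_bounded E F w" unfolding chart_bounded_def
  proof (intro allI impI)
    fix K :: "'x set" assume K: "compact K"
    obtain W \<psi> \<Psi> M where l: "(W, \<psi>, \<Psi>) \<in> vb_charts F" "compact M" "M \<subseteq> W"
      "\<forall>\<^sub>F \<epsilon> in at_right 0. \<forall>p\<in>K. hom_base E F (u \<epsilon>) p \<in> M" by (rule chart_boundedD[OF cb K])
    from hom_equiv_chart_bounded(1)[OF F u K l(1-4)] obtain M' where "compact M'" "M' \<subseteq> W"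
      "\<forall>\<^sub>F \<epsilon> in at_right 0. \<forall>p\<in>K. hom_base E F (w \<epsilon>) p \<in> M'" by (elim exE conjE) (rule that)
    then show "\<exists>W \<psi> \<Psi> M. (W, \<psi>, \<Psi>) \<in> vb_charts F \<and> compact M \<and> M \<subseteq> W \<and>
     (\<forall>\<^sub>F \<epsilon> in at_right 0. \<forall>p\<in>K. hom_base E F (w \<epsilon>) p \<in> M)" using l(1) by (intro exI conjI)
  qed
next
  assume cb: "chart_bounded E F w"
  show "chart_bounded E F u" unfolding chart_bounded_def
  proof (intro allI impI)
    fix K :: "'x set" assume K: "compact K"
    obtain W \<psi> \<Psi> M where l: "(W, \<psi>, \<Psi>) \<in> vb_charts F" "compact M" "M \<subseteq> W"
      "\<forall>\<^sub>F \<epsilon> in at_right 0. \<forall>p\<in>K. hom_base E F (w \<epsilon>) p \<in> M" by (rule chart_boundedD[OF cb K])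
    from hom_equiv_chart_bounded(2)[OF F u K l(1-4)] obtain M' where "compact M'" "M' \<subseteq> W"
      "\<forall>\<^sub>F \<epsilon> in at_right 0. \<forall>p\<in>K. hom_base E F (u \<epsilon>) p \<in> M'" by (elim exE conjE) (rule that)
    then show "\<exists>W \<psi> \<Psi> M. (W, \<psi>, \<Psi>) \<in> vb_charts F \<and> compact M \<and> M \<subseteq> W \<and>
     (\<forall>\<^sub>F \<epsilon> in at_right 0. \<forall>p\<in>K. hom_base E F (u \<epsilon>) p \<in> M)" using l(1) by (intro exI conjI)
  qed
qed

lemma vb_moderateD:
  assumes "e \<in> vb_moderate E"
  obtains K where "compact K" "\<forall>\<^sub>F \<epsilon> in at_right 0. vb_proj E (e \<epsilon>) \<in> K"
  using assms unfolding vb_moderate_iff by (elim conjE exE) (rule that)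

lemma vb_chart_nhd:
  assumes E: "vector_bundle E"
  obtains V \<phi> \<Phi> N L where "(V, \<phi>, \<Phi>) \<in> vb_charts E" "open N" "p0 \<in> N" "N \<subseteq> L" "compact L" "L \<subseteq> V"
proof -
  obtain V \<phi> \<Phi> where c: "(V, \<phi>, \<Phi>) \<in> vb_charts E" "p0 \<in> V" using vb_chart_at[OF E] .
  note A = vector_bundle_manifold[OF E]
  obtain N L where "open N" "p0 \<in> N" "N \<subseteq> L" "compact L" "L \<subseteq> V"
    by (rule manifold_compact_nhd[OF A c(2) chart_open[OF A vb_chart_base[OF E c(1)]]])
  then show thesis by (rule that[OF c(1)])
qed

lemma hom_value_bound:
  fixes E :: "('x::t2_space, 'a::finite_dim_inner, 'e::t2_space, 'v::finite_dim_inner,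
                'k::{real_normed_field, euclidean_space}) vbundle"
    and F :: "('y::t2_space, 'b::finite_dim_inner, 'f::t2_space, 'w::finite_dim_inner, 'k) vbundle"
  assumes E: "vector_bundle E" and F: "vector_bundle F" and v: "v \<in> EM_VB E F"
    and c: "(V, \<phi>, \<Phi>) \<in> vb_charts E" "(W, \<psi>, \<Psi>) \<in> vb_charts F"
    and L: "compact L" "L \<subseteq> V" "compact M" "M \<subseteq> W"
  obtains N :: nat and C where "C > 0" "\<forall>\<^sub>F \<epsilon> in at_right 0. \<forall>p\<in>L. hom_base E F (v \<epsilon>) p \<in> M \<longrightarrow>
    (\<forall>\<xi>. norm (hom_rep E (V, \<phi>, \<Phi>) (W, \<psi>, \<Psi>) (v \<epsilon>) (\<phi> p) \<xi>) \<le> C * \<epsilon> powr - real N * norm \<xi>)"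
proof -
  obtain N :: nat and C where C: "C > 0" "\<forall>\<^sub>F \<epsilon> in at_right 0. \<forall>p\<in>L. hom_base E F (v \<epsilon>) p \<in> M \<longrightarrow>
    hom_deriv_norm 0 (hom_rep E (V, \<phi>, \<Phi>) (W, \<psi>, \<Psi>) (v \<epsilon>)) (\<phi> p) \<le> ennreal (C * \<epsilon> powr - real N)"
    by (rule EM_VB_bound[OF v c L])
  have "\<forall>\<^sub>F \<epsilon> in at_right 0. \<forall>p\<in>L. hom_base E F (v \<epsilon>) p \<in> M \<longrightarrow>
    (\<forall>\<xi>. norm (hom_rep E (V, \<phi>, \<Phi>) (W, \<psi>, \<Psi>) (v \<epsilon>) (\<phi> p) \<xi>) \<le> C * \<epsilon> powr - real N * norm \<xi>)"
    using C(2) eventually_params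
  proof eventually_elim
    case (elim \<epsilon>)
    show ?case
    proof (intro ballI impI allI)
      fix p \<xi> assume p: "p \<in> L" "hom_base E F (v \<epsilon>) p \<in> M"
      have "linear (hom_rep E (V, \<phi>, \<Phi>) (W, \<psi>, \<Psi>) (v \<epsilon>) (\<phi> p))"
        by (rule hom_rep_linear[OF E F EM_VB_homs[OF v elim(2)] c]) (use p L in blast)+
      then show "norm (hom_rep E (V, \<phi>, \<Phi>) (W, \<psi>, \<Psi>) (v \<epsilon>) (\<phi> p) \<xi>) \<le> C * \<epsilon> powr - real N * norm \<xi>"
        by (rule hom_deriv_norm_0) (use elim(1) p C(1) in auto)
    qed
  qed
  then show thesis by (rule that[OF C(1)])
qed

text \<open>Base points stay in a compact set by moderateness of the base maps. Fiber norms are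
  estimated locally: a moderate matrix applied to a moderate vector, translated to the fiber metric
  of \<open>F\<close> over the compact set \<open>M\<close>.\<close>

lemma hom_value_moderate:
  fixes E :: "('x::t2_space, 'a::finite_dim_inner, 'e::t2_space, 'v::finite_dim_inner,
                'k::{real_normed_field, euclidean_space}) vbundle"
    and F :: "('y::t2_space, 'b::finite_dim_inner, 'f::t2_space, 'w::finite_dim_inner, 'k) vbundle"
  assumes E: "vector_bundle E" and F: "vector_bundle F" and v: "v \<in> EM_VB E F" and cb: "chart_bounded E F v"
    and e: "e \<in> vb_moderate E"
  shows "(\<lambda>\<epsilon>\<in>params. v \<epsilon> (e \<epsilon>)) \<in> vb_moderate F"
proof -
  obtain h where h: "fiber_metric F h" using vector_bundle_fiber_metric_ex[OF F] by (elim exE) (rule that)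
  obtain K where K: "compact K" "\<forall>\<^sub>F \<epsilon> in at_right 0. vb_proj E (e \<epsilon>) \<in> K" by (rule vb_moderateD[OF e])
  obtain K' where K': "compact K'" "\<forall>\<^sub>F \<epsilon> in at_right 0. \<forall>p\<in>K. (\<lambda>\<epsilon>\<in>params. hom_base E F (v \<epsilon>)) \<epsilon> p \<in> K'"
    by (rule EM_compact[OF EM_VB_base[OF v] K(1)])
  have 1: "\<forall>\<^sub>F \<epsilon> in at_right 0. vb_proj F (v \<epsilon> (e \<epsilon>)) \<in> K'"
    using K'(2) K(2) eventually_params
    by eventually_elim (simp add: vb_homs_proj[OF EM_VB_homs[OF v]])
  have "moder_on (\<lambda>\<epsilon>. vb_proj E (e \<epsilon>) \<in> K) (\<lambda>\<epsilon>. fiber_norm h (v \<epsilon> (e \<epsilon>)))" using K(1)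
  proof (induction rule: compact_local_induct)
    case (local p0)
    obtain V \<phi> \<Phi> N0 L where c: "(V, \<phi>, \<Phi>) \<in> vb_charts E" and N0: "open N0" "p0 \<in> N0" "N0 \<subseteq> L"
      and L: "compact L" "L \<subseteq> V" by (rule vb_chart_nhd[OF E])
    obtain W \<psi> \<Psi> M where d: "(W, \<psi>, \<Psi>) \<in> vb_charts F" and M: "compact M" "M \<subseteq> W"
      and stay: "\<forall>\<^sub>F \<epsilon> in at_right 0. \<forall>p\<in>L. hom_base E F (v \<epsilon>) p \<in> M" by (rule chart_boundedD[OF cb L(1)])
    obtain N :: nat and C where C: "C > 0" "\<forall>\<^sub>F \<epsilon> in at_right 0. \<forall>p\<in>L. hom_base E F (v \<epsilon>) p \<in> M \<longrightarrow>
      (\<forall>\<xi>. norm (hom_rep E (V, \<phi>, \<Phi>) (W, \<psi>, \<Psi>) (v \<epsilon>) (\<phi> p) \<xi>) \<le> C * \<epsilon> powr - real N * norm \<xi>)"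
      by (rule hom_value_bound[OF E F v c d L M])
    obtain k where k: "k > 0" "\<And>z. vb_proj F z \<in> M \<Longrightarrow> fiber_norm h z \<le> k * norm (\<Psi> z)"
      by (rule fiber_norm_bounds[OF F h d M]) (rule that; assumption)
    \<comment> \<open>\<open>k\<close> compares the fiber metric of \<open>F\<close> with
      coordinates, and \<open>C\<close> and \<open>N\<close> bound the matrix of
      \<open>v\<close>.\<close>
    have "moder_on (\<lambda>\<epsilon>. vb_proj E (e \<epsilon>) \<in> L) (\<lambda>\<epsilon>. (k * C) * \<epsilon> powr - real N * norm (\<Phi> (e \<epsilon>)))"
      by (rule moder_on_mult[OF moder_on_powr vb_moderate_chart[OF E e c L]]) (use k C in simp_all)
    then have "moder_on (\<lambda>\<epsilon>. vb_proj E (e \<epsilon>) \<in> N0) (\<lambda>\<epsilon>. fiber_norm h (v \<epsilon> (e \<epsilon>)))"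
    proof (rule moder_on_mono)
      show "\<forall>\<^sub>F \<epsilon> in at_right 0. vb_proj E (e \<epsilon>) \<in> N0 \<longrightarrow> vb_proj E (e \<epsilon>) \<in> L \<and>
        fiber_norm h (v \<epsilon> (e \<epsilon>)) \<le> (k * C) * \<epsilon> powr - real N * norm (\<Phi> (e \<epsilon>))"
        using C(2) stay eventually_params
      proof eventually_elim
        case (elim \<epsilon>)
        show ?case
        proof
          assume "vb_proj E (e \<epsilon>) \<in> N0"
          then have p: "vb_proj E (e \<epsilon>) \<in> L" "vb_proj E (e \<epsilon>) \<in> V" using N0 L by blast+
          then have pM: "vb_proj F (v \<epsilon> (e \<epsilon>)) \<in> M" using elim(2) by (simp add: vb_homs_proj[OF EM_VB_homs[OF v elim(3)]])
          have "norm (\<Psi> (v \<epsilon> (e \<epsilon>))) \<le> C * \<epsilon> powr - real N * norm (\<Phi> (e \<epsilon>))"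
            using bspec[OF elim(1) p(1)] bspec[OF elim(2) p(1)] hom_rep_apply[OF E c p(2), of W \<psi> \<Psi> "v \<epsilon>"] by metis
          then have "k * norm (\<Psi> (v \<epsilon> (e \<epsilon>))) \<le> k * (C * \<epsilon> powr - real N * norm (\<Phi> (e \<epsilon>)))"
            using k(1) by (intro mult_left_mono) auto
          then show "vb_proj E (e \<epsilon>) \<in> L \<and> fiber_norm h (v \<epsilon> (e \<epsilon>)) \<le> (k * C) * \<epsilon> powr - real N * norm (\<Phi> (e \<epsilon>))"
            using k(2)[OF pM] p(1) by (simp add: mult.assoc)
        qed
      qed
    qed
    then show ?case using N0 by (intro exI[of _ N0] conjI)
  next
    case empty show ?case using moder_on_False by simp
  next
    case (union X Y) from moder_on_Un[OF union] show ?case by (rule moder_on_mono[OF _ always_eventually]) auto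
  next
    case (mono X Y) show ?case by (rule moder_on_mono[OF mono(2) always_eventually]) (use mono(1) in auto)
  qed
  then have "moder_on (\<lambda>_. True) (\<lambda>\<epsilon>. fiber_norm h (v \<epsilon> (e \<epsilon>)))"
    by (rule moder_on_mono) (use K(2) in \<open>auto elim: eventually_mono\<close>)
  then show ?thesis by (rule vb_moderate_restrictI[OF K'(1) 1 h])
qed

text \<open>The argument is the same on both sides, so no derivative is involved: base coordinates
  are close by equivalence of the base maps, and the difference of the two matrices is negligible
  and acts on a moderate vector.\<close>

lemma hom_value_equiv:
  fixes E :: "('x::t2_space, 'a::finite_dim_inner, 'e::t2_space, 'v::finite_dim_inner,
                'k::{real_normed_field, euclidean_space}) vbundle"
    and F :: "('y::t2_space, 'b::finite_dim_inner, 'f::t2_space, 'w::finite_dim_inner, 'k) vbundle"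
  assumes E: "vector_bundle E" and F: "vector_bundle F" and uv: "(u, v) \<in> hom_equiv E F" and cb: "chart_bounded E F u"
    and g: "riemannian_metric (vb_base F) g" and e: "e \<in> vb_moderate E"
  shows "((\<lambda>\<epsilon>\<in>params. u \<epsilon> (e \<epsilon>)), (\<lambda>\<epsilon>\<in>params. v \<epsilon> (e \<epsilon>))) \<in> vb_equiv F"
proof -
  note u = hom_equivD(1)[OF uv] and v = hom_equivD(2)[OF uv]
  have cv: "chart_bounded E F v" using chart_bounded_equiv[OF F uv] cb by simp
  obtain K where K: "compact K" "\<forall>\<^sub>F \<epsilon> in at_right 0. vb_proj E (e \<epsilon>) \<in> K" by (rule vb_moderateD[OF e])
  show ?thesis
  proof (rule vb_equiv_local[OF F g hom_value_moderate[OF E F u cb e] hom_value_moderate[OF E F v cv e] K])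
    fix p0
    let ?p = "\<lambda>\<epsilon>. vb_proj E (e \<epsilon>)"
    obtain V \<phi> \<Phi> N0 L where c: "(V, \<phi>, \<Phi>) \<in> vb_charts E" and N0: "open N0" "p0 \<in> N0" "N0 \<subseteq> L"
      and L: "compact L" "L \<subseteq> V" by (rule vb_chart_nhd[OF E])
    obtain W \<psi> \<Psi> M0 where d: "(W, \<psi>, \<Psi>) \<in> vb_charts F" and M0: "compact M0" "M0 \<subseteq> W"
      and stay0: "\<forall>\<^sub>F \<epsilon> in at_right 0. \<forall>p\<in>L. hom_base E F (u \<epsilon>) p \<in> M0" by (rule chart_boundedD[OF cb L(1)])
    obtain M where M: "compact M" "M0 \<subseteq> M" "M \<subseteq> W"
      and stay: "\<forall>\<^sub>F \<epsilon> in at_right 0. \<forall>p\<in>L. hom_base E F (v \<epsilon>) p \<in> M"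
      using hom_equiv_chart_bounded(1)[OF F uv L(1) d M0 stay0] by (elim exE conjE) (rule that)
    have in_M: "\<forall>\<^sub>F \<epsilon> in at_right 0. \<forall>p\<in>L. hom_base E F (u \<epsilon>) p \<in> M \<and> hom_base E F (v \<epsilon>) p \<in> M"
      using stay0 stay by eventually_elim (use M(2) in blast)
    have pr: "\<forall>\<^sub>F \<epsilon> in at_right 0. vb_proj F (u \<epsilon> (e \<epsilon>)) = hom_base E F (u \<epsilon>) (?p \<epsilon>) \<and>
      vb_proj F (v \<epsilon> (e \<epsilon>)) = hom_base E F (v \<epsilon>) (?p \<epsilon>)"
      using eventually_params
      by eventually_elim (simp add: vb_homs_proj[OF EM_VB_homs[OF u]] vb_homs_proj[OF EM_VB_homs[OF v]])
    have "\<forall>\<^sub>F \<epsilon> in at_right 0. ?p \<epsilon> \<in> N0 \<longrightarrow> vb_proj F (u \<epsilon> (e \<epsilon>)) \<in> M \<and>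
        vb_proj F (v \<epsilon> (e \<epsilon>)) \<in> M"
      using pr in_M by eventually_elim (use N0(3) in auto)
    moreover have "negl_on (\<lambda>\<epsilon>. ?p \<epsilon> \<in> N0) (\<lambda>\<epsilon>. norm (\<psi> (vb_proj F (u \<epsilon> (e \<epsilon>)))
        - \<psi> (vb_proj F (v \<epsilon> (e \<epsilon>)))))"
    proof (rule negl_on_mono[OF EM_equiv_chart[OF vector_bundle_manifold[OF E] hom_equivD(3)[OF uv]
            vb_chart_base[OF E c] vb_chart_base[OF F d] L M(1,3), where p = ?p]])
      show "\<forall>\<^sub>F \<epsilon> in at_right 0. ?p \<epsilon> \<in> N0 \<longrightarrow>
         (?p \<epsilon> \<in> L \<and> (\<lambda>\<epsilon>\<in>params. hom_base E F (u \<epsilon>)) \<epsilon> (?p \<epsilon>) \<in> M \<and> (\<lambda>\<epsilon>\<in>params. hom_base E F (v \<epsilon>)) \<epsilon> (?p \<epsilon>) \<in> M) \<and>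
         norm (\<psi> (vb_proj F (u \<epsilon> (e \<epsilon>))) - \<psi> (vb_proj F (v \<epsilon> (e \<epsilon>)))) \<le>
         norm (\<psi> ((\<lambda>\<epsilon>\<in>params. hom_base E F (u \<epsilon>)) \<epsilon> (?p \<epsilon>)) - \<psi> ((\<lambda>\<epsilon>\<in>params. hom_base E F (v \<epsilon>)) \<epsilon> (?p \<epsilon>)))"
        using pr in_M eventually_params by eventually_elim (use N0(3) in auto)
    qed
    moreover have "negl_on (\<lambda>\<epsilon>. ?p \<epsilon> \<in> N0) (\<lambda>\<epsilon>. norm (\<Psi> (u \<epsilon> (e \<epsilon>)) - \<Psi> (v \<epsilon> (e \<epsilon>))))"
    proof -
      \<comment> \<open>The size of the matrix difference on the single vector that matters; it is
        negligible and is multiplied by the moderate norm of that vector.\<close>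
      define f where "f \<epsilon> = norm (\<Psi> (u \<epsilon> (e \<epsilon>)) - \<Psi> (v \<epsilon> (e \<epsilon>))) / norm (\<Phi> (e \<epsilon>))" for \<epsilon>
      have main: "\<forall>\<^sub>F \<epsilon> in at_right 0. ?p \<epsilon> \<in> L \<longrightarrow>
          norm (\<Psi> (u \<epsilon> (e \<epsilon>)) - \<Psi> (v \<epsilon> (e \<epsilon>))) \<le> C * \<epsilon> powr real m * norm (\<Phi> (e \<epsilon>))"
        if C: "C > 0" "\<forall>\<^sub>F \<epsilon> in at_right 0. \<forall>p\<in>L. hom_base E F (u \<epsilon>) p \<in> M \<longrightarrow> hom_base E F (v \<epsilon>) p \<in> M \<longrightarrow>
          hom_deriv_norm 0 (\<lambda>x \<xi>. hom_rep E (V, \<phi>, \<Phi>) (W, \<psi>, \<Psi>) (u \<epsilon>) x \<xi> - hom_rep E (V, \<phi>, \<Phi>) (W, \<psi>, \<Psi>) (v \<epsilon>) x \<xi>) (\<phi> p)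
          \<le> ennreal (C * \<epsilon> powr real m)" for C and m :: nat
        using C(2) in_M eventually_params
      proof eventually_elim
        case (elim \<epsilon>)
        show ?case
        proof
          assume p: "?p \<epsilon> \<in> L"
          then have pV: "?p \<epsilon> \<in> V" and b: "hom_base E F (u \<epsilon>) (?p \<epsilon>) \<in> W" "hom_base E F (v \<epsilon>) (?p \<epsilon>) \<in> W"
            using L(2) elim(2) M(3) by blast+
          let ?T = "\<lambda>x \<xi>. hom_rep E (V, \<phi>, \<Phi>) (W, \<psi>, \<Psi>) (u \<epsilon>) x \<xi> - hom_rep E (V, \<phi>, \<Phi>) (W, \<psi>, \<Psi>) (v \<epsilon>) x \<xi>"
          have "linear (?T (\<phi> (?p \<epsilon>)))"
            by (intro linear_compose_sub hom_rep_linear[OF E F _ c d pV] EM_VB_homs[OF u elim(3)] EM_VB_homs[OF v elim(3)] b)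
          then have "norm (?T (\<phi> (?p \<epsilon>)) (\<Phi> (e \<epsilon>))) \<le> C * \<epsilon> powr real m * norm (\<Phi> (e \<epsilon>))"
            by (rule hom_deriv_norm_0) (use elim p C(1) in auto)
          then show "norm (\<Psi> (u \<epsilon> (e \<epsilon>)) - \<Psi> (v \<epsilon> (e \<epsilon>))) \<le> C * \<epsilon> powr real m * norm (\<Phi> (e \<epsilon>))"
            by (simp add: hom_rep_apply[OF E c pV])
        qed
      qed
      have "negl_on (\<lambda>\<epsilon>. ?p \<epsilon> \<in> L) f"
        unfolding negl_on_def
      proof (intro allI impI)
        fix m :: nat assume m: "m \<ge> 1"
        obtain C where C: "C > 0" "\<forall>\<^sub>F \<epsilon> in at_right 0. \<forall>p\<in>L. hom_base E F (u \<epsilon>) p \<in> M \<longrightarrow> hom_base E F (v \<epsilon>) p \<in> M \<longrightarrow>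
          hom_deriv_norm 0 (\<lambda>x \<xi>. hom_rep E (V, \<phi>, \<Phi>) (W, \<psi>, \<Psi>) (u \<epsilon>) x \<xi> - hom_rep E (V, \<phi>, \<Phi>) (W, \<psi>, \<Psi>) (v \<epsilon>) x \<xi>) (\<phi> p)
          \<le> ennreal (C * \<epsilon> powr real m)"
          by (rule hom_equiv_bound[OF uv m c d L M(1,3)])
        have "\<forall>\<^sub>F \<epsilon> in at_right 0. ?p \<epsilon> \<in> L \<longrightarrow> f \<epsilon> \<le> C * \<epsilon> powr real m"
          using main[OF C]
        proof eventually_elim
          case (elim \<epsilon>) then show ?case using C(1) by (cases "\<Phi> (e \<epsilon>) = 0") (auto simp: f_def divide_le_eq)
        qed
        then show "\<exists>C>0. \<forall>\<^sub>F \<epsilon> in at_right 0. ?p \<epsilon> \<in> L \<longrightarrow> f \<epsilon> \<le> C * \<epsilon> powr real m"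
          using C(1) by (intro exI[of _ C] conjI)
      qed
      then have n: "negl_on (\<lambda>\<epsilon>. ?p \<epsilon> \<in> L) (\<lambda>\<epsilon>. norm (\<Phi> (e \<epsilon>)) * f \<epsilon>)"
        by (rule negl_on_mult[OF vb_moderate_chart[OF E e c L]]) (simp add: f_def)
      \<comment> \<open>Where the coordinate of \<open>e\<close> is 0 the quotient is 0 by
        convention. The estimate of order 1 shows that the difference of the values vanishes there
        too.\<close>
      obtain C where C: "C > 0" "\<forall>\<^sub>F \<epsilon> in at_right 0. \<forall>p\<in>L. hom_base E F (u \<epsilon>) p \<in> M \<longrightarrow> hom_base E F (v \<epsilon>) p \<in> M \<longrightarrow>
          hom_deriv_norm 0 (\<lambda>x \<xi>. hom_rep E (V, \<phi>, \<Phi>) (W, \<psi>, \<Psi>) (u \<epsilon>) x \<xi> - hom_rep E (V, \<phi>, \<Phi>) (W, \<psi>, \<Psi>) (v \<epsilon>) x \<xi>) (\<phi> p)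
          \<le> ennreal (C * \<epsilon> powr real 1)"
        by (rule hom_equiv_bound[OF uv order_refl c d L M(1,3)])
      show ?thesis
      proof (rule negl_on_mono[OF n])
        show "\<forall>\<^sub>F \<epsilon> in at_right 0. ?p \<epsilon> \<in> N0 \<longrightarrow> ?p \<epsilon> \<in> L \<and>
          norm (\<Psi> (u \<epsilon> (e \<epsilon>)) - \<Psi> (v \<epsilon> (e \<epsilon>))) \<le> norm (\<Phi> (e \<epsilon>)) * f \<epsilon>"
          using main[OF C] eventually_params
        proof eventually_elim
          case (elim \<epsilon>) then show ?case using N0(3) by (cases "\<Phi> (e \<epsilon>) = 0") (auto simp: f_def)
        qed
      qed
    qed
    ultimately show "\<exists>U W \<psi> \<Psi> M. open U \<and> p0 \<in> U \<and> (W, \<psi>, \<Psi>) \<in> vb_charts F \<and> compact M \<and> M \<subseteq> W \<and>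
      (\<forall>\<^sub>F \<epsilon> in at_right 0. ?p \<epsilon> \<in> U \<longrightarrow> vb_proj F (u \<epsilon> (e \<epsilon>)) \<in> M \<and>
        vb_proj F (v \<epsilon> (e \<epsilon>)) \<in> M) \<and>
      negl_on (\<lambda>\<epsilon>. ?p \<epsilon> \<in> U) (\<lambda>\<epsilon>. norm (\<psi> (vb_proj F (u \<epsilon> (e \<epsilon>)))
        - \<psi> (vb_proj F (v \<epsilon> (e \<epsilon>))))) \<and>
      negl_on (\<lambda>\<epsilon>. ?p \<epsilon> \<in> U) (\<lambda>\<epsilon>. norm (\<Psi> (u \<epsilon> (e \<epsilon>)) - \<Psi> (v \<epsilon> (e \<epsilon>))))"
      using N0(1,2) d M(1,3)
      by (intro exI[of _ N0] exI[of _ W] exI[of _ \<psi>] exI[of _ \<Psi>] exI[of _ M] conjI)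
  qed
qed

lemma smooth_maps_chart:
  assumes "f \<in> smooth_maps A B" "(V, \<phi>) \<in> A" "(W, \<psi>) \<in> B"
  shows "continuous_on UNIV f" "smooth_on (\<phi> ` (V \<inter> f -` W)) (\<psi> \<circ> f \<circ> inv_into V \<phi>)"
proof -
  note * = assms(1)[unfolded smooth_maps_def mem_Collect_eq]
  show "continuous_on UNIV f" by (rule *[THEN conjunct1])
  show "smooth_on (\<phi> ` (V \<inter> f -` W)) (\<psi> \<circ> f \<circ> inv_into V \<phi>)"
    by (rule bspec[OF bspec[OF *[THEN conjunct2] assms(2), unfolded prod.case] assms(3), unfolded prod.case])
qed

text \<open>Two mean value estimates on a coordinate ball around the first base point, one for the
  base map and one for the matrix applied to the fixed vector of \<open>e'\<close>.\<close>

lemma hom_value_point_equiv: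
  fixes E :: "('x::t2_space, 'a::finite_dim_inner, 'e::t2_space, 'v::finite_dim_inner,
                'k::{real_normed_field, euclidean_space}) vbundle"
    and F :: "('y::t2_space, 'b::finite_dim_inner, 'f::t2_space, 'w::finite_dim_inner, 'k) vbundle"
  assumes E: "vector_bundle E" and F: "vector_bundle F" and v: "v \<in> EM_VB E F" and cb: "chart_bounded E F v"
    and g: "riemannian_metric (vb_base F) g" and ee: "(e, e') \<in> vb_equiv E"
  shows "((\<lambda>\<epsilon>\<in>params. v \<epsilon> (e \<epsilon>)), (\<lambda>\<epsilon>\<in>params. v \<epsilon> (e' \<epsilon>))) \<in> vb_equiv F"
proof -
  note A = vector_bundle_manifold[OF E] and B = vector_bundle_manifold[OF F]
  note e = vb_equivD(1)[OF ee] and e' = vb_equivD(2)[OF ee]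
  obtain K where K: "compact K" "\<forall>\<^sub>F \<epsilon> in at_right 0. vb_proj E (e \<epsilon>) \<in> K" by (rule vb_moderateD[OF e])
  let ?p = "\<lambda>\<epsilon>. vb_proj E (e \<epsilon>)" and ?q = "\<lambda>\<epsilon>. vb_proj E (e' \<epsilon>)"
  show ?thesis
  proof (rule vb_equiv_local[OF F g hom_value_moderate[OF E F v cb e] hom_value_moderate[OF E F v cb e'] K])
    fix p0
    obtain V \<phi> \<Phi> N0 L where c: "(V, \<phi>, \<Phi>) \<in> vb_charts E" and N0: "open N0" "p0 \<in> N0" "N0 \<subseteq> L"
      and L: "compact L" "L \<subseteq> V" by (rule vb_chart_nhd[OF E])
    note cA = vb_chart_base[OF E c]
    obtain \<rho> X where X: "\<rho> > 0" "compact X" "X \<subseteq> V" "L \<subseteq> X" "\<And>p. p \<in> L \<Longrightarrow> cball (\<phi> p) \<rho> \<subseteq> \<phi> ` X"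
      "\<And>p q. p \<in> L \<Longrightarrow> q \<in> V \<Longrightarrow> norm (\<phi> p - \<phi> q) < \<rho> \<Longrightarrow> q \<in> X"
      by (rule chart_thickening[OF A cA L]) (rule that; assumption)
    \<comment> \<open>Applied to \<open>X\<close> and not to \<open>L\<close>, since every point of
      the ball must be mapped into the same chart.\<close>
    obtain W \<psi> \<Psi> M where d: "(W, \<psi>, \<Psi>) \<in> vb_charts F" and M: "compact M" "M \<subseteq> W"
      and stay: "\<forall>\<^sub>F \<epsilon> in at_right 0. \<forall>p\<in>X. hom_base E F (v \<epsilon>) p \<in> M" by (rule chart_boundedD[OF cb X(2)])
    note dB = vb_chart_base[OF F d]
    note pe = point_equiv_chart[OF A vb_equivD(3)[OF ee] cA L]
    let ?\<delta> = "\<lambda>\<epsilon>. norm (\<phi> (?p \<epsilon>) - \<phi> (?q \<epsilon>))"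
    have nd: "negl_on (\<lambda>\<epsilon>. ?p \<epsilon> \<in> N0) ?\<delta>"
    proof (rule negl_on_mono[OF pe(1)])
      show "\<forall>\<^sub>F \<epsilon> in at_right 0. ?p \<epsilon> \<in> N0 \<longrightarrow> (\<lambda>\<epsilon>\<in>params. ?p \<epsilon>) \<epsilon> \<in> L \<and>
        ?\<delta> \<epsilon> \<le> norm (\<phi> ((\<lambda>\<epsilon>\<in>params. ?p \<epsilon>) \<epsilon>) - \<phi> ((\<lambda>\<epsilon>\<in>params. ?q \<epsilon>) \<epsilon>))"
        using eventually_params by eventually_elim (use N0(3) in auto)
    qed
    have near: "\<forall>\<^sub>F \<epsilon> in at_right 0. ?p \<epsilon> \<in> N0 \<longrightarrow> ?p \<epsilon> \<in> L \<and> ?p \<epsilon> \<in> X \<and> ?q \<epsilon> \<in> X \<and> ?\<delta> \<epsilon> < \<rho>"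
      using negl_on_small[OF nd X(1)] pe(2) eventually_params
    proof eventually_elim
      case (elim \<epsilon>)
      show ?case
      proof
        assume "?p \<epsilon> \<in> N0"
        then have "?p \<epsilon> \<in> L" "?\<delta> \<epsilon> < \<rho>" using N0(3) elim by auto
        moreover from this elim have "?q \<epsilon> \<in> V" by simp
        ultimately show "?p \<epsilon> \<in> L \<and> ?p \<epsilon> \<in> X \<and> ?q \<epsilon> \<in> X \<and> ?\<delta> \<epsilon> < \<rho>" using X(4,6) by blast
      qed
    qed
    have pr: "\<forall>\<^sub>F \<epsilon> in at_right 0. vb_proj F (v \<epsilon> (e \<epsilon>)) = hom_base E F (v \<epsilon>) (?p \<epsilon>) \<and>
      vb_proj F (v \<epsilon> (e' \<epsilon>)) = hom_base E F (v \<epsilon>) (?q \<epsilon>)"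
      using eventually_params by eventually_elim (simp add: vb_homs_proj[OF EM_VB_homs[OF v]])
    have "\<forall>\<^sub>F \<epsilon> in at_right 0. ?p \<epsilon> \<in> N0 \<longrightarrow> vb_proj F (v \<epsilon> (e \<epsilon>)) \<in> M \<and>
        vb_proj F (v \<epsilon> (e' \<epsilon>)) \<in> M"
      using pr near stay by eventually_elim auto
    moreover have "negl_on (\<lambda>\<epsilon>. ?p \<epsilon> \<in> N0) (\<lambda>\<epsilon>. norm (\<psi> (vb_proj F (v \<epsilon> (e \<epsilon>)))
        - \<psi> (vb_proj F (v \<epsilon> (e' \<epsilon>)))))"
    proof -
      obtain N :: nat and C where C: "C > 0" "\<forall>\<^sub>F \<epsilon> in at_right 0. \<forall>p\<in>X. (\<lambda>\<epsilon>\<in>params. hom_base E F (v \<epsilon>)) \<epsilon> p \<in> M \<longrightarrow>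
        deriv_norm 1 (\<psi> \<circ> (\<lambda>\<epsilon>\<in>params. hom_base E F (v \<epsilon>)) \<epsilon> \<circ> inv_into V \<phi>) (\<phi> p) \<le> ennreal (C * \<epsilon> powr - real N)"
        by (rule EM_deriv_bound[OF EM_VB_base[OF v] order_refl cA dB X(2,3) M])
      have "negl_on (\<lambda>\<epsilon>. ?p \<epsilon> \<in> N0) (\<lambda>\<epsilon>. C * \<epsilon> powr - real N * ?\<delta> \<epsilon>)"
        by (rule negl_on_mult[OF moder_on_powr[OF C(1)] nd]) simp
      then show ?thesis
      proof (rule negl_on_mono)
        show "\<forall>\<^sub>F \<epsilon> in at_right 0. ?p \<epsilon> \<in> N0 \<longrightarrow> ?p \<epsilon> \<in> N0 \<and> norm (\<psi> (vb_proj F (v \<epsilon> (e \<epsilon>)))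
          - \<psi> (vb_proj F (v \<epsilon> (e' \<epsilon>)))) \<le> C * \<epsilon> powr - real N * ?\<delta> \<epsilon>"
          using C(2) pr near stay eventually_params
        proof eventually_elim
          case (elim \<epsilon>)
          let ?b = "hom_base E F (v \<epsilon>)"
          have b: "?b \<in> smooth_maps (vb_base E) (vb_base F)"
            using EM_smooth_maps[OF EM_VB_base[OF v] elim(5)] elim(5) by simp
          have bound: "norm (\<psi> (?b (?p \<epsilon>)) - \<psi> (?b (?q \<epsilon>))) \<le> C * \<epsilon> powr - real N * ?\<delta> \<epsilon>" if pN: "?p \<epsilon> \<in> N0"
          proof -
            have pq: "?p \<epsilon> \<in> L" "?p \<epsilon> \<in> V" "?q \<epsilon> \<in> V" "?\<delta> \<epsilon> < \<rho>" using elim(3) pN X(3) by auto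
            let ?f = "\<psi> \<circ> ?b \<circ> inv_into V \<phi>"
            have "norm (?f (\<phi> (?p \<epsilon>)) - ?f (\<phi> (?q \<epsilon>))) \<le> C * \<epsilon> powr - real N * ?\<delta> \<epsilon>"
            proof (rule mean_value_cball)
              fix x assume "x \<in> cball (\<phi> (?p \<epsilon>)) \<rho>"
              then obtain r where r: "r \<in> X" "x = \<phi> r" using X(5)[OF pq(1)] by blast
              have rM: "?b r \<in> M" using elim(4) r(1) by blast
              have "x \<in> \<phi> ` (V \<inter> ?b -` W)" using r rM X(3) M(2) by blast
              then show df: "?f differentiable at x"
                by (rule differentiableI[OF smooth_on_has_derivative[OF smooth_maps_chart(2)[OF b cA dB]]])
              have "deriv_norm 1 ?f x \<le> ennreal (C * \<epsilon> powr - real N)" using elim(1,5) r rM by simp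
              then show "norm (frechet_derivative ?f (at x) w) \<le> C * \<epsilon> powr - real N * norm w" for w
                by (rule deriv_norm_1[OF df]) (use C(1) in simp)
            next
              show "\<phi> (?q \<epsilon>) \<in> cball (\<phi> (?p \<epsilon>)) \<rho>" using pq(4) by (simp add: dist_norm)
            qed
            then show ?thesis using pq by (simp add: chart_inv[OF A cA])
          qed
          show ?case
          proof
            assume "?p \<epsilon> \<in> N0"
            with bound elim(2) show "?p \<epsilon> \<in> N0 \<and> norm (\<psi> (vb_proj F (v \<epsilon> (e \<epsilon>)))
              - \<psi> (vb_proj F (v \<epsilon> (e' \<epsilon>)))) \<le> C * \<epsilon> powr - real N * ?\<delta> \<epsilon>" by simp
          qed
        qed
      qed
    qed
    moreover have "negl_on (\<lambda>\<epsilon>. ?p \<epsilon> \<in> N0) (\<lambda>\<epsilon>. norm (\<Psi> (v \<epsilon> (e \<epsilon>)) - \<Psi> (v \<epsilon> (e' \<epsilon>))))"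
    proof -
      obtain N1 :: nat and C1 where C1: "C1 > 0" "\<forall>\<^sub>F \<epsilon> in at_right 0. \<forall>p\<in>X. hom_base E F (v \<epsilon>) p \<in> M \<longrightarrow>
        (\<forall>\<xi>. norm (hom_rep E (V, \<phi>, \<Phi>) (W, \<psi>, \<Psi>) (v \<epsilon>) (\<phi> p) \<xi>) \<le> C1 * \<epsilon> powr - real N1 * norm \<xi>)"
        by (rule hom_value_bound[OF E F v c d X(2,3) M])
      obtain N2 :: nat and C2 where C2: "C2 > 0" "\<forall>\<^sub>F \<epsilon> in at_right 0. \<forall>p\<in>X. hom_base E F (v \<epsilon>) p \<in> M \<longrightarrow>
        hom_deriv_norm 1 (hom_rep E (V, \<phi>, \<Phi>) (W, \<psi>, \<Psi>) (v \<epsilon>)) (\<phi> p) \<le> ennreal (C2 * \<epsilon> powr - real N2)"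
        by (rule EM_VB_bound[OF v c d X(2,3) M])
      \<comment> \<open>The second base point is only known to lie in \<open>X\<close>, so the
        equivalence of \<open>e\<close> and \<open>e'\<close> is evaluated on
        \<open>X\<close>.\<close>
      have n1: "negl_on (\<lambda>\<epsilon>. ?p \<epsilon> \<in> N0) (\<lambda>\<epsilon>. norm (\<Phi> (e \<epsilon>) - \<Phi> (e' \<epsilon>)))"
        by (rule negl_on_mono[OF vb_equivD(4)[OF ee c X(2,3)]]) (use near in eventually_elim, simp)
      have m1: "moder_on (\<lambda>\<epsilon>. ?p \<epsilon> \<in> N0) (\<lambda>\<epsilon>. norm (\<Phi> (e' \<epsilon>)))"
        by (rule moder_on_mono[OF vb_moderate_chart[OF E e' c X(2,3)]]) (use near in eventually_elim, simp)
      have n2: "negl_on (\<lambda>\<epsilon>. ?p \<epsilon> \<in> N0) (\<lambda>\<epsilon>. norm (\<Phi> (e' \<epsilon>)) * ?\<delta> \<epsilon>)"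
        by (rule negl_on_mult[OF m1 nd]) simp
      have "negl_on (\<lambda>\<epsilon>. ?p \<epsilon> \<in> N0) (\<lambda>\<epsilon>. C1 * \<epsilon> powr - real N1 * norm (\<Phi> (e \<epsilon>) - \<Phi> (e' \<epsilon>))
          + C2 * \<epsilon> powr - real N2 * (norm (\<Phi> (e' \<epsilon>)) * ?\<delta> \<epsilon>))"
        by (intro negl_on_add negl_on_mult[OF moder_on_powr[OF C1(1)] n1] negl_on_mult[OF moder_on_powr[OF C2(1)] n2]) simp_all
      then show ?thesis
      proof (rule negl_on_mono)
        show "\<forall>\<^sub>F \<epsilon> in at_right 0. ?p \<epsilon> \<in> N0 \<longrightarrow> ?p \<epsilon> \<in> N0 \<and>
          norm (\<Psi> (v \<epsilon> (e \<epsilon>)) - \<Psi> (v \<epsilon> (e' \<epsilon>)))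
          \<le> C1 * \<epsilon> powr - real N1 * norm (\<Phi> (e \<epsilon>) - \<Phi> (e' \<epsilon>))
            + C2 * \<epsilon> powr - real N2 * (norm (\<Phi> (e' \<epsilon>)) * ?\<delta> \<epsilon>)"
          using C1(2) C2(2) near stay eventually_params
        proof eventually_elim
          case (elim \<epsilon>)
          let ?b = "hom_base E F (v \<epsilon>)" and ?T = "hom_rep E (V, \<phi>, \<Phi>) (W, \<psi>, \<Psi>) (v \<epsilon>)"
          note hom = EM_VB_homs[OF v elim(5)]
          have b: "?b \<in> smooth_maps (vb_base E) (vb_base F)"
            using EM_smooth_maps[OF EM_VB_base[OF v] elim(5)] elim(5) by simp
          have "open (?b -` W)"
            using open_vimage[OF chart_open[OF B dB] smooth_maps_chart(1)[OF b cA dB]] .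
          then have o: "open (\<phi> ` (V \<inter> ?b -` W))" by (rule chart_open_image_Int[OF A cA])
          have lin: "linear (?T x)" if "x \<in> \<phi> ` (V \<inter> ?b -` W)" for x
            using that hom_rep_linear[OF E F hom c d] by blast
          have sm: "smooth_on (\<phi> ` (V \<inter> ?b -` W)) (\<lambda>x. ?T x \<xi>)" for \<xi> by (rule hom_rep_smooth[OF o hom c d])
          have bound: "norm (\<Psi> (v \<epsilon> (e \<epsilon>)) - \<Psi> (v \<epsilon> (e' \<epsilon>))) \<le> C1 * \<epsilon> powr - real N1 * norm (\<Phi> (e \<epsilon>) - \<Phi> (e' \<epsilon>))
            + C2 * \<epsilon> powr - real N2 * (norm (\<Phi> (e' \<epsilon>)) * ?\<delta> \<epsilon>)" if pN: "?p \<epsilon> \<in> N0"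
          proof -
            have pq: "?p \<epsilon> \<in> L" "?p \<epsilon> \<in> X" "?p \<epsilon> \<in> V" "?q \<epsilon> \<in> V" "?\<delta> \<epsilon> < \<rho>" using elim(3) pN X(3) by auto
            let ?x = "\<phi> (?p \<epsilon>)" and ?y = "\<phi> (?q \<epsilon>)" and ?\<xi> = "\<Phi> (e \<epsilon>)" and ?\<eta> = "\<Phi> (e' \<epsilon>)"
            have bp: "?b (?p \<epsilon>) \<in> M" using elim(4) pq(2) by blast
            have "?x \<in> \<phi> ` (V \<inter> ?b -` W)" using bp pq M(2) by blast
            note linx = lin[OF this]
            have 1: "norm (?T ?x (?\<xi> - ?\<eta>)) \<le> C1 * \<epsilon> powr - real N1 * norm (?\<xi> - ?\<eta>)"
              using elim(1) pq(2) bp by simp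
            have "norm (?T ?x ?\<eta> - ?T ?y ?\<eta>) \<le> C2 * \<epsilon> powr - real N2 * norm ?\<eta> * ?\<delta> \<epsilon>"
            proof (rule mean_value_cball)
              fix x assume "x \<in> cball ?x \<rho>"
              then obtain r where r: "r \<in> X" "x = \<phi> r" using X(5)[OF pq(1)] by blast
              have rM: "?b r \<in> M" using elim(4) r(1) by blast
              have xU: "x \<in> \<phi> ` (V \<inter> ?b -` W)" using r rM X(3) M(2) by blast
              have df: "(\<lambda>x. ?T x \<xi>) differentiable at x" for \<xi>
                by (rule differentiableI[OF smooth_on_has_derivative[OF sm xU]])
              then show "(\<lambda>x. ?T x ?\<eta>) differentiable at x" .
              have hd: "hom_deriv_norm 1 ?T x \<le> ennreal (C2 * \<epsilon> powr - real N2)" using elim(2) r rM by simp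
              show "norm (frechet_derivative (\<lambda>x. ?T x ?\<eta>) (at x) w) \<le> C2 * \<epsilon> powr - real N2 * norm ?\<eta> * norm w" for w
                by (rule hom_deriv_norm_1[OF o xU lin df hd]) (use C2(1) in simp_all)
            next
              show "?y \<in> cball ?x \<rho>" using pq(5) by (simp add: dist_norm)
            qed
            \<comment> \<open>The vector is changed at the first base point, afterwards the base
              point is changed for the second vector; only the latter needs a derivative.\<close>
            moreover have "\<Psi> (v \<epsilon> (e \<epsilon>)) - \<Psi> (v \<epsilon> (e' \<epsilon>)) = ?T ?x (?\<xi> - ?\<eta>) + (?T ?x ?\<eta> - ?T ?y ?\<eta>)"
              unfolding hom_rep_apply[OF E c pq(3), of W \<psi> \<Psi>, symmetric] hom_rep_apply[OF E c pq(4), of W \<psi> \<Psi>, symmetric]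
                linear_diff[OF linx] by simp
            ultimately show ?thesis
              using 1 norm_triangle_ineq[of "?T ?x (?\<xi> - ?\<eta>)" "?T ?x ?\<eta> - ?T ?y ?\<eta>"] by (simp add: mult.assoc)
          qed
          show ?case using bound elim(5) by auto
        qed
      qed
    qed
    ultimately show "\<exists>U W \<psi> \<Psi> M. open U \<and> p0 \<in> U \<and> (W, \<psi>, \<Psi>) \<in> vb_charts F \<and> compact M \<and> M \<subseteq> W \<and>
      (\<forall>\<^sub>F \<epsilon> in at_right 0. ?p \<epsilon> \<in> U \<longrightarrow> vb_proj F (v \<epsilon> (e \<epsilon>)) \<in> M \<and>
        vb_proj F (v \<epsilon> (e' \<epsilon>)) \<in> M) \<and>
      negl_on (\<lambda>\<epsilon>. ?p \<epsilon> \<in> U) (\<lambda>\<epsilon>. norm (\<psi> (vb_proj F (v \<epsilon> (e \<epsilon>)))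
        - \<psi> (vb_proj F (v \<epsilon> (e' \<epsilon>))))) \<and>
      negl_on (\<lambda>\<epsilon>. ?p \<epsilon> \<in> U) (\<lambda>\<epsilon>. norm (\<Psi> (v \<epsilon> (e \<epsilon>)) - \<Psi> (v \<epsilon> (e' \<epsilon>))))"
      using N0(1,2) d M
      by (intro exI[of _ N0] exI[of _ W] exI[of _ \<psi>] exI[of _ \<Psi>] exI[of _ M] conjI)
  qed
qed

section \<open>Independence of representatives\<close>

lemma hom_value_class:
  fixes E :: "('x::t2_space, 'a::finite_dim_inner, 'e::t2_space, 'v::finite_dim_inner,
                'k::{real_normed_field, euclidean_space}) vbundle"
    and F :: "('y::t2_space, 'b::finite_dim_inner, 'f::t2_space, 'w::finite_dim_inner, 'k) vbundle"
  assumes E: "vector_bundle E" and F: "vector_bundle F" and uv: "(u, v) \<in> hom_equiv E F" and cb: "chart_bounded E F u"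
    and ee: "(e, e') \<in> vb_equiv E"
  shows "vb_class F (\<lambda>\<epsilon>\<in>params. v \<epsilon> (e' \<epsilon>)) = vb_class F (\<lambda>\<epsilon>\<in>params. u \<epsilon> (e \<epsilon>))"
proof -
  \<comment> \<open>Only the metric is wanted here, so the compact set may be empty.\<close>
  obtain g where g: "riemannian_metric (vb_base F) g"
    by (rule EM_equiv_close[OF hom_equivD(3)[OF uv] compact_empty])
  from vb_class_eq[OF F hom_value_point_equiv[OF E F hom_equivD(1)[OF uv] cb g ee]]
    vb_class_eq[OF F hom_value_equiv[OF E F uv cb g vb_equivD(2)[OF ee]]]
  show ?thesis by simp
qed

text \<open>The closure of the union of the images can itself be taken as the compact set
  \<open>M\<close>.\<close>

lemma chart_boundedI:
  fixes E :: "('x::t2_space, 'a::finite_dim_inner, 'e::t2_space, 'v::finite_dim_inner, 'k) vbundle"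
    and F :: "('y::t2_space, 'b::finite_dim_inner, 'f::t2_space, 'w::finite_dim_inner, 'k) vbundle"
  assumes "\<forall>K. compact K \<longrightarrow>
           (\<exists>\<epsilon>\<^sub>0>0. \<exists>(W, \<psi>, \<Psi>)\<in>vb_charts F.
              compact (closure (\<Union>\<epsilon>\<in>{\<epsilon>\<in>params. \<epsilon> < \<epsilon>\<^sub>0}. hom_base E F (v \<epsilon>) ` K)) \<and>
              closure (\<Union>\<epsilon>\<in>{\<epsilon>\<in>params. \<epsilon> < \<epsilon>\<^sub>0}. hom_base E F (v \<epsilon>) ` K) \<subseteq> W)"
  shows "chart_bounded E F v"
  unfolding chart_bounded_def
proof (intro allI impI)
  fix K :: "'x set" assume "compact K"
  from assms[THEN spec[of _ K], THEN mp, OF this] obtain \<epsilon>0 c where \<epsilon>0: "\<epsilon>0 > 0" "c \<in> vb_charts F"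
    and "case c of (W, \<psi>, \<Psi>) \<Rightarrow> compact (closure (\<Union>\<epsilon>\<in>{\<epsilon>\<in>params. \<epsilon> < \<epsilon>0}. hom_base E F (v \<epsilon>) ` K)) \<and>
        closure (\<Union>\<epsilon>\<in>{\<epsilon>\<in>params. \<epsilon> < \<epsilon>0}. hom_base E F (v \<epsilon>) ` K) \<subseteq> W"
    by (elim exE conjE bexE) (rule that)
  moreover obtain W \<psi> \<Psi> where c: "c = (W, \<psi>, \<Psi>)" by (cases c)
  ultimately have M: "compact (closure (\<Union>\<epsilon>\<in>{\<epsilon>\<in>params. \<epsilon> < \<epsilon>0}. hom_base E F (v \<epsilon>) ` K))"
    "closure (\<Union>\<epsilon>\<in>{\<epsilon>\<in>params. \<epsilon> < \<epsilon>0}. hom_base E F (v \<epsilon>) ` K) \<subseteq> W" by simp_all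
  have "\<forall>p\<in>K. hom_base E F (v \<epsilon>) p \<in> closure (\<Union>\<epsilon>\<in>{\<epsilon>\<in>params. \<epsilon> < \<epsilon>0}. hom_base E F (v \<epsilon>) ` K)"
    if "\<epsilon> \<in> params" "\<epsilon> < \<epsilon>0" for \<epsilon>
    using that by (intro ballI subsetD[OF closure_subset]) blast
  then have "\<forall>\<^sub>F \<epsilon> in at_right 0. \<forall>p\<in>K. hom_base E F (v \<epsilon>) p \<in> closure (\<Union>\<epsilon>\<in>{\<epsilon>\<in>params. \<epsilon> < \<epsilon>0}. hom_base E F (v \<epsilon>) ` K)"
    unfolding params_eventually[symmetric] using \<epsilon>0(1) by (intro exI[of _ \<epsilon>0]) blast
  then show "\<exists>W \<psi> \<Psi> M. (W, \<psi>, \<Psi>) \<in> vb_charts F \<and> compact M \<and> M \<subseteq> W \<and>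
     (\<forall>\<^sub>F \<epsilon> in at_right 0. \<forall>p\<in>K. hom_base E F (v \<epsilon>) p \<in> M)"
    using M \<epsilon>0(2) unfolding c by (intro exI conjI)
qed

theorem proposition3p6:
  fixes E :: "('x::t2_space, 'a::finite_dim_inner, 'e::t2_space, 'v::finite_dim_inner,
                'k::{real_normed_field, euclidean_space}) vbundle"
    and F :: "('y::t2_space, 'b::finite_dim_inner, 'f::t2_space, 'w::finite_dim_inner, 'k) vbundle"
  assumes "vector_bundle E" and "vector_bundle F"
  shows
    "(\<forall>u\<^sub>G\<in>Gamma_G E. \<forall>p\<^sub>G\<in>gen_points (vb_base E). \<forall>u\<in>u\<^sub>G. \<forall>p\<in>p\<^sub>G.
        (\<lambda>\<epsilon>\<in>params. u \<epsilon> (p \<epsilon>)) \<in> vb_moderate E \<and>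
        vb_class E (\<lambda>\<epsilon>\<in>params. u \<epsilon> (p \<epsilon>)) \<in> gen_vb_points E \<and>
        (\<forall>u'\<in>u\<^sub>G. \<forall>p'\<in>p\<^sub>G.
           vb_class E (\<lambda>\<epsilon>\<in>params. u' \<epsilon> (p' \<epsilon>)) = vb_class E (\<lambda>\<epsilon>\<in>params. u \<epsilon> (p \<epsilon>))))
     \<and>
     (\<forall>v\<^sub>G\<in>Hom_G E F. \<forall>e\<^sub>G\<in>gen_vb_points E. \<forall>v\<in>v\<^sub>G. \<forall>e\<in>e\<^sub>G.
        (\<forall>K. compact K \<longrightarrow>
           (\<exists>\<epsilon>\<^sub>0>0. \<exists>(W, \<psi>, \<Psi>)\<in>vb_charts F.
              compact (closure (\<Union>\<epsilon>\<in>{\<epsilon>\<in>params. \<epsilon> < \<epsilon>\<^sub>0}. hom_base E F (v \<epsilon>) ` K)) \<and>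
              closure (\<Union>\<epsilon>\<in>{\<epsilon>\<in>params. \<epsilon> < \<epsilon>\<^sub>0}. hom_base E F (v \<epsilon>) ` K) \<subseteq> W)) \<longrightarrow>
        (\<lambda>\<epsilon>\<in>params. v \<epsilon> (e \<epsilon>)) \<in> vb_moderate F \<and>
        vb_class F (\<lambda>\<epsilon>\<in>params. v \<epsilon> (e \<epsilon>)) \<in> gen_vb_points F \<and>
        (\<forall>v'\<in>v\<^sub>G. \<forall>e'\<in>e\<^sub>G.
           (\<lambda>\<epsilon>\<in>params. v' \<epsilon> (e' \<epsilon>)) \<in> vb_moderate F \<and>
           vb_class F (\<lambda>\<epsilon>\<in>params. v' \<epsilon> (e' \<epsilon>)) = vb_class F (\<lambda>\<epsilon>\<in>params. v \<epsilon> (e \<epsilon>))))"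
proof (rule conjI; intro ballI)
  fix u\<^sub>G p\<^sub>G u p assume G: "u\<^sub>G \<in> Gamma_G E" "p\<^sub>G \<in> gen_points (vb_base E)" and up: "u \<in> u\<^sub>G" "p \<in> p\<^sub>G"
  obtain u0 where u0: "u\<^sub>G = Gamma_equiv E `` {u0}" by (rule quotientE[OF G(1)[unfolded Gamma_G_def]])
  obtain p0 where p0: "p\<^sub>G = point_equiv (vb_base E) `` {p0}" by (rule quotientE[OF G(2)[unfolded gen_points_def]])
  \<comment> \<open>All representatives are compared with the pair that generates the two classes;
    any two are then equal to each other.\<close>
  have cl: "vb_class E (\<lambda>\<epsilon>\<in>params. u' \<epsilon> (p' \<epsilon>)) = vb_class E (\<lambda>\<epsilon>\<in>params. u0 \<epsilon> (p0 \<epsilon>))"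
    if "u' \<in> u\<^sub>G" "p' \<in> p\<^sub>G" for u' p'
    using that unfolding u0 p0 by (intro section_value_class assms(1)) auto
  have "u \<in> Gamma_EM E" "p \<in> cpt_supp_nets"
    using up unfolding u0 p0 by (auto simp: Gamma_equiv_def point_equiv_def)
  then have m: "(\<lambda>\<epsilon>\<in>params. u \<epsilon> (p \<epsilon>)) \<in> vb_moderate E" by (rule section_value_moderate[OF assms(1)])
  then have "vb_class E (\<lambda>\<epsilon>\<in>params. u \<epsilon> (p \<epsilon>)) \<in> gen_vb_points E"
    unfolding vb_class_def gen_vb_points_def by (rule quotientI)
  with m show "(\<lambda>\<epsilon>\<in>params. u \<epsilon> (p \<epsilon>)) \<in> vb_moderate E \<and>
        vb_class E (\<lambda>\<epsilon>\<in>params. u \<epsilon> (p \<epsilon>)) \<in> gen_vb_points E \<and>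
        (\<forall>u'\<in>u\<^sub>G. \<forall>p'\<in>p\<^sub>G.
           vb_class E (\<lambda>\<epsilon>\<in>params. u' \<epsilon> (p' \<epsilon>)) = vb_class E (\<lambda>\<epsilon>\<in>params. u \<epsilon> (p \<epsilon>)))"
    using cl cl[OF up] by simp
next
  fix v\<^sub>G e\<^sub>G v e assume G: "v\<^sub>G \<in> Hom_G E F" "e\<^sub>G \<in> gen_vb_points E" and ve: "v \<in> v\<^sub>G" "e \<in> e\<^sub>G"
  show "(\<forall>K. compact K \<longrightarrow>
           (\<exists>\<epsilon>\<^sub>0>0. \<exists>(W, \<psi>, \<Psi>)\<in>vb_charts F.
              compact (closure (\<Union>\<epsilon>\<in>{\<epsilon>\<in>params. \<epsilon> < \<epsilon>\<^sub>0}. hom_base E F (v \<epsilon>) ` K)) \<and>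
              closure (\<Union>\<epsilon>\<in>{\<epsilon>\<in>params. \<epsilon> < \<epsilon>\<^sub>0}. hom_base E F (v \<epsilon>) ` K) \<subseteq> W)) \<longrightarrow>
        (\<lambda>\<epsilon>\<in>params. v \<epsilon> (e \<epsilon>)) \<in> vb_moderate F \<and>
        vb_class F (\<lambda>\<epsilon>\<in>params. v \<epsilon> (e \<epsilon>)) \<in> gen_vb_points F \<and>
        (\<forall>v'\<in>v\<^sub>G. \<forall>e'\<in>e\<^sub>G.
           (\<lambda>\<epsilon>\<in>params. v' \<epsilon> (e' \<epsilon>)) \<in> vb_moderate F \<and>
           vb_class F (\<lambda>\<epsilon>\<in>params. v' \<epsilon> (e' \<epsilon>)) = vb_class F (\<lambda>\<epsilon>\<in>params. v \<epsilon> (e \<epsilon>)))"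
  proof (rule impI, drule chart_boundedI)
    assume cb: "chart_bounded E F v"
    obtain v0 where v0: "v\<^sub>G = hom_equiv E F `` {v0}" by (rule quotientE[OF G(1)[unfolded Hom_G_def]])
    obtain e0 where e0: "e\<^sub>G = vb_equiv E `` {e0}" by (rule quotientE[OF G(2)[unfolded gen_vb_points_def]])
    have eqv: "(v0, v') \<in> hom_equiv E F" if "v' \<in> v\<^sub>G" for v' using that by (simp add: v0)
    have eqe: "(e0, e') \<in> vb_equiv E" if "e' \<in> e\<^sub>G" for e' using that by (simp add: e0)
    \<comment> \<open>The hypothesis is made for the one representative \<open>v\<close>; through
      \<open>v0\<close> it reaches every representative of the class.\<close>
    have cb0: "chart_bounded E F v0" using chart_bounded_equiv[OF assms(2) eqv[OF ve(1)]] cb by simp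
    have m: "(\<lambda>\<epsilon>\<in>params. v' \<epsilon> (e' \<epsilon>)) \<in> vb_moderate F" if "v' \<in> v\<^sub>G" "e' \<in> e\<^sub>G" for v' e'
    proof (rule hom_value_moderate[OF assms hom_equivD(2)[OF eqv[OF that(1)]] _ vb_equivD(2)[OF eqe[OF that(2)]]])
      show "chart_bounded E F v'" using chart_bounded_equiv[OF assms(2) eqv[OF that(1)]] cb0 by simp
    qed
    have cl: "vb_class F (\<lambda>\<epsilon>\<in>params. v' \<epsilon> (e' \<epsilon>)) = vb_class F (\<lambda>\<epsilon>\<in>params. v0 \<epsilon> (e0 \<epsilon>))"
      if "v' \<in> v\<^sub>G" "e' \<in> e\<^sub>G" for v' e'
      by (rule hom_value_class[OF assms eqv[OF that(1)] cb0 eqe[OF that(2)]])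
    have "vb_class F (\<lambda>\<epsilon>\<in>params. v \<epsilon> (e \<epsilon>)) \<in> gen_vb_points F"
      unfolding vb_class_def gen_vb_points_def by (rule quotientI[OF m[OF ve]])
    with m cl cl[OF ve] m[OF ve] show "(\<lambda>\<epsilon>\<in>params. v \<epsilon> (e \<epsilon>)) \<in> vb_moderate F \<and>
        vb_class F (\<lambda>\<epsilon>\<in>params. v \<epsilon> (e \<epsilon>)) \<in> gen_vb_points F \<and>
        (\<forall>v'\<in>v\<^sub>G. \<forall>e'\<in>e\<^sub>G.
           (\<lambda>\<epsilon>\<in>params. v' \<epsilon> (e' \<epsilon>)) \<in> vb_moderate F \<and>
           vb_class F (\<lambda>\<epsilon>\<in>params. v' \<epsilon> (e' \<epsilon>)) = vb_class F (\<lambda>\<epsilon>\<in>params. v \<epsilon> (e \<epsilon>)))"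
      by simp
  qed
qed

end
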